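(* Let $X$ be a complex Banach function space with absolutely continuous norm, let $s\in[1,\infty]$, and let $A$ be an $\mathcal R_s$-sectorial operator in $X$, injective and with dense domain and dense range. Let $\sigma>\omega_{\mathcal R_s}(A)$ and $\varphi\in\Phi^\Sigma_{\sigma,0}$. Then there is a constant $C>0$ such that for all $x\in X$ $$C^{-1}\Big\|\Big(\sum_{j\in\mathbb Z}|\varphi(2^jA)x|^s\Big)^{1/s}\Big\|_X\le\Big\|\Big(\int_0^\infty|\varphi(tA)x|^s\,\frac{dt}t\Big)^{1/s}\Big\|_X\le C\Big\|\Big(\sum_{j\in\mathbb Z}|\varphi(2^jA)x|^s\Big)^{1/s}\Big\|_X$$ (with the sum and integral replaced by suprema over $j\in\mathbb Z$ and $t>0$ if $s=\infty$; the expressions are elements of $[0,\infty]$).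
   Context: **Banach function spaces.** Let $(\Omega,\mu)$ be a $\sigma$-finite measure space with a fixed increasing sequence $(\Omega_n)_{n\in\mathbb N}$ of measurable sets of finite measure with union $\Omega$; a measurable set is bounded if it is contained in some $\Omega_n$. A Banach function norm is a map $\rho$ from the ($\mu$-a.e. classes of) measurable functions $\Omega\to[0,\infty]$ to $[0,\infty]$ with: $\rho(f)=0$ iff $f=0$ a.e., $\rho(\alpha f)=\alpha\rho(f)$ for $\alpha>0$, $\rho(f+g)\le\rho(f)+\rho(g)$; $0\le g\le f$ a.e. implies $\rho(g)\le\rho(f)$; $0\le f_n\nearrow f$ a.e. implies $\rho(f_n)\nearrow\rho(f)$; $\rho(\mathbf 1_M)<\infty$ for $M$ bounded; for each bounded $M$ there is $C_M$ with $\int_Mf\,d\mu\le C_M\rho(f)$ for all $f$. The complex Banach function space is $X=\{f:\Omega\to\mathbb C\text{ measurable}:\rho(|f|)<\infty\}$ with $\|f\|_X=\rho(|f|)$ (and we write $\|f\|_X=\infty$ if $\rho(|f|)=\infty$). It has absolutely continuous norm if $\|f\mathbf 1_{M_n}\|_X\to0$ whenever $f\in X$ and $(M_n)$ is a decreasing sequence of measurable sets with $\mathbf 1_{M_n}\to0$ a.e. **$\mathcal R_s$-boundedness.** $\mathcal T\subseteq L(X)$ is $\mathcal R_s$-bounded if there is $C>0$ with $\|(\sum_{j=1}^n|T_jx_j|^s)^{1/s}\|_X\le C\|(\sum_{j=1}^n|x_j|^s)^{1/s}\|_X$ for all $n\in\mathbb N$, $T_j\in\mathcal T$, $x_j\in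 X$ (suprema over $j$ instead of sums if $s=\infty$). **Sectors and operators.** $\Sigma_\sigma=\{z\in\mathbb C\setminus(-\infty,0]:|\arg z|<\sigma\}$ for $\sigma\in(0,\pi]$, $\Sigma_0=(0,\infty)$. $A$ is $\mathcal R_s$-sectorial if there is $\omega\in[0,\pi)$ with $\sigma(A)\subseteq\overline\Sigma_\omega$ and $\{zR(z,A):z\in\mathbb C\setminus\overline\Sigma_\sigma\}$ $\mathcal R_s$-bounded for every $\sigma\in(\omega,\pi)$; $\omega_{\mathcal R_s}(A)$ is the infimum of such $\omega$. **Functional calculus.** $H^\infty(\Sigma_\sigma)$: bounded analytic functions on $\Sigma_\sigma$ with norm $\|f\|_{\infty,\sigma}=\sup_{\Sigma_\sigma}|f|$. $H_0^\infty(\Sigma_\sigma)$: those with $\sup_{z\in\Sigma_\sigma}(|z|^\varepsilon\vee|z|^{-\varepsilon})|f(z)|<\infty$ for some $\varepsilon>0$. For $\varphi\in H_0^\infty(\Sigma_\sigma)$, $\varphi(A)=\frac1{2\pi i}\int_{\partial\Sigma_\omega}\varphi(\lambda)R(\lambda,A)\,d\lambda$, $\omega\in(\omega_{\mathcal R_s}(A),\sigma)$ ($\sigma(A)$ lying to the left of the contour); $\varphi(tA)=(\varphi(t\,\cdot))(A)$. $\mathcal E(\Sigma_\sigma)=H_0^\infty(\Sigma_\sigma)\oplus\mathbb C\frac1{1+z}\oplus\mathbb C\mathbf 1$; its elements have limits $f(0),f(\infty)$ at $0$ and $\infty$. **The class $\Phi^\Sigma_{\sigma,0}$** is the set of $\varphi\in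 H_0^\infty(\Sigma_\sigma)$ with $0\notin\varphi(\Sigma_\sigma)$ for which there are $d\in\mathbb Z$ and a set $\mathcal F\subseteq\mathcal E(\Sigma_\sigma)$ such that for some $\varepsilon>0$ $$\sup_{f\in\mathcal F}\|f\|_{\infty,\sigma}<\infty,\qquad \sup_{f\in\mathcal F}\sup_{z\in\Sigma_\sigma}(|z|^\varepsilon\vee|z|^{-\varepsilon})\Big|f(z)-\frac{f(0)+f(\infty)z}{1+z}\Big|<\infty,$$ and $\{\varphi(2^jt\,\cdot)/\varphi(2^{j-d}\,\cdot),\ \varphi(2^{j+d}\,\cdot)/\varphi(2^jt\,\cdot): j\in\mathbb Z,\ t\in[1,2]\}\subseteq\{f(r\,\cdot):f\in\mathcal F,\ r>0\}$. Integrals $\int_0^\infty|\varphi(tA)x|^s\,dt/t$ are taken pointwise on $\Omega$ using jointly measurable representatives; suprema are lattice suprema. *)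

theory Defs
  imports "HOL-Analysis.Analysis"
begin

text \<open>
  Elements of a Banach function space are represented by measurable functions; the passage to
  classes modulo a.e. equality is expressed by stating every identity between elements a.e.
\<close>

subsection \<open>Banach function spaces\<close>

definition bounded_set :: "'a measure \<Rightarrow> (nat \<Rightarrow> 'a set) \<Rightarrow> 'a set \<Rightarrow> bool" where
  "bounded_set M \<Omega> B \<longleftrightarrow> B \<in> sets M \<and> (\<exists>n. B \<subseteq> \<Omega> n)"

text \<open>The map \<open>\<rho>\<close> is only constrained on measurable functions; \<open>rho_mono\<close> makes it respect
  a.e. equality.\<close>

locale banach_function_norm = sigma_finite_measure M
  for M :: "'a measure" and \<Omega> :: "nat \<Rightarrow> 'a set" and \<rho> :: "('a \<Rightarrow> ennreal) \<Rightarrow> ennreal" +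
  assumes Omega_sets: "\<And>n. \<Omega> n \<in> sets M"
    and Omega_finite: "\<And>n. emeasure M (\<Omega> n) < \<infinity>"
    and Omega_incseq: "incseq \<Omega>"
    and Omega_Union: "(\<Union>n. \<Omega> n) = space M"
    and rho_eq_0_iff: "\<And>f. f \<in> borel_measurable M \<Longrightarrow> \<rho> f = 0 \<longleftrightarrow> (AE w in M. f w = 0)"
    and rho_scale: "\<And>f (a::real). f \<in> borel_measurable M \<Longrightarrow> 0 < a \<Longrightarrow>
          \<rho> (\<lambda>w. ennreal a * f w) = ennreal a * \<rho> f"
    and rho_triangle: "\<And>f g. f \<in> borel_measurable M \<Longrightarrow> g \<in> borel_measurable M \<Longrightarrow>
          \<rho> (\<lambda>w. f w + g w) \<le> \<rho> f + \<rho> g"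
    and rho_mono: "\<And>f g. f \<in> borel_measurable M \<Longrightarrow> g \<in> borel_measurable M \<Longrightarrow>
          (AE w in M. g w \<le> f w) \<Longrightarrow> \<rho> g \<le> \<rho> f"
    and rho_Fatou: "\<And>F f. (\<And>n. F n \<in> borel_measurable M) \<Longrightarrow> f \<in> borel_measurable M \<Longrightarrow>
          (AE w in M. incseq (\<lambda>n. F n w) \<and> (\<lambda>n. F n w) \<longlonglongrightarrow> f w) \<Longrightarrow>
          incseq (\<lambda>n. \<rho> (F n)) \<and> (\<lambda>n. \<rho> (F n)) \<longlonglongrightarrow> \<rho> f"
    and rho_indicator: "\<And>B. bounded_set M \<Omega> B \<Longrightarrow> \<rho> (indicator B) < \<infinity>"
    and rho_local_L1: "\<And>B. bounded_set M \<Omega> B \<Longrightarrow>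
          \<exists>C<\<infinity>. \<forall>f\<in>borel_measurable M. (\<integral>\<^sup>+w\<in>B. f w \<partial>M) \<le> C * \<rho> f"

definition bfs_norm :: "(('a \<Rightarrow> ennreal) \<Rightarrow> ennreal) \<Rightarrow> ('a \<Rightarrow> complex) \<Rightarrow> ennreal" where
  "bfs_norm \<rho> f = \<rho> (\<lambda>w. ennreal (cmod (f w)))"

definition bfs :: "'a measure \<Rightarrow> (('a \<Rightarrow> ennreal) \<Rightarrow> ennreal) \<Rightarrow> ('a \<Rightarrow> complex) set" where
  "bfs M \<rho> = {f \<in> borel_measurable M. bfs_norm \<rho> f < \<infinity>}"

definition abs_continuous_norm :: "'a measure \<Rightarrow> (('a \<Rightarrow> ennreal) \<Rightarrow> ennreal) \<Rightarrow> bool" where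
  "abs_continuous_norm M \<rho> \<longleftrightarrow>
     (\<forall>f\<in>bfs M \<rho>. \<forall>B :: nat \<Rightarrow> 'a set.
        (\<forall>n. B n \<in> sets M) \<and> decseq B \<and>
        (AE w in M. (\<lambda>n. indicator (B n) w :: real) \<longlonglongrightarrow> 0) \<longrightarrow>
        (\<lambda>n. bfs_norm \<rho> (\<lambda>w. f w * indicator (B n) w)) \<longlonglongrightarrow> 0)"

definition bfs_dense :: "'a measure \<Rightarrow> (('a \<Rightarrow> ennreal) \<Rightarrow> ennreal) \<Rightarrow> ('a \<Rightarrow> complex) set \<Rightarrow> bool" where
  "bfs_dense M \<rho> S \<longleftrightarrow>
     (\<forall>f\<in>bfs M \<rho>. \<forall>e>0. \<exists>g\<in>S. bfs_norm \<rho> (\<lambda>w. f w - g w) < e)"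

subsection \<open>The Bochner integral with values in a Banach function space\<close>

text \<open>This transcribes \<^const>\<open>has_bochner_integral\<close>, which needs the target space to be a type of
  class \<^class>\<open>banach\<close>. Measurability of the distances to the simple functions, together with
  the convergence of the integrals, amounts to strong measurability of the integrand.\<close>

definition bfs_simple ::
  "'a measure \<Rightarrow> (('a \<Rightarrow> ennreal) \<Rightarrow> ennreal) \<Rightarrow> 't measure \<Rightarrow> ('t \<Rightarrow> 'a \<Rightarrow> complex) \<Rightarrow> bool" where
  "bfs_simple M \<rho> N S \<longleftrightarrow>
     simple_function N S \<and> S ` space N \<subseteq> bfs M \<rho> \<and>
     emeasure N {t \<in> space N. S t \<noteq> (\<lambda>_. 0)} < \<infinity>"

definition bfs_simple_integral :: "'t measure \<Rightarrow> ('t \<Rightarrow> 'a \<Rightarrow> complex) \<Rightarrow> 'a \<Rightarrow> complex" where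
  "bfs_simple_integral N S =
     (\<lambda>w. \<Sum>v\<in>S ` space N. complex_of_real (measure N {t \<in> space N. S t = v}) * v w)"

definition has_bfs_integral ::
  "'a measure \<Rightarrow> (('a \<Rightarrow> ennreal) \<Rightarrow> ennreal) \<Rightarrow> 't measure \<Rightarrow> ('t \<Rightarrow> 'a \<Rightarrow> complex)
    \<Rightarrow> ('a \<Rightarrow> complex) \<Rightarrow> bool" where
  "has_bfs_integral M \<rho> N F y \<longleftrightarrow>
     (\<forall>t\<in>space N. F t \<in> bfs M \<rho>) \<and> y \<in> bfs M \<rho> \<and>
     (\<exists>S :: nat \<Rightarrow> 't \<Rightarrow> 'a \<Rightarrow> complex.
        (\<forall>n. bfs_simple M \<rho> N (S n)) \<and>
        (\<forall>n. (\<lambda>t. bfs_norm \<rho> (\<lambda>w. F t w - S n t w)) \<in> borel_measurable N) \<and>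
        (\<lambda>n. \<integral>\<^sup>+t. bfs_norm \<rho> (\<lambda>w. F t w - S n t w) \<partial>N) \<longlonglongrightarrow> 0 \<and>
        (\<lambda>n. bfs_norm \<rho> (\<lambda>w. bfs_simple_integral N (S n) w - y w)) \<longlonglongrightarrow> 0)"

subsection \<open>Operators in a Banach function space\<close>

text \<open>Compatibility with a.e. equality follows from linearity and the bound.\<close>

definition bfs_bounded_ops ::
  "'a measure \<Rightarrow> (('a \<Rightarrow> ennreal) \<Rightarrow> ennreal) \<Rightarrow> (('a \<Rightarrow> complex) \<Rightarrow> 'a \<Rightarrow> complex) set" where
  "bfs_bounded_ops M \<rho> =
     {T. (\<forall>f\<in>bfs M \<rho>. T f \<in> bfs M \<rho>) \<and>
         (\<forall>f\<in>bfs M \<rho>. \<forall>g\<in>bfs M \<rho>. AE w in M. T (\<lambda>v. f v + g v) w = T f w + T g w) \<and>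
         (\<forall>c::complex. \<forall>f\<in>bfs M \<rho>. AE w in M. T (\<lambda>v. c * f v) w = c * T f w) \<and>
         (\<exists>C::real. \<forall>f\<in>bfs M \<rho>. bfs_norm \<rho> (T f) \<le> ennreal C * bfs_norm \<rho> f)}"

definition bfs_operator ::
  "'a measure \<Rightarrow> (('a \<Rightarrow> ennreal) \<Rightarrow> ennreal) \<Rightarrow> ('a \<Rightarrow> complex) set
    \<Rightarrow> (('a \<Rightarrow> complex) \<Rightarrow> 'a \<Rightarrow> complex) \<Rightarrow> bool" where
  "bfs_operator M \<rho> D A \<longleftrightarrow>
     D \<subseteq> bfs M \<rho> \<and> (\<lambda>_. 0) \<in> D \<and>
     (\<forall>f\<in>D. \<forall>g\<in>D. (\<lambda>w. f w + g w) \<in> D) \<and>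
     (\<forall>c::complex. \<forall>f\<in>D. (\<lambda>w. c * f w) \<in> D) \<and>
     (\<forall>f\<in>D. A f \<in> bfs M \<rho>) \<and>
     (\<forall>f\<in>D. \<forall>g\<in>D. AE w in M. A (\<lambda>v. f v + g v) w = A f w + A g w) \<and>
     (\<forall>c::complex. \<forall>f\<in>D. AE w in M. A (\<lambda>v. c * f v) w = c * A f w) \<and>
     (\<forall>f\<in>D. \<forall>g\<in>bfs M \<rho>. (AE w in M. f w = g w) \<longrightarrow>
         g \<in> D \<and> (AE w in M. A f w = A g w))"

definition bfs_injective ::
  "'a measure \<Rightarrow> ('a \<Rightarrow> complex) set \<Rightarrow> (('a \<Rightarrow> complex) \<Rightarrow> 'a \<Rightarrow> complex) \<Rightarrow> bool" where
  "bfs_injective M D A \<longleftrightarrow>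
     (\<forall>f\<in>D. \<forall>g\<in>D. (AE w in M. A f w = A g w) \<longrightarrow> (AE w in M. f w = g w))"

definition is_resolvent ::
  "'a measure \<Rightarrow> (('a \<Rightarrow> ennreal) \<Rightarrow> ennreal) \<Rightarrow> ('a \<Rightarrow> complex) set
    \<Rightarrow> (('a \<Rightarrow> complex) \<Rightarrow> 'a \<Rightarrow> complex) \<Rightarrow> complex
    \<Rightarrow> (('a \<Rightarrow> complex) \<Rightarrow> 'a \<Rightarrow> complex) \<Rightarrow> bool" where
  "is_resolvent M \<rho> D A z R \<longleftrightarrow>
     R \<in> bfs_bounded_ops M \<rho> \<and>
     (\<forall>f\<in>bfs M \<rho>. R f \<in> D \<and> (AE w in M. z * R f w - A (R f) w = f w)) \<and>
     (\<forall>f\<in>D. AE w in M. R (\<lambda>v. z * f v - A f v) w = f w)"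

definition bfs_spectrum ::
  "'a measure \<Rightarrow> (('a \<Rightarrow> ennreal) \<Rightarrow> ennreal) \<Rightarrow> ('a \<Rightarrow> complex) set
    \<Rightarrow> (('a \<Rightarrow> complex) \<Rightarrow> 'a \<Rightarrow> complex) \<Rightarrow> complex set" where
  "bfs_spectrum M \<rho> D A = {z. \<nexists>R. is_resolvent M \<rho> D A z R}"

text \<open>For \<open>z\<close> outside the spectrum this is determined up to a.e. equality.\<close>

definition resolvent ::
  "'a measure \<Rightarrow> (('a \<Rightarrow> ennreal) \<Rightarrow> ennreal) \<Rightarrow> ('a \<Rightarrow> complex) set
    \<Rightarrow> (('a \<Rightarrow> complex) \<Rightarrow> 'a \<Rightarrow> complex) \<Rightarrow> complex
    \<Rightarrow> ('a \<Rightarrow> complex) \<Rightarrow> 'a \<Rightarrow> complex" where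
  "resolvent M \<rho> D A z = (SOME R. is_resolvent M \<rho> D A z R)"

subsection \<open>\<open>R\<^sub>s\<close>-boundedness and \<open>R\<^sub>s\<close>-sectoriality\<close>

text \<open>Only meant for exponents \<open>p > 0\<close>.\<close>

definition ennpow :: "ennreal \<Rightarrow> real \<Rightarrow> ennreal" where
  "ennpow a p = (if a = \<infinity> then \<infinity> else ennreal (enn2real a powr p))"

definition ls_norm :: "ennreal \<Rightarrow> 'i set \<Rightarrow> ('i \<Rightarrow> ennreal) \<Rightarrow> ennreal" where
  "ls_norm s I a =
     (if s = \<infinity> then (SUP j\<in>I. a j)
      else ennpow (\<Sum>\<^sub>\<infinity>j\<in>I. ennpow (a j) (enn2real s)) (1 / enn2real s))"

definition Rs_bounded ::
  "'a measure \<Rightarrow> (('a \<Rightarrow> ennreal) \<Rightarrow> ennreal) \<Rightarrow> ennreal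
    \<Rightarrow> (('a \<Rightarrow> complex) \<Rightarrow> 'a \<Rightarrow> complex) set \<Rightarrow> bool" where
  "Rs_bounded M \<rho> s \<T> \<longleftrightarrow>
     \<T> \<subseteq> bfs_bounded_ops M \<rho> \<and>
     (\<exists>C::real. C > 0 \<and>
       (\<forall>(n::nat) T x. (\<forall>j<n. T j \<in> \<T> \<and> x j \<in> bfs M \<rho>) \<longrightarrow>
          \<rho> (\<lambda>w. ls_norm s {..<n} (\<lambda>j. ennreal (cmod (T j (x j) w))))
            \<le> ennreal C * \<rho> (\<lambda>w. ls_norm s {..<n} (\<lambda>j. ennreal (cmod (x j w))))))"

definition sector :: "real \<Rightarrow> complex set" where
  "sector \<sigma> = (if \<sigma> = 0 then complex_of_real ` {0<..}
               else {z. z \<notin> \<real>\<^sub>\<le>\<^sub>0 \<and> \<bar>Arg z\<bar> < \<sigma>})"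

definition Rs_sectorial_of_angle ::
  "'a measure \<Rightarrow> (('a \<Rightarrow> ennreal) \<Rightarrow> ennreal) \<Rightarrow> ennreal \<Rightarrow> ('a \<Rightarrow> complex) set
    \<Rightarrow> (('a \<Rightarrow> complex) \<Rightarrow> 'a \<Rightarrow> complex) \<Rightarrow> real \<Rightarrow> bool" where
  "Rs_sectorial_of_angle M \<rho> s D A \<theta> \<longleftrightarrow>
     0 \<le> \<theta> \<and> \<theta> < pi \<and>
     bfs_spectrum M \<rho> D A \<subseteq> closure (sector \<theta>) \<and>
     (\<forall>\<tau>. \<theta> < \<tau> \<and> \<tau> < pi \<longrightarrow>
        Rs_bounded M \<rho> s
          ((\<lambda>z f w. z * resolvent M \<rho> D A z f w) ` (- closure (sector \<tau>))))"

definition Rs_sectorial ::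
  "'a measure \<Rightarrow> (('a \<Rightarrow> ennreal) \<Rightarrow> ennreal) \<Rightarrow> ennreal \<Rightarrow> ('a \<Rightarrow> complex) set
    \<Rightarrow> (('a \<Rightarrow> complex) \<Rightarrow> 'a \<Rightarrow> complex) \<Rightarrow> bool" where
  "Rs_sectorial M \<rho> s D A \<longleftrightarrow>
     bfs_operator M \<rho> D A \<and> (\<exists>\<theta>. Rs_sectorial_of_angle M \<rho> s D A \<theta>)"

definition omega_Rs ::
  "'a measure \<Rightarrow> (('a \<Rightarrow> ennreal) \<Rightarrow> ennreal) \<Rightarrow> ennreal \<Rightarrow> ('a \<Rightarrow> complex) set
    \<Rightarrow> (('a \<Rightarrow> complex) \<Rightarrow> 'a \<Rightarrow> complex) \<Rightarrow> real" where
  "omega_Rs M \<rho> s D A = Inf {\<theta>. Rs_sectorial_of_angle M \<rho> s D A \<theta>}"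

subsection \<open>Function classes on sectors and the functional calculus\<close>

definition Hinf :: "real \<Rightarrow> (complex \<Rightarrow> complex) set" where
  "Hinf \<sigma> = {f. f holomorphic_on sector \<sigma> \<and> bounded (f ` sector \<sigma>)}"

definition H0inf :: "real \<Rightarrow> (complex \<Rightarrow> complex) set" where
  "H0inf \<sigma> = {f \<in> Hinf \<sigma>. \<exists>\<epsilon>>0. \<exists>K::real. \<forall>z\<in>sector \<sigma>.
     max (cmod z powr \<epsilon>) (cmod z powr (- \<epsilon>)) * cmod (f z) \<le> K}"

definition Ealg :: "real \<Rightarrow> (complex \<Rightarrow> complex) set" where
  "Ealg \<sigma> = {f. \<exists>g\<in>H0inf \<sigma>. \<exists>a b. \<forall>z\<in>sector \<sigma>. f z = g z + a * (1 / (1 + z)) + b}"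

definition val_zero :: "real \<Rightarrow> (complex \<Rightarrow> complex) \<Rightarrow> complex" where
  "val_zero \<sigma> f = Lim (at 0 within sector \<sigma>) f"

definition val_infinity :: "real \<Rightarrow> (complex \<Rightarrow> complex) \<Rightarrow> complex" where
  "val_infinity \<sigma> f = Lim (inf at_infinity (principal (sector \<sigma>))) f"

text \<open>Values outside the sector are irrelevant, so the inclusion of sets of functions in the
  last condition is spelled out as equality on the sector.\<close>

definition Phi_class :: "real \<Rightarrow> (complex \<Rightarrow> complex) set" where
  "Phi_class \<sigma> = {\<phi> \<in> H0inf \<sigma>. 0 \<notin> \<phi> ` sector \<sigma> \<and>
     (\<exists>(d::int) \<F>. \<F> \<subseteq> Ealg \<sigma> \<and>
        (\<exists>\<epsilon>>0.
          (\<exists>K::real. \<forall>f\<in>\<F>. \<forall>z\<in>sector \<sigma>. cmod (f z) \<le> K) \<and>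
          (\<exists>K::real. \<forall>f\<in>\<F>. \<forall>z\<in>sector \<sigma>.
             max (cmod z powr \<epsilon>) (cmod z powr (- \<epsilon>)) *
               cmod (f z - (val_zero \<sigma> f + val_infinity \<sigma> f * z) / (1 + z)) \<le> K)) \<and>
        (\<forall>j::int. \<forall>t\<in>{1..2::real}.
          (\<exists>f\<in>\<F>. \<exists>r::real. r > 0 \<and> (\<forall>z\<in>sector \<sigma>.
             \<phi> (2 powi j * of_real t * z) / \<phi> (2 powi (j - d) * z) = f (of_real r * z))) \<and>
          (\<exists>f\<in>\<F>. \<exists>r::real. r > 0 \<and> (\<forall>z\<in>sector \<sigma>.
             \<phi> (2 powi (j + d) * z) / \<phi> (2 powi j * of_real t * z) = f (of_real r * z)))))}"

text \<open>\<open>\<phi>(A) x\<close>, up to a.e. equality: the contour \<open>\<partial>\<Sigma>\<^sub>\<theta>\<close> comes in from infinity along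
  \<open>arg z = \<theta>\<close> and leaves along \<open>arg z = -\<theta>\<close>, so that the positive half-line is on its left.\<close>

definition fun_calc ::
  "'a measure \<Rightarrow> (('a \<Rightarrow> ennreal) \<Rightarrow> ennreal) \<Rightarrow> ('a \<Rightarrow> complex) set
    \<Rightarrow> (('a \<Rightarrow> complex) \<Rightarrow> 'a \<Rightarrow> complex) \<Rightarrow> real \<Rightarrow> (complex \<Rightarrow> complex)
    \<Rightarrow> ('a \<Rightarrow> complex) \<Rightarrow> 'a \<Rightarrow> complex" where
  "fun_calc M \<rho> D A \<theta> \<phi> x =
     (SOME y. has_bfs_integral M \<rho> (restrict_space lborel {0<..})
        (\<lambda>r w. 1 / (2 * of_real pi * \<i>) *
           (\<phi> (rcis r (- \<theta>)) * resolvent M \<rho> D A (rcis r (- \<theta>)) x w * cis (- \<theta>)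
          - \<phi> (rcis r \<theta>) * resolvent M \<rho> D A (rcis r \<theta>) x w * cis \<theta>)) y)"

definition fun_calc_dil ::
  "'a measure \<Rightarrow> (('a \<Rightarrow> ennreal) \<Rightarrow> ennreal) \<Rightarrow> ('a \<Rightarrow> complex) set
    \<Rightarrow> (('a \<Rightarrow> complex) \<Rightarrow> 'a \<Rightarrow> complex) \<Rightarrow> real \<Rightarrow> (complex \<Rightarrow> complex) \<Rightarrow> real
    \<Rightarrow> ('a \<Rightarrow> complex) \<Rightarrow> 'a \<Rightarrow> complex" where
  "fun_calc_dil M \<rho> D A \<theta> \<phi> t x = fun_calc M \<rho> D A \<theta> (\<lambda>z. \<phi> (of_real t * z)) x"

subsection \<open>Square functions\<close>

definition lattice_sup :: "'a measure \<Rightarrow> ('a \<Rightarrow> ennreal) set \<Rightarrow> 'a \<Rightarrow> ennreal" where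
  "lattice_sup M \<F> = (SOME g. g \<in> borel_measurable M \<and>
     (\<forall>f\<in>\<F>. AE w in M. f w \<le> g w) \<and>
     (\<forall>h\<in>borel_measurable M. (\<forall>f\<in>\<F>. AE w in M. f w \<le> h w) \<longrightarrow> (AE w in M. g w \<le> h w)))"

text \<open>For \<open>s = \<infinity>\<close> the supremum is countable, so the pointwise one is the lattice supremum.\<close>

definition discrete_sq_fun ::
  "'a measure \<Rightarrow> (('a \<Rightarrow> ennreal) \<Rightarrow> ennreal) \<Rightarrow> ennreal \<Rightarrow> ('a \<Rightarrow> complex) set
    \<Rightarrow> (('a \<Rightarrow> complex) \<Rightarrow> 'a \<Rightarrow> complex) \<Rightarrow> real \<Rightarrow> (complex \<Rightarrow> complex)
    \<Rightarrow> ('a \<Rightarrow> complex) \<Rightarrow> 'a \<Rightarrow> ennreal" where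
  "discrete_sq_fun M \<rho> s D A \<theta> \<phi> x =
     (\<lambda>w. ls_norm s (UNIV :: int set)
        (\<lambda>j. ennreal (cmod (fun_calc_dil M \<rho> D A \<theta> \<phi> (2 powi j) x w))))"

text \<open>For \<open>s < \<infinity>\<close>, \<open>G\<close> is a jointly measurable representative of \<open>t \<mapsto> \<phi>(tA) x\<close>; by Fubini the
  result does not depend on its choice, up to a.e. equality.\<close>

definition continuous_sq_fun ::
  "'a measure \<Rightarrow> (('a \<Rightarrow> ennreal) \<Rightarrow> ennreal) \<Rightarrow> ennreal \<Rightarrow> ('a \<Rightarrow> complex) set
    \<Rightarrow> (('a \<Rightarrow> complex) \<Rightarrow> 'a \<Rightarrow> complex) \<Rightarrow> real \<Rightarrow> (complex \<Rightarrow> complex)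
    \<Rightarrow> ('a \<Rightarrow> complex) \<Rightarrow> 'a \<Rightarrow> ennreal" where
  "continuous_sq_fun M \<rho> s D A \<theta> \<phi> x =
     (if s = \<infinity> then
        lattice_sup M ((\<lambda>t w. ennreal (cmod (fun_calc_dil M \<rho> D A \<theta> \<phi> t x w))) ` {0<..})
      else
        (SOME g. \<exists>G :: real \<Rightarrow> 'a \<Rightarrow> complex.
           (\<lambda>(t, w). G t w) \<in> borel_measurable (lborel \<Otimes>\<^sub>M M) \<and>
           (\<forall>t>0. AE w in M. G t w = fun_calc_dil M \<rho> D A \<theta> \<phi> t x w) \<and>
           g = (\<lambda>w. ennpow
                 (\<integral>\<^sup>+t\<in>{0<..}. ennpow (ennreal (cmod (G t w))) (enn2real s) * ennreal (1 / t) \<partial>lborel)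
                 (1 / enn2real s))))"

end

theory Submission
  imports Defs "HOL-Complex_Analysis.Complex_Analysis"
begin

text \<open>
  By the defining property of the class, \<open>\<phi>(2\<^sup>jtA) = f(rA) \<phi>(2\<^sup>j\<^sup>-\<^sup>dA)\<close> and
  \<open>\<phi>(2\<^sup>j\<^sup>+\<^sup>dA) = f(rA) \<phi>(2\<^sup>jtA)\<close> for \<open>1 \<le> t \<le> 2\<close> with \<open>f\<close> in the family \<open>\<F>\<close> and \<open>r > 0\<close>
  depending on \<open>j\<close> and \<open>t\<close>. The operators \<open>f(rA)\<close> are \<open>R\<^sub>s\<close>-bounded: up to a combination of the
  identity and a resolvent, each is an integral of \<open>zR(z, A)\<close> along a slightly larger sector, with
  a kernel dominated by an integrable function independent of \<open>f\<close>, and Minkowski's inequality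
  carries the bound for \<open>zR(z, A)\<close> through the integral. Hence finite \<open>\<ell>\<^sup>s\<close> sums of
  \<open>\<phi>(2\<^sup>jt\<^sub>jA)x\<close> and of the shifted \<open>\<phi>(2\<^sup>jA)x\<close> are comparable, uniformly in the \<open>t\<^sub>j\<close>.
  The integral over \<open>[2\<^sup>j, 2\<^sup>j\<^sup>+\<^sup>1]\<close> is a limit of Riemann sums of such expressions;
  one inequality survives the limit by the Fatou property, the other by the absolute continuity of
  the norm. For \<open>s = \<infinity>\<close> it suffices to take rational \<open>t\<close>, because \<open>t \<mapsto> \<phi>(tA)x\<close> has a
  representative that is continuous in \<open>t\<close> for almost every point.
\<close>

section \<open>Powers and \<open>\<ell>\<^sup>s\<close> norms with values in the extended half-line\<close>

text \<open>Elements of the space are functions known up to null sets, and an identity such as the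
  resolvent equation holds for each point r of a contour off a null set depending on r. Before it
  can be integrated pointwise the quantifiers must be exchanged, which takes representatives jointly
  measurable in r and w. Resolvents are Lipschitz along a ray, so dyadic samples supply them; the
  same samples turn integrals over r into series, and Minkowski's inequality follows from the Fatou
  property without duality. The operator f(rA) is never formed: if \<psi> is \<eta> times the
  dilated f, then \<psi>(A)x is written directly through y = \<eta>(A)x, as a contour integral plus
  multiples of y and of one resolvent of y. This multiplicativity uses a second, wider contour, for
  which there is room because \<theta> < \<sigma>. The bounds for zR(z, A) are invariant under
  dilation, so the unknown r costs nothing. Absolute continuity enters where the continuous square
  function is the upper bound: there a limit superior of norms of Riemann sums must be controlled,
  whereas the Fatou property only bounds a limit inferior from below.\<close>

lemma ennpow_ennreal: "0 \<le> x \<Longrightarrow> ennpow (ennreal x) p = ennreal (x powr p)"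
  by (simp add: ennpow_def)

lemma ennpow_top [simp]: "ennpow top p = top"
  by (simp add: ennpow_def)

lemma ennpow_0 [simp]: "ennpow 0 p = 0"
  by (simp add: ennpow_def)

lemma ennpow_1 [simp]: "ennpow a 1 = a"
  by (cases a) (auto simp: ennpow_ennreal)

lemma ennpow_ennpow: "ennpow (ennpow a p) q = ennpow a (p * q)"
  by (cases a) (auto simp: ennpow_ennreal powr_powr)

lemma ennpow_mono: "0 < p \<Longrightarrow> a \<le> b \<Longrightarrow> ennpow a p \<le> ennpow b p"
  by (cases a; cases b) (auto simp: ennpow_ennreal top_unique intro: powr_mono2)

lemma ennpow_mult: "0 < p \<Longrightarrow> ennpow (a * b) p = ennpow a p * ennpow b p"
  by (cases a; cases b)
    (auto simp: ennpow_ennreal powr_mult ennreal_mult_top ennreal_top_mult simp flip: ennreal_mult'')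

text \<open>A power and its inverse power form a Galois connection; commutation with
  \<open>SUP\<close> and \<open>INF\<close>, and hence with \<open>liminf\<close>, follows without
  any continuity argument.\<close>

lemma ennpow_le_iff: "0 < p \<Longrightarrow> ennpow a p \<le> b \<longleftrightarrow> a \<le> ennpow b (1 / p)"
  using ennpow_mono[of "1/p" "ennpow a p" b] ennpow_mono[of p a "ennpow b (1/p)"]
  by (auto simp: ennpow_ennpow)

lemma le_ennpow_iff: "0 < p \<Longrightarrow> b \<le> ennpow a p \<longleftrightarrow> ennpow b (1 / p) \<le> a"
  using ennpow_le_iff[of "1/p" b a] by simp

lemma ennpow_SUP: 
  assumes "0 < p"
  shows "ennpow (SUP i\<in>I. a i) p = (SUP i\<in>I. ennpow (a i) p)"
proof (rule antisym)
  show "ennpow (SUP i\<in>I. a i) p \<le> (SUP i\<in>I. ennpow (a i) p)"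
    unfolding ennpow_le_iff[OF assms]
  proof (rule SUP_least)
    fix i assume "i \<in> I"
    then show "a i \<le> ennpow (SUP i\<in>I. ennpow (a i) p) (1 / p)"
      by (subst ennpow_le_iff[OF assms, symmetric]) (rule SUP_upper)
  qed
next
  show "(SUP i\<in>I. ennpow (a i) p) \<le> ennpow (SUP i\<in>I. a i) p"
    by (rule SUP_least, rule ennpow_mono[OF assms], rule SUP_upper)
qed

lemma ennpow_INF:
  assumes "0 < p"
  shows "ennpow (INF i\<in>I. a i) p = (INF i\<in>I. ennpow (a i) p)"
proof (rule antisym)
  show "(INF i\<in>I. ennpow (a i) p) \<le> ennpow (INF i\<in>I. a i) p"
    unfolding le_ennpow_iff[OF assms]
  proof (rule INF_greatest)
    fix i assume "i \<in> I"
    then show "ennpow (INF i\<in>I. ennpow (a i) p) (1 / p) \<le> a i"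
      by (subst le_ennpow_iff[OF assms, symmetric]) (rule INF_lower)
  qed
next
  show "ennpow (INF i\<in>I. a i) p \<le> (INF i\<in>I. ennpow (a i) p)"
    by (rule INF_greatest, rule ennpow_mono[OF assms], rule INF_lower)
qed

lemma ennpow_liminf: "0 < p \<Longrightarrow> ennpow (liminf a) p = liminf (\<lambda>n::nat. ennpow (a n) p)"
  by (simp add: liminf_SUP_INF ennpow_SUP ennpow_INF)

lemma measurable_ennpow [measurable]:
  "f \<in> borel_measurable M \<Longrightarrow> (\<lambda>x. ennpow (f x) p) \<in> borel_measurable M"
proof -
  assume f: "f \<in> borel_measurable M"
  have "{x \<in> space M. f x = \<infinity>} = f -` {\<infinity>} \<inter> space M" by auto
  also have "\<dots> \<in> sets M" by (rule measurable_sets[OF f]) auto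
  finally show "(\<lambda>x. ennpow (f x) p) \<in> borel_measurable M"
    unfolding ennpow_def by (intro measurable_If borel_measurable_const measurable_compose[OF _ measurable_ennreal]
      powr_real_measurable measurable_compose[OF f borel_measurable_enn2real]) auto
qed

lemma convex_powr_nonneg:
  fixes x y t p :: real
  assumes "1 \<le> p" "0 \<le> x" "0 \<le> y" "0 \<le> t" "t \<le> 1"
  shows "(t * x + (1 - t) * y) powr p \<le> t * x powr p + (1 - t) * y powr p"
proof -
  \<comment> \<open>When one of the two points is 0, the claim reduces to
    \<open>r powr p \<le> r\<close> on the unit interval; the remaining case is convexity on the
    open half-line.\<close>
  have *: "(r * z) powr p \<le> r * z powr p" if "0 \<le> r" "r \<le> 1" "0 \<le> z" for r z :: real
    using that assms powr_mono'[of 1 p r]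
    by (auto simp: powr_mult intro!: mult_right_mono)
  show ?thesis
  proof (cases "x = 0 \<or> y = 0")
    case True
    then show ?thesis using *[of t x] *[of "1 - t" y] assms by auto
  next
    case False
    then show ?thesis
      using convex_onD[OF powr_convex[OF assms(1)], of "1 - t" x y] assms by auto
  qed
qed

text \<open>Convexity after normalisation: \<open>(a i + b i) / (A + B)\<close> is the convex
  combination of \<open>a i / A\<close> and \<open>b i / B\<close> with weights
  \<open>A / (A + B)\<close> and \<open>B / (A + B)\<close>, and the \<open>p\<close>-th powers of
  either normalised family sum to 1.\<close>

lemma Minkowski_sum_real:
  fixes a b :: "'i \<Rightarrow> real"
  assumes "finite I" "1 \<le> p" and a: "\<And>i. i \<in> I \<Longrightarrow> 0 \<le> a i" and b: "\<And>i. i \<in> I \<Longrightarrow> 0 \<le> b i"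
  shows "(\<Sum>i\<in>I. (a i + b i) powr p) powr (1 / p)
    \<le> (\<Sum>i\<in>I. a i powr p) powr (1 / p) + (\<Sum>i\<in>I. b i powr p) powr (1 / p)"
proof -
  define A where "A = (\<Sum>i\<in>I. a i powr p) powr (1 / p)"
  define B where "B = (\<Sum>i\<in>I. b i powr p) powr (1 / p)"
  have "p > 0" using assms by simp
  have Ap: "A powr p = (\<Sum>i\<in>I. a i powr p)" and Bp: "B powr p = (\<Sum>i\<in>I. b i powr p)"
    using \<open>p > 0\<close> by (auto simp: A_def B_def powr_powr sum_nonneg)
  have [simp]: "A \<ge> 0" "B \<ge> 0" by (auto simp: A_def B_def)
  have "(\<Sum>i\<in>I. (a i + b i) powr p) \<le> (A + B) powr p"
  proof (cases "A = 0 \<or> B = 0")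
    case True
    then show ?thesis
    proof
      assume "A = 0"
      then have "\<forall>i\<in>I. a i = 0"
        using Ap assms \<open>p > 0\<close> by (auto simp: sum_nonneg_eq_0_iff)
      then show ?thesis using \<open>A = 0\<close> Bp by simp
    next
      assume "B = 0"
      then have "\<forall>i\<in>I. b i = 0"
        using Bp assms \<open>p > 0\<close> by (auto simp: sum_nonneg_eq_0_iff)
      then show ?thesis using \<open>B = 0\<close> Ap by simp
    qed
  next
    case False
    then have pos: "A > 0" "B > 0" using \<open>A \<ge> 0\<close> \<open>B \<ge> 0\<close> by linarith+
    define t where "t = A / (A + B)"
    have t: "0 \<le> t" "t \<le> 1" "1 - t = B / (A + B)" using pos by (auto simp: t_def field_simps)
    have "(\<Sum>i\<in>I. (a i + b i) powr p)
      \<le> (\<Sum>i\<in>I. (A + B) powr p * (t * (a i / A) powr p + (1 - t) * (b i / B) powr p))"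
    proof (rule sum_mono)
      fix i assume i: "i \<in> I"
      have "a i + b i = (A + B) * (t * (a i / A) + (1 - t) * (b i / B))"
        unfolding t(3) using pos by (simp add: t_def field_simps add_nonneg_eq_0_iff)
      then have "(a i + b i) powr p = (A + B) powr p * (t * (a i / A) + (1 - t) * (b i / B)) powr p"
        using pos a[OF i] b[OF i] t by (simp add: powr_mult)
      also have "\<dots> \<le> (A + B) powr p * (t * (a i / A) powr p + (1 - t) * (b i / B) powr p)"
        using pos a[OF i] b[OF i] t assms
        by (intro mult_left_mono convex_powr_nonneg) auto
      finally show "(a i + b i) powr p
        \<le> (A + B) powr p * (t * (a i / A) powr p + (1 - t) * (b i / B) powr p)" .
    qed
    also have "\<dots> = (A + B) powr p * (t * ((\<Sum>i\<in>I. a i powr p) / A powr p)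
        + (1 - t) * ((\<Sum>i\<in>I. b i powr p) / B powr p))"
      using a b pos
      by (simp add: sum_distrib_left sum.distrib powr_divide sum_divide_distrib algebra_simps)
    also have "\<dots> = (A + B) powr p"
      using pos by (simp add: Ap[symmetric] Bp[symmetric])
    finally show ?thesis .
  qed
  then have "(\<Sum>i\<in>I. (a i + b i) powr p) powr (1 / p) \<le> ((A + B) powr p) powr (1 / p)"
    using \<open>p > 0\<close> by (intro powr_mono2 sum_nonneg) auto
  also have "\<dots> = A + B" using \<open>p > 0\<close> by (simp add: powr_powr)
  finally show ?thesis by (simp add: A_def B_def)
qed

lemma enn2real_ge_1: "1 \<le> s \<Longrightarrow> s \<noteq> top \<Longrightarrow> 1 \<le> enn2real s"
  by (cases s) auto

lemma ls_norm_finite: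
  assumes "finite I" "s \<noteq> top"
  shows "ls_norm s I a = ennpow (\<Sum>j\<in>I. ennpow (a j) (enn2real s)) (1 / enn2real s)"
  using assms by (simp add: ls_norm_def)

lemma ls_norm_top: "ls_norm top I a = (SUP j\<in>I. a j)"
  by (simp add: ls_norm_def)

lemma ls_norm_cong: "(\<And>j. j \<in> I \<Longrightarrow> a j = b j) \<Longrightarrow> ls_norm s I a = ls_norm s I b"
  unfolding ls_norm_def by (auto cong: SUP_cong infsum_cong)

lemma ls_norm_mono:
  assumes "finite I" "1 \<le> s" "\<And>j. j \<in> I \<Longrightarrow> a j \<le> b j"
  shows "ls_norm s I a \<le> ls_norm s I b"
proof (cases "s = top")
  case False
  then show ?thesis
    using assms enn2real_ge_1[of s]
    by (auto simp: ls_norm_finite intro!: ennpow_mono sum_mono)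
qed (use assms in \<open>auto simp: ls_norm_top intro: SUP_mono\<close>)

lemma ls_norm_cmult:
  assumes "finite I" "1 \<le> s"
  shows "ls_norm s I (\<lambda>j. c * a j) = c * ls_norm s I a"
proof (cases "s = top")
  case False
  then show ?thesis
    using assms enn2real_ge_1[of s]
    by (simp add: ls_norm_finite ennpow_mult ennpow_ennpow flip: sum_distrib_left)
qed (simp add: ls_norm_top SUP_mult_left_ennreal)

lemma ls_norm_single: "1 \<le> s \<Longrightarrow> ls_norm s {i} a = a i"
  using enn2real_ge_1[of s] by (cases "s = top") (auto simp: ls_norm_top ls_norm_finite ennpow_ennpow)

lemma ls_norm_upper:
  assumes "finite I" "1 \<le> s" "j \<in> I"
  shows "a j \<le> ls_norm s I a"
proof (cases "s = top")
  case False
  have "ennpow (a j) (enn2real s) \<le> (\<Sum>j\<in>I. ennpow (a j) (enn2real s))"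
    using assms by (intro member_le_sum) auto
  with False enn2real_ge_1[of s] assms show ?thesis
    by (simp add: ls_norm_finite ennpow_le_iff)
qed (use assms in \<open>auto simp: ls_norm_top intro: SUP_upper\<close>)

lemma ls_norm_triangle:
  assumes "finite I" "1 \<le> s"
  shows "ls_norm s I (\<lambda>j. a j + b j) \<le> ls_norm s I a + ls_norm s I b"
proof (cases "s = top")
  case True
  then show ?thesis by (auto simp: ls_norm_top intro!: SUP_least add_mono SUP_upper)
next
  case False
  define p where "p = enn2real s"
  have p: "1 \<le> p" using enn2real_ge_1[of s] assms False by (simp add: p_def)
  \<comment> \<open>An infinite entry makes one of the norms on the right infinite, because a norm
    dominates each of its entries. Otherwise all entries are real.\<close>
  show ?thesis
  proof (cases "\<exists>j\<in>I. a j = top \<or> b j = top")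
    case True
    then obtain j where j: "j \<in> I" "a j = top \<or> b j = top" by auto
    then have "ls_norm s I a = top \<or> ls_norm s I b = top"
      using ls_norm_upper[OF assms j(1), of a] ls_norm_upper[OF assms j(1), of b]
      by (metis top_unique)
    then show ?thesis by (elim disjE) (simp_all only: add_top_left_ennreal add_top_right_ennreal top_greatest)
  next
    case fin: False
    obtain a' b' :: "'a \<Rightarrow> real" where nn: "\<And>j. 0 \<le> a' j" "\<And>j. 0 \<le> b' j"
      and *: "\<And>j. j \<in> I \<Longrightarrow> a j = ennreal (a' j)" "\<And>j. j \<in> I \<Longrightarrow> b j = ennreal (b' j)"
    proof
      show "a j = ennreal (enn2real (a j))" "b j = ennreal (enn2real (b j))" if "j \<in> I" for j
        using fin that by (auto simp: less_top)
    qed auto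
    have "ls_norm s I (\<lambda>j. a j + b j) = ls_norm s I (\<lambda>j. ennreal (a' j + b' j))"
      by (rule ls_norm_cong) (simp add: * nn ennreal_plus)
    also have "\<dots> = ennreal ((\<Sum>i\<in>I. (a' i + b' i) powr p) powr (1 / p))"
      using False assms by (simp add: ls_norm_finite p_def[symmetric] ennpow_ennreal nn sum_nonneg del: ennreal_plus flip: ennreal_plus)
    also have "\<dots> \<le> ennreal ((\<Sum>i\<in>I. a' i powr p) powr (1 / p) + (\<Sum>i\<in>I. b' i powr p) powr (1 / p))"
      using assms p by (intro ennreal_leI Minkowski_sum_real) (auto simp: nn)
    also have "\<dots> = ls_norm s I (\<lambda>j. ennreal (a' j)) + ls_norm s I (\<lambda>j. ennreal (b' j))"
      using False assms by (simp add: ls_norm_finite p_def[symmetric] ennpow_ennreal nn sum_nonneg)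
    also have "\<dots> = ls_norm s I a + ls_norm s I b"
      by (simp add: * cong: ls_norm_cong)
    finally show ?thesis .
  qed
qed

lemma ls_norm_measurable [measurable]:
  assumes "finite I" "\<And>j. j \<in> I \<Longrightarrow> (\<lambda>w. a j w) \<in> borel_measurable M"
  shows "(\<lambda>w. ls_norm s I (\<lambda>j. a j w)) \<in> borel_measurable M"
proof (cases "s = top")
  case True
  then show ?thesis using assms by (auto simp: ls_norm_top countable_finite)
next
  case False
  then show ?thesis using assms by (auto simp: ls_norm_finite intro!: measurable_ennpow borel_measurable_sum)
qed

lemma liminf_add_le:
  fixes a b :: "nat \<Rightarrow> ennreal"
  shows "liminf a + liminf b \<le> liminf (\<lambda>m. a m + b m)"
proof -
  have "liminf a + liminf b = (SUP n. (INF m\<in>{n..}. a m) + (INF m\<in>{n..}. b m))"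
    unfolding liminf_SUP_INF
    by (intro ennreal_SUP_add[symmetric] monoI INF_superset_mono) auto
  also have "\<dots> \<le> liminf (\<lambda>m. a m + b m)"
    unfolding liminf_SUP_INF
    by (intro SUP_mono' INF_greatest add_mono INF_lower) auto
  finally show ?thesis .
qed

lemma sum_liminf_le:
  fixes a :: "'i \<Rightarrow> nat \<Rightarrow> ennreal"
  shows "finite I \<Longrightarrow> (\<Sum>j\<in>I. liminf (a j)) \<le> liminf (\<lambda>m. \<Sum>j\<in>I. a j m)"
proof (induction I rule: finite_induct)
  case (insert i I)
  have "(\<Sum>j\<in>insert i I. liminf (a j)) \<le> liminf (a i) + liminf (\<lambda>m. \<Sum>j\<in>I. a j m)"
    using insert by (simp add: add_left_mono)
  also have "\<dots> \<le> liminf (\<lambda>m. a i m + (\<Sum>j\<in>I. a j m))"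
    by (rule liminf_add_le)
  finally show ?case using insert by simp
qed simp

text \<open>Lower semicontinuity of the norm. Through it the Fatou property of a function norm
  reaches families whose entries are only known as lower limits of approximants.\<close>

lemma ls_norm_liminf:
  assumes "finite I" "1 \<le> s"
  shows "ls_norm s I (\<lambda>j. liminf (a j)) \<le> liminf (\<lambda>m. ls_norm s I (\<lambda>j. a j m))"
proof (cases "s = top")
  case True
  then show ?thesis by (auto simp: ls_norm_top intro!: SUP_least Liminf_mono always_eventually SUP_upper)
next
  case False
  define p where "p = enn2real s"
  have p: "p > 0" using enn2real_ge_1[of s] assms False by (simp add: p_def)
  have "ls_norm s I (\<lambda>j. liminf (a j)) = ennpow (\<Sum>j\<in>I. liminf (\<lambda>m. ennpow (a j m) p)) (1 / p)"
    using p assms False by (simp add: ls_norm_finite p_def ennpow_liminf)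
  also have "\<dots> \<le> ennpow (liminf (\<lambda>m. \<Sum>j\<in>I. ennpow (a j m) p)) (1 / p)"
    using p assms by (intro ennpow_mono sum_liminf_le) auto
  also have "\<dots> = liminf (\<lambda>m. ls_norm s I (\<lambda>j. a j m))"
    using p assms False by (simp add: ls_norm_finite p_def ennpow_liminf)
  finally show ?thesis .
qed

text \<open>Symmetric windows exhaust the integers, so the norm of a two-sided sequence is an
  increasing limit of finite norms. In this form it is measurable in a parameter and accessible to
  \<open>rho_Fatou\<close>.\<close>

lemma ls_norm_int_SUP:
  assumes "1 \<le> s"
  shows "ls_norm s (UNIV :: int set) a = (SUP J::nat. ls_norm s {- int J..<int J} a)"
proof (cases "s = top")
  case True
  show ?thesis
  proof (rule antisym)
    show "ls_norm s UNIV a \<le> (SUP J. ls_norm s {- int J..<int J} a)"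
      unfolding True ls_norm_top
    proof (rule SUP_least)
      fix j :: int
      have "a j \<le> (SUP j\<in>{- int (nat (\<bar>j\<bar> + 1))..<int (nat (\<bar>j\<bar> + 1))}. a j)"
        by (rule SUP_upper) auto
      also have "\<dots> \<le> (SUP J. SUP j\<in>{- int J..<int J}. a j)"
        by (rule SUP_upper[of _ _ "\<lambda>J. SUP j\<in>{- int J..<int J}. a j"]) auto
      finally show "a j \<le> (SUP J. SUP j\<in>{- int J..<int J}. a j)" .
    qed
  qed (auto simp: True ls_norm_top intro!: SUP_least SUP_upper)
next
  case False
  define b where "b j = ennpow (a j) (enn2real s)" for j
  have "(\<Sum>\<^sub>\<infinity>j. b j) = (SUP F\<in>{F. finite F}. sum b F)"
    by (simp add: nonneg_infsum_complete)
  also have "\<dots> = (SUP J::nat. \<Sum>j\<in>{- int J..<int J}. b j)"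
  proof (rule antisym)
    show "(SUP F\<in>{F. finite F}. sum b F) \<le> (SUP J::nat. \<Sum>j\<in>{- int J..<int J}. b j)"
    proof (rule SUP_least)
      fix F :: "int set" assume "F \<in> {F. finite F}"
      then have F: "finite F" by simp
      \<comment> \<open>The window is half-open, hence the summand 1; inserting 0 keeps
        \<open>Max\<close> meaningful when \<open>F\<close> is empty.\<close>
      define J where "J = nat (Max (abs ` insert 0 F) + 1)"
      have "\<bar>j\<bar> < int J" if "j \<in> F" for j
      proof -
        have "\<bar>j\<bar> \<le> Max (abs ` insert 0 F)" using F that by (intro Max_ge) auto
        then show ?thesis by (auto simp: J_def)
      qed
      then have "F \<subseteq> {- int J..<int J}" by (force simp: abs_less_iff)
      then have "sum b F \<le> (\<Sum>j\<in>{- int J..<int J}. b j)" by (intro sum_mono2) auto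
      also have "\<dots> \<le> (SUP J::nat. \<Sum>j\<in>{- int J..<int J}. b j)"
        by (rule SUP_upper[of _ _ "\<lambda>J. \<Sum>j\<in>{- int J..<int J}. b j"]) auto
      finally show "sum b F \<le> (SUP J::nat. \<Sum>j\<in>{- int J..<int J}. b j)" .
    qed
  qed (auto intro!: SUP_least SUP_upper)
  finally show ?thesis
    using False assms enn2real_ge_1[of s]
    by (simp add: ls_norm_def b_def[symmetric] ennpow_SUP)
qed

lemma ls_norm_mono_set:
  assumes "finite J" "I \<subseteq> J" "1 \<le> s"
  shows "ls_norm s I a \<le> ls_norm s J a"
proof (cases "s = top")
  case True
  then show ?thesis using assms by (auto simp: ls_norm_top intro: SUP_subset_mono)
next
  case False
  then show ?thesis using assms enn2real_ge_1[of s] finite_subset[OF assms(2,1)]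
    by (auto simp: ls_norm_finite intro!: ennpow_mono sum_mono2)
qed

text \<open>\<open>Rs_bounded\<close> is phrased over the index sets \<open>{..<n}\<close>, whereas
  integers and pairs serve as indices later on.\<close>

lemma ls_norm_reindex:
  assumes "bij_betw h I J" "finite J"
  shows "ls_norm s J a = ls_norm s I (\<lambda>i. a (h i))"
proof -
  have "finite I" using assms bij_betw_finite by blast
  then show ?thesis
    using assms sum.reindex_bij_betw[OF assms(1), of "\<lambda>j. ennpow (a j) (enn2real s)"]
    by (cases "s = top") (auto simp: ls_norm_top ls_norm_finite bij_betw_def simp flip: image_image)
qed

section \<open>Banach function norms\<close>

text \<open>Turns an integral over \<open>r\<close> into a series, the form in which the triangle
  inequality and the Fatou property of a function norm can be applied.\<close>

lemma nn_integral_countable_valued: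
  fixes p :: "'r \<Rightarrow> nat"
  assumes [measurable]: "a \<in> borel_measurable N" "p \<in> measurable N (count_space UNIV)"
  shows "(\<integral>\<^sup>+r. a r * h (p r) \<partial>N) = (\<Sum>k. (\<integral>\<^sup>+r. a r * indicator {k} (p r) \<partial>N) * h k)"
proof -
  have [measurable]: "(\<lambda>r. indicator {k} (p r) :: ennreal) \<in> borel_measurable N" for k
    by (rule measurable_compose[OF assms(2)]) auto
  have "a r * h (p r) = (\<Sum>k. a r * indicator {k} (p r) * h k)" for r
  proof -
    have "(\<Sum>k. a r * indicator {k} (p r) * h k) = (\<Sum>k\<in>{p r}. a r * indicator {k} (p r) * h k)"
      by (rule suminf_finite) (auto simp: indicator_def)
    then show ?thesis by simp
  qed
  then have "(\<integral>\<^sup>+r. a r * h (p r) \<partial>N) = (\<integral>\<^sup>+r. (\<Sum>k. a r * indicator {k} (p r) * h k) \<partial>N)"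
    by simp
  also have "\<dots> = (\<Sum>k. \<integral>\<^sup>+r. a r * indicator {k} (p r) * h k \<partial>N)"
    by (rule nn_integral_suminf) simp
  finally show ?thesis by (simp add: nn_integral_multc)
qed

lemma suminf_eq_liminf:
  fixes f :: "nat \<Rightarrow> ennreal"
  shows "(\<Sum>k. f k) = liminf (\<lambda>m. \<Sum>k<m. f k)"
  using lim_imp_Liminf[OF _ summable_LIMSEQ[OF summableI[of f]]] by simp

lemma mult_liminf_le:
  fixes a :: ennreal
  shows "a * liminf f \<le> liminf (\<lambda>m::nat. a * f m)"
  unfolding liminf_SUP_INF SUP_mult_left_ennreal
  by (intro SUP_mono' INF_greatest mult_left_mono INF_lower) auto

context banach_function_norm
begin

lemma rho_cong_AE:
  assumes "f \<in> borel_measurable M" "g \<in> borel_measurable M" "AE w in M. f w = g w"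
  shows "\<rho> f = \<rho> g"
proof (rule antisym)
  show "\<rho> f \<le> \<rho> g" using assms(3) by (intro rho_mono assms) auto
  show "\<rho> g \<le> \<rho> f" using assms(3) by (intro rho_mono assms) auto
qed

lemma rho_mono':
  assumes "f \<in> borel_measurable M" "g \<in> borel_measurable M" "\<And>w. w \<in> space M \<Longrightarrow> g w \<le> f w"
  shows "\<rho> g \<le> \<rho> f"
  using assms by (intro rho_mono) auto

lemma rho_zero [simp]: "\<rho> (\<lambda>_. 0) = 0"
  by (subst rho_eq_0_iff) auto

lemma rho_SUP:
  assumes [measurable]: "\<And>n. F n \<in> borel_measurable M" and inc: "\<And>w. incseq (\<lambda>n::nat. F n w)"
  shows "\<rho> (\<lambda>w. SUP n. F n w) = (SUP n. \<rho> (F n))"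
proof -
  have "incseq (\<lambda>n. \<rho> (F n)) \<and> (\<lambda>n. \<rho> (F n)) \<longlonglongrightarrow> \<rho> (\<lambda>w. SUP n. F n w)"
    using inc by (intro rho_Fatou) (auto intro: LIMSEQ_SUP)
  then show ?thesis
    using LIMSEQ_SUP LIMSEQ_unique by blast
qed

lemma rho_liminf:
  assumes [measurable]: "\<And>n. F n \<in> borel_measurable M"
  shows "\<rho> (\<lambda>w. liminf (\<lambda>m. F m w)) \<le> liminf (\<lambda>m. \<rho> (F m))"
proof -
  have "\<rho> (\<lambda>w. liminf (\<lambda>m. F m w)) = (SUP n. \<rho> (\<lambda>w. INF m\<in>{n..}. F m w))"
    unfolding liminf_SUP_INF
    by (rule rho_SUP) (auto intro!: monoI INF_superset_mono)
  also have "\<dots> \<le> liminf (\<lambda>m. \<rho> (F m))"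
    unfolding liminf_SUP_INF
    by (intro SUP_mono' INF_greatest rho_mono') (auto intro: INF_lower)
  finally show ?thesis .
qed

lemma rho_cmult:
  assumes [measurable]: "f \<in> borel_measurable M"
  shows "\<rho> (\<lambda>w. c * f w) = c * \<rho> f"
proof (cases c)
  case (real r)
  then show ?thesis using rho_scale[of f r] assms by (cases "r = 0") auto
next
  case top
  \<comment> \<open>The factor \<open>top\<close> is the supremum of the natural numbers, so
    homogeneity for it is a monotone limit of homogeneity for finite factors.\<close>
  have *: "top * x = (SUP n::nat. of_nat n * x)" for x :: ennreal
    by (simp add: SUP_mult_right_ennreal[symmetric] ennreal_SUP_of_nat_eq_top)
  have "\<rho> (\<lambda>w. of_nat n * f w) = of_nat n * \<rho> f" for n :: nat
    using rho_scale[of f "real n"] assms by (cases "n = 0") (auto simp: ennreal_of_nat_eq_real_of_nat)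
  moreover have "\<rho> (\<lambda>w. SUP n::nat. of_nat n * f w) = (SUP n::nat. \<rho> (\<lambda>w. of_nat n * f w))"
    by (rule rho_SUP) (auto intro!: monoI mult_right_mono simp: of_nat_mono)
  ultimately show ?thesis by (simp add: top *)
qed

lemma rho_sum:
  assumes "finite K" "\<And>k. k \<in> K \<Longrightarrow> f k \<in> borel_measurable M"
  shows "\<rho> (\<lambda>w. \<Sum>k\<in>K. f k w) \<le> (\<Sum>k\<in>K. \<rho> (f k))"
  using assms
proof (induction K rule: finite_induct)
  case (insert i K)
  have "\<rho> (\<lambda>w. \<Sum>k\<in>insert i K. f k w) = \<rho> (\<lambda>w. f i w + (\<Sum>k\<in>K. f k w))"
    using insert by simp
  also have "\<dots> \<le> \<rho> (f i) + \<rho> (\<lambda>w. \<Sum>k\<in>K. f k w)"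
    using insert by (intro rho_triangle) auto
  also have "\<dots> \<le> \<rho> (f i) + (\<Sum>k\<in>K. \<rho> (f k))"
    using insert by (intro add_left_mono) auto
  finally show ?case using insert by simp
qed simp

lemma rho_suminf:
  assumes "\<And>k. f k \<in> borel_measurable M"
  shows "\<rho> (\<lambda>w. \<Sum>k. f k w) \<le> (\<Sum>k. \<rho> (f k))"
proof -
  have "\<rho> (\<lambda>w. \<Sum>k. f k w) \<le> liminf (\<lambda>m. \<rho> (\<lambda>w. \<Sum>k<m. f k w))"
    unfolding suminf_eq_liminf using assms by (intro rho_liminf) auto
  also have "\<dots> \<le> liminf (\<lambda>m. \<Sum>k<m. \<rho> (f k))"
    using assms by (intro Liminf_mono always_eventually allI rho_sum) auto
  also have "\<dots> = (\<Sum>k. \<rho> (f k))" by (rule suminf_eq_liminf[symmetric])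
  finally show ?thesis .
qed

text \<open>The local embedding into the integrable functions forces finiteness almost everywhere on
  each \<open>\<Omega> n\<close>, and these countably many sets cover the space.\<close>

lemma rho_finite_AE:
  assumes [measurable]: "f \<in> borel_measurable M" and fin: "\<rho> f < \<infinity>"
  shows "AE w in M. f w < \<infinity>"
proof -
  have "AE w in M. w \<in> \<Omega> n \<longrightarrow> f w < \<infinity>" for n
  proof -
    have [measurable]: "\<Omega> n \<in> sets M" by (rule Omega_sets)
    have "bounded_set M \<Omega> (\<Omega> n)" by (auto simp: bounded_set_def Omega_sets)
    from rho_local_L1[OF this] obtain C where C: "C < \<infinity>"
      "(\<integral>\<^sup>+w\<in>\<Omega> n. f w \<partial>M) \<le> C * \<rho> f" by auto
    have "(\<integral>\<^sup>+w\<in>\<Omega> n. f w \<partial>M) < \<infinity>"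
      using C(2) ennreal_mult_less_top[of C "\<rho> f"] C(1) fin by (simp add: order_le_less_trans)
    then have "AE w in M. f w * indicator (\<Omega> n) w \<noteq> \<infinity>"
      by (intro nn_integral_PInf_AE) auto
    then show ?thesis
      by eventually_elim (auto simp: indicator_def less_top split: if_splits)
  qed
  then have "AE w in M. \<forall>n. w \<in> \<Omega> n \<longrightarrow> f w < \<infinity>" by (subst AE_all_countable) simp
  then show ?thesis
    using AE_space by eventually_elim (use Omega_Union in auto)
qed

lemma rho_ls_sum:
  assumes "finite I" "1 \<le> s" "finite K" and f: "\<And>k j. j \<in> I \<Longrightarrow> f k j \<in> borel_measurable M"
  shows "\<rho> (\<lambda>w. ls_norm s I (\<lambda>j. \<Sum>k\<in>K. f k j w)) \<le> (\<Sum>k\<in>K. \<rho> (\<lambda>w. ls_norm s I (\<lambda>j. f k j w)))"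
proof -
  have *: "ls_norm s I (\<lambda>j. \<Sum>k\<in>K. g k j) \<le> (\<Sum>k\<in>K. ls_norm s I (g k))" for g :: "_ \<Rightarrow> _ \<Rightarrow> ennreal"
    using \<open>finite K\<close>
  proof (induction K rule: finite_induct)
    case empty
    have "ls_norm s I (\<lambda>j. 0) = 0" using ls_norm_cmult[OF assms(1,2), of 0] by simp
    then show ?case by simp
  next
    case (insert k K)
    have "ls_norm s I (\<lambda>j. \<Sum>k\<in>insert k K. g k j) = ls_norm s I (\<lambda>j. g k j + (\<Sum>k\<in>K. g k j))"
      using insert by simp
    also have "\<dots> \<le> ls_norm s I (g k) + ls_norm s I (\<lambda>j. \<Sum>k\<in>K. g k j)"
      using assms by (intro ls_norm_triangle)
    also have "\<dots> \<le> ls_norm s I (g k) + (\<Sum>k\<in>K. ls_norm s I (g k))"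
      using insert by (intro add_left_mono)
    finally show ?case using insert by simp
  qed
  have "\<rho> (\<lambda>w. ls_norm s I (\<lambda>j. \<Sum>k\<in>K. f k j w)) \<le> \<rho> (\<lambda>w. \<Sum>k\<in>K. ls_norm s I (\<lambda>j. f k j w))"
    using assms by (intro rho_mono' * ls_norm_measurable borel_measurable_sum) auto
  also have "\<dots> \<le> (\<Sum>k\<in>K. \<rho> (\<lambda>w. ls_norm s I (\<lambda>j. f k j w)))"
    using assms by (intro rho_sum ls_norm_measurable) auto
  finally show ?thesis .
qed

lemma rho_ls_liminf:
  assumes "finite I" "1 \<le> s" and f: "\<And>k j. j \<in> I \<Longrightarrow> f k j \<in> borel_measurable M"
  shows "\<rho> (\<lambda>w. ls_norm s I (\<lambda>j. liminf (\<lambda>m. f m j w))) \<le> liminf (\<lambda>m. \<rho> (\<lambda>w. ls_norm s I (\<lambda>j. f m j w)))"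
proof -
  have "\<rho> (\<lambda>w. ls_norm s I (\<lambda>j. liminf (\<lambda>m. f m j w))) \<le> \<rho> (\<lambda>w. liminf (\<lambda>m. ls_norm s I (\<lambda>j. f m j w)))"
    using assms by (intro rho_mono' ls_norm_liminf ls_norm_measurable borel_measurable_liminf) auto
  also have "\<dots> \<le> liminf (\<lambda>m. \<rho> (\<lambda>w. ls_norm s I (\<lambda>j. f m j w)))"
    using assms by (intro rho_liminf ls_norm_measurable) auto
  finally show ?thesis .
qed

lemma rho_ls_suminf:
  assumes "finite I" "1 \<le> s" and f: "\<And>k j. j \<in> I \<Longrightarrow> f k j \<in> borel_measurable M"
  shows "\<rho> (\<lambda>w. ls_norm s I (\<lambda>j. \<Sum>k. c k * f k j w)) \<le> (\<Sum>k. c k * \<rho> (\<lambda>w. ls_norm s I (\<lambda>j. f k j w)))"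
proof -
  have "\<rho> (\<lambda>w. ls_norm s I (\<lambda>j. \<Sum>k. c k * f k j w))
      \<le> liminf (\<lambda>m. \<rho> (\<lambda>w. ls_norm s I (\<lambda>j. \<Sum>k<m. c k * f k j w)))"
    unfolding suminf_eq_liminf using assms by (intro rho_ls_liminf) auto
  also have "\<dots> \<le> liminf (\<lambda>m. \<Sum>k<m. \<rho> (\<lambda>w. ls_norm s I (\<lambda>j. c k * f k j w)))"
    using assms by (intro Liminf_mono always_eventually allI rho_ls_sum) auto
  also have "\<dots> = liminf (\<lambda>m. \<Sum>k<m. c k * \<rho> (\<lambda>w. ls_norm s I (\<lambda>j. f k j w)))"
    using assms by (simp add: ls_norm_cmult rho_cmult)
  also have "\<dots> = (\<Sum>k. c k * \<rho> (\<lambda>w. ls_norm s I (\<lambda>j. f k j w)))"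
    by (rule suminf_eq_liminf[symmetric])
  finally show ?thesis .
qed

text \<open>Minkowski's integral inequality, available here only for integrands that are limits of
  functions taking countably many values in the variable of integration.\<close>

lemma rho_ls_nn_integral_le:
  fixes N :: "'r measure" and p :: "nat \<Rightarrow> 'r \<Rightarrow> nat" and V :: "nat \<Rightarrow> nat \<Rightarrow> 'i \<Rightarrow> 'a \<Rightarrow> ennreal"
  assumes N: "sigma_finite_measure N" and "finite I" "1 \<le> s"
    and a [measurable]: "a \<in> borel_measurable N"
    and p [measurable]: "\<And>m. p m \<in> measurable N (count_space UNIV)"
    and V: "\<And>m k j. j \<in> I \<Longrightarrow> V m k j \<in> borel_measurable M"
    and U: "\<And>j. j \<in> I \<Longrightarrow> (\<lambda>(r, w). U j r w) \<in> borel_measurable (N \<Otimes>\<^sub>M M)"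
    and UV: "\<And>r j. r \<in> space N \<Longrightarrow> j \<in> I \<Longrightarrow> AE w in M. U j r w \<le> liminf (\<lambda>m. V m (p m r) j w)"
    and b: "\<And>m r. r \<in> space N \<Longrightarrow> \<rho> (\<lambda>w. ls_norm s I (\<lambda>j. V m (p m r) j w)) \<le> b m r"
  shows "\<rho> (\<lambda>w. ls_norm s I (\<lambda>j. \<integral>\<^sup>+r. a r * U j r w \<partial>N)) \<le> liminf (\<lambda>m. \<integral>\<^sup>+r. a r * b m r \<partial>N)"
proof -
  interpret N: sigma_finite_measure N by fact
  interpret NM: pair_sigma_finite N M ..
  \<comment> \<open>\<open>c m k\<close> is the mass that the weight \<open>a\<close> gives to the
    set where the \<open>m\<close>-th approximant takes its \<open>k\<close>-th value.\<close>
  define c where "c m k = (\<integral>\<^sup>+r. a r * indicator {k} (p m r) \<partial>N)" for m k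
  have Vint: "(\<integral>\<^sup>+r. a r * V m (p m r) j w \<partial>N) = (\<Sum>k. c m k * V m k j w)" for m j w
    unfolding c_def by (rule nn_integral_countable_valued[where h = "\<lambda>k. V m k j w"]) auto
  have VM: "(\<lambda>x. V m (p m (fst x)) j (snd x)) \<in> borel_measurable (N \<Otimes>\<^sub>M M)" if "j \<in> I" for m j
    by (rule measurable_compose_countable[where f = "\<lambda>k x. V m k j (snd x)"])
      (use V[OF that] in \<open>auto intro!: measurable_compose[OF measurable_snd] measurable_compose[OF measurable_fst p]\<close>)
  have AEj: "AE w in M. (\<integral>\<^sup>+r. a r * U j r w \<partial>N) \<le> liminf (\<lambda>m. \<Sum>k. c m k * V m k j w)" if j: "j \<in> I" for j
  proof -
    \<comment> \<open>By hypothesis the bound holds for each \<open>r\<close> off a null set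
      depending on \<open>r\<close>. Joint measurability lets a single null set of points
      \<open>w\<close> serve almost every \<open>r\<close>.\<close>
    have "AE w in M. AE r in N. U j r w \<le> liminf (\<lambda>m. V m (p m r) j w)"
    proof (subst NM.AE_commute[symmetric])
      have "{x \<in> space (N \<Otimes>\<^sub>M M). (\<lambda>(r, w). U j r w) x \<le> liminf (\<lambda>m. V m (p m (fst x)) j (snd x))}
          \<in> sets (N \<Otimes>\<^sub>M M)"
        using U[OF j] VM[OF j] by measurable
      then show "{x \<in> space (N \<Otimes>\<^sub>M M). U j (fst x) (snd x) \<le> liminf (\<lambda>m. V m (p m (fst x)) j (snd x))}
          \<in> sets (N \<Otimes>\<^sub>M M)" by (simp add: case_prod_unfold)
      show "AE r in N. AE w in M. U j r w \<le> liminf (\<lambda>m. V m (p m r) j w)"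
        using UV[OF _ j] by auto
    qed
    then show ?thesis
      using AE_space
    proof eventually_elim
      case (elim w)
      have Vm: "(\<lambda>r. V m (p m r) j w) \<in> borel_measurable N" for m
        using measurable_compose[OF p, of "\<lambda>k. V m k j w" borel m] by simp
      have "(\<integral>\<^sup>+r. a r * U j r w \<partial>N) \<le> (\<integral>\<^sup>+r. liminf (\<lambda>m. a r * V m (p m r) j w) \<partial>N)"
        using elim(1)
        by (intro nn_integral_mono_AE) (auto elim!: eventually_mono intro!: order_trans[OF mult_left_mono mult_liminf_le])
      also have "\<dots> \<le> liminf (\<lambda>m. \<integral>\<^sup>+r. a r * V m (p m r) j w \<partial>N)"
        using Vm by (intro nn_integral_liminf) auto
      finally show ?case by (simp add: Vint)
    qed
  qed
  have Um: "(\<lambda>w. \<integral>\<^sup>+r. a r * U j r w \<partial>N) \<in> borel_measurable M" if "j \<in> I" for j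
  proof -
    have "(\<lambda>x. a (snd x) * (\<lambda>(r, w). U j r w) (snd x, fst x)) \<in> borel_measurable (M \<Otimes>\<^sub>M N)"
      using measurable_compose[OF measurable_pair_swap' U[OF that]] by (auto simp: split_beta')
    then have "(\<lambda>(w, r). a r * U j r w) \<in> borel_measurable (M \<Otimes>\<^sub>M N)"
      by (simp add: split_beta')
    from N.borel_measurable_nn_integral[OF this] show ?thesis by simp
  qed
  have "\<rho> (\<lambda>w. ls_norm s I (\<lambda>j. \<integral>\<^sup>+r. a r * U j r w \<partial>N))
      \<le> \<rho> (\<lambda>w. ls_norm s I (\<lambda>j. liminf (\<lambda>m. \<Sum>k. c m k * V m k j w)))"
  proof (intro rho_mono ls_norm_measurable)
    have "AE w in M. \<forall>j\<in>I. (\<integral>\<^sup>+r. a r * U j r w \<partial>N) \<le> liminf (\<lambda>m. \<Sum>k. c m k * V m k j w)"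
      using AEj \<open>finite I\<close> by (auto intro: AE_finite_allI)
    then show "AE w in M. ls_norm s I (\<lambda>j. \<integral>\<^sup>+r. a r * U j r w \<partial>N)
        \<le> ls_norm s I (\<lambda>j. liminf (\<lambda>m. \<Sum>k. c m k * V m k j w))"
      by eventually_elim (use assms in \<open>auto intro!: ls_norm_mono\<close>)
  qed (use V \<open>finite I\<close> Um in auto)
  also have "\<dots> \<le> liminf (\<lambda>m. \<rho> (\<lambda>w. ls_norm s I (\<lambda>j. \<Sum>k. c m k * V m k j w)))"
    using assms by (intro rho_ls_liminf) auto
  also have "\<dots> \<le> liminf (\<lambda>m. \<integral>\<^sup>+r. a r * b m r \<partial>N)"
  proof (intro Liminf_mono always_eventually allI)
    fix m
    have "\<rho> (\<lambda>w. ls_norm s I (\<lambda>j. \<Sum>k. c m k * V m k j w))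
        \<le> (\<Sum>k. c m k * \<rho> (\<lambda>w. ls_norm s I (\<lambda>j. V m k j w)))"
      using assms by (intro rho_ls_suminf) auto
    also have "\<dots> = (\<integral>\<^sup>+r. a r * \<rho> (\<lambda>w. ls_norm s I (\<lambda>j. V m (p m r) j w)) \<partial>N)"
      unfolding c_def
      by (rule nn_integral_countable_valued[where h = "\<lambda>k. \<rho> (\<lambda>w. ls_norm s I (\<lambda>j. V m k j w))", symmetric]) auto
    also have "\<dots> \<le> (\<integral>\<^sup>+r. a r * b m r \<partial>N)"
      using b by (intro nn_integral_mono mult_left_mono) auto
    finally show "\<rho> (\<lambda>w. ls_norm s I (\<lambda>j. \<Sum>k. c m k * V m k j w)) \<le> (\<integral>\<^sup>+r. a r * b m r \<partial>N)" .
  qed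
  finally show ?thesis .
qed

text \<open>The upper half of dominated convergence. \<open>B n\<close> collects the points where
  some \<open>f m\<close> with \<open>m \<ge> n\<close> still exceeds \<open>F + d * g\<close>;
  these sets decrease to a null set. Off \<open>B n\<close> the function \<open>f n\<close> lies
  below \<open>F + d * g\<close>, on \<open>B n\<close> below \<open>g\<close>, and absolute
  continuity removes the second contribution.\<close>

lemma rho_dominated_limsup:
  assumes ac: "abs_continuous_norm M \<rho>"
    and f [measurable]: "\<And>n. f n \<in> borel_measurable M" "F \<in> borel_measurable M" "g \<in> borel_measurable M"
    and lim: "AE w in M. (\<lambda>n. f n w) \<longlonglongrightarrow> F w"
    and dom: "\<And>n. AE w in M. f n w \<le> g w" and g: "\<rho> g < \<infinity>"
  shows "limsup (\<lambda>n. \<rho> (f n)) \<le> \<rho> F"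
proof (rule ennreal_le_epsilon)
  fix e :: real assume "e > 0"
  \<comment> \<open>With this choice \<open>d * \<rho> g\<close> is at most \<open>e\<close>; the
    summand 1 covers \<open>\<rho> g = 0\<close>.\<close>
  define d where "d = e / (2 * (enn2real (\<rho> g) + 1))"
  have d: "d > 0" using \<open>e > 0\<close> by (simp add: d_def add_nonneg_pos)
  define B where "B n = {w \<in> space M. \<exists>m\<ge>n. F w + ennreal d * g w < f m w}" for n
  have B [measurable]: "B n \<in> sets M" for n unfolding B_def by measurable
  have fin: "AE w in M. g w < \<infinity>" by (rule rho_finite_AE) fact+
  have domall: "AE w in M. \<forall>n. f n w \<le> g w" using dom by (simp add: AE_all_countable)
  \<comment> \<open>Absolute continuity of the norm speaks of complex functions, so \<open>g\<close>
    is replaced by a finite complex version that equals it almost everywhere.\<close>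
  define h where "h w = complex_of_real (enn2real (g w))" for w
  have h [measurable]: "h \<in> borel_measurable M" unfolding h_def by measurable
  have hg: "AE w in M. ennreal (cmod (h w)) = g w"
    using fin by eventually_elim (auto simp: h_def)
  have "bfs_norm \<rho> h = \<rho> g"
    unfolding bfs_norm_def using hg by (intro rho_cong_AE) auto
  then have "h \<in> bfs M \<rho>" using g by (simp add: bfs_def)
  moreover have "decseq B"
    unfolding decseq_def B_def by (blast intro: order_trans)
  moreover have "AE w in M. (\<lambda>n. indicator (B n) w :: real) \<longlonglongrightarrow> 0"
    using lim domall fin AE_space
  proof eventually_elim
    case (elim w)
    \<comment> \<open>Where \<open>g\<close> vanishes, so does every \<open>f m\<close>. Elsewhere
      \<open>F + d * g\<close> lies strictly above the limit \<open>F\<close>, hence above all late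
      terms.\<close>
    have "\<exists>n. \<forall>m\<ge>n. f m w \<le> F w + ennreal d * g w"
    proof (cases "g w = 0")
      case True
      then show ?thesis using elim(2) by (metis le_zero_eq zero_le)
    next
      case False
      have "F w \<le> g w" using elim(2) by (intro LIMSEQ_le_const2[OF elim(1)]) auto
      then have "F w < F w + ennreal d * g w"
        using False d elim(3) by (cases "F w"; cases "g w") (auto simp: ennreal_mult[symmetric] ennreal_plus[symmetric] simp del: ennreal_plus
            intro!: ennreal_lessI add_nonneg_pos mult_pos_pos simp: top_unique)
      from order_tendstoD(2)[OF elim(1) this] show ?thesis
        by (auto simp: eventually_sequentially intro: less_imp_le)
    qed
    then obtain n where "\<forall>m\<ge>n. f m w \<le> F w + ennreal d * g w" ..
    then have "\<forall>m\<ge>n. w \<notin> B m" 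
      unfolding B_def by (simp add: not_less)
    then have "eventually (\<lambda>m. indicator (B m) w = (0::real)) sequentially"
      by (auto simp: eventually_sequentially indicator_def)
    then show ?case by (rule tendsto_eventually)
  qed
  ultimately have "(\<lambda>n. bfs_norm \<rho> (\<lambda>w. h w * indicator (B n) w)) \<longlonglongrightarrow> 0"
    using ac B unfolding abs_continuous_norm_def by blast
  moreover have "bfs_norm \<rho> (\<lambda>w. h w * indicator (B n) w) = \<rho> (\<lambda>w. g w * indicator (B n) w)" for n
    unfolding bfs_norm_def
    by (rule rho_cong_AE) (use hg in \<open>auto elim!: eventually_mono simp: indicator_def\<close>)
  ultimately have 0: "(\<lambda>n. \<rho> (\<lambda>w. g w * indicator (B n) w)) \<longlonglongrightarrow> 0" by simp
  have "\<rho> (f n) \<le> (\<rho> F + ennreal d * \<rho> g) + \<rho> (\<lambda>w. g w * indicator (B n) w)" for n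
  proof -
    have "\<rho> (f n) \<le> \<rho> (\<lambda>w. (F w + ennreal d * g w) + g w * indicator (B n) w)"
    proof (rule rho_mono)
      show "AE w in M. f n w \<le> (F w + ennreal d * g w) + g w * indicator (B n) w"
        using domall AE_space
      proof eventually_elim
        case (elim w)
        show ?case
        proof (cases "w \<in> B n")
          case True
          then show ?thesis using elim(1) by (simp add: add_increasing)
        next
          case False
          then have "f n w \<le> F w + ennreal d * g w" using elim(2) by (auto simp: B_def not_less)
          then show ?thesis using False by simp
        qed
      qed
    qed auto
    also have "\<dots> \<le> \<rho> (\<lambda>w. F w + ennreal d * g w) + \<rho> (\<lambda>w. g w * indicator (B n) w)"
      by (rule rho_triangle) auto
    also have "\<dots> \<le> (\<rho> F + \<rho> (\<lambda>w. ennreal d * g w)) + \<rho> (\<lambda>w. g w * indicator (B n) w)"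
      by (intro add_right_mono rho_triangle) auto
    finally show ?thesis by (simp add: rho_cmult)
  qed
  then have "limsup (\<lambda>n. \<rho> (f n)) \<le> limsup (\<lambda>n. (\<rho> F + ennreal d * \<rho> g) + \<rho> (\<lambda>w. g w * indicator (B n) w))"
    by (intro Limsup_mono always_eventually) auto
  also have "\<dots> = \<rho> F + ennreal d * \<rho> g + 0"
    by (intro lim_imp_Limsup tendsto_add tendsto_const 0) auto
  also have "\<dots> \<le> \<rho> F + ennreal e"
  proof -
    have "ennreal d * \<rho> g = ennreal (d * enn2real (\<rho> g))"
      using g d by (simp add: ennreal_mult less_top)
    also have "\<dots> \<le> ennreal e"
    proof (rule ennreal_leI)
      have "d * enn2real (\<rho> g) \<le> d * (2 * (enn2real (\<rho> g) + 1))"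
        using d by (intro mult_left_mono) auto
      also have "\<dots> = e" unfolding d_def by (simp add: add_nonneg_eq_0_iff)
      finally show "d * enn2real (\<rho> g) \<le> e" .
    qed
    finally show ?thesis by (simp add: add_left_mono)
  qed
  finally show "limsup (\<lambda>n. \<rho> (f n)) \<le> \<rho> F + ennreal e" .
qed

end

section \<open>Weights on the half-line and dyadic approximation\<close>

abbreviation lpos :: "real measure" where
  "lpos \<equiv> restrict_space lborel {0<..}"

lemma space_lpos [simp]: "space lpos = {0<..}"
  by (simp add: space_restrict_space)

lemma sigma_finite_lpos: "sigma_finite_measure lpos"
  by (rule sigma_finite_measure_restrict_space) (auto intro: lborel.sigma_finite_measure_axioms)

lemma borel_measurable_lpos: "f \<in> measurable borel N \<Longrightarrow> f \<in> measurable lpos N"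
  by (rule measurable_restrict_space1) simp

lemma continuous_imp_measurable_lpos:
  fixes f :: "real \<Rightarrow> 'b::topological_space"
  assumes "continuous_on {0<..} f"
  shows "f \<in> borel_measurable lpos"
proof -
  have "f \<in> borel_measurable (restrict_space borel {0<..})"
    by (rule borel_measurable_continuous_on_restrict) fact
  then show ?thesis by (simp cong: measurable_cong_sets add: sets_restrict_space)
qed

text \<open>The reciprocal of the weight in \<open>H0inf\<close>. As a bound on a scalar weight it
  matches resolvents, which decay like \<open>1 / r\<close>: the quotient
  \<open>decay \<epsilon> r / r\<close> is integrable on the half-line.\<close>

definition decay :: "real \<Rightarrow> real \<Rightarrow> real" where
  "decay \<epsilon> r = min (r powr \<epsilon>) (r powr (- \<epsilon>))"

lemma decay_nonneg [simp]: "0 \<le> decay \<epsilon> r"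
  by (simp add: decay_def)

lemma decay_measurable [measurable]: "decay \<epsilon> \<in> borel_measurable borel"
  unfolding decay_def by measurable

text \<open>A dilation costs a factor that is locally uniform in \<open>t\<close>. This gives one
  majorant for all \<open>t\<close> in a compact part of the half-line.\<close>

lemma decay_mult_le:
  assumes "0 < t" "0 < r" "0 < \<epsilon>" and m: "t \<le> m" "1 / t \<le> m"
  shows "decay \<epsilon> (t * r) \<le> m powr \<epsilon> * decay \<epsilon> r"
proof -
  have 1: "t powr \<epsilon> \<le> m powr \<epsilon>" using assms by (intro powr_mono2) auto
  have "t powr (- \<epsilon>) = (1 / t) powr \<epsilon>" using assms by (simp add: powr_minus powr_divide field_simps)
  also have "\<dots> \<le> m powr \<epsilon>" using assms by (intro powr_mono2) auto
  finally have 2: "t powr (- \<epsilon>) \<le> m powr \<epsilon>" .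
  have "decay \<epsilon> (t * r) = min (t powr \<epsilon> * r powr \<epsilon>) (t powr (- \<epsilon>) * r powr (- \<epsilon>))"
    using assms by (simp add: decay_def powr_mult)
  also have "\<dots> \<le> min (m powr \<epsilon> * r powr \<epsilon>) (m powr \<epsilon> * r powr (- \<epsilon>))"
    using 1 2 by (intro min.mono mult_right_mono) auto
  also have "\<dots> = m powr \<epsilon> * decay \<epsilon> r"
    by (simp add: decay_def min_mult_distrib_left)
  finally show ?thesis .
qed

lemma nn_integral_decay_finite:
  assumes "0 < \<epsilon>"
  shows "(\<integral>\<^sup>+r. ennreal (decay \<epsilon> r / r) \<partial>lpos) < \<infinity>"
proof -
  have 1: "(\<integral>\<^sup>+x. ennreal (indicator {0..1} x * x powr (\<epsilon> - 1)) \<partial>lborel)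
      = ennreal (1 powr (\<epsilon> - 1 + 1) / (\<epsilon> - 1 + 1))"
    using assms by (intro nn_integral_has_integral_lebesgue has_integral_powr_from_0) auto
  have 2: "(\<integral>\<^sup>+x. ennreal (indicator {1..} x * x powr (- \<epsilon> - 1)) \<partial>lborel)
      = ennreal (- (1 powr (- \<epsilon> - 1 + 1)) / (- \<epsilon> - 1 + 1))"
    using assms by (intro nn_integral_has_integral_lebesgue has_integral_powr_to_inf) auto
  have "(\<integral>\<^sup>+r. ennreal (decay \<epsilon> r / r) \<partial>lpos)
      = (\<integral>\<^sup>+r. ennreal (decay \<epsilon> r / r) * indicator {0<..} r \<partial>lborel)"
    by (rule nn_integral_restrict_space) simp
  also have "\<dots> \<le> (\<integral>\<^sup>+x. ennreal (indicator {0..1} x * x powr (\<epsilon> - 1))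
      + ennreal (indicator {1..} x * x powr (- \<epsilon> - 1)) \<partial>lborel)"
  proof (intro nn_integral_mono)
    fix x :: real
    have "decay \<epsilon> x / x \<le> indicator {0..1} x * x powr (\<epsilon> - 1) + indicator {1..} x * x powr (- \<epsilon> - 1)"
      if "x > 0"
    proof (cases "x \<le> 1")
      case True
      have "decay \<epsilon> x / x \<le> x powr \<epsilon> / x" using that by (intro divide_right_mono) (auto simp: decay_def)
      then show ?thesis using True that by (auto simp: powr_diff indicator_def)
    next
      case False
      have "decay \<epsilon> x / x \<le> x powr (- \<epsilon>) / x" using that by (intro divide_right_mono) (auto simp: decay_def)
      then show ?thesis using False that by (auto simp: powr_diff)
    qed
    then show "ennreal (decay \<epsilon> x / x) * indicator {0<..} x
      \<le> ennreal (indicator {0..1} x * x powr (\<epsilon> - 1)) + ennreal (indicator {1..} x * x powr (- \<epsilon> - 1))"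
      by (auto simp: indicator_def ennreal_plus[symmetric] simp del: ennreal_plus intro: ennreal_leI)
  qed
  also have "\<dots> = (\<integral>\<^sup>+x. ennreal (indicator {0..1} x * x powr (\<epsilon> - 1)) \<partial>lborel)
      + (\<integral>\<^sup>+x. ennreal (indicator {1..} x * x powr (- \<epsilon> - 1)) \<partial>lborel)"
    by (rule nn_integral_add) auto
  also have "\<dots> < \<infinity>" unfolding 1 2 by (simp add: less_top[symmetric])
  finally show ?thesis .
qed

text \<open>\<open>r\<close> lies in the cell \<open>(k / 2\<^sup>m, (k + 1) / 2\<^sup>m]\<close> with \<open>k = dyidx m r\<close>. Sampling at the right
  endpoint keeps bounds of the form \<open>B / r\<close>.\<close>

definition dyidx :: "nat \<Rightarrow> real \<Rightarrow> nat" where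
  "dyidx m r = nat (\<lceil>r * 2 ^ m\<rceil> - 1)"

definition dypt :: "nat \<Rightarrow> nat \<Rightarrow> real" where
  "dypt m k = (real k + 1) / 2 ^ m"

lemma dyidx_measurable [measurable]: "dyidx m \<in> measurable lpos (count_space UNIV)"
proof -
  have "dyidx m \<in> measurable borel (count_space UNIV)"
    unfolding dyidx_def by measurable
  then show ?thesis by (rule borel_measurable_lpos)
qed

lemma dypt_pos [simp]: "0 < dypt m k"
  by (simp add: dypt_def add_nonneg_pos)

lemma dypt_dyidx:
  assumes "0 < r"
  shows "r \<le> dypt m (dyidx m r)" "dypt m (dyidx m r) < r + 1 / 2 ^ m"
proof -
  have "0 < r * 2 ^ m" using assms by simp
  then have "1 \<le> \<lceil>r * 2 ^ m\<rceil>" by (simp add: le_ceiling_iff)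
  then have "real (dyidx m r) + 1 = of_int \<lceil>r * 2 ^ m\<rceil>"
    by (simp add: dyidx_def)
  then have *: "dypt m (dyidx m r) = of_int \<lceil>r * 2 ^ m\<rceil> / 2 ^ m" by (simp add: dypt_def)
  show "r \<le> dypt m (dyidx m r)" "dypt m (dyidx m r) < r + 1 / 2 ^ m"
    unfolding * using le_of_int_ceiling[of "r * 2 ^ m"] ceiling_correct[of "r * 2 ^ m"]
    by (auto simp: field_simps)
qed

lemma dypt_dyidx_tendsto:
  assumes "0 < r"
  shows "(\<lambda>m. dypt m (dyidx m r)) \<longlonglongrightarrow> r"
proof (rule tendsto_sandwich)
  show "(\<lambda>m. r) \<longlonglongrightarrow> r" by simp
  have "(\<lambda>m. r + (1/2) ^ m) \<longlonglongrightarrow> r + 0"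
    by (intro tendsto_add tendsto_const LIMSEQ_power_zero) auto
  then show "(\<lambda>m. r + 1 / 2 ^ m) \<longlonglongrightarrow> r" by (simp add: power_divide)
qed (use dypt_dyidx[OF assms] in \<open>auto intro!: always_eventually less_imp_le\<close>)

text \<open>A pointwise limit of dyadic step functions is jointly measurable, whatever the values of
  \<open>F\<close> at non-dyadic points; it serves as the jointly measurable representative of a Lipschitz
  family of classes of functions.\<close>

definition rep :: "(real \<Rightarrow> 'a \<Rightarrow> complex) \<Rightarrow> real \<Rightarrow> 'a \<Rightarrow> complex" where
  "rep F r w = lim (\<lambda>m. F (dypt m (dyidx m r)) w)"

lemma step_measurable:
  assumes "\<And>k. V k \<in> borel_measurable M" "p \<in> measurable N (count_space (UNIV :: nat set))"
  shows "(\<lambda>x. V (p (fst x)) (snd x)) \<in> borel_measurable (N \<Otimes>\<^sub>M M)"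
  by (rule measurable_compose_countable[where f = "\<lambda>k x. V k (snd x)"])
    (auto intro!: measurable_compose[OF measurable_snd] measurable_compose[OF measurable_fst] assms)

lemma rep_measurable:
  assumes "\<And>r. 0 < r \<Longrightarrow> F r \<in> borel_measurable M"
  shows "(\<lambda>(r, w). rep F r w) \<in> borel_measurable (lpos \<Otimes>\<^sub>M M)"
proof -
  have "(\<lambda>x. F (dypt m (dyidx m (fst x))) (snd x)) \<in> borel_measurable (lpos \<Otimes>\<^sub>M M)" for m
    by (rule step_measurable[where V = "\<lambda>k. F (dypt m k)" and p = "dyidx m"])
       (use assms in auto)
  then show ?thesis
    unfolding rep_def split_beta' by (rule borel_measurable_lim_metric)
qed

lemma rep_measurable1:
  assumes "\<And>r. 0 < r \<Longrightarrow> F r \<in> borel_measurable M" "w \<in> space M"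
  shows "(\<lambda>r. rep F r w) \<in> borel_measurable lpos"
  using measurable_compose[OF measurable_Pair2'[OF assms(2)] rep_measurable[OF assms(1)]] by simp

context banach_function_norm
begin

lemma bfs_measurable: "f \<in> bfs M \<rho> \<Longrightarrow> f \<in> borel_measurable M"
  by (simp add: bfs_def)

lemma bfs_norm_finite: "f \<in> bfs M \<rho> \<Longrightarrow> bfs_norm \<rho> f < \<infinity>"
  by (simp add: bfs_def)

lemma bfs_norm_cong_AE:
  assumes "f \<in> borel_measurable M" "g \<in> borel_measurable M" "AE w in M. f w = g w"
  shows "bfs_norm \<rho> f = bfs_norm \<rho> g"
  unfolding bfs_norm_def using assms by (intro rho_cong_AE) (auto elim: eventually_mono)

lemma bfs_norm_add:
  assumes [measurable]: "f \<in> borel_measurable M" "g \<in> borel_measurable M"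
  shows "bfs_norm \<rho> (\<lambda>w. f w + g w) \<le> bfs_norm \<rho> f + bfs_norm \<rho> g"
proof -
  have "bfs_norm \<rho> (\<lambda>w. f w + g w) \<le> \<rho> (\<lambda>w. ennreal (cmod (f w)) + ennreal (cmod (g w)))"
    unfolding bfs_norm_def
    by (intro rho_mono') (auto simp: ennreal_plus[symmetric] norm_triangle_ineq simp del: ennreal_plus intro!: ennreal_leI)
  also have "\<dots> \<le> bfs_norm \<rho> f + bfs_norm \<rho> g"
    unfolding bfs_norm_def by (intro rho_triangle) auto
  finally show ?thesis .
qed

lemma bfs_norm_cmult:
  assumes [measurable]: "f \<in> borel_measurable M"
  shows "bfs_norm \<rho> (\<lambda>w. c * f w) = ennreal (cmod c) * bfs_norm \<rho> f"
  unfolding bfs_norm_def by (simp add: norm_mult ennreal_mult rho_cmult)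

lemma bfs_norm_minus_commute: "bfs_norm \<rho> (\<lambda>w. f w - g w) = bfs_norm \<rho> (\<lambda>w. g w - f w)"
  by (simp add: bfs_norm_def norm_minus_commute)

lemma bfs_norm_triangle_diff:
  assumes [measurable]: "f \<in> borel_measurable M" "g \<in> borel_measurable M" "h \<in> borel_measurable M"
  shows "bfs_norm \<rho> (\<lambda>w. f w - h w) \<le> bfs_norm \<rho> (\<lambda>w. f w - g w) + bfs_norm \<rho> (\<lambda>w. g w - h w)"
  using bfs_norm_add[of "\<lambda>w. f w - g w" "\<lambda>w. g w - h w"] by simp

lemma bfs_zero [simp]: "(\<lambda>_. 0) \<in> bfs M \<rho>"
  by (simp add: bfs_def bfs_norm_def)

lemma bfs_add:
  assumes "f \<in> bfs M \<rho>" "g \<in> bfs M \<rho>"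
  shows "(\<lambda>w. f w + g w) \<in> bfs M \<rho>"
proof -
  have "bfs_norm \<rho> (\<lambda>w. f w + g w) \<le> bfs_norm \<rho> f + bfs_norm \<rho> g"
    using assms by (intro bfs_norm_add) (auto simp: bfs_def)
  also have "\<dots> < \<infinity>" using assms by (simp add: bfs_def)
  finally show ?thesis using assms by (auto simp: bfs_def)
qed

lemma bfs_cmult:
  assumes "f \<in> bfs M \<rho>"
  shows "(\<lambda>w. c * f w) \<in> bfs M \<rho>"
  using assms by (auto simp: bfs_def bfs_norm_cmult ennreal_mult_less_top)

lemma bfs_diff:
  assumes "f \<in> bfs M \<rho>" "g \<in> bfs M \<rho>"
  shows "(\<lambda>w. f w - g w) \<in> bfs M \<rho>"
  using bfs_add[OF assms(1) bfs_cmult[OF assms(2), of "-1"]] by simp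

lemma bfs_sum:
  assumes "\<And>k. k \<in> K \<Longrightarrow> f k \<in> bfs M \<rho>"
  shows "(\<lambda>w. \<Sum>k\<in>K. f k w) \<in> bfs M \<rho>"
  using assms by (induction K rule: infinite_finite_induct) (auto intro: bfs_add)

lemma bfs_norm_0_AE:
  assumes "f \<in> borel_measurable M" "bfs_norm \<rho> f = 0"
  shows "AE w in M. f w = 0"
  using assms rho_eq_0_iff[of "\<lambda>w. ennreal (cmod (f w))"] by (simp add: bfs_norm_def)

lemma AE_eq_if_bfs_norm_le:
  assumes "f \<in> borel_measurable M" "g \<in> borel_measurable M"
    and le: "\<And>n. bfs_norm \<rho> (\<lambda>w. f w - g w) \<le> e n" and e: "e \<longlonglongrightarrow> 0"
  shows "AE w in M. f w = g w"
proof -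
  have "bfs_norm \<rho> (\<lambda>w. f w - g w) \<le> 0"
    using le by (intro LIMSEQ_le_const[OF e]) auto
  then have "AE w in M. f w - g w = 0"
    using assms by (intro bfs_norm_0_AE) auto
  then show ?thesis by simp
qed

text \<open>Modelled on \<open>r \<mapsto> R(re\<^sup>i\<^sup>\<alpha>, A) x\<close>: sectoriality gives the norm bound, the resolvent
  identity the Lipschitz bound.\<close>

definition good_family :: "(real \<Rightarrow> 'a \<Rightarrow> complex) \<Rightarrow> real \<Rightarrow> bool" where
  "good_family F B \<longleftrightarrow> 0 \<le> B \<and> (\<forall>r>0. F r \<in> bfs M \<rho>) \<and>
     (\<forall>r>0. bfs_norm \<rho> (F r) \<le> ennreal (B / r)) \<and>
     (\<forall>r>0. \<forall>r'>0. bfs_norm \<rho> (\<lambda>w. F r w - F r' w) \<le> ennreal (B * \<bar>r - r'\<bar> / (r * r')))"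

lemma good_familyD:
  assumes "good_family F B"
  shows "0 \<le> B" "\<And>r. 0 < r \<Longrightarrow> F r \<in> bfs M \<rho>" "\<And>r. 0 < r \<Longrightarrow> F r \<in> borel_measurable M"
    "\<And>r. 0 < r \<Longrightarrow> bfs_norm \<rho> (F r) \<le> ennreal (B / r)"
    "\<And>r r'. 0 < r \<Longrightarrow> 0 < r' \<Longrightarrow> bfs_norm \<rho> (\<lambda>w. F r w - F r' w) \<le> ennreal (B * \<bar>r - r'\<bar> / (r * r'))"
  using assms by (auto simp: good_family_def bfs_def)

lemma good_family_dyadic:
  assumes "good_family F B" "0 < r"
  shows "bfs_norm \<rho> (\<lambda>w. F (dypt m (dyidx m r)) w - F r w) \<le> ennreal (B / 2 ^ m / r ^ 2)"
proof -
  note F = good_familyD[OF assms(1)]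
  let ?q = "dypt m (dyidx m r)"
  have q: "r \<le> ?q" "?q < r + 1 / 2 ^ m" using dypt_dyidx[OF assms(2)] by auto
  have "bfs_norm \<rho> (\<lambda>w. F ?q w - F r w) \<le> ennreal (B * \<bar>?q - r\<bar> / (?q * r))"
    using assms by (intro F) auto
  also have "\<dots> \<le> ennreal (B * (1 / 2 ^ m) / (r * r))"
    using q assms F(1) by (intro ennreal_leI frac_le mult_left_mono mult_right_mono) auto
  finally show ?thesis by (simp add: power2_eq_square)
qed

text \<open>The dyadic errors form a geometric series in norm. Hence the series of their moduli has
  finite norm, is finite almost everywhere, and its terms tend to 0 there.\<close>

lemma rep_AE:
  assumes "good_family F B" "0 < r"
  shows "AE w in M. (\<lambda>m. F (dypt m (dyidx m r)) w) \<longlonglongrightarrow> F r w"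
proof -
  note F = good_familyD[OF assms(1)]
  define d where "d m w = ennreal (cmod (F (dypt m (dyidx m r)) w - F r w))" for m w
  have d [measurable]: "d m \<in> borel_measurable M" for m
    unfolding d_def using F(3)[OF assms(2)] F(3)[OF dypt_pos] by measurable
  have "\<rho> (\<lambda>w. \<Sum>m. d m w) \<le> (\<Sum>m. \<rho> (d m))" by (rule rho_suminf) measurable
  also have "\<dots> \<le> (\<Sum>m. ennreal (B / r ^ 2 * (1 / 2) ^ m))"
    using good_family_dyadic[OF assms] 
    by (intro suminf_le) (auto simp: d_def[abs_def] bfs_norm_def field_simps)
  also have "\<dots> = ennreal (\<Sum>m. B / r ^ 2 * (1 / 2) ^ m)"
    using F(1) by (intro suminf_ennreal2) (auto intro!: summable_mult summable_geometric)
  also have "\<dots> < \<infinity>" by simp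
  finally have "AE w in M. (\<Sum>m. d m w) < \<infinity>" by (intro rho_finite_AE) measurable
  then show ?thesis
  proof eventually_elim
    case (elim w)
    then have "summable (\<lambda>m. cmod (F (dypt m (dyidx m r)) w - F r w))"
      by (intro summable_suminf_not_top) (auto simp: d_def less_top)
    then have "(\<lambda>m. cmod (F (dypt m (dyidx m r)) w - F r w)) \<longlonglongrightarrow> 0"
      by (rule summable_LIMSEQ_zero)
    then show ?case by (simp add: tendsto_norm_zero_iff LIM_zero_iff)
  qed
qed

lemma rep_eq_AE:
  assumes "good_family F B" "0 < r"
  shows "AE w in M. rep F r w = F r w"
  using rep_AE[OF assms] by eventually_elim (auto simp: rep_def intro: limI)

lemma good_rep_measurable:
  assumes "good_family F B"
  shows "(\<lambda>(r, w). rep F r w) \<in> borel_measurable (lpos \<Otimes>\<^sub>M M)"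
  using good_familyD(3)[OF assms] by (rule rep_measurable)

text \<open>The approximants only use values of \<open>F j\<close> at grid points, where hypothesis
  \<open>b\<close> applies; since the grid point lies to the right of \<open>r\<close>, the bound
  \<open>1 / r\<close> survives. With a family of resolvents for \<open>F\<close>, this is how
  \<open>\<R>\<^sub>s\<close>-boundedness passes through a contour integral.\<close>

lemma rho_ls_rep_le:
  assumes I: "finite I" "1 \<le> s" and F: "\<And>j. j \<in> I \<Longrightarrow> good_family (F j) (B j)"
    and a: "a \<in> borel_measurable lpos"
    and b: "\<And>r. 0 < r \<Longrightarrow> \<rho> (\<lambda>w. ls_norm s I (\<lambda>j. ennreal (cmod (F j r w)))) \<le> b * ennreal (1 / r)"
  shows "\<rho> (\<lambda>w. ls_norm s I (\<lambda>j. \<integral>\<^sup>+r. a r * ennreal (cmod (rep (F j) r w)) \<partial>lpos))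
    \<le> (\<integral>\<^sup>+r. a r * ennreal (1 / r) \<partial>lpos) * b"
proof -
  have [measurable]: "(\<lambda>r. ennreal (1 / r)) \<in> borel_measurable lpos"
    by (rule borel_measurable_lpos) measurable
  have "\<rho> (\<lambda>w. ls_norm s I (\<lambda>j. \<integral>\<^sup>+r. a r * ennreal (cmod (rep (F j) r w)) \<partial>lpos))
    \<le> liminf (\<lambda>m. \<integral>\<^sup>+r. a r * (b * ennreal (1 / r)) \<partial>lpos)"
  proof (rule rho_ls_nn_integral_le[where p = dyidx and V = "\<lambda>m k j w. ennreal (cmod (F j (dypt m k) w))"])
    fix m k j assume "j \<in> I"
    then show "(\<lambda>w. ennreal (cmod (F j (dypt m k) w))) \<in> borel_measurable M"
      using good_familyD(3)[OF F dypt_pos] by auto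
  next
    fix j assume "j \<in> I"
    then show "(\<lambda>(r, w). ennreal (cmod (rep (F j) r w))) \<in> borel_measurable (lpos \<Otimes>\<^sub>M M)"
      using good_rep_measurable[OF F] by (auto simp: split_beta')
  next
    fix r j assume "r \<in> space lpos" "j \<in> I"
    then have "0 < r" by simp
    from rep_AE[OF F[OF \<open>j \<in> I\<close>] this]
    show "AE w in M. ennreal (cmod (rep (F j) r w)) \<le> liminf (\<lambda>m. ennreal (cmod (F j (dypt m (dyidx m r)) w)))"
    proof eventually_elim
      case (elim w)
      then have "rep (F j) r w = F j r w" by (auto simp: rep_def intro: limI)
      moreover have "(\<lambda>m. ennreal (cmod (F j (dypt m (dyidx m r)) w))) \<longlonglongrightarrow> ennreal (cmod (F j r w))"
        using elim by (intro tendsto_ennrealI tendsto_norm)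
      ultimately show ?case
        using lim_imp_Liminf[OF trivial_limit_sequentially] by fastforce
    qed
  next
    fix m r assume "r \<in> space lpos"
    then have r: "0 < r" by simp
    have "\<rho> (\<lambda>w. ls_norm s I (\<lambda>j. ennreal (cmod (F j (dypt m (dyidx m r)) w)))) \<le> b * ennreal (1 / dypt m (dyidx m r))"
      by (rule b) simp
    also have "\<dots> \<le> b * ennreal (1 / r)"
      using r dypt_dyidx[OF r, of m] by (intro mult_left_mono ennreal_leI divide_left_mono) auto
    finally show "\<rho> (\<lambda>w. ls_norm s I (\<lambda>j. ennreal (cmod (F j (dypt m (dyidx m r)) w)))) \<le> b * ennreal (1 / r)" .
  qed (use I a sigma_finite_lpos in auto)
  also have "\<dots> = (\<integral>\<^sup>+r. a r * ennreal (1 / r) * b \<partial>lpos)"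
    by (simp add: ac_simps Liminf_const)
  also have "\<dots> = (\<integral>\<^sup>+r. a r * ennreal (1 / r) \<partial>lpos) * b"
    using a by (intro nn_integral_multc) auto
  finally show ?thesis .
qed

end

section \<open>Step functions on a ray and the error of their integrals\<close>

lemma measurable_ennreal_cmod: "a \<in> borel_measurable N \<Longrightarrow> (\<lambda>r. ennreal (cmod (a r))) \<in> borel_measurable N"
  by measurable

text \<open>Index \<open>0\<close> marks the points outside \<open>(2\<^sup>-\<^sup>n, n]\<close>; there the step function vanishes, so that it
  is \<^const>\<open>bfs_simple\<close>.\<close>

definition stepidx :: "nat \<Rightarrow> real \<Rightarrow> nat" where
  "stepidx n r = (if 1 / 2 ^ n < r \<and> r \<le> real n then Suc (dyidx n r) else 0)"

definition stepfun :: "nat \<Rightarrow> (real \<Rightarrow> 'a \<Rightarrow> complex) \<Rightarrow> real \<Rightarrow> 'a \<Rightarrow> complex" where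
  "stepfun n v r = (if stepidx n r = 0 then (\<lambda>_. 0) else v (dypt n (stepidx n r - 1)))"

lemma stepidx_measurable [measurable]: "stepidx n \<in> measurable lpos (count_space UNIV)"
proof -
  have [measurable]: "dyidx n \<in> measurable borel (count_space UNIV)"
    unfolding dyidx_def by measurable
  have "stepidx n \<in> measurable borel (count_space UNIV)"
    unfolding stepidx_def by measurable
  then show ?thesis by (rule borel_measurable_lpos)
qed

lemma sets_stepidx: "{r. 0 < r \<and> P (stepidx n r)} \<in> sets lpos"
proof -
  have "{r. 0 < r \<and> P (stepidx n r)} = stepidx n -` Collect P \<inter> space lpos" by auto
  also have "\<dots> \<in> sets lpos" by (rule measurable_sets[OF stepidx_measurable]) simp
  finally show ?thesis .
qed

lemma stepidx_le: "0 < r \<Longrightarrow> stepidx n r \<le> n * 2 ^ n"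
proof -
  assume r: "0 < r"
  have "Suc (dyidx n r) \<le> n * 2 ^ n" if "r \<le> real n"
  proof -
    have "0 < r * 2 ^ n" using r by simp
    then have 1: "1 \<le> \<lceil>r * 2 ^ n\<rceil>" by (simp add: le_ceiling_iff)
    have "r * 2 ^ n \<le> real_of_int (int n * 2 ^ n)" using that by (simp add: mult_right_mono)
    then have "\<lceil>r * 2 ^ n\<rceil> \<le> int n * 2 ^ n" by (simp only: ceiling_le_iff)
    then have "int (Suc (dyidx n r)) \<le> int (n * 2 ^ n)" using 1 by (simp add: dyidx_def)
    then show ?thesis by (simp only: of_nat_le_iff)
  qed
  then show ?thesis by (auto simp: stepidx_def)
qed

lemma emeasure_stepidx_finite:
  "emeasure lpos {r \<in> space lpos. stepidx n r \<noteq> 0} < \<infinity>"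
proof -
  have "emeasure lpos {r \<in> space lpos. stepidx n r \<noteq> 0} \<le> emeasure lpos {0<..real n}"
    by (rule emeasure_mono) (auto simp: stepidx_def sets_restrict_space split: if_splits)
  also have "\<dots> = emeasure lborel {0<..real n}"
    by (rule emeasure_restrict_space) auto
  also have "\<dots> < \<infinity>" by simp
  finally show ?thesis .
qed

lemma emeasure_stepidx_Suc_finite: "emeasure lpos {r \<in> space lpos. stepidx n r = Suc i} < \<infinity>"
proof -
  have "emeasure lpos {r \<in> space lpos. stepidx n r = Suc i} \<le> emeasure lpos {r \<in> space lpos. stepidx n r \<noteq> 0}"
    by (rule emeasure_mono) (use sets_stepidx[of "\<lambda>k. k \<noteq> 0" n] in auto)
  then show ?thesis using emeasure_stepidx_finite[of n] by (rule order_le_less_trans)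
qed

lemma stepfun_eq_sum:
  assumes "0 < r"
  shows "stepfun n v r w = (\<Sum>i<n * 2 ^ n. indicator {r \<in> space lpos. stepidx n r = Suc i} r *\<^sub>R v (dypt n i) w)"
proof (cases "stepidx n r")
  case 0
  then show ?thesis by (simp add: stepfun_def)
next
  case (Suc k)
  have k: "k < n * 2 ^ n" using stepidx_le[OF assms, of n] Suc by simp
  have "(\<Sum>i<n * 2 ^ n. indicator {r \<in> space lpos. stepidx n r = Suc i} r *\<^sub>R v (dypt n i) w)
    = (\<Sum>i<n * 2 ^ n. if i = k then v (dypt n i) w else 0)"
    using Suc assms by (intro sum.cong) (auto simp: indicator_def)
  also have "\<dots> = v (dypt n k) w" using k by (simp add: sum.delta)
  finally show ?thesis using Suc by (simp add: stepfun_def)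
qed

lemma stepfun_integrable: "integrable lpos (\<lambda>r. stepfun n v r w)"
  and stepfun_integral: "(LINT r|lpos. stepfun n v r w)
    = (\<Sum>i<n * 2 ^ n. of_real (measure lpos {r \<in> space lpos. stepidx n r = Suc i}) * v (dypt n i) w)"
proof -
  have 1: "integrable lpos (\<lambda>r. indicator {r \<in> space lpos. stepidx n r = Suc i} r *\<^sub>R v (dypt n i) w)" for i
    using emeasure_stepidx_Suc_finite[of n i]
    by (intro integrable_scaleR_left integrable_real_indicator) (auto intro!: sets_stepidx)
  have "integrable lpos (\<lambda>r. stepfun n v r w)
    \<longleftrightarrow> integrable lpos (\<lambda>r. \<Sum>i<n * 2 ^ n. indicator {r \<in> space lpos. stepidx n r = Suc i} r *\<^sub>R v (dypt n i) w)"
    by (rule Bochner_Integration.integrable_cong[OF refl]) (rule stepfun_eq_sum, simp)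
  then show "integrable lpos (\<lambda>r. stepfun n v r w)"
    by (rule iffD2) (intro Bochner_Integration.integrable_sum 1)
  have "(LINT r|lpos. stepfun n v r w)
    = (LINT r|lpos. (\<Sum>i<n * 2 ^ n. indicator {r \<in> space lpos. stepidx n r = Suc i} r *\<^sub>R v (dypt n i) w))"
    by (rule Bochner_Integration.integral_cong[OF refl]) (rule stepfun_eq_sum, simp)
  also have "\<dots> = (\<Sum>i<n * 2 ^ n. LINT r|lpos. indicator {r \<in> space lpos. stepidx n r = Suc i} r *\<^sub>R v (dypt n i) w)"
    using 1 by (intro Bochner_Integration.integral_sum)
  also have "\<dots> = (\<Sum>i<n * 2 ^ n. of_real (measure lpos {r \<in> space lpos. stepidx n r = Suc i}) * v (dypt n i) w)"
  proof (intro sum.cong refl)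
    fix i
    have "(LINT r|lpos. indicator {r \<in> space lpos. stepidx n r = Suc i} r *\<^sub>R v (dypt n i) w)
      = measure lpos ({r \<in> space lpos. stepidx n r = Suc i} \<inter> space lpos) *\<^sub>R v (dypt n i) w"
      using emeasure_stepidx_Suc_finite[of n i]
      by (subst integral_scaleR_left) (auto intro!: integrable_real_indicator sets_stepidx)
    also have "{r \<in> space lpos. stepidx n r = Suc i} \<inter> space lpos = {r \<in> space lpos. stepidx n r = Suc i}" by auto
    finally show "(LINT r|lpos. indicator {r \<in> space lpos. stepidx n r = Suc i} r *\<^sub>R v (dypt n i) w)
      = of_real (measure lpos {r \<in> space lpos. stepidx n r = Suc i}) * v (dypt n i) w"
      by (simp add: scaleR_conv_of_real)
  qed
  finally show "(LINT r|lpos. stepfun n v r w)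
    = (\<Sum>i<n * 2 ^ n. of_real (measure lpos {r \<in> space lpos. stepidx n r = Suc i}) * v (dypt n i) w)" .
qed

definition step_coeff :: "nat \<Rightarrow> (real \<Rightarrow> complex) \<Rightarrow> real \<Rightarrow> complex" where
  "step_coeff n a r = (if stepidx n r = 0 then 0 else a (dypt n (dyidx n r)))"

lemma stepfun_mult: "stepfun n (\<lambda>r w. a r * F r w) r w = step_coeff n a r * F (dypt n (dyidx n r)) w"
  by (auto simp: stepfun_def step_coeff_def stepidx_def)

text \<open>The first term accounts for the variation of the family between \<open>r\<close> and its
  grid point, the second for replacing the weight by its sample. In the minimum,
  \<open>2 * B / r\<close> gives a majorant independent of \<open>n\<close>, the other entry the
  convergence to 0.\<close>

definition step_err :: "nat \<Rightarrow> (real \<Rightarrow> complex) \<Rightarrow> real \<Rightarrow> real \<Rightarrow> real" where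
  "step_err n a B r = cmod (a r) * min (2 * B / r) (B / 2 ^ n / r ^ 2) + cmod (a r - step_coeff n a r) * (B / r)"

lemma step_coeff_measurable: "step_coeff n a \<in> borel_measurable lpos"
  unfolding step_coeff_def
  using measurable_compose[OF dyidx_measurable, of "\<lambda>k. a (dypt n k)" borel n]
  by (intro measurable_If) (auto intro!: sets_stepidx)

lemma step_err_measurable:
  assumes [measurable]: "a \<in> borel_measurable lpos"
  shows "step_err n a B \<in> borel_measurable lpos"
proof -
  note step_coeff_measurable[measurable]
  have [measurable]: "(\<lambda>r. min (2 * B / r) (B / 2 ^ n / r ^ 2)) \<in> borel_measurable lpos"
    "(\<lambda>r. B / r) \<in> borel_measurable lpos"
    by ((rule borel_measurable_lpos, measurable)[1])+
  show ?thesis unfolding step_err_def by measurable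
qed

text \<open>The cut-off at \<open>1 / 2 ^ n\<close> exceeds no active \<open>r\<close>, so the grid
  point is at most \<open>2 * r\<close>; hence the factor \<open>2 powr \<epsilon>\<close>.\<close>

lemma step_coeff_le:
  assumes a: "\<And>r. 0 < r \<Longrightarrow> cmod (a r) \<le> K * decay \<epsilon> r" and "0 < r" "0 < \<epsilon>" "0 \<le> K"
  shows "cmod (step_coeff n a r) \<le> K * (2 powr \<epsilon> * decay \<epsilon> r)"
proof (cases "stepidx n r = 0")
  case True
  then show ?thesis using assms by (simp add: step_coeff_def)
next
  case False
  define q where "q = dypt n (dyidx n r)"
  have q: "r \<le> q" "q < r + 1 / 2 ^ n" using dypt_dyidx[OF \<open>0 < r\<close>, of n] by (auto simp: q_def)
  moreover have "1 / 2 ^ n < r" using False by (auto simp: stepidx_def split: if_splits)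
  ultimately have "q \<le> 2 * r" by linarith
  then have "decay \<epsilon> (q / r * r) \<le> 2 powr \<epsilon> * decay \<epsilon> r"
    using q assms by (intro decay_mult_le) (auto simp: field_simps)
  then have "decay \<epsilon> q \<le> 2 powr \<epsilon> * decay \<epsilon> r" using \<open>0 < r\<close> by simp
  moreover have "cmod (step_coeff n a r) \<le> K * decay \<epsilon> q"
    using False a[of q] by (simp add: step_coeff_def q_def)
  ultimately show ?thesis using \<open>0 \<le> K\<close> by (meson mult_left_mono order_trans)
qed

lemma step_coeff_tendsto:
  assumes "continuous_on {0<..} a" "0 < r"
  shows "(\<lambda>n. step_coeff n a r) \<longlonglongrightarrow> a r"
proof -
  have "(\<lambda>n. a (dypt n (dyidx n r))) \<longlonglongrightarrow> a r"
    using assms dypt_dyidx_tendsto[OF assms(2)]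
    by (intro continuous_on_tendsto_compose[OF assms(1)]) auto
  moreover have "eventually (\<lambda>n. step_coeff n a r = a (dypt n (dyidx n r))) sequentially"
  proof -
    have "(\<lambda>n. (1/2::real) ^ n) \<longlonglongrightarrow> 0" by (rule LIMSEQ_power_zero) auto
    from order_tendstoD(2)[OF this assms(2)]
    have "eventually (\<lambda>n. 1 / 2 ^ n < r) sequentially" by (simp add: power_divide)
    moreover have "eventually (\<lambda>n. r \<le> real n) sequentially"
      by (meson eventually_sequentiallyI nat_ceiling_le_eq)
    ultimately show ?thesis by eventually_elim (auto simp: step_coeff_def stepidx_def)
  qed
  ultimately show ?thesis by (simp add: filterlim_cong)
qed

lemma nn_integral_decaying_finite:
  assumes a: "\<And>r. 0 < r \<Longrightarrow> cmod (a r) \<le> K * decay \<epsilon> r" and "0 < \<epsilon>" "0 \<le> K"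
  shows "(\<integral>\<^sup>+r. ennreal (cmod (a r)) * ennreal (1 / r) \<partial>lpos) < \<infinity>"
proof -
  have [measurable]: "(\<lambda>r. ennreal (decay \<epsilon> r / r)) \<in> borel_measurable lpos"
    by (rule borel_measurable_lpos) measurable
  have "(\<integral>\<^sup>+r. ennreal (cmod (a r)) * ennreal (1 / r) \<partial>lpos) \<le> (\<integral>\<^sup>+r. ennreal K * ennreal (decay \<epsilon> r / r) \<partial>lpos)"
    using a \<open>0 \<le> K\<close> by (intro nn_integral_mono) (auto simp: ennreal_mult[symmetric] divide_right_mono intro!: ennreal_leI)
  also have "\<dots> = ennreal K * (\<integral>\<^sup>+r. ennreal (decay \<epsilon> r / r) \<partial>lpos)"
    by (rule nn_integral_cmult) measurable
  also have "\<dots> < \<infinity>"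
    using nn_integral_decay_finite[OF \<open>0 < \<epsilon>\<close>] by (simp add: ennreal_mult_less_top)
  finally show ?thesis .
qed

lemma step_err_tendsto_0:
  assumes a: "\<And>r. 0 < r \<Longrightarrow> cmod (a r) \<le> K * decay \<epsilon> r" and "0 < \<epsilon>" "0 \<le> K"
    and cont: "continuous_on {0<..} a" and "0 \<le> B"
  shows "(\<lambda>n. \<integral>\<^sup>+r. ennreal (step_err n a B r) \<partial>lpos) \<longlonglongrightarrow> 0"
proof -
  have am: "a \<in> borel_measurable lpos" by (rule continuous_imp_measurable_lpos) fact
  have dm [measurable]: "(\<lambda>r. ennreal (decay \<epsilon> r / r)) \<in> borel_measurable lpos"
    by (rule borel_measurable_lpos) measurable
  \<comment> \<open>The first summand comes from the branch \<open>2 * B / r\<close> of the minimum;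
    in the second, \<open>K\<close> bounds the weight and \<open>K * 2 powr \<epsilon>\<close> its
    sample.\<close>
  define C where "C = K * (2 * B) + (K + K * 2 powr \<epsilon>) * B"
  have "C \<ge> 0" using assms by (simp add: C_def)
  have "(\<lambda>n. \<integral>\<^sup>+r. ennreal (step_err n a B r) \<partial>lpos) \<longlonglongrightarrow> (\<integral>\<^sup>+r. 0 \<partial>lpos)"
  proof (rule nn_integral_dominated_convergence[where w = "\<lambda>r. ennreal C * ennreal (decay \<epsilon> r / r)"])
    show "AE r in lpos. ennreal (step_err n a B r) \<le> ennreal C * ennreal (decay \<epsilon> r / r)" for n
    proof (rule AE_I2)
      fix r assume "r \<in> space lpos"
      then have r: "0 < r" by simp
      have "cmod (a r - step_coeff n a r) \<le> K * decay \<epsilon> r + K * (2 powr \<epsilon> * decay \<epsilon> r)"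
        using norm_triangle_ineq4[of "a r" "step_coeff n a r"] a[OF r]
          step_coeff_le[OF a r \<open>0 < \<epsilon>\<close> \<open>0 \<le> K\<close>, of n] by linarith
      then have "step_err n a B r \<le> (K * decay \<epsilon> r) * (2 * B / r)
          + (K * decay \<epsilon> r + K * (2 powr \<epsilon> * decay \<epsilon> r)) * (B / r)"
        unfolding step_err_def using a[OF r] r assms by (intro add_mono mult_mono) auto
      also have "\<dots> = C * (decay \<epsilon> r / r)" by (simp add: C_def divide_inverse algebra_simps)
      finally show "ennreal (step_err n a B r) \<le> ennreal C * ennreal (decay \<epsilon> r / r)"
        using r \<open>C \<ge> 0\<close> by (simp add: ennreal_mult[symmetric] ennreal_leI)
    qed
    have "(\<integral>\<^sup>+r. ennreal C * ennreal (decay \<epsilon> r / r) \<partial>lpos) = ennreal C * (\<integral>\<^sup>+r. ennreal (decay \<epsilon> r / r) \<partial>lpos)"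
      by (rule nn_integral_cmult) measurable
    then show "(\<integral>\<^sup>+r. ennreal C * ennreal (decay \<epsilon> r / r) \<partial>lpos) < \<infinity>"
      using nn_integral_decay_finite[OF \<open>0 < \<epsilon>\<close>] by (simp add: ennreal_mult_less_top)
    show "AE r in lpos. (\<lambda>n. ennreal (step_err n a B r)) \<longlonglongrightarrow> 0"
    proof (rule AE_I2)
      fix r assume "r \<in> space lpos"
      then have r: "0 < r" by simp
      have "(\<lambda>n. min (2 * B / r) (B * (1/2) ^ n / r ^ 2)) \<longlonglongrightarrow> min (2 * B / r) (B * 0 / r ^ 2)"
        using r by (intro tendsto_min tendsto_intros LIMSEQ_power_zero) auto
      then have 1: "(\<lambda>n. min (2 * B / r) (B / 2 ^ n / r ^ 2)) \<longlonglongrightarrow> 0"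
        using r \<open>0 \<le> B\<close> by (simp add: power_divide)
      have 2: "(\<lambda>n. a r - step_coeff n a r) \<longlonglongrightarrow> a r - a r"
        by (intro tendsto_diff tendsto_const step_coeff_tendsto cont r)
      have "(\<lambda>n. step_err n a B r) \<longlonglongrightarrow> cmod (a r) * 0 + cmod (a r - a r) * (B / r)"
        unfolding step_err_def by (intro tendsto_intros 1 tendsto_norm 2)
      then show "(\<lambda>n. ennreal (step_err n a B r)) \<longlonglongrightarrow> 0"
        using tendsto_ennrealI by fastforce
    qed
  qed (auto intro!: measurable_compose[OF step_err_measurable[OF am] measurable_ennreal])
  then show ?thesis by simp
qed

text \<open>The integral is a scalar one at each point \<open>w\<close>, made possible by the
  jointly measurable representative. It turns out to represent the Bochner integral of the weighted
  family, and unlike that integral it is open to Fubini's theorem.\<close>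

definition ray_int :: "(real \<Rightarrow> complex) \<Rightarrow> (real \<Rightarrow> 'a \<Rightarrow> complex) \<Rightarrow> 'a \<Rightarrow> complex" where
  "ray_int a F w = (LINT r|lpos. a r * rep F r w)"

context banach_function_norm
begin

lemma rho_nn_integral_le:
  fixes N :: "'r measure" and p :: "nat \<Rightarrow> 'r \<Rightarrow> nat" and V :: "nat \<Rightarrow> nat \<Rightarrow> 'a \<Rightarrow> ennreal"
  assumes "sigma_finite_measure N" "a \<in> borel_measurable N"
    and "\<And>m. p m \<in> measurable N (count_space UNIV)"
    and "\<And>m k. V m k \<in> borel_measurable M"
    and "(\<lambda>(r, w). U r w) \<in> borel_measurable (N \<Otimes>\<^sub>M M)"
    and "\<And>r. r \<in> space N \<Longrightarrow> AE w in M. U r w \<le> liminf (\<lambda>m. V m (p m r) w)"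
    and "\<And>m r. r \<in> space N \<Longrightarrow> \<rho> (V m (p m r)) \<le> b m r"
  shows "\<rho> (\<lambda>w. \<integral>\<^sup>+r. a r * U r w \<partial>N) \<le> liminf (\<lambda>m. \<integral>\<^sup>+r. a r * b m r \<partial>N)"
  using rho_ls_nn_integral_le[of N "{0::nat}" 1 a p "\<lambda>m k j. V m k" "\<lambda>j. U" b] assms
  by (simp add: ls_norm_single)

lemma rho_rep_le:
  assumes F: "good_family F B" and a: "a \<in> borel_measurable lpos"
  shows "\<rho> (\<lambda>w. \<integral>\<^sup>+r. a r * ennreal (cmod (rep F r w)) \<partial>lpos)
    \<le> (\<integral>\<^sup>+r. a r * ennreal (1 / r) \<partial>lpos) * ennreal B"
proof -
  have "bfs_norm \<rho> (F r) \<le> ennreal B * ennreal (1 / r)" if "0 < r" for r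
    using good_familyD(4)[OF F that] good_familyD(1)[OF F] that by (simp add: ennreal_mult[symmetric])
  then show ?thesis
    using rho_ls_rep_le[of "{0::nat}" 1 "\<lambda>_. F" "\<lambda>_. B" a "ennreal B"] F a
    by (simp add: ls_norm_single bfs_norm_def)
qed

lemma ray_int_jointly_measurable:
  assumes F: "good_family F B" and a [measurable]: "a \<in> borel_measurable lpos"
  shows "(\<lambda>(w, r). a r * rep F r w) \<in> borel_measurable (M \<Otimes>\<^sub>M lpos)"
proof -
  have "(\<lambda>x. a (snd x) * (\<lambda>(r, w). rep F r w) (snd x, fst x)) \<in> borel_measurable (M \<Otimes>\<^sub>M lpos)"
    using measurable_compose[OF measurable_pair_swap' good_rep_measurable[OF F]] by (auto simp: split_beta')
  then show ?thesis by (simp add: split_beta')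
qed

lemma nn_ray_int_measurable:
  assumes F: "good_family F B" and a [measurable]: "a \<in> borel_measurable lpos"
  shows "(\<lambda>w. \<integral>\<^sup>+r. a r * ennreal (cmod (rep F r w)) \<partial>lpos) \<in> borel_measurable M"
proof -
  interpret sigma_finite_measure lpos by (rule sigma_finite_lpos)
  have "(\<lambda>x. a (snd x) * ennreal (cmod ((\<lambda>(r, w). rep F r w) (snd x, fst x)))) \<in> borel_measurable (M \<Otimes>\<^sub>M lpos)"
    using measurable_compose[OF measurable_pair_swap' good_rep_measurable[OF F]] by (auto simp: split_beta')
  then have "(\<lambda>(w, r). a r * ennreal (cmod (rep F r w))) \<in> borel_measurable (M \<Otimes>\<^sub>M lpos)"
    by (simp add: split_beta')
  from borel_measurable_nn_integral[OF this] show ?thesis by simp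
qed

lemma ray_int_measurable:
  assumes F: "good_family F B" and a: "a \<in> borel_measurable lpos"
  shows "ray_int a F \<in> borel_measurable M"
proof -
  interpret sigma_finite_measure lpos by (rule sigma_finite_lpos)
  show ?thesis
    unfolding ray_int_def[abs_def]
    using borel_measurable_lebesgue_integral[OF ray_int_jointly_measurable[OF F a]] by simp
qed

lemma ray_int_AE_finite:
  assumes F: "good_family F B" and a: "a \<in> borel_measurable lpos"
    and fin: "(\<integral>\<^sup>+r. ennreal (cmod (a r)) * ennreal (1 / r) \<partial>lpos) < \<infinity>"
  shows "AE w in M. (\<integral>\<^sup>+r. ennreal (cmod (a r)) * ennreal (cmod (rep F r w)) \<partial>lpos) < \<infinity>"
proof (rule rho_finite_AE)
  have "\<rho> (\<lambda>w. \<integral>\<^sup>+r. ennreal (cmod (a r)) * ennreal (cmod (rep F r w)) \<partial>lpos)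
    \<le> (\<integral>\<^sup>+r. ennreal (cmod (a r)) * ennreal (1 / r) \<partial>lpos) * ennreal B"
    by (rule rho_rep_le[OF F measurable_ennreal_cmod[OF a]])
  also have "\<dots> < \<infinity>" using fin by (simp add: ennreal_mult_less_top)
  finally show "\<rho> (\<lambda>w. \<integral>\<^sup>+r. ennreal (cmod (a r)) * ennreal (cmod (rep F r w)) \<partial>lpos) < \<infinity>" .
qed (rule nn_ray_int_measurable[OF F measurable_ennreal_cmod[OF a]])

lemma ray_int_AE_integrable:
  assumes F: "good_family F B" and a: "a \<in> borel_measurable lpos"
    and fin: "(\<integral>\<^sup>+r. ennreal (cmod (a r)) * ennreal (1 / r) \<partial>lpos) < \<infinity>"
  shows "AE w in M. integrable lpos (\<lambda>r. a r * rep F r w)"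
  using ray_int_AE_finite[OF assms] AE_space
proof eventually_elim
  case (elim w)
  have "(\<lambda>r. rep F r w) \<in> borel_measurable lpos"
    using good_familyD(3)[OF F] elim by (intro rep_measurable1) auto
  then show ?case
    using elim a by (intro integrableI_bounded) (auto simp: norm_mult ennreal_mult)
qed

text \<open>This holds at every point: where the integrand fails to be integrable, the integral has
  the default value 0.\<close>

lemma norm_ray_int_le: "ennreal (cmod (ray_int a F w)) \<le> (\<integral>\<^sup>+r. ennreal (cmod (a r)) * ennreal (cmod (rep F r w)) \<partial>lpos)"
proof (cases "integrable lpos (\<lambda>r. a r * rep F r w)")
  case True
  then show ?thesis using integral_norm_bound_ennreal[OF True] by (simp add: ray_int_def norm_mult ennreal_mult)
qed (simp add: ray_int_def not_integrable_integral_eq)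

lemma ray_int_bfs:
  assumes F: "good_family F B" and a: "a \<in> borel_measurable lpos"
    and fin: "(\<integral>\<^sup>+r. ennreal (cmod (a r)) * ennreal (1 / r) \<partial>lpos) < \<infinity>"
  shows "ray_int a F \<in> bfs M \<rho>"
proof -
  have "bfs_norm \<rho> (ray_int a F) \<le> \<rho> (\<lambda>w. \<integral>\<^sup>+r. ennreal (cmod (a r)) * ennreal (cmod (rep F r w)) \<partial>lpos)"
    unfolding bfs_norm_def using ray_int_measurable[OF F a]
    by (intro rho_mono' norm_ray_int_le nn_ray_int_measurable[OF F measurable_ennreal_cmod[OF a]]) auto
  also have "\<dots> \<le> (\<integral>\<^sup>+r. ennreal (cmod (a r)) * ennreal (1 / r) \<partial>lpos) * ennreal B"
    by (rule rho_rep_le[OF F measurable_ennreal_cmod[OF a]])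
  also have "\<dots> < \<infinity>" using fin by (simp add: ennreal_mult_less_top)
  finally show ?thesis using ray_int_measurable[OF F a] by (simp add: bfs_def)
qed

lemma good_family_dyadic2:
  assumes F: "good_family F B" and r: "0 < r"
  shows "bfs_norm \<rho> (\<lambda>w. F (dypt m (dyidx m r)) w - F (dypt n (dyidx n r)) w) \<le> ennreal (2 * B / r)"
    and "n \<le> m \<Longrightarrow> bfs_norm \<rho> (\<lambda>w. F (dypt m (dyidx m r)) w - F (dypt n (dyidx n r)) w) \<le> ennreal (B / 2 ^ n / r ^ 2)"
proof -
  define q where "q = dypt m (dyidx m r)"
  define q' where "q' = dypt n (dyidx n r)"
  have q: "r \<le> q" "q < r + 1 / 2 ^ m" "r \<le> q'" "q' < r + 1 / 2 ^ n"
    using dypt_dyidx[OF r, of m] dypt_dyidx[OF r, of n] by (auto simp: q_def q'_def)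
  then have qpos: "0 < q" "0 < q'" using r by auto
  note FD = good_familyD[OF F]
  have "bfs_norm \<rho> (\<lambda>w. F q w - F q' w) \<le> ennreal (B * \<bar>q - q'\<bar> / (q * q'))"
    using qpos by (rule FD)
  moreover have "B * \<bar>q - q'\<bar> / (q * q') \<le> 2 * B / r"
  proof -
    have "\<bar>q - q'\<bar> / (q * q') \<le> 1 / r"
    proof (cases "q \<le> q'")
      case True
      then have "\<bar>q - q'\<bar> / (q * q') = 1 / q - 1 / q'" using qpos by (simp add: field_simps)
      also have "\<dots> \<le> 1 / q" using qpos by simp
      also have "\<dots> \<le> 1 / r" using q r by (simp add: frac_le)
      finally show ?thesis .
    next
      case False
      then have "\<bar>q - q'\<bar> / (q * q') = 1 / q' - 1 / q" using qpos by (simp add: field_simps)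
      also have "\<dots> \<le> 1 / q'" using qpos by simp
      also have "\<dots> \<le> 1 / r" using q r by (simp add: frac_le)
      finally show ?thesis .
    qed
    then have "B * (\<bar>q - q'\<bar> / (q * q')) \<le> B * (1 / r)" using FD(1) by (intro mult_left_mono)
    also have "\<dots> \<le> 2 * B / r" using FD(1) r by (simp add: field_simps)
    finally show ?thesis by simp
  qed
  ultimately show "bfs_norm \<rho> (\<lambda>w. F (dypt m (dyidx m r)) w - F (dypt n (dyidx n r)) w) \<le> ennreal (2 * B / r)"
    unfolding q_def[symmetric] q'_def[symmetric] by (meson ennreal_leI order_trans)
  assume "n \<le> m"
  then have "(1::real) / 2 ^ m \<le> 1 / 2 ^ n" by (simp add: frac_le)
  then have "\<bar>q - q'\<bar> \<le> 1 / 2 ^ n" using q by linarith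
  then have "B * \<bar>q - q'\<bar> / (q * q') \<le> B * (1 / 2 ^ n) / (r * r)"
    using q qpos r FD(1) by (intro frac_le mult_left_mono mult_mono) auto
  then have "B * \<bar>q - q'\<bar> / (q * q') \<le> B / 2 ^ n / r ^ 2" by (simp add: power2_eq_square)
  with \<open>bfs_norm \<rho> (\<lambda>w. F q w - F q' w) \<le> ennreal (B * \<bar>q - q'\<bar> / (q * q'))\<close>
  show "bfs_norm \<rho> (\<lambda>w. F (dypt m (dyidx m r)) w - F (dypt n (dyidx n r)) w) \<le> ennreal (B / 2 ^ n / r ^ 2)"
    unfolding q_def[symmetric] q'_def[symmetric] by (meson ennreal_leI order_trans)
qed

lemma good_family_dyadic3:
  assumes F: "good_family F B" and r: "0 < r"
  shows "bfs_norm \<rho> (\<lambda>w. F r w - F (dypt n (dyidx n r)) w) \<le> ennreal (min (2 * B / r) (B / 2 ^ n / r ^ 2))"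
proof -
  have "bfs_norm \<rho> (\<lambda>w. F r w - F (dypt n (dyidx n r)) w) \<le> ennreal (B / 2 ^ n / r ^ 2)"
    using good_family_dyadic[OF assms] by (simp add: bfs_norm_minus_commute)
  moreover have "bfs_norm \<rho> (\<lambda>w. F r w - F (dypt n (dyidx n r)) w) \<le> ennreal (2 * B / r)"
  proof -
    let ?q = "dypt n (dyidx n r)"
    have q: "r \<le> ?q" using dypt_dyidx[OF r] by auto
    have "bfs_norm \<rho> (\<lambda>w. F r w - F ?q w) \<le> ennreal (B * \<bar>r - ?q\<bar> / (r * ?q))"
      using r by (intro good_familyD[OF F]) auto
    also have "B * \<bar>r - ?q\<bar> / (r * ?q) = B * (1 / r - 1 / ?q)"
      using q r by (simp add: field_simps)
    also have "\<dots> \<le> B * (1 / r)" using good_familyD(1)[OF F] by (intro mult_left_mono) (auto simp: less_imp_le[OF dypt_pos])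
    also have "\<dots> \<le> 2 * B / r" using good_familyD(1)[OF F] r by (simp add: field_simps)
    finally show ?thesis by (simp add: ennreal_leI)
  qed
  ultimately show ?thesis by (auto simp: min_def)
qed

lemma bfs_norm_stepfun_le:
  assumes F: "good_family F B" and r: "0 < r"
  shows "bfs_norm \<rho> (\<lambda>w. a r * F r w - stepfun n (\<lambda>r w. a r * F r w) r w) \<le> ennreal (step_err n a B r)"
proof -
  let ?q = "dypt n (dyidx n r)"
  note FD = good_familyD[OF F]
  have [measurable]: "F r \<in> borel_measurable M" "F ?q \<in> borel_measurable M" using r FD(3) by auto
  have "bfs_norm \<rho> (\<lambda>w. a r * F r w - stepfun n (\<lambda>r w. a r * F r w) r w)
      = bfs_norm \<rho> (\<lambda>w. a r * (F r w - F ?q w) + (a r - step_coeff n a r) * F ?q w)"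
    by (simp add: stepfun_mult algebra_simps)
  also have "\<dots> \<le> bfs_norm \<rho> (\<lambda>w. a r * (F r w - F ?q w)) + bfs_norm \<rho> (\<lambda>w. (a r - step_coeff n a r) * F ?q w)"
    by (rule bfs_norm_add) measurable
  also have "\<dots> = ennreal (cmod (a r)) * bfs_norm \<rho> (\<lambda>w. F r w - F ?q w)
      + ennreal (cmod (a r - step_coeff n a r)) * bfs_norm \<rho> (F ?q)"
    by (simp add: bfs_norm_cmult)
  also have "\<dots> \<le> ennreal (cmod (a r)) * ennreal (min (2 * B / r) (B / 2 ^ n / r ^ 2))
      + ennreal (cmod (a r - step_coeff n a r)) * ennreal (B / r)"
  proof (intro add_mono mult_left_mono good_family_dyadic3[OF F r])
    have "bfs_norm \<rho> (F ?q) \<le> ennreal (B / ?q)" by (rule FD) simp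
    also have "\<dots> \<le> ennreal (B / r)" using dypt_dyidx[OF r, of n] r FD(1) by (intro ennreal_leI divide_left_mono mult_pos_pos) auto
    finally show "bfs_norm \<rho> (F ?q) \<le> ennreal (B / r)" .
  qed auto
  also have "\<dots> = ennreal (step_err n a B r)"
    using FD(1) r by (simp add: step_err_def ennreal_mult[symmetric] ennreal_plus[symmetric] del: ennreal_plus)
  finally show ?thesis .
qed

lemma stepfun_rep_measurable:
  assumes F: "good_family F B" and a: "a \<in> borel_measurable lpos"
  shows "(\<lambda>w. \<integral>\<^sup>+r. ennreal (cmod (stepfun n (\<lambda>r w. a r * F r w) r w - a r * rep F r w)) \<partial>lpos) \<in> borel_measurable M"
proof (rule sigma_finite_measure.borel_measurable_nn_integral[OF sigma_finite_lpos])
  have stp: "(\<lambda>x. F (dypt n (dyidx n (fst x))) (snd x)) \<in> borel_measurable (lpos \<Otimes>\<^sub>M M)"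
    by (rule step_measurable[where V = "\<lambda>k. F (dypt n k)"]) (use good_familyD(3)[OF F] in auto)
  have "(\<lambda>x. step_coeff n a (fst x) * F (dypt n (dyidx n (fst x))) (snd x) - a (fst x) * rep F (fst x) (snd x)) \<in> borel_measurable (lpos \<Otimes>\<^sub>M M)"
    using stp good_rep_measurable[OF F] a step_coeff_measurable[of n a] by (simp add: split_beta')
  then have "(\<lambda>(r, w). ennreal (cmod (stepfun n (\<lambda>r w. a r * F r w) r w - a r * rep F r w))) \<in> borel_measurable (lpos \<Otimes>\<^sub>M M)"
    by (simp add: split_beta' stepfun_mult)
  from measurable_compose[OF measurable_pair_swap' this]
  show "(\<lambda>(w, r). ennreal (cmod (stepfun n (\<lambda>r w. a r * F r w) r w - a r * rep F r w))) \<in> borel_measurable (M \<Otimes>\<^sub>M lpos)"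
    by (simp add: split_beta')
qed

text \<open>The pointwise error splits as in \<open>step_err\<close> into \<open>U1\<close>, the
  variation of the family, and \<open>U2\<close>, its value at the grid point. Minkowski's
  inequality is applied to each part separately, since the bound for \<open>U1\<close> is only
  reached as a limit of finer grids.\<close>

lemma rho_stepfun_rep_le:
  assumes F: "good_family F B" and a: "a \<in> borel_measurable lpos"
  shows "\<rho> (\<lambda>w. \<integral>\<^sup>+r. ennreal (cmod (stepfun n (\<lambda>r w. a r * F r w) r w - a r * rep F r w)) \<partial>lpos)
    \<le> (\<integral>\<^sup>+r. ennreal (step_err n a B r) \<partial>lpos)"
proof -
  note FD = good_familyD[OF F]
  interpret sigma_finite_measure lpos by (rule sigma_finite_lpos)
  define c where "c r = ennreal (cmod (a r - step_coeff n a r))" for r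
  have cm [measurable]: "c \<in> borel_measurable lpos"
    unfolding c_def using a step_coeff_measurable[of n a] by measurable
  have bm [measurable]: "(\<lambda>r. ennreal (min (2 * B / r) (B / 2 ^ n / r ^ 2))) \<in> borel_measurable lpos"
    "(\<lambda>r. ennreal (B / r)) \<in> borel_measurable lpos"
    by ((rule borel_measurable_lpos, measurable)[1])+
  define U1 where "U1 r w = ennreal (cmod (rep F r w - F (dypt n (dyidx n r)) w))" for r w
  define U2 where "U2 r w = ennreal (cmod (F (dypt n (dyidx n r)) w))" for r w
  have stp: "(\<lambda>x. F (dypt n (dyidx n (fst x))) (snd x)) \<in> borel_measurable (lpos \<Otimes>\<^sub>M M)"
    by (rule step_measurable[where V = "\<lambda>k. F (dypt n k)"]) (use FD(3) in auto)
  have U1m: "(\<lambda>(r, w). U1 r w) \<in> borel_measurable (lpos \<Otimes>\<^sub>M M)"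
    unfolding U1_def using stp good_rep_measurable[OF F] by (simp add: split_beta')
  have U2m: "(\<lambda>(r, w). U2 r w) \<in> borel_measurable (lpos \<Otimes>\<^sub>M M)"
    unfolding U2_def using stp by (simp add: split_beta')
  \<comment> \<open>The difference involves two grid cells of \<open>r\<close>, one for each
    fineness, so the pair of their indices is coded as one natural number. For \<open>m < n\<close>
    the bound is \<open>top\<close>, which the lower limit over \<open>m\<close> does not
    see.\<close>
  have 1: "\<rho> (\<lambda>w. \<integral>\<^sup>+r. ennreal (cmod (a r)) * U1 r w \<partial>lpos)
    \<le> liminf (\<lambda>m. \<integral>\<^sup>+r. ennreal (cmod (a r)) * (if m < n then top else ennreal (min (2 * B / r) (B / 2 ^ n / r ^ 2))) \<partial>lpos)"
  proof (rule rho_nn_integral_le[where p = "\<lambda>m r. prod_encode (dyidx m r, dyidx n r)"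
        and V = "\<lambda>m k w. ennreal (cmod (F (dypt m (fst (prod_decode k))) w - F (dypt n (snd (prod_decode k))) w))"])
    show "(\<lambda>r. prod_encode (dyidx m r, dyidx n r)) \<in> measurable lpos (count_space UNIV)" for m
    proof -
      have [measurable]: "(\<lambda>r. (dyidx m r, dyidx n r)) \<in> measurable lpos (count_space (UNIV \<times> UNIV))"
        by (simp add: pair_measure_countable[symmetric])
      have "prod_encode \<in> measurable (count_space (UNIV \<times> UNIV)) (count_space UNIV)" by simp
      then show ?thesis using measurable_compose by force
    qed
    show "(\<lambda>w. ennreal (cmod (F (dypt m (fst (prod_decode k))) w - F (dypt n (snd (prod_decode k))) w))) \<in> borel_measurable M" for m k
      using FD(3)[OF dypt_pos] by measurable
    fix r assume "r \<in> space lpos"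
    then have r: "0 < r" by simp
    from rep_AE[OF F r]
    show "AE w in M. U1 r w \<le> liminf (\<lambda>m. ennreal (cmod (F (dypt m (fst (prod_decode (prod_encode (dyidx m r, dyidx n r))))) w
        - F (dypt n (snd (prod_decode (prod_encode (dyidx m r, dyidx n r))))) w)))"
    proof eventually_elim
      case (elim w)
      then have "rep F r w = F r w" by (auto simp: rep_def intro: limI)
      moreover have "(\<lambda>m. ennreal (cmod (F (dypt m (dyidx m r)) w - F (dypt n (dyidx n r)) w)))
          \<longlonglongrightarrow> ennreal (cmod (F r w - F (dypt n (dyidx n r)) w))"
        using elim by (intro tendsto_ennrealI tendsto_norm tendsto_diff tendsto_const)
      ultimately show ?case
        using lim_imp_Liminf[OF trivial_limit_sequentially] by (fastforce simp: U1_def)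
    qed
    fix m
    have "\<not> m < n \<Longrightarrow> bfs_norm \<rho> (\<lambda>w. F (dypt m (dyidx m r)) w - F (dypt n (dyidx n r)) w) \<le> ennreal (min (2 * B / r) (B / 2 ^ n / r ^ 2))"
      using good_family_dyadic2(1)[OF F r, of m n] good_family_dyadic2(2)[OF F r, of n m] by (simp add: min_def)
    then show "\<rho> (\<lambda>w. ennreal (cmod (F (dypt m (fst (prod_decode (prod_encode (dyidx m r, dyidx n r))))) w
        - F (dypt n (snd (prod_decode (prod_encode (dyidx m r, dyidx n r))))) w)))
      \<le> (if m < n then top else ennreal (min (2 * B / r) (B / 2 ^ n / r ^ 2)))"
      by (simp add: bfs_norm_def)
  qed (fact sigma_finite_lpos measurable_ennreal_cmod[OF a] U1m)+
  also have "\<dots> = (\<integral>\<^sup>+r. ennreal (cmod (a r)) * ennreal (min (2 * B / r) (B / 2 ^ n / r ^ 2)) \<partial>lpos)"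
    by (intro lim_imp_Liminf tendsto_eventually)
       (auto simp: eventually_sequentially intro!: exI[of _ n])
  finally have 1: "\<rho> (\<lambda>w. \<integral>\<^sup>+r. ennreal (cmod (a r)) * U1 r w \<partial>lpos)
    \<le> (\<integral>\<^sup>+r. ennreal (cmod (a r)) * ennreal (min (2 * B / r) (B / 2 ^ n / r ^ 2)) \<partial>lpos)" .
  have "\<rho> (\<lambda>w. \<integral>\<^sup>+r. c r * U2 r w \<partial>lpos) \<le> liminf (\<lambda>m. \<integral>\<^sup>+r. c r * ennreal (B / r) \<partial>lpos)"
  proof (rule rho_nn_integral_le[where p = "\<lambda>m. dyidx n" and V = "\<lambda>m k w. ennreal (cmod (F (dypt n k) w))"])
    show "(\<lambda>w. ennreal (cmod (F (dypt n k) w))) \<in> borel_measurable M" for k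
      using FD(3)[OF dypt_pos] by measurable
    fix r assume "r \<in> space lpos"
    then have r: "0 < r" by simp
    have "bfs_norm \<rho> (F (dypt n (dyidx n r))) \<le> ennreal (B / dypt n (dyidx n r))" by (rule FD) simp
    also have "\<dots> \<le> ennreal (B / r)"
      using dypt_dyidx[OF r, of n] r FD(1) by (intro ennreal_leI divide_left_mono mult_pos_pos) auto
    finally show "\<rho> (\<lambda>w. ennreal (cmod (F (dypt n (dyidx n r)) w))) \<le> ennreal (B / r)"
      by (simp add: bfs_norm_def)
    show "AE w in M. U2 r w \<le> liminf (\<lambda>m. ennreal (cmod (F (dypt n (dyidx n r)) w)))"
      by (simp add: U2_def Liminf_const)
  qed (fact sigma_finite_lpos cm dyidx_measurable U2m)+
  then have 2: "\<rho> (\<lambda>w. \<integral>\<^sup>+r. c r * U2 r w \<partial>lpos) \<le> (\<integral>\<^sup>+r. c r * ennreal (B / r) \<partial>lpos)"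
    by (simp add: Liminf_const)
  have msw: "(\<lambda>(w, r). a' r * U r w) \<in> borel_measurable (M \<Otimes>\<^sub>M lpos)"
    if "a' \<in> borel_measurable lpos" "(\<lambda>(r, w). U r w) \<in> borel_measurable (lpos \<Otimes>\<^sub>M M)"
    for a' :: "real \<Rightarrow> ennreal" and U
  proof -
    have "(\<lambda>x. a' (snd x) * (\<lambda>(r, w). U r w) (snd x, fst x)) \<in> borel_measurable (M \<Otimes>\<^sub>M lpos)"
      using measurable_compose[OF measurable_pair_swap' that(2)] that(1) by (auto simp: split_beta')
    then show ?thesis by (simp add: split_beta')
  qed
  have m1: "(\<lambda>(w, r). ennreal (cmod (a r)) * U1 r w) \<in> borel_measurable (M \<Otimes>\<^sub>M lpos)"
    using a by (intro msw U1m) auto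
  have m2: "(\<lambda>(w, r). c r * U2 r w) \<in> borel_measurable (M \<Otimes>\<^sub>M lpos)"
    by (intro msw U2m cm)
  have n1: "(\<lambda>w. \<integral>\<^sup>+r. ennreal (cmod (a r)) * U1 r w \<partial>lpos) \<in> borel_measurable M"
    by (rule borel_measurable_nn_integral[OF m1])
  have n2: "(\<lambda>w. \<integral>\<^sup>+r. c r * U2 r w \<partial>lpos) \<in> borel_measurable M"
    by (rule borel_measurable_nn_integral[OF m2])
  note m0 = stepfun_rep_measurable[OF F a, of n]
  have "\<rho> (\<lambda>w. \<integral>\<^sup>+r. ennreal (cmod (stepfun n (\<lambda>r w. a r * F r w) r w - a r * rep F r w)) \<partial>lpos)
    \<le> \<rho> (\<lambda>w. (\<integral>\<^sup>+r. ennreal (cmod (a r)) * U1 r w \<partial>lpos) + (\<integral>\<^sup>+r. c r * U2 r w \<partial>lpos))"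
  proof (rule rho_mono')
    fix w assume w: "w \<in> space M"
    have w1: "(\<lambda>r. ennreal (cmod (a r)) * U1 r w) \<in> borel_measurable lpos"
      "(\<lambda>r. c r * U2 r w) \<in> borel_measurable lpos"
      using measurable_compose[OF measurable_Pair1'[OF w] m1] measurable_compose[OF measurable_Pair1'[OF w] m2]
      by (simp_all only: split_conv)
    have "(\<integral>\<^sup>+r. ennreal (cmod (stepfun n (\<lambda>r w. a r * F r w) r w - a r * rep F r w)) \<partial>lpos)
      \<le> (\<integral>\<^sup>+r. ennreal (cmod (a r)) * U1 r w + c r * U2 r w \<partial>lpos)"
    proof (rule nn_integral_mono)
      fix r
      have "stepfun n (\<lambda>r w. a r * F r w) r w - a r * rep F r w
        = - (a r * (rep F r w - F (dypt n (dyidx n r)) w) + (a r - step_coeff n a r) * F (dypt n (dyidx n r)) w)"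
        by (simp add: stepfun_mult algebra_simps)
      then have "cmod (stepfun n (\<lambda>r w. a r * F r w) r w - a r * rep F r w)
        = cmod (a r * (rep F r w - F (dypt n (dyidx n r)) w) + (a r - step_coeff n a r) * F (dypt n (dyidx n r)) w)"
        by (simp only: norm_minus_cancel)
      also have "\<dots> \<le> cmod (a r) * cmod (rep F r w - F (dypt n (dyidx n r)) w) + cmod (a r - step_coeff n a r) * cmod (F (dypt n (dyidx n r)) w)"
        by (rule order_trans[OF norm_triangle_ineq]) (simp only: norm_mult order_refl)
      finally have "cmod (stepfun n (\<lambda>r w. a r * F r w) r w - a r * rep F r w)
        \<le> cmod (a r) * cmod (rep F r w - F (dypt n (dyidx n r)) w) + cmod (a r - step_coeff n a r) * cmod (F (dypt n (dyidx n r)) w)" .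
      then show "ennreal (cmod (stepfun n (\<lambda>r w. a r * F r w) r w - a r * rep F r w)) \<le> ennreal (cmod (a r)) * U1 r w + c r * U2 r w"
        by (simp add: U1_def U2_def c_def ennreal_mult[symmetric] ennreal_plus[symmetric] ennreal_leI del: ennreal_plus)
    qed
    also have "\<dots> = (\<integral>\<^sup>+r. ennreal (cmod (a r)) * U1 r w \<partial>lpos) + (\<integral>\<^sup>+r. c r * U2 r w \<partial>lpos)"
      by (rule nn_integral_add[OF w1])
    finally show "(\<integral>\<^sup>+r. ennreal (cmod (stepfun n (\<lambda>r w. a r * F r w) r w - a r * rep F r w)) \<partial>lpos)
      \<le> (\<integral>\<^sup>+r. ennreal (cmod (a r)) * U1 r w \<partial>lpos) + (\<integral>\<^sup>+r. c r * U2 r w \<partial>lpos)" .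
  qed (intro borel_measurable_add n1 n2 m0)+
  also have "\<dots> \<le> \<rho> (\<lambda>w. \<integral>\<^sup>+r. ennreal (cmod (a r)) * U1 r w \<partial>lpos) + \<rho> (\<lambda>w. \<integral>\<^sup>+r. c r * U2 r w \<partial>lpos)"
    by (intro rho_triangle n1 n2)
  also have "\<dots> \<le> (\<integral>\<^sup>+r. ennreal (cmod (a r)) * ennreal (min (2 * B / r) (B / 2 ^ n / r ^ 2)) \<partial>lpos) + (\<integral>\<^sup>+r. c r * ennreal (B / r) \<partial>lpos)"
    by (intro add_mono 1 2)
  also have "\<dots> = (\<integral>\<^sup>+r. ennreal (cmod (a r)) * ennreal (min (2 * B / r) (B / 2 ^ n / r ^ 2)) + c r * ennreal (B / r) \<partial>lpos)"
    by (intro nn_integral_add[symmetric] borel_measurable_times_ennreal measurable_ennreal_cmod a bm cm)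
  also have "\<dots> = (\<integral>\<^sup>+r. ennreal (step_err n a B r) \<partial>lpos)"
    using FD(1) by (intro nn_integral_cong) (simp add: step_err_def c_def ennreal_mult[symmetric] ennreal_plus[symmetric] del: ennreal_plus)
  finally show ?thesis .
qed

text \<open>Wherever both integrals exist, their difference is dominated by the integral of the
  pointwise error over \<open>r\<close>, whose norm \<open>rho_stepfun_rep_le\<close>
  estimates.\<close>

lemma bfs_norm_riemann_sum_le:
  assumes F: "good_family F B" and a: "a \<in> borel_measurable lpos"
    and fin: "(\<integral>\<^sup>+r. ennreal (cmod (a r)) * ennreal (1 / r) \<partial>lpos) < \<infinity>"
  shows "bfs_norm \<rho> (\<lambda>w. (LINT r|lpos. stepfun n (\<lambda>r w. a r * F r w) r w) - ray_int a F w)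
    \<le> (\<integral>\<^sup>+r. ennreal (step_err n a B r) \<partial>lpos)"
proof -
  note FD = good_familyD[OF F]
  define g where "g w = (\<integral>\<^sup>+r. ennreal (cmod (stepfun n (\<lambda>r w. a r * F r w) r w - a r * rep F r w)) \<partial>lpos)" for w
  have intm: "(\<lambda>w. LINT r|lpos. stepfun n (\<lambda>r w. a r * F r w) r w) \<in> borel_measurable M"
    unfolding stepfun_integral
    by (intro borel_measurable_sum borel_measurable_times borel_measurable_const FD(3)[OF dypt_pos])
  have "bfs_norm \<rho> (\<lambda>w. (LINT r|lpos. stepfun n (\<lambda>r w. a r * F r w) r w) - ray_int a F w) \<le> \<rho> g"
    unfolding bfs_norm_def
  proof (rule rho_mono)
    show "AE w in M. ennreal (cmod ((LINT r|lpos. stepfun n (\<lambda>r w. a r * F r w) r w) - ray_int a F w)) \<le> g w"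
      using ray_int_AE_integrable[OF F a fin]
    proof eventually_elim
      case (elim w)
      have eq: "(LINT r|lpos. stepfun n (\<lambda>r w. a r * F r w) r w) - ray_int a F w
        = (LINT r|lpos. stepfun n (\<lambda>r w. a r * F r w) r w - a r * rep F r w)"
        unfolding ray_int_def by (rule Bochner_Integration.integral_diff[symmetric]; intro elim stepfun_integrable)
      show ?case
        unfolding g_def eq by (rule integral_norm_bound_ennreal, rule Bochner_Integration.integrable_diff)
          (rule stepfun_integrable, rule elim)
    qed
    show "g \<in> borel_measurable M"
      unfolding g_def[abs_def] by (rule stepfun_rep_measurable[OF F a])
    show "(\<lambda>w. ennreal (cmod ((LINT r|lpos. stepfun n (\<lambda>r w. a r * F r w) r w) - ray_int a F w))) \<in> borel_measurable M"
      by (intro measurable_ennreal_cmod borel_measurable_diff intm ray_int_measurable[OF F a])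
  qed
  also have "\<dots> \<le> (\<integral>\<^sup>+r. ennreal (step_err n a B r) \<partial>lpos)"
    unfolding g_def[abs_def] by (rule rho_stepfun_rep_le[OF F a])
  finally show ?thesis .
qed

end

definition good_weight :: "(real \<Rightarrow> complex) \<Rightarrow> bool" where
  "good_weight a \<longleftrightarrow> continuous_on {0<..} a \<and> (\<exists>K\<ge>0. \<exists>\<epsilon>>0. \<forall>r>0. cmod (a r) \<le> K * decay \<epsilon> r)"

lemma good_weight_measurable: "good_weight a \<Longrightarrow> a \<in> borel_measurable lpos"
  by (auto simp: good_weight_def intro: continuous_imp_measurable_lpos)

lemma good_weight_finite:
  "good_weight a \<Longrightarrow> (\<integral>\<^sup>+r. ennreal (cmod (a r)) * ennreal (1 / r) \<partial>lpos) < \<infinity>"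
  unfolding good_weight_def using nn_integral_decaying_finite by blast

lemma good_weight_step_err:
  "good_weight a \<Longrightarrow> 0 \<le> B \<Longrightarrow> (\<lambda>n. \<integral>\<^sup>+r. ennreal (step_err n a B r) \<partial>lpos) \<longlonglongrightarrow> 0"
  unfolding good_weight_def using step_err_tendsto_0 by blast

section \<open>Existence and uniqueness of the Bochner integral\<close>

lemma simple_function_stepidx: "simple_function lpos (stepidx n)"
  unfolding simple_function_def
proof
  show "finite (stepidx n ` space lpos)"
    by (rule finite_subset[of _ "{..n * 2 ^ n}"]) (auto intro: stepidx_le)
  show "\<forall>x\<in>stepidx n ` space lpos. stepidx n -` {x} \<inter> space lpos \<in> sets lpos"
    by (intro ballI measurable_sets[OF stepidx_measurable]) simp
qed

lemma stepfun_comp: "stepfun n v = (\<lambda>k. if k = 0 then (\<lambda>_. 0) else v (dypt n (k - 1))) \<circ> stepidx n"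
  by (auto simp: stepfun_def)

context banach_function_norm
begin

lemma bfs_simple_stepfun:
  assumes "\<And>r. 0 < r \<Longrightarrow> v r \<in> bfs M \<rho>"
  shows "bfs_simple M \<rho> lpos (stepfun n v)"
  unfolding bfs_simple_def
proof (intro conjI)
  show "simple_function lpos (stepfun n v)"
    unfolding stepfun_comp by (rule simple_function_compose[OF simple_function_stepidx])
  show "stepfun n v ` space lpos \<subseteq> bfs M \<rho>"
    using assms by (auto simp: stepfun_def)
  have "emeasure lpos {t \<in> space lpos. stepfun n v t \<noteq> (\<lambda>_. 0)} \<le> emeasure lpos {r. 0 < r \<and> stepidx n r \<noteq> 0}"
    by (rule emeasure_mono) (auto simp: stepfun_def sets_stepidx[of "\<lambda>k. k \<noteq> 0", simplified])
  also have "\<dots> < \<infinity>" using emeasure_stepidx_finite[of n] by simp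
  finally show "emeasure lpos {t \<in> space lpos. stepfun n v t \<noteq> (\<lambda>_. 0)} < \<infinity>" .
qed

text \<open>Evaluated at a point, the integral of a simple function is a scalar Lebesgue integral,
  for which linearity and the norm bound are available.\<close>

lemma bfs_simple_integral_eq:
  assumes "bfs_simple M \<rho> N S"
  shows "integrable N (\<lambda>t. S t w)" "bfs_simple_integral N S w = (LINT t|N. S t w)"
proof -
  from assms have sf: "simple_function N S" and fin: "emeasure N {t \<in> space N. S t \<noteq> (\<lambda>_. 0)} < \<infinity>"
    by (auto simp: bfs_simple_def)
  define A where "A v = {t \<in> space N. S t = v}" for v
  have A: "A v \<in> sets N" for v
    using simple_functionD(2)[OF sf, of "{v}"] by (simp add: A_def vimage_def Int_def conj_commute)
  have finA: "emeasure N (A v) < \<infinity>" if "v \<noteq> (\<lambda>_. 0)" for v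
  proof -
    have "{t \<in> space N. S t \<noteq> (\<lambda>_. 0)} = S -` (- {\<lambda>_. 0}) \<inter> space N" by auto
    then have "{t \<in> space N. S t \<noteq> (\<lambda>_. 0)} \<in> sets N"
      using simple_functionD(2)[OF sf] by simp
    then have "emeasure N (A v) \<le> emeasure N {t \<in> space N. S t \<noteq> (\<lambda>_. 0)}"
      using that by (intro emeasure_mono) (auto simp: A_def)
    then show ?thesis using fin by (rule order_le_less_trans)
  qed
  \<comment> \<open>Only the level set of the zero function may have infinite measure, and for it
    the factor \<open>v w\<close> vanishes.\<close>
  have int: "integrable N (\<lambda>t. indicator (A v) t *\<^sub>R v w)" for v
  proof (cases "v = (\<lambda>_. 0)")
    case False
    then show ?thesis
      using A finA by (intro integrable_scaleR_left integrable_real_indicator) auto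
  qed simp
  have val: "(LINT t|N. indicator (A v) t *\<^sub>R v w) = of_real (measure N (A v)) * v w" for v
  proof (cases "v = (\<lambda>_. 0)")
    case False
    have "(LINT t|N. indicator (A v) t *\<^sub>R v w) = measure N (A v \<inter> space N) *\<^sub>R v w"
      using A finA[OF False] by (subst integral_scaleR_left) (auto intro!: integrable_real_indicator)
    also have "A v \<inter> space N = A v" by (auto simp: A_def)
    finally show ?thesis by (simp add: scaleR_conv_of_real)
  qed simp
  have eq: "S t w = (\<Sum>v\<in>S ` space N. indicator (A v) t *\<^sub>R v w)" if "t \<in> space N" for t
  proof -
    have "(\<Sum>v\<in>S ` space N. indicator (A v) t *\<^sub>R v w) = (\<Sum>v\<in>S ` space N. if v = S t then v w else 0)"
      using that by (intro sum.cong) (auto simp: A_def indicator_def)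
    also have "\<dots> = S t w"
      using simple_functionD(1)[OF sf] that by (subst sum.delta) auto
    finally show ?thesis ..
  qed
  have "integrable N (\<lambda>t. \<Sum>v\<in>S ` space N. indicator (A v) t *\<^sub>R v w)"
    by (intro Bochner_Integration.integrable_sum int)
  moreover have "integrable N (\<lambda>t. S t w) \<longleftrightarrow> integrable N (\<lambda>t. \<Sum>v\<in>S ` space N. indicator (A v) t *\<^sub>R v w)"
    by (rule Bochner_Integration.integrable_cong[OF refl]) (rule eq)
  ultimately show "integrable N (\<lambda>t. S t w)" by (simp only:)
  have "(LINT t|N. S t w) = (LINT t|N. (\<Sum>v\<in>S ` space N. indicator (A v) t *\<^sub>R v w))"
    by (rule Bochner_Integration.integral_cong[OF refl eq])
  also have "\<dots> = (\<Sum>v\<in>S ` space N. LINT t|N. indicator (A v) t *\<^sub>R v w)"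
    by (intro Bochner_Integration.integral_sum int)
  finally show "bfs_simple_integral N S w = (LINT t|N. S t w)"
    by (simp only: val) (simp only: bfs_simple_integral_def A_def)
qed

lemma bfs_simple_integral_bfs:
  assumes "bfs_simple M \<rho> N S"
  shows "bfs_simple_integral N S \<in> bfs M \<rho>"
  unfolding bfs_simple_integral_def
  using assms by (intro bfs_sum bfs_cmult) (auto simp: bfs_simple_def)

text \<open>The triangle inequality for the vector-valued integral. The pair of simple functions
  takes finitely many values, so a natural number codes it and Minkowski's inequality applies with a
  constant sequence of approximants.\<close>

lemma bfs_simple_integral_diff_le:
  assumes N: "sigma_finite_measure N" "space N \<noteq> {}" and S: "bfs_simple M \<rho> N S" and S': "bfs_simple M \<rho> N S'"
  shows "bfs_norm \<rho> (\<lambda>w. bfs_simple_integral N S w - bfs_simple_integral N S' w)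
    \<le> (\<integral>\<^sup>+t. bfs_norm \<rho> (\<lambda>w. S t w - S' t w) \<partial>N)"
proof -
  interpret N: sigma_finite_measure N by fact
  define A where "A = (S ` space N) \<times> (S' ` space N)"
  define p where "p t = to_nat_on A (S t, S' t)" for t
  define V where "V k w = ennreal (cmod (fst (from_nat_into A k) w - snd (from_nat_into A k) w))" for k w
  have sf: "simple_function N S" "simple_function N S'" and sub: "S ` space N \<subseteq> bfs M \<rho>" "S' ` space N \<subseteq> bfs M \<rho>"
    using S S' by (auto simp: bfs_simple_def)
  have cA: "countable A" and neA: "A \<noteq> {}"
    using simple_functionD(1)[OF sf(1)] simple_functionD(1)[OF sf(2)] N(2)
    by (auto simp: A_def intro!: countable_finite)
  have "simple_function N (to_nat_on A \<circ> (\<lambda>t. (S t, S' t)))"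
    by (intro simple_function_compose simple_function_Pair sf)
  then have p: "p \<in> measurable N (count_space UNIV)"
    unfolding p_def comp_def by (rule measurable_simple_function)
  have fni: "fst (from_nat_into A k) \<in> bfs M \<rho>" "snd (from_nat_into A k) \<in> bfs M \<rho>" for k
    using from_nat_into[OF neA, of k] sub by (auto simp: A_def)
  have V: "V k \<in> borel_measurable M" for k
    unfolding V_def[abs_def] by (intro measurable_ennreal_cmod borel_measurable_diff bfs_measurable fni)
  have Vp: "V (p t) w = ennreal (cmod (S t w - S' t w))" if "t \<in> space N" for t w
    using that cA by (simp add: V_def p_def A_def)
  have U: "(\<lambda>(t, w). V (p t) w) \<in> borel_measurable (N \<Otimes>\<^sub>M M)"
    using step_measurable[OF V p] by (simp add: split_beta')
  have "(\<lambda>(w, t). V (p t) w) \<in> borel_measurable (M \<Otimes>\<^sub>M N)"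
    using measurable_compose[OF measurable_pair_swap' U] by (simp add: split_beta')
  then have Um: "(\<lambda>w. \<integral>\<^sup>+t. V (p t) w \<partial>N) \<in> borel_measurable M"
    by (rule N.borel_measurable_nn_integral)
  have "bfs_norm \<rho> (\<lambda>w. bfs_simple_integral N S w - bfs_simple_integral N S' w) \<le> \<rho> (\<lambda>w. \<integral>\<^sup>+t. V (p t) w \<partial>N)"
    unfolding bfs_norm_def
  proof (rule rho_mono')
    fix w
    have "ennreal (cmod (bfs_simple_integral N S w - bfs_simple_integral N S' w))
        = ennreal (cmod (LINT t|N. S t w - S' t w))"
      by (simp add: bfs_simple_integral_eq[OF S] bfs_simple_integral_eq[OF S'])
    also have "\<dots> \<le> (\<integral>\<^sup>+t. ennreal (cmod (S t w - S' t w)) \<partial>N)"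
      by (intro integral_norm_bound_ennreal Bochner_Integration.integrable_diff bfs_simple_integral_eq(1)[OF S] bfs_simple_integral_eq(1)[OF S'])
    also have "\<dots> = (\<integral>\<^sup>+t. V (p t) w \<partial>N)"
      by (rule nn_integral_cong) (simp add: Vp)
    finally show "ennreal (cmod (bfs_simple_integral N S w - bfs_simple_integral N S' w)) \<le> (\<integral>\<^sup>+t. V (p t) w \<partial>N)" .
  qed (intro Um measurable_ennreal_cmod borel_measurable_diff bfs_measurable bfs_simple_integral_bfs S S')+
  also have "\<dots> = \<rho> (\<lambda>w. \<integral>\<^sup>+t. 1 * V (p t) w \<partial>N)" by simp
  also have "\<dots> \<le> liminf (\<lambda>m::nat. \<integral>\<^sup>+t. 1 * \<rho> (V (p t)) \<partial>N)"
    by (rule rho_nn_integral_le[where p = "\<lambda>_. p" and V = "\<lambda>_. V"])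
      (use N p V U in \<open>simp_all add: Liminf_const\<close>)
  also have "\<dots> = (\<integral>\<^sup>+t. bfs_norm \<rho> (\<lambda>w. S t w - S' t w) \<partial>N)"
  proof -
    have "V (p t) = (\<lambda>w. ennreal (cmod (S t w - S' t w)))" if "t \<in> space N" for t
      using Vp[OF that] by (rule ext)
    then have "(\<integral>\<^sup>+t. \<rho> (V (p t)) \<partial>N) = (\<integral>\<^sup>+t. bfs_norm \<rho> (\<lambda>w. S t w - S' t w) \<partial>N)"
      unfolding bfs_norm_def by (intro nn_integral_cong) simp
    then show ?thesis by (simp add: Liminf_const)
  qed
  finally show ?thesis .
qed

text \<open>Makes the choice by \<open>SOME\<close> in \<open>fun_calc\<close> harmless: whatever it
  picks agrees almost everywhere with any integral constructed explicitly.\<close>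

lemma has_bfs_integral_unique:
  assumes N: "sigma_finite_measure N" "space N \<noteq> {}"
    and y: "has_bfs_integral M \<rho> N F y" and y': "has_bfs_integral M \<rho> N F y'"
  shows "AE w in M. y w = y' w"
proof -
  from y obtain S where S: "\<And>n. bfs_simple M \<rho> N (S n)"
    and Sm: "\<And>n. (\<lambda>t. bfs_norm \<rho> (\<lambda>w. F t w - S n t w)) \<in> borel_measurable N"
    and S0: "(\<lambda>n. \<integral>\<^sup>+t. bfs_norm \<rho> (\<lambda>w. F t w - S n t w) \<partial>N) \<longlonglongrightarrow> 0"
    and Sy: "(\<lambda>n::nat. bfs_norm \<rho> (\<lambda>w. bfs_simple_integral N (S n) w - y w)) \<longlonglongrightarrow> 0"
    by (auto simp: has_bfs_integral_def)
  from y' obtain S' where S': "\<And>n. bfs_simple M \<rho> N (S' n)"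
    and S'm: "\<And>n. (\<lambda>t. bfs_norm \<rho> (\<lambda>w. F t w - S' n t w)) \<in> borel_measurable N"
    and S'0: "(\<lambda>n. \<integral>\<^sup>+t. bfs_norm \<rho> (\<lambda>w. F t w - S' n t w) \<partial>N) \<longlonglongrightarrow> 0"
    and S'y: "(\<lambda>n::nat. bfs_norm \<rho> (\<lambda>w. bfs_simple_integral N (S' n) w - y' w)) \<longlonglongrightarrow> 0"
    by (auto simp: has_bfs_integral_def)
  have Fb: "F t \<in> bfs M \<rho>" if "t \<in> space N" for t using y that by (auto simp: has_bfs_integral_def)
  have yb: "y \<in> borel_measurable M" "y' \<in> borel_measurable M"
    using y y' by (auto simp: has_bfs_integral_def bfs_def)
  define I where "I n = bfs_simple_integral N (S n)" for n
  define I' where "I' n = bfs_simple_integral N (S' n)" for n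
  have Im: "I n \<in> borel_measurable M" "I' n \<in> borel_measurable M" for n
    unfolding I_def I'_def by (intro bfs_measurable bfs_simple_integral_bfs S S')+
  define e where "e n = bfs_norm \<rho> (\<lambda>w. I n w - y w) + ((\<integral>\<^sup>+t. bfs_norm \<rho> (\<lambda>w. F t w - S n t w) \<partial>N)
     + (\<integral>\<^sup>+t. bfs_norm \<rho> (\<lambda>w. F t w - S' n t w) \<partial>N) + bfs_norm \<rho> (\<lambda>w. I' n w - y' w))" for n
  show ?thesis
  proof (rule AE_eq_if_bfs_norm_le[OF yb])
    show "e \<longlonglongrightarrow> 0"
      unfolding e_def[abs_def] I_def I'_def
      using tendsto_add[OF Sy tendsto_add[OF tendsto_add[OF S0 S'0] S'y]] by simp
    fix n
    have "bfs_norm \<rho> (\<lambda>w. I n w - I' n w) \<le> (\<integral>\<^sup>+t. bfs_norm \<rho> (\<lambda>w. S n t w - S' n t w) \<partial>N)"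
      unfolding I_def I'_def by (rule bfs_simple_integral_diff_le[OF N S S'])
    also have "\<dots> \<le> (\<integral>\<^sup>+t. bfs_norm \<rho> (\<lambda>w. F t w - S n t w) + bfs_norm \<rho> (\<lambda>w. F t w - S' n t w) \<partial>N)"
    proof (rule nn_integral_mono)
      fix t assume t: "t \<in> space N"
      have b: "S n t \<in> bfs M \<rho>" "S' n t \<in> bfs M \<rho>" using S[of n] S'[of n] t by (auto simp: bfs_simple_def)
      have "bfs_norm \<rho> (\<lambda>w. S n t w - S' n t w) \<le> bfs_norm \<rho> (\<lambda>w. S n t w - F t w) + bfs_norm \<rho> (\<lambda>w. F t w - S' n t w)"
        by (intro bfs_norm_triangle_diff bfs_measurable b Fb t)
      then show "bfs_norm \<rho> (\<lambda>w. S n t w - S' n t w) \<le> bfs_norm \<rho> (\<lambda>w. F t w - S n t w) + bfs_norm \<rho> (\<lambda>w. F t w - S' n t w)"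
        by (simp only: bfs_norm_minus_commute[of "S n t"])
    qed
    also have "\<dots> = (\<integral>\<^sup>+t. bfs_norm \<rho> (\<lambda>w. F t w - S n t w) \<partial>N) + (\<integral>\<^sup>+t. bfs_norm \<rho> (\<lambda>w. F t w - S' n t w) \<partial>N)"
      by (rule nn_integral_add[OF Sm S'm])
    finally have m: "bfs_norm \<rho> (\<lambda>w. I n w - I' n w) \<le> (\<integral>\<^sup>+t. bfs_norm \<rho> (\<lambda>w. F t w - S n t w) \<partial>N) + (\<integral>\<^sup>+t. bfs_norm \<rho> (\<lambda>w. F t w - S' n t w) \<partial>N)" .
    have "bfs_norm \<rho> (\<lambda>w. y w - y' w) \<le> bfs_norm \<rho> (\<lambda>w. y w - I n w) + bfs_norm \<rho> (\<lambda>w. I n w - y' w)"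
      by (intro bfs_norm_triangle_diff yb Im)
    also have "\<dots> \<le> bfs_norm \<rho> (\<lambda>w. y w - I n w) + (bfs_norm \<rho> (\<lambda>w. I n w - I' n w) + bfs_norm \<rho> (\<lambda>w. I' n w - y' w))"
      by (intro add_left_mono bfs_norm_triangle_diff yb Im)
    also have "\<dots> \<le> e n"
      unfolding e_def by (intro add_mono m order_refl) (simp only: bfs_norm_minus_commute[of y] order_refl)
    finally show "bfs_norm \<rho> (\<lambda>w. y w - y' w) \<le> e n" .
  qed
qed

text \<open>\<open>has_bfs_integral\<close> asks for measurable distances between the integrand and
  the step functions. Continuity in norm suffices, since the distance to a fixed element is then a
  continuous function of \<open>r\<close>.\<close>

lemma norm_continuous_measurable:
  assumes v: "\<And>r. 0 < r \<Longrightarrow> v r \<in> bfs M \<rho>" and h: "h \<in> bfs M \<rho>"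
    and cont: "\<And>r. 0 < r \<Longrightarrow> ((\<lambda>r'. bfs_norm \<rho> (\<lambda>w. v r' w - v r w)) \<longlongrightarrow> 0) (at r within {0<..})"
  shows "(\<lambda>r. bfs_norm \<rho> (\<lambda>w. v r w - h w)) \<in> borel_measurable lpos"
proof -
  define \<nu> where "\<nu> r = enn2real (bfs_norm \<rho> (\<lambda>w. v r w - h w))" for r
  have fin: "bfs_norm \<rho> (\<lambda>w. v r w - h w) < top" if "0 < r" for r
    using bfs_norm_finite[OF bfs_diff[OF v[OF that] h]] by simp
  have le: "\<nu> r' \<le> \<nu> r + enn2real (bfs_norm \<rho> (\<lambda>w. v r' w - v r w))" if "0 < r" "0 < r'" for r r'
  proof -
    have f: "bfs_norm \<rho> (\<lambda>w. v r' w - v r w) < top"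
      using bfs_norm_finite[OF bfs_diff[OF v[OF that(2)] v[OF that(1)]]] by simp
    have "bfs_norm \<rho> (\<lambda>w. v r' w - h w) \<le> bfs_norm \<rho> (\<lambda>w. v r' w - v r w) + bfs_norm \<rho> (\<lambda>w. v r w - h w)"
      by (intro bfs_norm_triangle_diff bfs_measurable v h that)
    then have "\<nu> r' \<le> enn2real (bfs_norm \<rho> (\<lambda>w. v r' w - v r w) + bfs_norm \<rho> (\<lambda>w. v r w - h w))"
      unfolding \<nu>_def using f fin[OF that(1)] by (intro enn2real_mono) auto
    also have "\<dots> = enn2real (bfs_norm \<rho> (\<lambda>w. v r' w - v r w)) + \<nu> r"
      unfolding \<nu>_def using f fin[OF that(1)] by (intro enn2real_plus) auto
    finally show ?thesis by simp
  qed
  have "continuous_on {0<..} \<nu>"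
    unfolding continuous_on_def
  proof
    fix r :: real assume "r \<in> {0<..}"
    then have r: "0 < r" by simp
    have 0: "((\<lambda>r'. enn2real (bfs_norm \<rho> (\<lambda>w. v r' w - v r w))) \<longlongrightarrow> 0) (at r within {0<..})"
      by (rule tendsto_enn2real) (use cont[OF r] in simp_all)
    have "((\<lambda>r'. \<nu> r' - \<nu> r) \<longlongrightarrow> 0) (at r within {0<..})"
    proof (rule Lim_null_comparison[OF _ 0])
      show "\<forall>\<^sub>F r' in at r within {0<..}. norm (\<nu> r' - \<nu> r) \<le> enn2real (bfs_norm \<rho> (\<lambda>w. v r' w - v r w))"
        unfolding eventually_at_filter
      proof (rule always_eventually, intro allI impI)
        fix r' :: real assume "r' \<in> {0<..}"
        then have r': "0 < r'" by simp
        show "norm (\<nu> r' - \<nu> r) \<le> enn2real (bfs_norm \<rho> (\<lambda>w. v r' w - v r w))"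
          using le[OF r r'] le[OF r' r] by (simp add: bfs_norm_minus_commute[of "v r"])
      qed
    qed
    then show "(\<nu> \<longlongrightarrow> \<nu> r) (at r within {0<..})" by (simp add: LIM_zero_iff)
  qed
  then have "\<nu> \<in> borel_measurable lpos" by (rule continuous_imp_measurable_lpos)
  then have "(\<lambda>r. ennreal (\<nu> r)) \<in> borel_measurable lpos" by (rule measurable_compose[OF _ measurable_ennreal])
  moreover have "ennreal (\<nu> r) = bfs_norm \<rho> (\<lambda>w. v r w - h w)" if "r \<in> space lpos" for r
    using fin that by (simp add: \<nu>_def)
  ultimately show ?thesis by (subst (asm) measurable_cong) auto
qed

lemma good_family_mult_continuous:
  assumes F: "good_family F B" and a: "continuous_on {0<..} a" and r: "0 < r"
  shows "((\<lambda>r'. bfs_norm \<rho> (\<lambda>w. a r' * F r' w - a r * F r w)) \<longlongrightarrow> 0) (at r within {0<..})"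
proof -
  note FD = good_familyD[OF F]
  have "((\<lambda>r'. cmod (a r' - a r) * (B / r') + cmod (a r) * (B * \<bar>r' - r\<bar> / (r' * r)))
      \<longlongrightarrow> cmod (a r - a r) * (B / r) + cmod (a r) * (B * \<bar>r - r\<bar> / (r * r))) (at r within {0<..})"
    using r a by (intro tendsto_intros) (auto simp: continuous_on_def)
  then have lim: "((\<lambda>r'. ennreal (cmod (a r' - a r) * (B / r') + cmod (a r) * (B * \<bar>r' - r\<bar> / (r' * r)))) \<longlongrightarrow> 0) (at r within {0<..})"
    using tendsto_ennrealI by fastforce
  show ?thesis
  proof (rule tendsto_sandwich[OF _ _ tendsto_const lim])
    show "\<forall>\<^sub>F r' in at r within {0<..}. bfs_norm \<rho> (\<lambda>w. a r' * F r' w - a r * F r w)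
      \<le> ennreal (cmod (a r' - a r) * (B / r') + cmod (a r) * (B * \<bar>r' - r\<bar> / (r' * r)))"
      unfolding eventually_at_filter
    proof (rule always_eventually, intro allI impI)
      fix r' :: real assume "r' \<in> {0<..}"
      then have r': "0 < r'" by simp
      have Fm: "F r \<in> borel_measurable M" "F r' \<in> borel_measurable M" using FD(3) r r' by auto
      have "bfs_norm \<rho> (\<lambda>w. a r' * F r' w - a r * F r w) = bfs_norm \<rho> (\<lambda>w. (a r' - a r) * F r' w + a r * (F r' w - F r w))"
        by (simp add: algebra_simps)
      also have "\<dots> \<le> bfs_norm \<rho> (\<lambda>w. (a r' - a r) * F r' w) + bfs_norm \<rho> (\<lambda>w. a r * (F r' w - F r w))"
        using Fm by (intro bfs_norm_add) auto
      also have "\<dots> = ennreal (cmod (a r' - a r)) * bfs_norm \<rho> (F r') + ennreal (cmod (a r)) * bfs_norm \<rho> (\<lambda>w. F r' w - F r w)"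
        using Fm by (simp add: bfs_norm_cmult)
      also have "\<dots> \<le> ennreal (cmod (a r' - a r)) * ennreal (B / r') + ennreal (cmod (a r)) * ennreal (B * \<bar>r' - r\<bar> / (r' * r))"
        by (intro add_mono mult_left_mono FD r r') auto
      also have "\<dots> = ennreal (cmod (a r' - a r) * (B / r') + cmod (a r) * (B * \<bar>r' - r\<bar> / (r' * r)))"
        using FD(1) r r' by (simp add: ennreal_mult[symmetric] ennreal_plus[symmetric] del: ennreal_plus)
      finally show "bfs_norm \<rho> (\<lambda>w. a r' * F r' w - a r * F r w)
        \<le> ennreal (cmod (a r' - a r) * (B / r') + cmod (a r) * (B * \<bar>r' - r\<bar> / (r' * r)))" .
    qed
  qed auto
qed

text \<open>A contour consists of two rays, so existence is stated for the sum of two weighted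
  families. Sampling both on one grid makes the step function of the sum the sum of the step
  functions, and the errors add up.\<close>

lemma has_bfs_integral_ray_int:
  assumes F1: "good_family F1 B1" and F2: "good_family F2 B2" and a: "good_weight a" and b: "good_weight b"
  shows "has_bfs_integral M \<rho> lpos (\<lambda>r w. a r * F1 r w + b r * F2 r w) (\<lambda>w. ray_int a F1 w + ray_int b F2 w)"
proof -
  define v where "v r w = a r * F1 r w + b r * F2 r w" for r w
  define v1 where "v1 r w = a r * F1 r w" for r w
  define v2 where "v2 r w = b r * F2 r w" for r w
  have v12: "v r w = v1 r w + v2 r w" for r w by (simp add: v_def v1_def v2_def)
  have v1b: "v1 r \<in> bfs M \<rho>" and v2b: "v2 r \<in> bfs M \<rho>" if "0 < r" for r
    unfolding v1_def[abs_def] v2_def[abs_def]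
    using good_familyD(2)[OF F1 that] good_familyD(2)[OF F2 that] by (auto intro: bfs_cmult)
  have vb: "v r \<in> bfs M \<rho>" if "0 < r" for r
    using bfs_add[OF v1b[OF that] v2b[OF that]] by (simp add: v12[symmetric])
  have step: "stepfun n v r w = stepfun n v1 r w + stepfun n v2 r w" for n r w
    by (simp add: stepfun_def v12)
  have s1b: "stepfun n v1 r \<in> bfs M \<rho>" and s2b: "stepfun n v2 r \<in> bfs M \<rho>" for n r
    by (auto simp: stepfun_def intro: v1b v2b)
  have ca: "continuous_on {0<..} a" and cb: "continuous_on {0<..} b" using a b by (auto simp: good_weight_def)
  define e where "e n = (\<integral>\<^sup>+r. ennreal (step_err n a B1 r) \<partial>lpos) + (\<integral>\<^sup>+r. ennreal (step_err n b B2 r) \<partial>lpos)" for n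
  have e: "e \<longlonglongrightarrow> 0"
    unfolding e_def[abs_def]
    using tendsto_add[OF good_weight_step_err[OF a good_familyD(1)[OF F1]] good_weight_step_err[OF b good_familyD(1)[OF F2]]] by simp
  have errm: "(\<lambda>r. ennreal (step_err n a B1 r)) \<in> borel_measurable lpos" "(\<lambda>r. ennreal (step_err n b B2 r)) \<in> borel_measurable lpos" for n
    by (intro measurable_compose[OF step_err_measurable measurable_ennreal] good_weight_measurable a b)+
  have i1: "ray_int a F1 \<in> bfs M \<rho>" and i2: "ray_int b F2 \<in> bfs M \<rho>"
    by (intro ray_int_bfs[OF F1] ray_int_bfs[OF F2] good_weight_measurable good_weight_finite a b)+
  have J: "bfs_simple_integral lpos (stepfun n v) w = (LINT r|lpos. stepfun n v1 r w) + (LINT r|lpos. stepfun n v2 r w)" for n w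
  proof -
    have "bfs_simple_integral lpos (stepfun n v) w = (LINT r|lpos. stepfun n v r w)"
      by (rule bfs_simple_integral_eq(2)[OF bfs_simple_stepfun[OF vb]])
    also have "\<dots> = (LINT r|lpos. stepfun n v1 r w + stepfun n v2 r w)" by (simp only: step)
    also have "\<dots> = (LINT r|lpos. stepfun n v1 r w) + (LINT r|lpos. stepfun n v2 r w)"
      by (rule Bochner_Integration.integral_add[OF stepfun_integrable stepfun_integrable])
    finally show ?thesis .
  qed
  have Lm: "(\<lambda>w. LINT r|lpos. stepfun n u r w) \<in> borel_measurable M" if "\<And>r. 0 < r \<Longrightarrow> u r \<in> bfs M \<rho>" for n u
    unfolding stepfun_integral
    by (intro borel_measurable_sum borel_measurable_times borel_measurable_const bfs_measurable that dypt_pos)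
  have "has_bfs_integral M \<rho> lpos v (\<lambda>w. ray_int a F1 w + ray_int b F2 w)"
    unfolding has_bfs_integral_def
  proof (intro conjI exI[of _ "\<lambda>n. stepfun n v"] allI ballI)
    show "v t \<in> bfs M \<rho>" if "t \<in> space lpos" for t using vb that by simp
    show "(\<lambda>w. ray_int a F1 w + ray_int b F2 w) \<in> bfs M \<rho>" by (rule bfs_add[OF i1 i2])
    show "bfs_simple M \<rho> lpos (stepfun n v)" for n by (rule bfs_simple_stepfun[OF vb])
    show "(\<lambda>t. bfs_norm \<rho> (\<lambda>w. v t w - stepfun n v t w)) \<in> borel_measurable lpos" for n
    proof -
      have c: "((\<lambda>r'. bfs_norm \<rho> (\<lambda>w. v r' w - v r w)) \<longlongrightarrow> 0) (at r within {0<..})" if r: "0 < r" for r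
      proof (rule tendsto_sandwich[OF _ _ tendsto_const])
        show "((\<lambda>r'. bfs_norm \<rho> (\<lambda>w. v1 r' w - v1 r w) + bfs_norm \<rho> (\<lambda>w. v2 r' w - v2 r w)) \<longlongrightarrow> 0) (at r within {0<..})"
          unfolding v1_def v2_def
          using tendsto_add[OF good_family_mult_continuous[OF F1 ca r] good_family_mult_continuous[OF F2 cb r]] by simp
        show "\<forall>\<^sub>F r' in at r within {0<..}. bfs_norm \<rho> (\<lambda>w. v r' w - v r w)
          \<le> bfs_norm \<rho> (\<lambda>w. v1 r' w - v1 r w) + bfs_norm \<rho> (\<lambda>w. v2 r' w - v2 r w)"
          unfolding eventually_at_filter
        proof (rule always_eventually, intro allI impI)
          fix r' :: real assume "r' \<in> {0<..}"
          then have r': "0 < r'" by simp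
          have "bfs_norm \<rho> (\<lambda>w. v r' w - v r w) = bfs_norm \<rho> (\<lambda>w. (v1 r' w - v1 r w) + (v2 r' w - v2 r w))"
            by (simp add: v12 algebra_simps)
          also have "\<dots> \<le> bfs_norm \<rho> (\<lambda>w. v1 r' w - v1 r w) + bfs_norm \<rho> (\<lambda>w. v2 r' w - v2 r w)"
            by (intro bfs_norm_add borel_measurable_diff bfs_measurable v1b v2b r r')
          finally show "bfs_norm \<rho> (\<lambda>w. v r' w - v r w) \<le> bfs_norm \<rho> (\<lambda>w. v1 r' w - v1 r w) + bfs_norm \<rho> (\<lambda>w. v2 r' w - v2 r w)" .
        qed
      qed auto
      \<comment> \<open>For a fixed cell index the subtracted value is a fixed element of the space;
        the countably many cells are then put together.\<close>
      have "(\<lambda>t. (\<lambda>k t. bfs_norm \<rho> (\<lambda>w. v t w - (if k = 0 then (\<lambda>_. 0) else v (dypt n (k - 1))) w)) (stepidx n t) t) \<in> borel_measurable lpos"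
      proof (rule measurable_compose_countable[OF _ stepidx_measurable])
        show "(\<lambda>t. bfs_norm \<rho> (\<lambda>w. v t w - (if k = 0 then (\<lambda>_. 0) else v (dypt n (k - 1))) w)) \<in> borel_measurable lpos" for k
          by (rule norm_continuous_measurable[OF vb _ c]) (auto intro: vb)
      qed
      then show ?thesis by (simp add: stepfun_def)
    qed
    have le: "bfs_norm \<rho> (\<lambda>w. v r w - stepfun n v r w) \<le> ennreal (step_err n a B1 r) + ennreal (step_err n b B2 r)" if r: "0 < r" for n r
    proof -
      have "bfs_norm \<rho> (\<lambda>w. v r w - stepfun n v r w) = bfs_norm \<rho> (\<lambda>w. (v1 r w - stepfun n v1 r w) + (v2 r w - stepfun n v2 r w))"
        by (simp add: v12 step algebra_simps)
      also have "\<dots> \<le> bfs_norm \<rho> (\<lambda>w. v1 r w - stepfun n v1 r w) + bfs_norm \<rho> (\<lambda>w. v2 r w - stepfun n v2 r w)"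
        by (intro bfs_norm_add borel_measurable_diff bfs_measurable v1b v2b r s1b s2b)
      also have "\<dots> \<le> ennreal (step_err n a B1 r) + ennreal (step_err n b B2 r)"
        unfolding v1_def v2_def
        by (intro add_mono bfs_norm_stepfun_le[OF F1 r] bfs_norm_stepfun_le[OF F2 r])
      finally show ?thesis .
    qed
    show "(\<lambda>n. \<integral>\<^sup>+t. bfs_norm \<rho> (\<lambda>w. v t w - stepfun n v t w) \<partial>lpos) \<longlonglongrightarrow> 0"
    proof (rule tendsto_sandwich[OF _ _ tendsto_const e])
      show "\<forall>\<^sub>F n in sequentially. (\<integral>\<^sup>+t. bfs_norm \<rho> (\<lambda>w. v t w - stepfun n v t w) \<partial>lpos) \<le> e n"
      proof (rule always_eventually, rule allI)
        fix n
        have "(\<integral>\<^sup>+t. bfs_norm \<rho> (\<lambda>w. v t w - stepfun n v t w) \<partial>lpos)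
          \<le> (\<integral>\<^sup>+r. ennreal (step_err n a B1 r) + ennreal (step_err n b B2 r) \<partial>lpos)"
          by (rule nn_integral_mono) (rule le, simp)
        also have "\<dots> = e n" unfolding e_def by (rule nn_integral_add[OF errm])
        finally show "(\<integral>\<^sup>+t. bfs_norm \<rho> (\<lambda>w. v t w - stepfun n v t w) \<partial>lpos) \<le> e n" .
      qed
    qed auto
    show "(\<lambda>n. bfs_norm \<rho> (\<lambda>w. bfs_simple_integral lpos (stepfun n v) w - (ray_int a F1 w + ray_int b F2 w))) \<longlonglongrightarrow> 0"
    proof (rule tendsto_sandwich[OF _ _ tendsto_const e])
      show "\<forall>\<^sub>F n in sequentially. bfs_norm \<rho> (\<lambda>w. bfs_simple_integral lpos (stepfun n v) w - (ray_int a F1 w + ray_int b F2 w)) \<le> e n"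
      proof (rule always_eventually, rule allI)
        fix n
        have "bfs_norm \<rho> (\<lambda>w. bfs_simple_integral lpos (stepfun n v) w - (ray_int a F1 w + ray_int b F2 w))
          = bfs_norm \<rho> (\<lambda>w. ((LINT r|lpos. stepfun n v1 r w) - ray_int a F1 w) + ((LINT r|lpos. stepfun n v2 r w) - ray_int b F2 w))"
          by (simp only: J add_diff_add)
        also have "\<dots> \<le> bfs_norm \<rho> (\<lambda>w. (LINT r|lpos. stepfun n v1 r w) - ray_int a F1 w) + bfs_norm \<rho> (\<lambda>w. (LINT r|lpos. stepfun n v2 r w) - ray_int b F2 w)"
          by (intro bfs_norm_add borel_measurable_diff Lm v1b v2b bfs_measurable i1 i2)
        also have "\<dots> \<le> e n"
          unfolding e_def v1_def v2_def
          by (intro add_mono bfs_norm_riemann_sum_le[OF F1] bfs_norm_riemann_sum_le[OF F2] good_weight_measurable good_weight_finite a b)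
        finally show "bfs_norm \<rho> (\<lambda>w. bfs_simple_integral lpos (stepfun n v) w - (ray_int a F1 w + ray_int b F2 w)) \<le> e n" .
      qed
    qed auto
  qed
  then show ?thesis by (simp only: v_def[abs_def])
qed

lemma some_bfs_integral_AE:
  assumes "good_family F1 B1" "good_family F2 B2" "good_weight a" "good_weight b"
  defines "y \<equiv> (SOME y. has_bfs_integral M \<rho> lpos (\<lambda>r w. a r * F1 r w + b r * F2 r w) y)"
  shows "y \<in> bfs M \<rho>" "AE w in M. y w = ray_int a F1 w + ray_int b F2 w"
proof -
  note h = has_bfs_integral_ray_int[OF assms(1-4)]
  have y: "has_bfs_integral M \<rho> lpos (\<lambda>r w. a r * F1 r w + b r * F2 r w) y"
    unfolding y_def using h by (rule someI[of "has_bfs_integral M \<rho> lpos (\<lambda>r w. a r * F1 r w + b r * F2 r w)"])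
  then show "y \<in> bfs M \<rho>" by (simp add: has_bfs_integral_def)
  have "space lpos \<noteq> {}" by auto
  from has_bfs_integral_unique[OF sigma_finite_lpos this y h]
  show "AE w in M. y w = ray_int a F1 w + ray_int b F2 w" .
qed

section \<open>Bounded operators\<close>

lemma bounded_opsD:
  assumes "T \<in> bfs_bounded_ops M \<rho>"
  shows "\<And>f. f \<in> bfs M \<rho> \<Longrightarrow> T f \<in> bfs M \<rho>"
    "\<And>f g. f \<in> bfs M \<rho> \<Longrightarrow> g \<in> bfs M \<rho> \<Longrightarrow> AE w in M. T (\<lambda>v. f v + g v) w = T f w + T g w"
    "\<And>c f. f \<in> bfs M \<rho> \<Longrightarrow> AE w in M. T (\<lambda>v. c * f v) w = c * T f w"
    "\<exists>C\<ge>0. \<forall>f\<in>bfs M \<rho>. bfs_norm \<rho> (T f) \<le> ennreal C * bfs_norm \<rho> f"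
proof -
  from assms obtain C :: real where C: "\<forall>f\<in>bfs M \<rho>. bfs_norm \<rho> (T f) \<le> ennreal C * bfs_norm \<rho> f"
    by (auto simp: bfs_bounded_ops_def)
  then have "\<forall>f\<in>bfs M \<rho>. bfs_norm \<rho> (T f) \<le> ennreal (max C 0) * bfs_norm \<rho> f"
    by (auto simp: max_def ennreal_neg)
  then show "\<exists>C\<ge>0. \<forall>f\<in>bfs M \<rho>. bfs_norm \<rho> (T f) \<le> ennreal C * bfs_norm \<rho> f"
    by (intro exI[of _ "max C 0"]) auto
qed (use assms in \<open>auto simp: bfs_bounded_ops_def\<close>)

lemma bounded_ops_diff:
  assumes T: "T \<in> bfs_bounded_ops M \<rho>" and f: "f \<in> bfs M \<rho>" and g: "g \<in> bfs M \<rho>"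
  shows "AE w in M. T (\<lambda>v. f v - g v) w = T f w - T g w"
  using bounded_opsD(2)[OF T f bfs_cmult[OF g, of "-1"]] bounded_opsD(3)[OF T g, of "-1"]
  by eventually_elim simp

lemma bounded_ops_cong_AE:
  assumes T: "T \<in> bfs_bounded_ops M \<rho>" and f: "f \<in> bfs M \<rho>" and g: "g \<in> bfs M \<rho>"
    and eq: "AE w in M. f w = g w"
  shows "AE w in M. T f w = T g w"
proof -
  obtain C where C: "C \<ge> 0" "\<forall>f\<in>bfs M \<rho>. bfs_norm \<rho> (T f) \<le> ennreal C * bfs_norm \<rho> f"
    using bounded_opsD(4)[OF T] by auto
  have d: "(\<lambda>v. f v - g v) \<in> bfs M \<rho>" by (rule bfs_diff[OF f g])
  have "bfs_norm \<rho> (\<lambda>v. f v - g v) = bfs_norm \<rho> (\<lambda>v. 0)"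
    using eq by (intro bfs_norm_cong_AE bfs_measurable d bfs_zero) (auto elim: eventually_mono)
  then have "bfs_norm \<rho> (\<lambda>v. f v - g v) = 0" by (simp add: bfs_norm_def)
  then have "bfs_norm \<rho> (T (\<lambda>v. f v - g v)) \<le> 0" using C(2) d by fastforce
  then have "AE w in M. T (\<lambda>v. f v - g v) w = 0"
    by (intro bfs_norm_0_AE bfs_measurable bounded_opsD(1)[OF T] d) simp
  with bounded_ops_diff[OF T f g] show ?thesis by eventually_elim simp
qed

lemma bounded_ops_sum:
  assumes T: "T \<in> bfs_bounded_ops M \<rho>" and "finite K" and f: "\<And>k. k \<in> K \<Longrightarrow> f k \<in> bfs M \<rho>"
  shows "AE w in M. T (\<lambda>v. \<Sum>k\<in>K. c k * f k v) w = (\<Sum>k\<in>K. c k * T (f k) w)"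
  using \<open>finite K\<close> f
proof (induction K rule: finite_induct)
  case empty
  show ?case using bounded_opsD(3)[OF T bfs_zero, of 0] by simp
next
  case (insert k K)
  have "AE w in M. T (\<lambda>v. c k * f k v + (\<Sum>k\<in>K. c k * f k v)) w = T (\<lambda>v. c k * f k v) w + T (\<lambda>v. \<Sum>k\<in>K. c k * f k v) w"
    by (rule bounded_opsD(2)[OF T bfs_cmult bfs_sum[OF bfs_cmult]]) (use insert in auto)
  moreover have "AE w in M. T (\<lambda>v. c k * f k v) w = c k * T (f k) w"
    by (rule bounded_opsD(3)[OF T]) (use insert in auto)
  moreover have "AE w in M. T (\<lambda>v. \<Sum>k\<in>K. c k * f k v) w = (\<Sum>k\<in>K. c k * T (f k) w)"
    using insert by auto
  ultimately show ?case
    by eventually_elim (use insert in simp)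
qed

text \<open>For step functions this is linearity. On both sides the step integrals converge in norm,
  on the left because \<open>T\<close> is bounded.\<close>

lemma bounded_ops_ray_int:
  assumes T: "T \<in> bfs_bounded_ops M \<rho>" and F: "good_family F B" and TF: "good_family (\<lambda>r. T (F r)) B'"
    and a: "good_weight a"
  shows "AE w in M. T (ray_int a F) w = ray_int a (\<lambda>r. T (F r)) w"
proof -
  obtain C where C: "C \<ge> 0" "\<And>f. f \<in> bfs M \<rho> \<Longrightarrow> bfs_norm \<rho> (T f) \<le> ennreal C * bfs_norm \<rho> f"
    using bounded_opsD(4)[OF T] by auto
  define S where "S n w = (LINT r|lpos. stepfun n (\<lambda>r w. a r * F r w) r w)" for n w
  define S' where "S' n w = (LINT r|lpos. stepfun n (\<lambda>r w. a r * T (F r) w) r w)" for n w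
  note ia = ray_int_bfs[OF F good_weight_measurable[OF a] good_weight_finite[OF a]]
  note iT = ray_int_bfs[OF TF good_weight_measurable[OF a] good_weight_finite[OF a]]
  have S_eq: "S n = (\<lambda>w. \<Sum>i<n * 2 ^ n. (of_real (measure lpos {r \<in> space lpos. stepidx n r = Suc i}) * a (dypt n i)) * F (dypt n i) w)" for n
    by (simp add: S_def stepfun_integral mult.assoc fun_eq_iff)
  have S'_eq: "S' n = (\<lambda>w. \<Sum>i<n * 2 ^ n. (of_real (measure lpos {r \<in> space lpos. stepidx n r = Suc i}) * a (dypt n i)) * T (F (dypt n i)) w)" for n
    by (simp add: S'_def stepfun_integral mult.assoc fun_eq_iff)
  have Sb: "S n \<in> bfs M \<rho>" for n
    unfolding S_eq by (intro bfs_sum bfs_cmult good_familyD(2)[OF F] dypt_pos)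
  have S'b: "S' n \<in> bfs M \<rho>" for n
    unfolding S'_eq by (intro bfs_sum bfs_cmult good_familyD(2)[OF TF] dypt_pos)
  have TS: "AE w in M. T (S n) w = S' n w" for n
    unfolding S_eq S'_eq by (rule bounded_ops_sum[OF T]) (auto intro: good_familyD(2)[OF F])
  define e where "e n = ennreal C * (\<integral>\<^sup>+r. ennreal (step_err n a B r) \<partial>lpos) + (\<integral>\<^sup>+r. ennreal (step_err n a B' r) \<partial>lpos)" for n
  show ?thesis
  proof (rule AE_eq_if_bfs_norm_le)
    show "T (ray_int a F) \<in> borel_measurable M" by (intro bfs_measurable bounded_opsD(1)[OF T] ia)
    show "ray_int a (\<lambda>r. T (F r)) \<in> borel_measurable M" by (intro bfs_measurable iT)
    have "e \<longlonglongrightarrow> ennreal C * 0 + 0"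
      unfolding e_def[abs_def]
      by (intro tendsto_add ennreal_tendsto_cmult good_weight_step_err a good_familyD(1)[OF F] good_familyD(1)[OF TF]) simp
    then show "e \<longlonglongrightarrow> 0" by simp
    fix n
    have "bfs_norm \<rho> (\<lambda>w. T (ray_int a F) w - ray_int a (\<lambda>r. T (F r)) w)
      \<le> bfs_norm \<rho> (\<lambda>w. T (ray_int a F) w - S' n w) + bfs_norm \<rho> (\<lambda>w. S' n w - ray_int a (\<lambda>r. T (F r)) w)"
      by (intro bfs_norm_triangle_diff bfs_measurable bounded_opsD(1)[OF T] ia iT S'b)
    also have "bfs_norm \<rho> (\<lambda>w. T (ray_int a F) w - S' n w) = bfs_norm \<rho> (T (\<lambda>w. S n w - ray_int a F w))"
    proof -
      have "bfs_norm \<rho> (\<lambda>w. T (ray_int a F) w - S' n w) = bfs_norm \<rho> (\<lambda>w. S' n w - T (ray_int a F) w)"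
        by (rule bfs_norm_minus_commute)
      also have "\<dots> = bfs_norm \<rho> (T (\<lambda>w. S n w - ray_int a F w))"
      proof (rule bfs_norm_cong_AE)
        show "AE w in M. S' n w - T (ray_int a F) w = T (\<lambda>w. S n w - ray_int a F w) w"
          using TS[of n] bounded_ops_diff[OF T Sb[of n] ia] by eventually_elim simp
      qed (intro borel_measurable_diff bfs_measurable S'b bounded_opsD(1)[OF T] ia bfs_diff Sb)+
      finally show ?thesis .
    qed
    also have "\<dots> \<le> ennreal C * bfs_norm \<rho> (\<lambda>w. S n w - ray_int a F w)"
      by (intro C(2) bfs_diff Sb ia)
    also have "\<dots> \<le> ennreal C * (\<integral>\<^sup>+r. ennreal (step_err n a B r) \<partial>lpos)"
      unfolding S_def by (intro mult_left_mono bfs_norm_riemann_sum_le[OF F] good_weight_measurable good_weight_finite a) simp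
    also have "bfs_norm \<rho> (\<lambda>w. S' n w - ray_int a (\<lambda>r. T (F r)) w) \<le> (\<integral>\<^sup>+r. ennreal (step_err n a B' r) \<partial>lpos)"
      unfolding S'_def by (intro bfs_norm_riemann_sum_le[OF TF] good_weight_measurable good_weight_finite a)
    finally show "bfs_norm \<rho> (\<lambda>w. T (ray_int a F) w - ray_int a (\<lambda>r. T (F r)) w) \<le> e n"
      unfolding e_def by (simp add: add_mono)
  qed
qed

end

section \<open>Contour integrals along the boundary of a sector\<close>

lemma has_contour_integral_linepath_translate:
  "(f has_contour_integral I) (linepath (a + d) (b + d)) \<longleftrightarrow> ((\<lambda>z. f (z + d)) has_contour_integral I) (linepath a b)"
proof -
  have "linepath (a + d) (b + d) x = linepath a b x + d" for x
    by (simp add: linepath_def scaleR_conv_of_real algebra_simps)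
  then show ?thesis by (simp add: has_contour_integral_linepath)
qed

lemma has_contour_integral_linepath_same_Im_iff:
  assumes "0 < R"
  shows "(f has_contour_integral I) (linepath (Complex (- R) c) (Complex R c)) \<longleftrightarrow>
    ((\<lambda>x. f (Complex x c)) has_integral I) {- R..R}"
proof -
  have eq: "of_real x + \<i> * of_real c = Complex x c" for x by (simp add: complex_eq_iff)
  have "(f has_contour_integral I) (linepath (Complex (- R) c) (Complex R c)) \<longleftrightarrow>
    (f has_contour_integral I) (linepath (of_real (- R) + \<i> * of_real c) (of_real R + \<i> * of_real c))"
    by (simp only: eq)
  also have "\<dots> \<longleftrightarrow> ((\<lambda>z. f (z + \<i> * of_real c)) has_contour_integral I) (linepath (of_real (- R)) (of_real R))"
    by (rule has_contour_integral_linepath_translate)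
  also have "\<dots> \<longleftrightarrow> ((\<lambda>x. f (of_real x + \<i> * of_real c)) has_integral I) {- R..R}"
    by (subst has_contour_integral_linepath_Reals_iff) (use assms in auto)
  finally show ?thesis by (simp only: eq)
qed

lemma integral_symmetric_interval_tendsto:
  fixes f :: "real \<Rightarrow> complex"
  assumes f: "integrable lborel f"
  shows "(\<lambda>n::nat. integral {- real n..real n} f) \<longlonglongrightarrow> (LINT x|lborel. f x)"
proof -
  have "(\<lambda>n::nat. LINT x|lborel. indicator {- real n..real n} x *\<^sub>R f x) \<longlonglongrightarrow> (LINT x|lborel. f x)"
  proof (rule integral_dominated_convergence[where w = "\<lambda>x. norm (f x)"])
    show "AE x in lborel. (\<lambda>n::nat. indicator {- real n..real n} x *\<^sub>R f x) \<longlonglongrightarrow> f x"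
    proof (rule AE_I2)
      fix x :: real
      obtain n0 :: nat where "\<bar>x\<bar> \<le> real n0" using real_arch_simple by blast
      then have "eventually (\<lambda>n::nat. indicator {- real n..real n} x *\<^sub>R f x = f x) sequentially"
        by (intro eventually_sequentiallyI[of n0]) (auto simp: indicator_def)
      then show "(\<lambda>n::nat. indicator {- real n..real n} x *\<^sub>R f x) \<longlonglongrightarrow> f x"
        by (rule tendsto_eventually)
    qed
  qed (use f in \<open>auto simp: indicator_def\<close>)
  moreover have "(LINT x|lborel. indicator {- real n..real n} x *\<^sub>R f x) = integral {- real n..real n} f" for n
    using set_borel_integral_eq_integral(2)[of "{- real n..real n}" f] f
    by (simp add: set_lebesgue_integral_def set_integrable_def integrable_mult_indicator)
  ultimately show ?thesis by simp
qed

text \<open>The rectangle is run through anticlockwise, so its lower edge counts positively and its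
  upper edge negatively. The vertical edges have fixed length and the integrand on them tends to 0,
  so only the two full lines remain in the limit.\<close>

lemma strip_boundary_integral:
  fixes F :: "complex \<Rightarrow> complex"
  assumes \<theta>: "0 < \<theta>"
    and F: "\<And>R. Rb \<le> R \<Longrightarrow> (F has_contour_integral I) (rectpath (Complex (- R) (- \<theta>)) (Complex R \<theta>))"
    and cont: "\<And>R. Rb \<le> R \<Longrightarrow> continuous_on (path_image (rectpath (Complex (- R) (- \<theta>)) (Complex R \<theta>))) F"
    and int: "integrable lborel (\<lambda>x. F (Complex x (- \<theta>)))" "integrable lborel (\<lambda>x. F (Complex x \<theta>))"
    and side: "\<And>R y. Rb \<le> R \<Longrightarrow> \<bar>y\<bar> \<le> \<theta> \<Longrightarrow> cmod (F (Complex R y)) \<le> g R"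
      "\<And>R y. Rb \<le> R \<Longrightarrow> \<bar>y\<bar> \<le> \<theta> \<Longrightarrow> cmod (F (Complex (- R) y)) \<le> g R"
    and g: "(\<lambda>n::nat. g (real n)) \<longlonglongrightarrow> 0"
  shows "(LINT x|lborel. F (Complex x (- \<theta>))) - (LINT x|lborel. F (Complex x \<theta>)) = I"
proof -
  define J where "J n = integral {- real n..real n} (\<lambda>x. F (Complex x (- \<theta>)))" for n :: nat
  define K where "K n = integral {- real n..real n} (\<lambda>x. F (Complex x \<theta>))" for n :: nat
  \<comment> \<open>Each of the two vertical edges has length \<open>2 * \<theta>\<close>.\<close>
  have est: "cmod (J n - K n - I) \<le> 4 * \<theta> * g (real n)" if n: "Rb \<le> real n" "0 < real n" for n
  proof -
    define R where "R = real n"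
    define a1 where "a1 = Complex (- R) (- \<theta>)"
    define a2 where "a2 = Complex R (- \<theta>)"
    define a3 where "a3 = Complex R \<theta>"
    define a4 where "a4 = Complex (- R) \<theta>"
    have R: "Rb \<le> R" "0 < R" using n by (auto simp: R_def)
    have path: "path_image (rectpath a1 a3) = {z. Re z \<in> {- R, R} \<and> Im z \<in> {- \<theta>..\<theta>}} \<union> {z. Im z \<in> {- \<theta>, \<theta>} \<and> Re z \<in> {- R..R}}"
      using R \<theta> by (subst path_image_rectpath) (auto simp: a1_def a3_def)
    have seg: "closed_segment a1 a2 \<subseteq> path_image (rectpath a1 a3)" "closed_segment a2 a3 \<subseteq> path_image (rectpath a1 a3)"
      "closed_segment a3 a4 \<subseteq> path_image (rectpath a1 a3)" "closed_segment a4 a1 \<subseteq> path_image (rectpath a1 a3)"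
      by (auto simp: rectpath_def Let_def path_image_join a1_def a2_def a3_def a4_def)
    have cF: "continuous_on (path_image (rectpath a1 a3)) F" using cont[OF R(1)] by (simp add: a1_def a3_def)
    have ci: "F contour_integrable_on linepath a1 a2" "F contour_integrable_on linepath a2 a3"
      "F contour_integrable_on linepath a3 a4" "F contour_integrable_on linepath a4 a1"
      using seg by (auto intro!: contour_integrable_continuous_linepath continuous_on_subset[OF cF])
    have "contour_integral (rectpath a1 a3) F = I"
      using contour_integral_unique[OF F[OF R(1)]] by (simp add: a1_def a3_def)
    moreover have "rectpath a1 a3 = linepath a1 a2 +++ linepath a2 a3 +++ linepath a3 a4 +++ linepath a4 a1"
      by (simp add: rectpath_def Let_def a1_def a2_def a3_def a4_def)
    ultimately have sum: "contour_integral (linepath a1 a2) F + (contour_integral (linepath a2 a3) F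
        + (contour_integral (linepath a3 a4) F + contour_integral (linepath a4 a1) F)) = I"
      using ci by (simp add: contour_integral_join contour_integrable_joinI)
    have 1: "contour_integral (linepath a1 a2) F = J n"
      using has_contour_integral_integral[OF ci(1)] has_contour_integral_linepath_same_Im_iff[OF R(2), of F _ "- \<theta>"]
      by (auto simp: a1_def a2_def J_def R_def dest: integral_unique)
    have ci34: "F contour_integrable_on linepath a4 a3"
      using seg(3) by (auto intro!: contour_integrable_continuous_linepath continuous_on_subset[OF cF] simp: closed_segment_commute)
    have "contour_integral (linepath a4 a3) F = K n"
      using has_contour_integral_integral[OF ci34] has_contour_integral_linepath_same_Im_iff[OF R(2), of F _ "\<theta>"]
      by (auto simp: a3_def a4_def K_def R_def dest: integral_unique)
    moreover have "contour_integral (linepath a3 a4) F = - contour_integral (linepath a4 a3) F"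
    proof -
      have "closed_segment a4 a3 = closed_segment a3 a4" by (rule closed_segment_commute)
      then have "continuous_on (closed_segment a4 a3) F" using continuous_on_subset[OF cF seg(3)] by (simp only:)
      from contour_integral_reverse_linepath[OF this] show ?thesis by (simp only: minus_minus)
    qed
    ultimately have 3: "contour_integral (linepath a3 a4) F = - K n" by simp
    have gnn: "0 \<le> g R" using \<theta> by (intro order_trans[OF norm_ge_zero side(1)[OF R(1), of 0]]) simp
    have 2: "cmod (contour_integral (linepath a2 a3) F) \<le> g R * cmod (a3 - a2)"
    proof (rule contour_integral_bound_linepath[OF ci(2) gnn])
      fix z assume "z \<in> closed_segment a2 a3"
      then have "z = Complex R (Im z)" "\<bar>Im z\<bar> \<le> \<theta>"
        using \<theta> by (auto simp: a2_def a3_def closed_segment_same_Re closed_segment_eq_real_ivl complex_eq_iff)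
      then show "cmod (F z) \<le> g R" using side(1)[OF R(1), of "Im z"] by (simp only:)
    qed
    have 4: "cmod (contour_integral (linepath a4 a1) F) \<le> g R * cmod (a1 - a4)"
    proof (rule contour_integral_bound_linepath[OF ci(4) gnn])
      fix z assume "z \<in> closed_segment a4 a1"
      then have "z = Complex (- R) (Im z)" "\<bar>Im z\<bar> \<le> \<theta>"
        using \<theta> by (auto simp: a4_def a1_def closed_segment_same_Re closed_segment_eq_real_ivl complex_eq_iff split: if_splits)
      then show "cmod (F z) \<le> g R" using side(2)[OF R(1), of "Im z"] by (simp only:)
    qed
    have "a3 - a2 = \<i> * of_real (2 * \<theta>)" "a1 - a4 = - (\<i> * of_real (2 * \<theta>))"
      by (auto simp: a1_def a2_def a3_def a4_def complex_eq_iff)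
    then have len: "cmod (a3 - a2) = 2 * \<theta>" "cmod (a1 - a4) = 2 * \<theta>"
      using \<theta> by (auto simp: norm_mult)
    have "J n - K n - I = - (contour_integral (linepath a2 a3) F + contour_integral (linepath a4 a1) F)"
      unfolding sum[symmetric] 1 3 by simp
    then have "cmod (J n - K n - I) = cmod (contour_integral (linepath a2 a3) F + contour_integral (linepath a4 a1) F)"
      by (simp only: norm_minus_cancel)
    also have "\<dots> \<le> g R * (2 * \<theta>) + g R * (2 * \<theta>)"
      using 2 4 unfolding len by (intro order_trans[OF norm_triangle_ineq add_mono])
    finally show ?thesis by (simp add: R_def algebra_simps)
  qed
  have "(\<lambda>n. J n - K n - I) \<longlonglongrightarrow> 0"
  proof (rule Lim_null_comparison)
    obtain n0 :: nat where "Rb \<le> real n0" using real_arch_simple by blast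
    then show "\<forall>\<^sub>F n in sequentially. cmod (J n - K n - I) \<le> 4 * \<theta> * g (real n)"
      by (intro eventually_sequentiallyI[of "max 1 n0"] est) auto
    show "(\<lambda>n. 4 * \<theta> * g (real n)) \<longlonglongrightarrow> 0" using tendsto_mult_right_zero[OF g] by simp
  qed
  moreover have "(\<lambda>n. J n - K n - I) \<longlonglongrightarrow> (LINT x|lborel. F (Complex x (- \<theta>))) - (LINT x|lborel. F (Complex x \<theta>)) - I"
    unfolding J_def K_def by (intro tendsto_intros integral_symmetric_interval_tendsto int)
  ultimately have "(LINT x|lborel. F (Complex x (- \<theta>))) - (LINT x|lborel. F (Complex x \<theta>)) - I = 0"
    using LIMSEQ_unique by blast
  then show ?thesis by simp
qed

text \<open>The substitution \<open>r = exp x\<close> carries a ray to a horizontal line; its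
  derivative supplies the factor \<open>exp x\<close>.\<close>

lemma lpos_exp_substitution:
  fixes k :: "real \<Rightarrow> complex"
  assumes k: "integrable lpos k" and cont: "continuous_on {0<..} k"
  shows "integrable lborel (\<lambda>x. k (exp x) * of_real (exp x))"
    and "(LINT r|lpos. k r) = (LINT x|lborel. k (exp x) * of_real (exp x))"
proof -
  have set: "set_integrable lborel {0<..} k"
    using k by (simp add: set_integrable_def integrable_restrict_space)
  have img: "exp ` (UNIV :: real set) = {0<..}" by (auto simp: image_iff intro: exp_ln[symmetric])
  have abs: "k absolutely_integrable_on {0<..}"
    using set by (simp add: set_integrable_def integrable_completion borel_measurable_integrable)
  have "(\<lambda>x. \<bar>exp x\<bar> *\<^sub>R k (exp x)) absolutely_integrable_on UNIV
    \<and> integral UNIV (\<lambda>x. \<bar>exp x\<bar> *\<^sub>R k (exp x)) = integral {0<..} k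
    \<longleftrightarrow> k absolutely_integrable_on (exp ` UNIV) \<and> integral (exp ` UNIV) k = integral {0<..} k"
    by (rule has_absolute_integral_change_of_variables_real) (auto intro!: derivative_eq_intros inj_onI)
  then have *: "(\<lambda>x. exp x *\<^sub>R k (exp x)) absolutely_integrable_on UNIV"
    "integral UNIV (\<lambda>x. exp x *\<^sub>R k (exp x)) = integral {0<..} k"
    unfolding img using abs by auto
  have c: "continuous_on UNIV (\<lambda>x. k (exp x) * of_real (exp x))"
    by (intro continuous_intros continuous_on_compose2[OF cont]) auto
  have eq: "exp x *\<^sub>R k (exp x) = k (exp x) * of_real (exp x)" for x
    by (simp add: scaleR_conv_of_real)
  have m: "(\<lambda>x. k (exp x) * of_real (exp x)) \<in> borel_measurable borel"
    by (rule borel_measurable_continuous_onI[OF c])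
  show int: "integrable lborel (\<lambda>x. k (exp x) * of_real (exp x))"
    using *(1) m unfolding eq set_integrable_def by (simp add: integrable_completion)
  have "(LINT r|lpos. k r) = (LINT r:{0<..}|lborel. k r)"
    by (simp add: set_lebesgue_integral_def integral_restrict_space)
  also have "\<dots> = integral {0<..} k" by (rule set_borel_integral_eq_integral(2)[OF set])
  also have "\<dots> = integral UNIV (\<lambda>x. k (exp x) * of_real (exp x))" using *(2) by (simp only: eq)
  also have "\<dots> = (LINT x|lborel. k (exp x) * of_real (exp x))"
    using set_borel_integral_eq_integral(2)[of UNIV "\<lambda>x. k (exp x) * of_real (exp x)"] int
    by (simp add: set_lebesgue_integral_def set_integrable_def)
  finally show "(LINT r|lpos. k r) = (LINT x|lborel. k (exp x) * of_real (exp x))" .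
qed

section \<open>Points of sectors and distances between rays\<close>

lemma rcis_in_sector:
  assumes "0 < r" "\<bar>\<alpha>\<bar> < \<sigma>" "\<sigma> \<le> pi"
  shows "rcis r \<alpha> \<in> sector \<sigma>"
proof -
  have "\<sigma> \<noteq> 0" using assms by auto
  have \<alpha>: "- pi < \<alpha>" "\<alpha> < pi" using assms by auto
  have arg: "Arg (rcis r \<alpha>) = \<alpha>"
    by (rule Arg_unique[of r]) (use assms \<alpha> in \<open>auto simp: rcis_def cis_conv_exp\<close>)
  have "sin \<alpha> \<noteq> 0 \<or> \<alpha> = 0"
    using sin_gt_zero[of \<alpha>] sin_gt_zero[of "- \<alpha>"] \<alpha> by (cases "\<alpha>" "0 :: real" rule: linorder_cases) auto
  then have "rcis r \<alpha> \<notin> \<real>\<^sub>\<le>\<^sub>0"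
    using assms(1) by (auto simp: complex_nonpos_Reals_iff)
  with arg show ?thesis using assms \<open>\<sigma> \<noteq> 0\<close> by (simp add: sector_def)
qed

lemma exp_eq_rcis: "exp w = rcis (exp (Re w)) (Im w)"
  by (simp add: exp_eq_polar rcis_def)

lemma exp_in_sector: "\<bar>Im w\<bar> < \<sigma> \<Longrightarrow> \<sigma> \<le> pi \<Longrightarrow> exp w \<in> sector \<sigma>"
  unfolding exp_eq_rcis by (rule rcis_in_sector) auto

lemma sector_nonzero: "0 < \<sigma> \<Longrightarrow> z \<in> sector \<sigma> \<Longrightarrow> z \<noteq> 0"
  by (auto simp: sector_def)

lemma sector_mult_pos:
  assumes "z \<in> sector \<sigma>" "0 < t" "0 < \<sigma>"
  shows "of_real t * z \<in> sector \<sigma>"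
proof -
  have "of_real t * z \<notin> \<real>\<^sub>\<le>\<^sub>0"
    using assms by (auto simp: sector_def complex_nonpos_Reals_iff mult_le_0_iff)
  then show ?thesis using assms by (auto simp: sector_def Arg_times_of_real)
qed

text \<open>By the law of cosines the squared distance is at least
  \<open>r\<^sup>2 + m\<^sup>2 - 2 * r * m * \<kappa>\<close>, which equals \<open>(1 - \<kappa>) *
  (r\<^sup>2 + m\<^sup>2) + \<kappa> * (r - m)\<^sup>2\<close>.\<close>

lemma ray_dist_le:
  assumes "0 \<le> \<kappa>" "\<kappa> < 1" "cos (\<alpha> - \<beta>) \<le> \<kappa>" "0 < r" "0 < m"
  shows "sqrt (1 - \<kappa>) * r \<le> cmod (rcis r \<alpha> - rcis m \<beta>)"
    and "sqrt (1 - \<kappa>) * m \<le> cmod (rcis r \<alpha> - rcis m \<beta>)"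
proof -
  have "(cmod (rcis r \<alpha> - rcis m \<beta>))\<^sup>2 = (r * cos \<alpha> - m * cos \<beta>)\<^sup>2 + (r * sin \<alpha> - m * sin \<beta>)\<^sup>2"
    by (simp add: cmod_power2)
  also have "\<dots> = r\<^sup>2 * ((sin \<alpha>)\<^sup>2 + (cos \<alpha>)\<^sup>2) + m\<^sup>2 * ((sin \<beta>)\<^sup>2 + (cos \<beta>)\<^sup>2) - 2 * r * m * cos (\<alpha> - \<beta>)"
    unfolding cos_diff by algebra
  also have "\<dots> = r\<^sup>2 + m\<^sup>2 - 2 * r * m * cos (\<alpha> - \<beta>)"
    by (simp only: sin_cos_squared_add mult_1_right)
  finally have sq: "(cmod (rcis r \<alpha> - rcis m \<beta>))\<^sup>2 = r\<^sup>2 + m\<^sup>2 - 2 * r * m * cos (\<alpha> - \<beta>)" .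
  have "r\<^sup>2 + m\<^sup>2 - 2 * r * m * cos (\<alpha> - \<beta>) \<ge> r\<^sup>2 + m\<^sup>2 - 2 * r * m * \<kappa>"
    using assms by (simp add: mult_left_mono)
  also have "r\<^sup>2 + m\<^sup>2 - 2 * r * m * \<kappa> = (1 - \<kappa>) * (r\<^sup>2 + m\<^sup>2) + \<kappa> * (r - m)\<^sup>2"
    by (simp add: power2_eq_square algebra_simps)
  finally have ge: "(1 - \<kappa>) * (r\<^sup>2 + m\<^sup>2) \<le> (cmod (rcis r \<alpha> - rcis m \<beta>))\<^sup>2"
    using assms sq by (smt (verit) mult_nonneg_nonneg zero_le_power2)
  have "(sqrt (1 - \<kappa>) * r)\<^sup>2 \<le> (cmod (rcis r \<alpha> - rcis m \<beta>))\<^sup>2"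
    using ge assms by (simp add: power_mult_distrib) (smt (verit) distrib_left mult_nonneg_nonneg zero_le_power2)
  then show "sqrt (1 - \<kappa>) * r \<le> cmod (rcis r \<alpha> - rcis m \<beta>)"
    by (rule power2_le_imp_le) simp
  have "(sqrt (1 - \<kappa>) * m)\<^sup>2 \<le> (cmod (rcis r \<alpha> - rcis m \<beta>))\<^sup>2"
    using ge assms by (simp add: power_mult_distrib) (smt (verit) distrib_left mult_nonneg_nonneg zero_le_power2)
  then show "sqrt (1 - \<kappa>) * m \<le> cmod (rcis r \<alpha> - rcis m \<beta>)"
    by (rule power2_le_imp_le) simp
qed

lemma cos_less_1:
  assumes "0 < x" "x < 2 * pi"
  shows "cos x < 1"
proof (rule ccontr)
  assume "\<not> cos x < 1"
  then have "cos x = 1" using cos_le_one[of x] by linarith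
  then obtain n :: int where "x = of_int n * (2 * pi)" using cos_one_2pi_int by (auto simp: mult.commute)
  with assms have "0 < of_int n * (2 * pi)" "of_int n * (2 * pi) < 1 * (2 * pi)" by auto
  then have "0 < n" "n < 1" by (auto simp: zero_less_mult_iff)
  then show False by linarith
qed

text \<open>Two contours of different opening are separated at the scale of either point. Whatever
  the signs, the rays differ by the angle \<theta>' - \<theta> or \<theta>' + \<theta>; both lie
  strictly between 0 and a full turn, so one constant serves all sign choices.\<close>

lemma ray_dist:
  assumes "0 < \<theta>" "\<theta> < \<theta>'" "\<theta>' \<le> pi"
  obtains c where "0 < c" "\<And>r m \<alpha> \<beta>. 0 < r \<Longrightarrow> 0 < m \<Longrightarrow> \<bar>\<alpha>\<bar> = \<theta> \<Longrightarrow> \<bar>\<beta>\<bar> = \<theta>' \<Longrightarrow>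
    c * r \<le> cmod (rcis r \<alpha> - rcis m \<beta>) \<and> c * m \<le> cmod (rcis r \<alpha> - rcis m \<beta>)"
proof
  define \<kappa> where "\<kappa> = max 0 (max (cos (\<theta>' - \<theta>)) (cos (\<theta>' + \<theta>)))"
  have \<kappa>: "0 \<le> \<kappa>" "\<kappa> < 1" using assms by (auto simp: \<kappa>_def intro!: cos_less_1)
  show "0 < sqrt (1 - \<kappa>)" using \<kappa> by simp
  fix r m \<alpha> \<beta> :: real
  assume *: "0 < r" "0 < m" "\<bar>\<alpha>\<bar> = \<theta>" "\<bar>\<beta>\<bar> = \<theta>'"
  have "cos (\<alpha> - \<beta>) = cos \<bar>\<alpha> - \<beta>\<bar>" by simp
  moreover have "\<bar>\<alpha> - \<beta>\<bar> = \<theta>' - \<theta> \<or> \<bar>\<alpha> - \<beta>\<bar> = \<theta>' + \<theta>" using * assms by linarith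
  ultimately have "cos (\<alpha> - \<beta>) \<le> \<kappa>" unfolding \<kappa>_def by (metis max.cobounded1 max.cobounded2 max.coboundedI2)
  then show "sqrt (1 - \<kappa>) * r \<le> cmod (rcis r \<alpha> - rcis m \<beta>) \<and> sqrt (1 - \<kappa>) * m \<le> cmod (rcis r \<alpha> - rcis m \<beta>)"
    using ray_dist_le[OF \<kappa>(1,2)] * by blast
qed

lemma integrable_decaying:
  assumes cont: "continuous_on {0<..} k" and "0 < \<epsilon>" "0 \<le> K"
    and bound: "\<And>r. 0 < r \<Longrightarrow> cmod (k r) \<le> K * (decay \<epsilon> r / r)"
  shows "integrable lpos k"
proof (rule integrableI_bounded)
  show "k \<in> borel_measurable lpos" by (rule continuous_imp_measurable_lpos[OF cont])
  have [measurable]: "(\<lambda>r. ennreal (decay \<epsilon> r / r)) \<in> borel_measurable lpos"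
    by (rule borel_measurable_lpos) measurable
  have "(\<integral>\<^sup>+r. ennreal (cmod (k r)) \<partial>lpos) \<le> (\<integral>\<^sup>+r. ennreal K * ennreal (decay \<epsilon> r / r) \<partial>lpos)"
    using bound \<open>0 \<le> K\<close> by (intro nn_integral_mono) (auto simp: ennreal_mult[symmetric] intro!: ennreal_leI)
  also have "\<dots> = ennreal K * (\<integral>\<^sup>+r. ennreal (decay \<epsilon> r / r) \<partial>lpos)"
    by (rule nn_integral_cmult) measurable
  also have "\<dots> < \<infinity>"
    using nn_integral_decay_finite[OF \<open>0 < \<epsilon>\<close>] by (simp add: ennreal_mult_less_top)
  finally show "(\<integral>\<^sup>+r. ennreal (cmod (k r)) \<partial>lpos) < \<infinity>" .
qed

lemma kernel_integrable:
  assumes "0 < \<sigma>" "\<sigma> \<le> pi" "\<bar>\<alpha>\<bar> < \<sigma>" "0 < c" "0 < \<epsilon>" "0 \<le> K"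
    and \<psi>: "continuous_on (sector \<sigma>) \<psi>" "\<And>z. z \<in> sector \<sigma> \<Longrightarrow> cmod (\<psi> z) \<le> K * decay \<epsilon> (cmod z)"
    and dist: "\<And>r. 0 < r \<Longrightarrow> c * r \<le> cmod (rcis r \<alpha> - p)"
  shows "integrable lpos (\<lambda>r. \<psi> (rcis r \<alpha>) / (rcis r \<alpha> - p) * cis \<alpha>)"
    and "continuous_on {0<..} (\<lambda>r. \<psi> (rcis r \<alpha>) / (rcis r \<alpha> - p) * cis \<alpha>)"
proof -
  have nz: "rcis r \<alpha> - p \<noteq> 0" if "0 < r" for r
    using dist[OF that] mult_pos_pos[OF \<open>0 < c\<close> that] by (metis norm_zero not_le)
  show cont: "continuous_on {0<..} (\<lambda>r. \<psi> (rcis r \<alpha>) / (rcis r \<alpha> - p) * cis \<alpha>)"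
    using nz assms
    by (intro continuous_intros continuous_on_compose2[OF \<psi>(1)]) (auto intro: rcis_in_sector)
  show "integrable lpos (\<lambda>r. \<psi> (rcis r \<alpha>) / (rcis r \<alpha> - p) * cis \<alpha>)"
  proof (rule integrable_decaying[OF cont \<open>0 < \<epsilon>\<close>])
    show "0 \<le> K / c" using assms by simp
    fix r :: real assume r: "0 < r"
    have "cmod (\<psi> (rcis r \<alpha>) / (rcis r \<alpha> - p) * cis \<alpha>) = cmod (\<psi> (rcis r \<alpha>)) / cmod (rcis r \<alpha> - p)"
      by (simp add: norm_mult norm_divide)
    also have "\<dots> \<le> (K * decay \<epsilon> r) / (c * r)"
      using \<psi>(2)[OF rcis_in_sector[OF r assms(3,2)]] dist[OF r] r assms
      by (intro frac_le) auto
    finally show "cmod (\<psi> (rcis r \<alpha>) / (rcis r \<alpha> - p) * cis \<alpha>) \<le> K / c * (decay \<epsilon> r / r)" by simp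
  qed
qed

lemma decay_exp: "decay \<epsilon> (exp x) \<le> exp (- \<epsilon> * \<bar>x\<bar>)" if "0 < \<epsilon>"
  unfolding decay_def by (auto simp: exp_powr_real abs_if min_def mult.commute)

text \<open>Passing to \<open>w = Ln z\<close> turns the truncated sector into a rectangle.\<close>

lemma sector_kernel_integral:
  assumes \<theta>: "0 < \<theta>" "\<theta> < \<sigma>" "\<sigma> \<le> pi" and "0 < \<epsilon>" "0 \<le> K" "0 < c" "p \<noteq> 0"
    and \<psi>: "continuous_on (sector \<sigma>) \<psi>" "\<And>z. z \<in> sector \<sigma> \<Longrightarrow> cmod (\<psi> z) \<le> K * decay \<epsilon> (cmod z)"
    and dist: "\<And>r. 0 < r \<Longrightarrow> c * r \<le> cmod (rcis r \<theta> - p)" "\<And>r. 0 < r \<Longrightarrow> c * r \<le> cmod (rcis r (- \<theta>) - p)"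
    and F: "\<And>R. Rb \<le> R \<Longrightarrow> ((\<lambda>w. \<psi> (exp w) * exp w / (exp w - p)) has_contour_integral I) (rectpath (Complex (- R) (- \<theta>)) (Complex R \<theta>))"
    and cont: "\<And>R. Rb \<le> R \<Longrightarrow> continuous_on (path_image (rectpath (Complex (- R) (- \<theta>)) (Complex R \<theta>))) (\<lambda>w. \<psi> (exp w) * exp w / (exp w - p))"
  shows "(LINT r|lpos. \<psi> (rcis r (- \<theta>)) / (rcis r (- \<theta>) - p) * cis (- \<theta>))
    - (LINT r|lpos. \<psi> (rcis r \<theta>) / (rcis r \<theta> - p) * cis \<theta>) = I"
proof -
  define G where "G w = \<psi> (exp w) * exp w / (exp w - p)" for w
  have sub: "integrable lborel (\<lambda>x. G (Complex x \<alpha>))"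
    "(LINT r|lpos. \<psi> (rcis r \<alpha>) / (rcis r \<alpha> - p) * cis \<alpha>) = (LINT x|lborel. G (Complex x \<alpha>))"
    if \<alpha>: "\<bar>\<alpha>\<bar> < \<sigma>" and d: "\<And>r. 0 < r \<Longrightarrow> c * r \<le> cmod (rcis r \<alpha> - p)" for \<alpha>
  proof -
    have "0 < \<sigma>" using \<theta> by simp
    note k = kernel_integrable[OF \<open>0 < \<sigma>\<close> \<theta>(3) \<alpha> \<open>0 < c\<close> \<open>0 < \<epsilon>\<close> \<open>0 \<le> K\<close> \<psi> d]
    have eq: "\<psi> (rcis (exp x) \<alpha>) / (rcis (exp x) \<alpha> - p) * cis \<alpha> * of_real (exp x) = G (Complex x \<alpha>)" for x
      unfolding G_def exp_eq_rcis by (simp add: rcis_def mult_ac)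
    show "integrable lborel (\<lambda>x. G (Complex x \<alpha>))"
      using lpos_exp_substitution(1)[OF k(1) k(2)] by (simp only: eq)
    show "(LINT r|lpos. \<psi> (rcis r \<alpha>) / (rcis r \<alpha> - p) * cis \<alpha>) = (LINT x|lborel. G (Complex x \<alpha>))"
      using lpos_exp_substitution(2)[OF k(1) k(2)] by (simp only: eq)
  qed
  have t: "\<bar>\<theta>\<bar> < \<sigma>" "\<bar>- \<theta>\<bar> < \<sigma>" using \<theta> by auto
  \<comment> \<open>Beyond \<open>R2\<close>, the moduli of \<open>p\<close> and of a point
    \<open>z\<close> whose logarithm lies on a vertical edge differ by a factor of at least e, hence
    of at least 2. This gives \<open>cmod z \<le> 2 * cmod (z - p)\<close> there.\<close>
  define R2 where "R2 = max Rb (max 1 (\<bar>ln (cmod p)\<bar> + 1))"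
  have "(2::real) \<le> exp 1" using exp_ge_add_one_self[of 1] by simp
  have G_le: "cmod (G (Complex x y)) \<le> 2 * K * exp (- \<epsilon> * R)" if xR: "\<bar>x\<bar> = R" "R2 \<le> R" and y: "\<bar>y\<bar> \<le> \<theta>" for x y R
  proof -
    define z where "z = exp (Complex x y)"
    have z: "cmod z = exp x" by (simp add: z_def)
    have "z \<in> sector \<sigma>" unfolding z_def using y \<theta> by (intro exp_in_sector) auto
    then have "cmod (\<psi> z) \<le> K * decay \<epsilon> (exp x)" using \<psi>(2)[of z] z by simp
    also have "\<dots> \<le> K * exp (- \<epsilon> * R)"
      using decay_exp[OF \<open>0 < \<epsilon>\<close>, of x] xR \<open>0 \<le> K\<close> by (intro mult_left_mono) auto
    finally have 1: "cmod (\<psi> z) \<le> K * exp (- \<epsilon> * R)" .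
    have lp: "cmod p = exp (ln (cmod p))" using \<open>p \<noteq> 0\<close> by simp
    have Rp: "\<bar>ln (cmod p)\<bar> + 1 \<le> R" using xR by (simp add: R2_def)
    have 2: "cmod z \<le> 2 * cmod (z - p)" "z - p \<noteq> 0"
    proof -
      have "cmod z \<le> 2 * cmod (z - p) \<and> 0 < cmod (z - p)"
      proof (cases "0 \<le> x")
        case True
        then have "ln (cmod p) + 1 \<le> x" using xR Rp by simp
        then have "exp (ln (cmod p)) * exp 1 \<le> exp x" by (simp flip: exp_add)
        moreover have "cmod p * 2 \<le> cmod p * exp 1" using \<open>2 \<le> exp 1\<close> by (intro mult_left_mono) auto
        ultimately have "2 * cmod p \<le> cmod z" using z lp by simp
        moreover have "0 < cmod p" using \<open>p \<noteq> 0\<close> by simp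
        ultimately show ?thesis using norm_triangle_ineq2[of z p] by linarith
      next
        case False
        then have "x + 1 \<le> ln (cmod p)" using xR Rp by simp
        then have "exp x * exp 1 \<le> cmod p" using lp by (metis exp_add exp_le_cancel_iff)
        moreover have "exp x * 2 \<le> exp x * exp 1" using \<open>2 \<le> exp 1\<close> by (intro mult_left_mono) auto
        ultimately have "2 * cmod z \<le> cmod p" using z by linarith
        moreover have "0 < cmod z" by (simp add: z)
        ultimately show ?thesis using norm_triangle_ineq3[of z p] by linarith
      qed
      then show "cmod z \<le> 2 * cmod (z - p)" "z - p \<noteq> 0" by auto
    qed
    have "cmod (G (Complex x y)) = cmod (\<psi> z) * (cmod z / cmod (z - p))"
      by (simp add: G_def z_def norm_mult norm_divide)
    also have "\<dots> \<le> (K * exp (- \<epsilon> * R)) * 2"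
      using 1 2 \<open>0 \<le> K\<close> by (intro mult_mono) (auto simp: pos_divide_le_eq)
    finally show ?thesis by simp
  qed
  have "(LINT x|lborel. G (Complex x (- \<theta>))) - (LINT x|lborel. G (Complex x \<theta>)) = I"
  proof (rule strip_boundary_integral[where g = "\<lambda>R. 2 * K * exp (- \<epsilon> * R)" and Rb = R2, OF \<theta>(1)])
    show "(G has_contour_integral I) (rectpath (Complex (- R) (- \<theta>)) (Complex R \<theta>))" if "R2 \<le> R" for R
      unfolding G_def[abs_def] using that by (intro F) (auto simp: R2_def)
    show "continuous_on (path_image (rectpath (Complex (- R) (- \<theta>)) (Complex R \<theta>))) G" if "R2 \<le> R" for R
      unfolding G_def[abs_def] using that by (intro cont) (auto simp: R2_def)
    show "cmod (G (Complex R y)) \<le> 2 * K * exp (- \<epsilon> * R)" if "R2 \<le> R" "\<bar>y\<bar> \<le> \<theta>" for R y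
      using that by (intro G_le) (auto simp: R2_def)
    show "cmod (G (Complex (- R) y)) \<le> 2 * K * exp (- \<epsilon> * R)" if "R2 \<le> R" "\<bar>y\<bar> \<le> \<theta>" for R y
      using that by (intro G_le) (auto simp: R2_def)
    have "(\<lambda>n::nat. exp (- \<epsilon>) ^ n) \<longlonglongrightarrow> 0" using \<open>0 < \<epsilon>\<close> by (intro LIMSEQ_power_zero) simp
    then have "(\<lambda>n::nat. exp (- \<epsilon> * real n)) \<longlonglongrightarrow> 0" by (simp add: exp_of_nat2_mult[symmetric])
    then show "(\<lambda>n. 2 * K * exp (- \<epsilon> * real n)) \<longlonglongrightarrow> 0" by (rule tendsto_mult_right_zero)
    show "integrable lborel (\<lambda>x. G (Complex x (- \<theta>)))" by (rule sub(1)[OF t(2)]) (rule dist(2))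
    show "integrable lborel (\<lambda>x. G (Complex x \<theta>))" by (rule sub(1)[OF t(1)]) (rule dist(1))
  qed
  then show ?thesis by (simp only: sub(2)[OF t(1) dist(1)] sub(2)[OF t(2) dist(2)])
qed

section \<open>Cauchy's theorem and Cauchy's formula on sectors\<close>

lemma open_strip: "open {w. \<bar>Im w\<bar> < \<sigma>}" and convex_strip: "convex {w. \<bar>Im w\<bar> < \<sigma>}"
proof -
  have eq: "{w. \<bar>Im w\<bar> < \<sigma>} = {w. Im w < \<sigma>} \<inter> {w. Im w > - \<sigma>}" by auto
  show "open {w. \<bar>Im w\<bar> < \<sigma>}" unfolding eq by (intro open_Int open_halfspace_Im_lt open_halfspace_Im_gt)
  show "convex {w. \<bar>Im w\<bar> < \<sigma>}" unfolding eq by (intro convex_Int convex_halfspace_Im_lt convex_halfspace_Im_gt)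
qed

lemma path_image_strip:
  assumes "0 < \<theta>" "\<theta> < \<sigma>" "0 \<le> R"
  shows "path_image (rectpath (Complex (- R) (- \<theta>)) (Complex R \<theta>)) \<subseteq> {w. \<bar>Im w\<bar> < \<sigma>}"
  using assms by (subst path_image_rectpath) auto

lemma holomorphic_exp_strip:
  assumes "\<psi> holomorphic_on sector \<sigma>" "\<sigma> \<le> pi"
  shows "(\<lambda>w. \<psi> (exp w)) holomorphic_on {w. \<bar>Im w\<bar> < \<sigma>}"
  using holomorphic_on_compose_gen[of exp "{w. \<bar>Im w\<bar> < \<sigma>}" \<psi> "sector \<sigma>"] assms
  by (auto simp: comp_def holomorphic_on_exp intro: exp_in_sector)

lemma exp_strip_inj:
  assumes "exp w = exp v" "\<bar>Im w - Im v\<bar> < 2 * pi"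
  shows "w = v"
proof -
  obtain n :: int where n: "w = v + (of_int (2 * n) * pi) * \<i>" using assms(1) by (auto simp: exp_eq)
  then have "Im w - Im v = of_int n * (2 * pi)" by simp
  then have "\<bar>of_int n\<bar> * (2 * pi) < 1 * (2 * pi)" using assms(2) by (simp add: abs_mult)
  then have "\<bar>real_of_int n\<bar> < 1" by (rule mult_right_less_imp_less) simp
  then have "n = 0" by linarith
  then show ?thesis using n by simp
qed

text \<open>In logarithmic coordinates the pole sits at height \<beta>, outside the strip bounded by
  the contour, so the integrand is holomorphic on a convex neighbourhood of every rectangle.\<close>

lemma sector_Cauchy_outside:
  assumes \<theta>: "0 < \<theta>" "\<theta> < \<sigma>" "\<sigma> \<le> pi" "\<theta> < \<bar>\<beta>\<bar>" "\<bar>\<beta>\<bar> \<le> pi" "0 < m" and "0 < \<epsilon>" "0 \<le> K"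
    and holo: "\<psi> holomorphic_on sector \<sigma>" and \<psi>: "\<And>z. z \<in> sector \<sigma> \<Longrightarrow> cmod (\<psi> z) \<le> K * decay \<epsilon> (cmod z)"
  shows "(LINT r|lpos. \<psi> (rcis r (- \<theta>)) / (rcis r (- \<theta>) - rcis m \<beta>) * cis (- \<theta>))
    - (LINT r|lpos. \<psi> (rcis r \<theta>) / (rcis r \<theta> - rcis m \<beta>) * cis \<theta>) = 0"
proof -
  obtain c where c: "0 < c" "\<And>r m' \<alpha>' \<beta>'. 0 < r \<Longrightarrow> 0 < m' \<Longrightarrow> \<bar>\<alpha>'\<bar> = \<theta> \<Longrightarrow> \<bar>\<beta>'\<bar> = \<bar>\<beta>\<bar> \<Longrightarrow>
    c * r \<le> cmod (rcis r \<alpha>' - rcis m' \<beta>') \<and> c * m' \<le> cmod (rcis r \<alpha>' - rcis m' \<beta>')"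
    using ray_dist[OF \<theta>(1) \<theta>(4,5)] by metis
  \<comment> \<open>The strip must contain the contour, stay where \<psi> is holomorphic, and stop
    below the height of the pole.\<close>
  define \<sigma>' where "\<sigma>' = min \<sigma> \<bar>\<beta>\<bar>"
  have s': "\<theta> < \<sigma>'" "\<sigma>' \<le> \<sigma>" using \<theta> by (auto simp: \<sigma>'_def)
  define S where "S = {w. \<bar>Im w\<bar> < \<sigma>'}"
  have nz: "exp w - rcis m \<beta> \<noteq> 0" if "w \<in> S" for w
  proof
    assume "exp w - rcis m \<beta> = 0"
    then have "exp w = exp (Complex (ln m) \<beta>)" using \<theta>(6) by (simp add: exp_eq_rcis)
    moreover have "\<bar>Im w - Im (Complex (ln m) \<beta>)\<bar> < 2 * pi" using that \<theta> by (auto simp: S_def \<sigma>'_def)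
    ultimately have "w = Complex (ln m) \<beta>" by (rule exp_strip_inj)
    then show False using that by (simp add: S_def \<sigma>'_def)
  qed
  have "(\<lambda>w. \<psi> (exp w)) holomorphic_on S"
    by (rule holomorphic_on_subset[OF holomorphic_exp_strip[OF holo \<theta>(3)]]) (use s' in \<open>auto simp: S_def\<close>)
  then have hol: "(\<lambda>w. \<psi> (exp w) * exp w / (exp w - rcis m \<beta>)) holomorphic_on S"
    using nz by (intro holomorphic_intros) auto
  have path: "path_image (rectpath (Complex (- R) (- \<theta>)) (Complex R \<theta>)) \<subseteq> S" if "0 \<le> R" for R
    unfolding S_def by (rule path_image_strip[OF \<theta>(1) s'(1) that])
  show ?thesis
  proof (rule sector_kernel_integral[where Rb = 0, OF \<theta>(1-3) \<open>0 < \<epsilon>\<close> \<open>0 \<le> K\<close> c(1)])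
    show "continuous_on (sector \<sigma>) \<psi>" by (rule holomorphic_on_imp_continuous_on[OF holo])
    show "rcis m \<beta> \<noteq> 0" using \<theta> by simp
    show "c * r \<le> cmod (rcis r \<theta> - rcis m \<beta>)" "c * r \<le> cmod (rcis r (- \<theta>) - rcis m \<beta>)" if "0 < r" for r
      using c(2)[OF that \<theta>(6)] \<theta>(1) by auto
    fix R :: real assume R: "0 \<le> R"
    show "((\<lambda>w. \<psi> (exp w) * exp w / (exp w - rcis m \<beta>)) has_contour_integral 0) (rectpath (Complex (- R) (- \<theta>)) (Complex R \<theta>))"
      by (rule Cauchy_theorem_convex_simple[OF hol]) (use path[OF R] in \<open>auto simp: S_def convex_strip\<close>)
    show "continuous_on (path_image (rectpath (Complex (- R) (- \<theta>)) (Complex R \<theta>))) (\<lambda>w. \<psi> (exp w) * exp w / (exp w - rcis m \<beta>))"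
      by (rule continuous_on_subset[OF holomorphic_on_imp_continuous_on[OF hol] path[OF R]])
  qed (rule \<psi>)
qed

text \<open>In logarithmic coordinates the denominator has exactly one zero \<open>v\<close> in the
  strip, because the strip is too narrow for two logarithms of the same point, and this zero is
  simple. Cauchy's formula then applies to the integrand multiplied by \<open>w - v\<close>.\<close>

lemma sector_Cauchy_inside:
  assumes \<theta>: "0 < \<theta>" "\<theta> < \<sigma>" "\<sigma> \<le> pi" "\<bar>\<beta>\<bar> < \<theta>" "0 < m" "\<beta> \<noteq> 0" and "0 < \<epsilon>" "0 \<le> K"
    and holo: "\<psi> holomorphic_on sector \<sigma>" and \<psi>: "\<And>z. z \<in> sector \<sigma> \<Longrightarrow> cmod (\<psi> z) \<le> K * decay \<epsilon> (cmod z)"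
  shows "(LINT r|lpos. \<psi> (rcis r (- \<theta>)) / (rcis r (- \<theta>) - rcis m \<beta>) * cis (- \<theta>))
    - (LINT r|lpos. \<psi> (rcis r \<theta>) / (rcis r \<theta> - rcis m \<beta>) * cis \<theta>) = 2 * of_real pi * \<i> * \<psi> (rcis m \<beta>)"
proof -
  have "0 < \<bar>\<beta>\<bar>" "\<theta> \<le> pi" using \<theta> by auto
  then obtain c where c: "0 < c" "\<And>r m' \<alpha>' \<beta>'. 0 < r \<Longrightarrow> 0 < m' \<Longrightarrow> \<bar>\<alpha>'\<bar> = \<bar>\<beta>\<bar> \<Longrightarrow> \<bar>\<beta>'\<bar> = \<theta> \<Longrightarrow>
    c * r \<le> cmod (rcis r \<alpha>' - rcis m' \<beta>') \<and> c * m' \<le> cmod (rcis r \<alpha>' - rcis m' \<beta>')"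
    using ray_dist[OF _ \<theta>(4)] by metis
  define v where "v = Complex (ln m) \<beta>"
  have v: "exp v = rcis m \<beta>" using \<theta>(5) by (simp add: v_def exp_eq_rcis)
  define S where "S = {w. \<bar>Im w\<bar> < \<sigma>}"
  have vS: "v \<in> S" using \<theta> by (simp add: S_def v_def)
  \<comment> \<open>The difference quotient of the exponential at \<open>v\<close>: holomorphic and
    free of zeros on the strip. Since its value at \<open>v\<close> is \<open>exp v\<close>, the
    factor \<open>exp w\<close> in the integrand cancels there.\<close>
  define q where "q w = (if w = v then deriv exp v else (exp w - exp v) / (w - v))" for w
  have holq: "q holomorphic_on S"
    unfolding q_def[abs_def] S_def by (rule pole_lemma_open[OF holomorphic_on_exp open_strip])
  have ne: "exp w \<noteq> exp v" if "w \<in> S" "w \<noteq> v" for w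
  proof
    assume "exp w = exp v"
    moreover have "\<bar>Im w - Im v\<bar> < 2 * pi"
      using that(1) \<theta> abs_triangle_ineq4[of "Im w" "Im v"] by (simp add: S_def v_def)
    ultimately show False using exp_strip_inj that(2) by blast
  qed
  have dexp: "deriv exp v = exp v" by (rule DERIV_imp_deriv[OF DERIV_exp])
  have qnz: "q w \<noteq> 0" if "w \<in> S" for w
    using ne[OF that] by (auto simp: q_def dexp)
  define f where "f w = \<psi> (exp w) * exp w / q w" for w
  have holpsi: "(\<lambda>w. \<psi> (exp w)) holomorphic_on S"
    unfolding S_def by (rule holomorphic_exp_strip[OF holo \<theta>(3)])
  have holf: "f holomorphic_on S"
    unfolding f_def[abs_def] by (intro holomorphic_intros holpsi holq qnz)
  have fv: "f v = \<psi> (rcis m \<beta>)" using \<theta>(5) by (simp add: f_def q_def v dexp)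
  have eq: "\<psi> (exp w) * exp w / (exp w - rcis m \<beta>) = f w / (w - v)" if "w \<noteq> v" for w
    using that by (simp add: f_def q_def v)
  have path: "path_image (rectpath (Complex (- R) (- \<theta>)) (Complex R \<theta>)) \<subseteq> S - {v}" "v \<in> box (Complex (- R) (- \<theta>)) (Complex R \<theta>)"
    if "\<bar>ln m\<bar> + 1 \<le> R" for R
  proof -
    show vb: "v \<in> box (Complex (- R) (- \<theta>)) (Complex R \<theta>)"
      using that \<theta> by (auto simp: v_def in_box_complex_iff)
    have "0 \<le> R" using that by simp
    from path_image_strip[OF \<theta>(1,2) this]
    have "path_image (rectpath (Complex (- R) (- \<theta>)) (Complex R \<theta>)) \<subseteq> S" by (simp add: S_def)
    moreover have "v \<notin> path_image (rectpath (Complex (- R) (- \<theta>)) (Complex R \<theta>))"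
      using vb \<open>0 \<le> R\<close> \<theta>(1) by (subst path_image_rectpath) (auto simp: in_box_complex_iff)
    ultimately show "path_image (rectpath (Complex (- R) (- \<theta>)) (Complex R \<theta>)) \<subseteq> S - {v}" by auto
  qed
  show ?thesis
  proof (rule sector_kernel_integral[where Rb = "\<bar>ln m\<bar> + 1", OF \<theta>(1-3) \<open>0 < \<epsilon>\<close> \<open>0 \<le> K\<close> c(1)])
    show "continuous_on (sector \<sigma>) \<psi>" by (rule holomorphic_on_imp_continuous_on[OF holo])
    show "rcis m \<beta> \<noteq> 0" using \<theta> by simp
    show "c * r \<le> cmod (rcis r \<theta> - rcis m \<beta>)" "c * r \<le> cmod (rcis r (- \<theta>) - rcis m \<beta>)" if "0 < r" for r
      using c(2)[OF \<theta>(5) that, of \<beta> \<theta>] c(2)[OF \<theta>(5) that, of \<beta> "- \<theta>"] \<theta>(1) by (auto simp: norm_minus_commute)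
    fix R :: real assume R: "\<bar>ln m\<bar> + 1 \<le> R"
    have "v \<in> interior S" using vS open_strip[of \<sigma>] by (simp add: S_def interior_open)
    moreover have "convex S" by (simp add: S_def convex_strip)
    ultimately have "((\<lambda>w. f w / (w - v)) has_contour_integral (2 * pi * \<i> * winding_number (rectpath (Complex (- R) (- \<theta>)) (Complex R \<theta>)) v * f v))
        (rectpath (Complex (- R) (- \<theta>)) (Complex R \<theta>))"
      by (intro Cauchy_integral_formula_convex_simple[OF _ holf] path(1)[OF R]) auto
    then have "((\<lambda>w. f w / (w - v)) has_contour_integral 2 * of_real pi * \<i> * \<psi> (rcis m \<beta>)) (rectpath (Complex (- R) (- \<theta>)) (Complex R \<theta>))"
      using winding_number_rectpath[OF path(2)[OF R]] by (simp add: fv)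
    then show "((\<lambda>w. \<psi> (exp w) * exp w / (exp w - rcis m \<beta>)) has_contour_integral 2 * of_real pi * \<i> * \<psi> (rcis m \<beta>)) (rectpath (Complex (- R) (- \<theta>)) (Complex R \<theta>))"
      by (rule has_contour_integral_eq) (use path(1)[OF R] eq in force)
    have "continuous_on (S - {v}) (\<lambda>w. f w / (w - v))"
      by (intro continuous_intros continuous_on_subset[OF holomorphic_on_imp_continuous_on[OF holf]]) auto
    then have "continuous_on (S - {v}) (\<lambda>w. \<psi> (exp w) * exp w / (exp w - rcis m \<beta>))"
      by (rule continuous_on_eq) (simp add: eq)
    then show "continuous_on (path_image (rectpath (Complex (- R) (- \<theta>)) (Complex R \<theta>))) (\<lambda>w. \<psi> (exp w) * exp w / (exp w - rcis m \<beta>))"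
      by (rule continuous_on_subset) (rule path(1)[OF R])
  qed (rule \<psi>)
qed

section \<open>Resolvents on rays\<close>

text \<open>The closed cone \<open>cmod z * cos \<tau> \<le> Re z\<close> contains the sector but
  misses the ray, since the cosine decreases strictly on \<open>{0..pi}\<close>. It replaces a
  description of the closure.\<close>

lemma rcis_notin_closure_sector:
  assumes "0 \<le> \<tau>" "\<tau> < \<bar>\<alpha>\<bar>" "\<bar>\<alpha>\<bar> \<le> pi" "0 < r"
  shows "rcis r \<alpha> \<notin> closure (sector \<tau>)"
proof -
  define H where "H = {z. cmod z * cos \<tau> \<le> Re z}"
  have "closed H" unfolding H_def by (intro closed_Collect_le continuous_intros)
  moreover have "sector \<tau> \<subseteq> H"
  proof
    fix z assume z: "z \<in> sector \<tau>"
    show "z \<in> H"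
    proof (cases "\<tau> = 0")
      case True
      then show ?thesis using z by (auto simp: sector_def H_def)
    next
      case False
      then have "\<bar>Arg z\<bar> < \<tau>" using z by (auto simp: sector_def)
      then have "cos \<tau> \<le> cos \<bar>Arg z\<bar>" using assms by (intro cos_monotone_0_pi_le) auto
      then have "cmod z * cos \<tau> \<le> cmod z * cos (Arg z)" by (intro mult_left_mono) auto
      also have "\<dots> = Re (rcis (cmod z) (Arg z))" by simp
      also have "\<dots> = Re z" by (simp only: rcis_cmod_Arg)
      finally show ?thesis by (simp add: H_def)
    qed
  qed
  ultimately have "closure (sector \<tau>) \<subseteq> H" by (simp add: closure_minimal)
  moreover have "rcis r \<alpha> \<notin> H"
  proof -
    have "cos \<bar>\<alpha>\<bar> < cos \<tau>" using assms by (intro cos_monotone_0_pi) auto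
    then have "r * cos \<alpha> < r * cos \<tau>" using assms by simp
    then show ?thesis using assms by (simp add: H_def)
  qed
  ultimately show ?thesis by blast
qed

definition decaying_on :: "real \<Rightarrow> (complex \<Rightarrow> complex) \<Rightarrow> bool" where
  "decaying_on \<sigma> \<eta> \<longleftrightarrow> \<eta> holomorphic_on sector \<sigma> \<and>
     (\<exists>K\<ge>0. \<exists>\<epsilon>>0. \<forall>z\<in>sector \<sigma>. cmod (\<eta> z) \<le> K * decay \<epsilon> (cmod z))"

text \<open>With the sign of \<open>\<alpha>\<close>, the integral over the boundary of the sector of angle \<open>\<theta>\<close> is the sum of
  the integrals over the two rays \<open>\<alpha> = \<theta>\<close> and \<open>\<alpha> = -\<theta>\<close>.\<close>

definition ray_weight :: "real \<Rightarrow> (complex \<Rightarrow> complex) \<Rightarrow> real \<Rightarrow> complex" where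
  "ray_weight \<alpha> \<eta> r = - of_real (sgn \<alpha>) / (2 * of_real pi * \<i>) * (\<eta> (rcis r \<alpha>) * cis \<alpha>)"

lemma norm_ray_weight: "cmod (ray_weight \<alpha> \<eta> r) \<le> cmod (\<eta> (rcis r \<alpha>))"
proof -
  have "cmod (ray_weight \<alpha> \<eta> r) = \<bar>sgn \<alpha>\<bar> / (2 * pi) * cmod (\<eta> (rcis r \<alpha>))"
    by (simp add: ray_weight_def norm_mult norm_divide)
  also have "\<dots> \<le> 1 * cmod (\<eta> (rcis r \<alpha>))"
    using pi_ge_two by (intro mult_right_mono) (auto simp: sgn_if)
  finally show ?thesis by simp
qed

lemma continuous_ray_weight:
  assumes "continuous_on (sector \<sigma>) \<eta>" "\<bar>\<alpha>\<bar> < \<sigma>" "\<sigma> \<le> pi"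
  shows "continuous_on {0<..} (ray_weight \<alpha> \<eta>)"
  unfolding ray_weight_def[abs_def] using assms
  by (intro continuous_intros continuous_on_compose2[OF assms(1)]) (auto intro: rcis_in_sector)

lemma good_weight_ray:
  assumes "decaying_on \<sigma> \<eta>" "\<bar>\<alpha>\<bar> < \<sigma>" "\<sigma> \<le> pi"
  shows "good_weight (ray_weight \<alpha> \<eta>)"
proof -
  obtain K \<epsilon> where K: "0 \<le> K" "0 < \<epsilon>" "\<And>z. z \<in> sector \<sigma> \<Longrightarrow> cmod (\<eta> z) \<le> K * decay \<epsilon> (cmod z)"
    and h: "\<eta> holomorphic_on sector \<sigma>" using assms(1) by (auto simp: decaying_on_def)
  have "cmod (ray_weight \<alpha> \<eta> r) \<le> K * decay \<epsilon> r" if "0 < r" for r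
    using norm_ray_weight[of \<alpha> \<eta> r] K(3)[OF rcis_in_sector[OF that assms(2,3)]] that by simp
  then show ?thesis
    using continuous_ray_weight[OF holomorphic_on_imp_continuous_on[OF h] assms(2,3)] K(1,2)
    unfolding good_weight_def by blast
qed

lemma good_weight_mult_bounded:
  assumes a: "good_weight a" and b: "continuous_on {0<..} b" "0 \<le> L" "\<And>r. 0 < r \<Longrightarrow> cmod (b r) \<le> L"
  shows "good_weight (\<lambda>r. a r * b r)"
proof -
  obtain K \<epsilon> where K: "0 \<le> K" "0 < \<epsilon>" "\<And>r. 0 < r \<Longrightarrow> cmod (a r) \<le> K * decay \<epsilon> r"
    and c: "continuous_on {0<..} a" using a by (auto simp: good_weight_def)
  have "cmod (a r * b r) \<le> (K * L) * decay \<epsilon> r" if "0 < r" for r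
  proof -
    have "cmod (a r * b r) \<le> (K * decay \<epsilon> r) * L"
      unfolding norm_mult using K b(2,3) that by (intro mult_mono) auto
    then show ?thesis by (simp add: mult_ac)
  qed
  then show ?thesis
    unfolding good_weight_def using K b(2) continuous_on_mult[OF c b(1)]
    by (intro conjI exI[of _ "K * L"] exI[of _ \<epsilon>]) auto
qed

lemma good_weight_kernel:
  assumes a: "good_weight a" and \<alpha>: "0 < \<bar>\<alpha>\<bar>" "\<bar>\<alpha>\<bar> < \<bar>\<beta>\<bar>" "\<bar>\<beta>\<bar> \<le> pi" "0 < m"
  shows "good_weight (\<lambda>r. a r / (rcis m \<beta> - rcis r \<alpha>))"
proof -
  obtain c where c: "0 < c" "\<And>r m \<alpha>' \<beta>'. 0 < r \<Longrightarrow> 0 < m \<Longrightarrow> \<bar>\<alpha>'\<bar> = \<bar>\<alpha>\<bar> \<Longrightarrow> \<bar>\<beta>'\<bar> = \<bar>\<beta>\<bar> \<Longrightarrow>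
    c * r \<le> cmod (rcis r \<alpha>' - rcis m \<beta>') \<and> c * m \<le> cmod (rcis r \<alpha>' - rcis m \<beta>')"
    using ray_dist[OF \<alpha>(1-3)] by metis
  have kd: "c * m \<le> cmod (rcis m \<beta> - rcis r \<alpha>)" if "0 < r" for r
    using c(2)[OF that \<alpha>(4), of \<alpha> \<beta>] by (simp add: norm_minus_commute)
  have cm: "0 < c * m" using c(1) \<alpha>(4) by simp
  have nz: "rcis m \<beta> - rcis r \<alpha> \<noteq> 0" if "0 < r" for r
    using kd[OF that] cm by auto
  have "good_weight (\<lambda>r. a r * (1 / (rcis m \<beta> - rcis r \<alpha>)))"
  proof (rule good_weight_mult_bounded[OF a, where L = "1 / (c * m)"])
    show "continuous_on {0<..} (\<lambda>r. 1 / (rcis m \<beta> - rcis r \<alpha>))"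
      using nz by (intro continuous_intros) auto
    show "0 \<le> 1 / (c * m)" using cm by simp
    show "cmod (1 / (rcis m \<beta> - rcis r \<alpha>)) \<le> 1 / (c * m)" if "0 < r" for r
      unfolding norm_divide norm_one using kd[OF that] cm by (intro frac_le) auto
  qed
  then show ?thesis by simp
qed

text \<open>Identities between resolvents hold for each \<open>r\<close> off a null set depending on
  \<open>r\<close>. After this exchange, almost every point \<open>w\<close> satisfies them for
  almost every \<open>r\<close>, and they can be used under an integral over
  \<open>r\<close>.\<close>

lemma AE_rays_commute:
  assumes M: "sigma_finite_measure M"
    and P: "{x \<in> space (lpos \<Otimes>\<^sub>M M). P (fst x) (snd x)} \<in> sets (lpos \<Otimes>\<^sub>M M)"
    and AE: "\<And>r. 0 < r \<Longrightarrow> AE w in M. P r w"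
  shows "AE w in M. AE r in lpos. P r w"
proof -
  interpret L: sigma_finite_measure lpos by (rule sigma_finite_lpos)
  interpret M: sigma_finite_measure M by (rule M)
  interpret LM: pair_sigma_finite lpos M ..
  have "AE r in lpos. AE w in M. P r w" by (rule AE_I2) (use AE in simp)
  then show ?thesis using LM.AE_commute[OF P] by simp
qed

text \<open>\<tau> stands for an angle strictly between a sectoriality angle of the operator and the
  opening \<theta> of the contour. The bound \<open>B\<close> is taken at least 1, so that
  \<open>B ^ 2\<close> dominates the norm constants of one resolvent and of a product of
  two.\<close>

locale Rs_sectorial_op = banach_function_norm M \<Omega> \<rho>
  for M :: "'a measure" and \<Omega> :: "nat \<Rightarrow> 'a set" and \<rho> :: "('a \<Rightarrow> ennreal) \<Rightarrow> ennreal" +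
  fixes s :: ennreal and D :: "('a \<Rightarrow> complex) set" and A :: "('a \<Rightarrow> complex) \<Rightarrow> 'a \<Rightarrow> complex"
    and \<tau> :: real and B :: real
  assumes s: "1 \<le> s"
    and operator: "bfs_operator M \<rho> D A"
    and \<tau>: "0 < \<tau>" "\<tau> < pi"
    and is_res: "\<And>z. z \<notin> closure (sector \<tau>) \<Longrightarrow> is_resolvent M \<rho> D A z (resolvent M \<rho> D A z)"
    and B: "1 \<le> B"
    and Rs: "\<And>(n::nat) z x. (\<And>j. j < n \<Longrightarrow> z j \<notin> closure (sector \<tau>)) \<Longrightarrow> (\<And>j. j < n \<Longrightarrow> x j \<in> bfs M \<rho>) \<Longrightarrow>
      \<rho> (\<lambda>w. ls_norm s {..<n} (\<lambda>j. ennreal (cmod (z j * resolvent M \<rho> D A (z j) (x j) w))))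
        \<le> ennreal B * \<rho> (\<lambda>w. ls_norm s {..<n} (\<lambda>j. ennreal (cmod (x j w))))"
begin

abbreviation Res :: "complex \<Rightarrow> ('a \<Rightarrow> complex) \<Rightarrow> 'a \<Rightarrow> complex" where
  "Res \<equiv> resolvent M \<rho> D A"

lemma Res_bounded: "z \<notin> closure (sector \<tau>) \<Longrightarrow> Res z \<in> bfs_bounded_ops M \<rho>"
  using is_res by (auto simp: is_resolvent_def)

lemma Res_bfs: "z \<notin> closure (sector \<tau>) \<Longrightarrow> x \<in> bfs M \<rho> \<Longrightarrow> Res z x \<in> bfs M \<rho>"
  by (rule bounded_opsD(1)[OF Res_bounded])

lemma Res_norm:
  assumes z: "z \<notin> closure (sector \<tau>)" "z \<noteq> 0" and x: "x \<in> bfs M \<rho>"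
  shows "bfs_norm \<rho> (Res z x) \<le> ennreal (B / cmod z) * bfs_norm \<rho> x"
proof -
  have one: "{..<Suc 0} = {0::nat}" by auto
  have "\<rho> (\<lambda>w. ennreal (cmod (z * Res z x w))) \<le> ennreal B * \<rho> (\<lambda>w. ennreal (cmod (x w)))"
    using Rs[of 1 "\<lambda>_. z" "\<lambda>_. x"] z x by (simp add: one ls_norm_single[OF s])
  then have "bfs_norm \<rho> (\<lambda>w. z * Res z x w) \<le> ennreal B * bfs_norm \<rho> x" by (simp add: bfs_norm_def)
  then have 1: "ennreal (cmod z) * bfs_norm \<rho> (Res z x) \<le> ennreal B * bfs_norm \<rho> x"
    by (simp add: bfs_norm_cmult bfs_measurable Res_bfs z x)
  have "bfs_norm \<rho> (Res z x) = ennreal (1 / cmod z) * (ennreal (cmod z) * bfs_norm \<rho> (Res z x))"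
    using z by (simp add: mult.assoc[symmetric] ennreal_mult[symmetric])
  also have "\<dots> \<le> ennreal (1 / cmod z) * (ennreal B * bfs_norm \<rho> x)"
    by (rule mult_left_mono[OF 1]) simp
  also have "\<dots> = ennreal (B / cmod z) * bfs_norm \<rho> x"
    using B by (simp add: mult.assoc[symmetric] ennreal_mult[symmetric])
  finally show ?thesis .
qed

text \<open>Apply \<open>Res z\<close> to the equation
  \<open>z * u - A u = x + (z - z') * u\<close>, valid almost everywhere for
  \<open>u = Res z' x\<close>.\<close>

lemma resolvent_identity:
  assumes z: "z \<notin> closure (sector \<tau>)" and z': "z' \<notin> closure (sector \<tau>)" and x: "x \<in> bfs M \<rho>"
  shows "AE w in M. Res z x w - Res z' x w = (z' - z) * Res z (Res z' x) w"
proof -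
  define u where "u = Res z' x"
  have u: "u \<in> D" "AE w in M. z' * u w - A u w = x w"
    using is_res[OF z'] x by (auto simp: is_resolvent_def u_def)
  have ub: "u \<in> bfs M \<rho>" "A u \<in> bfs M \<rho>"
    using u(1) operator by (auto simp: bfs_operator_def)
  have 1: "AE w in M. Res z (\<lambda>v. z * u v - A u v) w = u w"
    using is_res[OF z] u(1) by (auto simp: is_resolvent_def)
  have b1: "(\<lambda>v. z * u v - A u v) \<in> bfs M \<rho>" by (intro bfs_diff bfs_cmult ub)
  have b2: "(\<lambda>v. (z - z') * u v) \<in> bfs M \<rho>" by (intro bfs_cmult ub)
  have 2: "AE w in M. Res z (\<lambda>v. z * u v - A u v) w = Res z (\<lambda>v. x v + (z - z') * u v) w"
  proof (rule bounded_ops_cong_AE[OF Res_bounded[OF z] b1 bfs_add[OF x b2]])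
    show "AE w in M. z * u w - A u w = x w + (z - z') * u w"
      using u(2) by eventually_elim (auto simp: algebra_simps)
  qed
  have 3: "AE w in M. Res z (\<lambda>v. x v + (z - z') * u v) w = Res z x w + Res z (\<lambda>v. (z - z') * u v) w"
    by (rule bounded_opsD(2)[OF Res_bounded[OF z] x b2])
  have 4: "AE w in M. Res z (\<lambda>v. (z - z') * u v) w = (z - z') * Res z u w"
    by (rule bounded_opsD(3)[OF Res_bounded[OF z] ub(1)])
  from 1 2 3 4 have "AE w in M. u w = Res z x w + (z - z') * Res z u w"
    by eventually_elim simp
  then show ?thesis
    unfolding u_def[symmetric] by eventually_elim (simp add: algebra_simps)
qed

text \<open>This is \<open>R(re\<^sup>i\<^sup>\<alpha>, c A) x\<close>.\<close>

definition ray_family :: "real \<Rightarrow> real \<Rightarrow> ('a \<Rightarrow> complex) \<Rightarrow> real \<Rightarrow> 'a \<Rightarrow> complex" where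
  "ray_family c \<alpha> x r w = of_real (1 / c) * Res (rcis (r / c) \<alpha>) x w"

lemma ray_notin:
  assumes "\<tau> < \<bar>\<alpha>\<bar>" "\<bar>\<alpha>\<bar> \<le> pi" "0 < r"
  shows "rcis r \<alpha> \<notin> closure (sector \<tau>)"
  by (rule rcis_notin_closure_sector) (use assms \<tau> in auto)

text \<open>The norm bound is sectoriality, the Lipschitz bound the resolvent identity with both
  resolvents estimated. All powers of \<open>c\<close> cancel; this independence of the dilation
  carries over to every later estimate.\<close>

lemma good_ray_family:
  assumes c: "0 < c" and \<alpha>: "\<tau> < \<bar>\<alpha>\<bar>" "\<bar>\<alpha>\<bar> \<le> pi" and x: "x \<in> bfs M \<rho>"
  shows "good_family (ray_family c \<alpha> x) (B ^ 2 * enn2real (bfs_norm \<rho> x))"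
proof -
  define N where "N = enn2real (bfs_norm \<rho> x)"
  have N: "bfs_norm \<rho> x = ennreal N" "0 \<le> N"
    using bfs_norm_finite[OF x] by (auto simp: N_def)
  have z: "rcis (r / c) \<alpha> \<notin> closure (sector \<tau>)" "rcis (r / c) \<alpha> \<noteq> 0" "cmod (rcis (r / c) \<alpha>) = r / c" if "0 < r" for r
    using ray_notin[OF \<alpha>, of "r / c"] that c by auto
  have Fb: "ray_family c \<alpha> x r \<in> bfs M \<rho>" if "0 < r" for r
    unfolding ray_family_def[abs_def] by (intro bfs_cmult Res_bfs z x that)
  have RN: "bfs_norm \<rho> (Res (rcis (r / c) \<alpha>) x) \<le> ennreal (B / (r / c) * N)" if "0 < r" for r
    using Res_norm[OF z(1,2)[OF that] x] B N that c unfolding z(3)[OF that]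
    by (simp add: ennreal_mult[symmetric])
  have BB: "B \<le> B ^ 2" using B by (simp add: power2_eq_square)
  show ?thesis
    unfolding good_family_def N_def[symmetric]
  proof (intro conjI allI impI)
    show "0 \<le> B ^ 2 * N" using N by simp
    show "ray_family c \<alpha> x r \<in> bfs M \<rho>" if "0 < r" for r by (rule Fb[OF that])
    show "bfs_norm \<rho> (ray_family c \<alpha> x r) \<le> ennreal (B ^ 2 * N / r)" if r: "0 < r" for r
    proof -
      have "bfs_norm \<rho> (ray_family c \<alpha> x r) = ennreal (1 / c) * bfs_norm \<rho> (Res (rcis (r / c) \<alpha>) x)"
        unfolding ray_family_def[abs_def] using c
        by (subst bfs_norm_cmult) (auto intro!: bfs_measurable Res_bfs z x r simp: norm_divide)
      also have "\<dots> \<le> ennreal (1 / c) * ennreal (B / (r / c) * N)"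
        by (intro mult_left_mono RN[OF r]) simp
      also have "\<dots> = ennreal (B * N / r)" using c r B N by (simp add: ennreal_mult[symmetric])
      also have "\<dots> \<le> ennreal (B ^ 2 * N / r)"
        using BB N r by (intro ennreal_leI divide_right_mono mult_right_mono) auto
      finally show ?thesis .
    qed
    fix r r' :: real assume r: "0 < r" and r': "0 < r'"
    define z1 where "z1 = rcis (r / c) \<alpha>"
    define z2 where "z2 = rcis (r' / c) \<alpha>"
    note zz = z(1,2)[OF r, folded z1_def] z(1,2)[OF r', folded z2_def]
    have cz: "cmod z1 = r / c" "cmod z2 = r' / c" unfolding z1_def z2_def by (rule z(3)[OF r], rule z(3)[OF r'])
    have d: "cmod (z2 - z1) = \<bar>r - r'\<bar> / c"
    proof -
      have "z2 - z1 = of_real ((r' - r) / c) * cis \<alpha>" by (simp add: z1_def z2_def rcis_def algebra_simps diff_divide_distrib)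
      then have "cmod (z2 - z1) = \<bar>(r' - r) / c\<bar>" by (simp only: norm_mult norm_of_real norm_cis mult_1_right)
      then show ?thesis using c by (simp add: abs_minus_commute)
    qed
    have R2: "Res z2 x \<in> bfs M \<rho>" by (rule Res_bfs[OF zz(3) x])
    have R12: "Res z1 (Res z2 x) \<in> bfs M \<rho>" by (rule Res_bfs[OF zz(1) R2])
    have "bfs_norm \<rho> (\<lambda>w. ray_family c \<alpha> x r w - ray_family c \<alpha> x r' w)
      = bfs_norm \<rho> (\<lambda>w. of_real (1 / c) * (z2 - z1) * Res z1 (Res z2 x) w)"
    proof (rule bfs_norm_cong_AE)
      show "AE w in M. ray_family c \<alpha> x r w - ray_family c \<alpha> x r' w = of_real (1 / c) * (z2 - z1) * Res z1 (Res z2 x) w"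
        using resolvent_identity[OF zz(1) zz(3) x]
        unfolding ray_family_def z1_def[symmetric] z2_def[symmetric]
        by eventually_elim (simp add: diff_divide_distrib[symmetric])
    qed (intro bfs_measurable bfs_diff Fb r r' bfs_cmult R12)+
    also have "\<dots> = ennreal (1 / c * (\<bar>r - r'\<bar> / c)) * bfs_norm \<rho> (Res z1 (Res z2 x))"
      using c d by (subst bfs_norm_cmult[OF bfs_measurable[OF R12]]) (simp add: norm_mult norm_divide)
    also have "\<dots> \<le> ennreal (1 / c * (\<bar>r - r'\<bar> / c)) * (ennreal (B / cmod z1) * (ennreal (B / cmod z2) * ennreal N))"
      unfolding N(1)[symmetric]
      by (intro mult_left_mono order_trans[OF Res_norm[OF zz(1,2) R2]] Res_norm[OF zz(3,4) x]) auto
    also have "\<dots> = ennreal (B ^ 2 * N * \<bar>r - r'\<bar> / (r * r'))"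
      using c r r' B N unfolding cz
      by (simp add: ennreal_mult[symmetric] power2_eq_square field_simps)
    finally show "bfs_norm \<rho> (\<lambda>w. ray_family c \<alpha> x r w - ray_family c \<alpha> x r' w) \<le> ennreal (B ^ 2 * N * \<bar>r - r'\<bar> / (r * r'))" .
  qed
qed

text \<open>Passes from the element chosen in \<open>fun_calc\<close> to integrals that can be
  computed pointwise. The factor \<open>sgn \<alpha>\<close> in \<open>ray_weight\<close> absorbs
  the opposite orientations of the two rays.\<close>

lemma fun_calc_eq:
  assumes \<theta>: "\<tau> < \<theta>" "\<theta> < \<sigma>" "\<sigma> \<le> pi" and x: "x \<in> bfs M \<rho>" and \<eta>: "decaying_on \<sigma> \<eta>"
  shows "fun_calc M \<rho> D A \<theta> \<eta> x \<in> bfs M \<rho>"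
    and "AE w in M. fun_calc M \<rho> D A \<theta> \<eta> x w
      = ray_int (ray_weight (- \<theta>) \<eta>) (ray_family 1 (- \<theta>) x) w + ray_int (ray_weight \<theta> \<eta>) (ray_family 1 \<theta> x) w"
proof -
  have t: "\<bar>\<theta>\<bar> < \<sigma>" "\<bar>- \<theta>\<bar> < \<sigma>" "\<tau> < \<bar>\<theta>\<bar>" "\<tau> < \<bar>- \<theta>\<bar>" "\<bar>\<theta>\<bar> \<le> pi" "\<bar>- \<theta>\<bar> \<le> pi" "0 < \<theta>" using \<theta> \<tau> by auto
  have eq: "(\<lambda>r w. 1 / (2 * of_real pi * \<i>) *
           (\<eta> (rcis r (- \<theta>)) * Res (rcis r (- \<theta>)) x w * cis (- \<theta>)
          - \<eta> (rcis r \<theta>) * Res (rcis r \<theta>) x w * cis \<theta>))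
    = (\<lambda>r w. ray_weight (- \<theta>) \<eta> r * ray_family 1 (- \<theta>) x r w + ray_weight \<theta> \<eta> r * ray_family 1 \<theta> x r w)"
    using t(7) by (simp add: fun_eq_iff ray_weight_def ray_family_def sgn_if field_simps)
  note h = some_bfs_integral_AE[OF good_ray_family[OF zero_less_one t(4,6) x] good_ray_family[OF zero_less_one t(3,5) x]
      good_weight_ray[OF \<eta> t(2) \<theta>(3)] good_weight_ray[OF \<eta> t(1) \<theta>(3)]]
  show "fun_calc M \<rho> D A \<theta> \<eta> x \<in> bfs M \<rho>"
    unfolding fun_calc_def eq by (rule h(1))
  show "AE w in M. fun_calc M \<rho> D A \<theta> \<eta> x w
      = ray_int (ray_weight (- \<theta>) \<eta>) (ray_family 1 (- \<theta>) x) w + ray_int (ray_weight \<theta> \<eta>) (ray_family 1 \<theta> x) w"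
    unfolding fun_calc_def eq by (rule h(2))
qed

text \<open>The first resolvent equation under the integral sign.\<close>

lemma Res_ray_int:
  assumes \<alpha>: "\<tau> < \<bar>\<alpha>\<bar>" "\<bar>\<alpha>\<bar> < \<bar>\<beta>\<bar>" "\<bar>\<beta>\<bar> \<le> pi" "0 < m" and x: "x \<in> bfs M \<rho>" and a: "good_weight a"
    and int: "integrable lpos (\<lambda>r. a r / (rcis r \<alpha> - rcis m \<beta>))"
  shows "AE w in M. Res (rcis m \<beta>) (ray_int a (ray_family 1 \<alpha> x)) w
    = (LINT r|lpos. a r / (rcis r \<alpha> - rcis m \<beta>)) * Res (rcis m \<beta>) x w
      + ray_int (\<lambda>r. a r / (rcis m \<beta> - rcis r \<alpha>)) (ray_family 1 \<alpha> x) w"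
proof -
  define \<mu> where "\<mu> = rcis m \<beta>"
  define F where "F = ray_family 1 \<alpha> x"
  define k where "k r = rcis r \<alpha> - \<mu>" for r
  have "0 < \<bar>\<alpha>\<bar>" "\<bar>\<alpha>\<bar> \<le> pi" using \<alpha> \<tau> by auto
  obtain c where c: "0 < c" "\<And>r m \<alpha>' \<beta>'. 0 < r \<Longrightarrow> 0 < m \<Longrightarrow> \<bar>\<alpha>'\<bar> = \<bar>\<alpha>\<bar> \<Longrightarrow> \<bar>\<beta>'\<bar> = \<bar>\<beta>\<bar> \<Longrightarrow>
    c * r \<le> cmod (rcis r \<alpha>' - rcis m \<beta>') \<and> c * m \<le> cmod (rcis r \<alpha>' - rcis m \<beta>')"
    using ray_dist[OF \<open>0 < \<bar>\<alpha>\<bar>\<close> \<alpha>(2,3)] by metis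
  have kd: "c * m \<le> cmod (k r)" if "0 < r" for r
    using c(2)[OF that \<alpha>(4), of \<alpha> \<beta>] by (simp add: k_def \<mu>_def)
  have knz: "k r \<noteq> 0" if "0 < r" for r
    using kd[OF that] mult_pos_pos[OF c(1) \<alpha>(4)] by auto
  have \<mu>: "\<mu> \<notin> closure (sector \<tau>)" unfolding \<mu>_def using \<alpha> by (intro ray_notin) auto
  have lam: "rcis r \<alpha> \<notin> closure (sector \<tau>)" if "0 < r" for r using \<alpha> that by (intro ray_notin) auto
  have F: "good_family F (B ^ 2 * enn2real (bfs_norm \<rho> x))"
    unfolding F_def using \<alpha> by (intro good_ray_family x) auto
  have Feq: "F r w = Res (rcis r \<alpha>) x w" for r w by (simp add: F_def ray_family_def)
  have Ffun: "F r = Res (rcis r \<alpha>) x" for r by (simp add: fun_eq_iff Feq)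
  note FD = good_familyD[OF F]
  obtain C where C: "0 \<le> C" "\<And>f. f \<in> bfs M \<rho> \<Longrightarrow> bfs_norm \<rho> (Res \<mu> f) \<le> ennreal C * bfs_norm \<rho> f"
    using bounded_opsD(4)[OF Res_bounded[OF \<mu>]] by auto
  have TF: "good_family (\<lambda>r. Res \<mu> (F r)) (C * (B ^ 2 * enn2real (bfs_norm \<rho> x)))"
    unfolding good_family_def
  proof (intro conjI allI impI)
    define N where "N = B ^ 2 * enn2real (bfs_norm \<rho> x)"
    have N: "0 \<le> N" by (simp add: N_def)
    show "0 \<le> C * (B ^ 2 * enn2real (bfs_norm \<rho> x))" using C by simp
    show "Res \<mu> (F r) \<in> bfs M \<rho>" if "0 < r" for r by (intro Res_bfs \<mu> FD that)
    show "bfs_norm \<rho> (Res \<mu> (F r)) \<le> ennreal (C * (B ^ 2 * enn2real (bfs_norm \<rho> x)) / r)" if "0 < r" for r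
    proof -
      have "bfs_norm \<rho> (Res \<mu> (F r)) \<le> ennreal C * ennreal (N / r)"
        unfolding N_def by (rule order_trans[OF C(2)[OF FD(2)[OF that]]]) (intro mult_left_mono FD(4) that, simp)
      also have "\<dots> = ennreal (C * N / r)" using C N that by (simp add: ennreal_mult[symmetric])
      finally show ?thesis by (simp add: N_def)
    qed
    show "bfs_norm \<rho> (\<lambda>w. Res \<mu> (F r) w - Res \<mu> (F r') w) \<le> ennreal (C * (B ^ 2 * enn2real (bfs_norm \<rho> x)) * \<bar>r - r'\<bar> / (r * r'))"
      if r: "0 < r" "0 < r'" for r r'
    proof -
      have "bfs_norm \<rho> (\<lambda>w. Res \<mu> (F r) w - Res \<mu> (F r') w) = bfs_norm \<rho> (Res \<mu> (\<lambda>w. F r w - F r' w))"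
      proof (rule bfs_norm_cong_AE)
        show "AE w in M. Res \<mu> (F r) w - Res \<mu> (F r') w = Res \<mu> (\<lambda>w. F r w - F r' w) w"
          using bounded_ops_diff[OF Res_bounded[OF \<mu>] FD(2)[OF r(1)] FD(2)[OF r(2)]] by eventually_elim simp
      qed (intro bfs_measurable bfs_diff Res_bfs \<mu> FD r)+
      also have "\<dots> \<le> ennreal C * ennreal (N * \<bar>r - r'\<bar> / (r * r'))"
        unfolding N_def by (rule order_trans[OF C(2)[OF bfs_diff[OF FD(2)[OF r(1)] FD(2)[OF r(2)]]]]) (intro mult_left_mono FD(5) r, simp)
      also have "\<dots> = ennreal (C * N * \<bar>r - r'\<bar> / (r * r'))" using C N r by (simp add: ennreal_mult[symmetric] mult_ac)
      finally show ?thesis by (simp add: N_def)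
    qed
  qed
  have kc: "continuous_on {0<..} k" unfolding k_def by (intro continuous_intros)
  have Rx: "Res \<mu> x \<in> borel_measurable M" by (intro bfs_measurable Res_bfs \<mu> x)
  have 1: "AE w in M. Res \<mu> (ray_int a F) w = ray_int a (\<lambda>r. Res \<mu> (F r)) w"
    by (rule bounded_ops_ray_int[OF Res_bounded[OF \<mu>] F TF a])
  \<comment> \<open>The resolvent identity at each radius, carried over to the representatives and
    then to almost every radius off one null set.\<close>
  have 2: "AE w in M. AE r in lpos. rep (\<lambda>r. Res \<mu> (F r)) r w * k r = Res \<mu> x w - rep F r w"
  proof (rule AE_rays_commute)
    show "sigma_finite_measure M" by (rule sigma_finite_measure_axioms)
    have [measurable]: "(\<lambda>z. rep (\<lambda>r. Res \<mu> (F r)) (fst z) (snd z)) \<in> borel_measurable (lpos \<Otimes>\<^sub>M M)"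
      "(\<lambda>z. rep F (fst z) (snd z)) \<in> borel_measurable (lpos \<Otimes>\<^sub>M M)"
      using good_rep_measurable[OF TF] good_rep_measurable[OF F] by (simp_all add: split_beta')
    have [measurable]: "(\<lambda>z. k (fst z)) \<in> borel_measurable (lpos \<Otimes>\<^sub>M M)"
      by (rule measurable_compose[OF measurable_fst continuous_imp_measurable_lpos[OF kc]])
    have [measurable]: "(\<lambda>z. Res \<mu> x (snd z)) \<in> borel_measurable (lpos \<Otimes>\<^sub>M M)"
      by (rule measurable_compose[OF measurable_snd Rx])
    show "{z \<in> space (lpos \<Otimes>\<^sub>M M). rep (\<lambda>r. Res \<mu> (F r)) (fst z) (snd z) * k (fst z) = Res \<mu> x (snd z) - rep F (fst z) (snd z)} \<in> sets (lpos \<Otimes>\<^sub>M M)"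
      by measurable
    fix r :: real assume r: "0 < r"
    show "AE w in M. rep (\<lambda>r. Res \<mu> (F r)) r w * k r = Res \<mu> x w - rep F r w"
      using rep_eq_AE[OF TF r] rep_eq_AE[OF F r] resolvent_identity[OF \<mu> lam[OF r] x]
      by eventually_elim (simp add: Ffun k_def mult.commute)
  qed
  have gk: "good_weight (\<lambda>r. a r / (\<mu> - rcis r \<alpha>))"
    unfolding \<mu>_def by (rule good_weight_kernel[OF a \<open>0 < \<bar>\<alpha>\<bar>\<close> \<alpha>(2-4)])
  have 3: "AE w in M. integrable lpos (\<lambda>r. a r / (\<mu> - rcis r \<alpha>) * rep F r w)"
    by (rule ray_int_AE_integrable[OF F good_weight_measurable[OF gk] good_weight_finite[OF gk]])
  have "AE w in M. Res \<mu> (ray_int a F) w = (LINT r|lpos. a r / (rcis r \<alpha> - \<mu>)) * Res \<mu> x w + ray_int (\<lambda>r. a r / (\<mu> - rcis r \<alpha>)) F w"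
    using 1 2 3 AE_space
  proof eventually_elim
    case (elim w)
    have m1: "(\<lambda>r. rep (\<lambda>r. Res \<mu> (F r)) r w) \<in> borel_measurable lpos"
      by (rule rep_measurable1[OF good_familyD(3)[OF TF]]) (use elim in auto)
    have m2: "(\<lambda>r. rep F r w) \<in> borel_measurable lpos"
      by (rule rep_measurable1[OF FD(3)]) (use elim in auto)
    have am: "a \<in> borel_measurable lpos" by (rule good_weight_measurable[OF a])
    have km: "(\<lambda>r. rcis r \<alpha> - \<mu>) \<in> borel_measurable lpos"
      using continuous_imp_measurable_lpos[OF kc] by (simp only: k_def[abs_def])
    have km': "(\<lambda>r. \<mu> - rcis r \<alpha>) \<in> borel_measurable lpos"
      by (intro continuous_imp_measurable_lpos continuous_intros)
    have "Res \<mu> (ray_int a F) w = (LINT r|lpos. a r * rep (\<lambda>r. Res \<mu> (F r)) r w)"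
      using elim(1) by (simp add: ray_int_def)
    also have "\<dots> = (LINT r|lpos. a r / (rcis r \<alpha> - \<mu>) * Res \<mu> x w + a r / (\<mu> - rcis r \<alpha>) * rep F r w)"
    proof (rule integral_cong_AE)
      show "AE r in lpos. a r * rep (\<lambda>r. Res \<mu> (F r)) r w = a r / (rcis r \<alpha> - \<mu>) * Res \<mu> x w + a r / (\<mu> - rcis r \<alpha>) * rep F r w"
        using elim(2) AE_space
      proof eventually_elim
        case (elim r)
        then have "k r \<noteq> 0" using knz by simp
        then have "rep (\<lambda>r. Res \<mu> (F r)) r w = (Res \<mu> x w - rep F r w) / k r" using elim(1) by (simp add: field_simps)
        moreover have e: "\<mu> - rcis r \<alpha> = - k r" "rcis r \<alpha> - \<mu> = k r" by (auto simp: k_def)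
        ultimately show ?case unfolding e by (simp add: diff_divide_distrib right_diff_distrib)
      qed
    qed (intro borel_measurable_times borel_measurable_add borel_measurable_divide am km km' m1 m2 borel_measurable_const)+
    also have "\<dots> = (LINT r|lpos. a r / (rcis r \<alpha> - \<mu>) * Res \<mu> x w) + (LINT r|lpos. a r / (\<mu> - rcis r \<alpha>) * rep F r w)"
      using int elim(3) unfolding \<mu>_def[symmetric]
      by (intro Bochner_Integration.integral_add integrable_mult_left)
    also have "(LINT r|lpos. a r / (rcis r \<alpha> - \<mu>) * Res \<mu> x w) = (LINT r|lpos. a r / (rcis r \<alpha> - \<mu>)) * Res \<mu> x w"
      by (rule integral_mult_left_zero)
    finally show ?case unfolding ray_int_def[of "\<lambda>r. a r / (\<mu> - rcis r \<alpha>)" F w] .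
  qed
  then show ?thesis by (simp only: \<mu>_def F_def)
qed

end

section \<open>Two contours and the product of functions of the operator\<close>

lemma decay_le_1: "0 < r \<Longrightarrow> 0 < \<epsilon> \<Longrightarrow> decay \<epsilon> r \<le> 1"
proof (cases "r \<le> 1")
  case True
  assume "0 < r" "0 < \<epsilon>"
  then have "r powr \<epsilon> \<le> 1" using True powr_le1 by auto
  then show ?thesis by (simp add: decay_def min.coboundedI1)
next
  case False
  assume "0 < r" "0 < \<epsilon>"
  then have "r powr (- \<epsilon>) \<le> 1" using False by (simp add: powr_minus inverse_le_1_iff ge_one_powr_ge_zero)
  then show ?thesis by (simp add: decay_def min.coboundedI2)
qed

lemma rcis_mult_real: "of_real c * rcis r \<alpha> = rcis (c * r) \<alpha>"
  by (simp add: rcis_def)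

text \<open>The bound on the kernel gives the product majorant of
  \<open>cmod (v x) / (c * x)\<close> and \<open>cmod (u y)\<close>. It uses integrability of
  \<open>v\<close> against \<open>1 / x\<close> and plain integrability of \<open>u\<close>, exactly
  what a weight on one contour and a weighted resolvent on the other provide.\<close>

lemma kernel_Fubini:
  fixes u v :: "real \<Rightarrow> complex" and k :: "real \<Rightarrow> real \<Rightarrow> complex"
  assumes u: "integrable lpos u" and v: "v \<in> borel_measurable lpos"
    and fin: "(\<integral>\<^sup>+x. ennreal (cmod (v x)) * ennreal (1 / x) \<partial>lpos) < \<infinity>"
    and k: "(\<lambda>(x, y). k x y) \<in> borel_measurable (lpos \<Otimes>\<^sub>M lpos)" and "0 < c"
    and kle: "\<And>x y. 0 < x \<Longrightarrow> 0 < y \<Longrightarrow> cmod (k x y) \<le> 1 / (c * x)"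
  shows "integrable lpos (\<lambda>x. v x * (LINT y|lpos. u y * k x y))"
    and "integrable lpos (\<lambda>y. u y * (LINT x|lpos. v x * k x y))"
    and "(LINT x|lpos. v x * (LINT y|lpos. u y * k x y)) = (LINT y|lpos. u y * (LINT x|lpos. v x * k x y))"
proof -
  interpret L: sigma_finite_measure lpos by (rule sigma_finite_lpos)
  interpret LL: pair_sigma_finite lpos lpos ..
  define f where "f x y = v x * u y * k x y" for x y
  have um [measurable]: "u \<in> borel_measurable lpos" using u by simp
  note v[measurable] k[measurable]
  have fm: "(\<lambda>(x, y). f x y) \<in> borel_measurable (lpos \<Otimes>\<^sub>M lpos)"
    unfolding f_def by measurable
  have int: "integrable (lpos \<Otimes>\<^sub>M lpos) (\<lambda>(x, y). f x y)"
  proof (rule integrableI_bounded[OF fm])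
    have om: "(\<lambda>x. ennreal (cmod (v x)) * ennreal (1 / x)) \<in> borel_measurable lpos"
      by (intro borel_measurable_times_ennreal measurable_ennreal_cmod v borel_measurable_lpos) measurable
    have "(\<integral>\<^sup>+z. ennreal (norm (case z of (x, y) \<Rightarrow> f x y)) \<partial>(lpos \<Otimes>\<^sub>M lpos))
      = (\<integral>\<^sup>+x. \<integral>\<^sup>+y. ennreal (cmod (f x y)) \<partial>lpos \<partial>lpos)"
      using fm by (subst L.nn_integral_fst[symmetric]) auto
    also have "\<dots> \<le> (\<integral>\<^sup>+x. \<integral>\<^sup>+y. (ennreal (1 / c) * (ennreal (cmod (v x)) * ennreal (1 / x))) * ennreal (cmod (u y)) \<partial>lpos \<partial>lpos)"
    proof (intro nn_integral_mono)
      fix x y assume "x \<in> space lpos" "y \<in> space lpos"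
      then have xy: "0 < x" "0 < y" by auto
      have "cmod (f x y) \<le> cmod (v x) * cmod (u y) * (1 / (c * x))"
        unfolding f_def norm_mult by (intro mult_left_mono kle xy) auto
      also have "\<dots> = 1 / c * (cmod (v x) * (1 / x)) * cmod (u y)" by simp
      finally show "ennreal (cmod (f x y)) \<le> (ennreal (1 / c) * (ennreal (cmod (v x)) * ennreal (1 / x))) * ennreal (cmod (u y))"
        using xy \<open>0 < c\<close> by (simp add: ennreal_mult[symmetric] ennreal_leI)
    qed
    also have "\<dots> = (\<integral>\<^sup>+x. ennreal (1 / c) * (ennreal (cmod (v x)) * ennreal (1 / x)) * (\<integral>\<^sup>+y. ennreal (cmod (u y)) \<partial>lpos) \<partial>lpos)"
      by (intro nn_integral_cong nn_integral_cmult measurable_ennreal_cmod um)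
    also have "\<dots> = ennreal (1 / c) * (\<integral>\<^sup>+x. ennreal (cmod (v x)) * ennreal (1 / x) \<partial>lpos) * (\<integral>\<^sup>+y. ennreal (cmod (u y)) \<partial>lpos)"
      unfolding nn_integral_cmult[OF om, symmetric]
      by (rule nn_integral_multc) (intro borel_measurable_times_ennreal om borel_measurable_const)
    also have "\<dots> < \<infinity>"
      using fin u by (simp add: ennreal_mult_less_top integrable_iff_bounded)
    finally show "(\<integral>\<^sup>+z. ennreal (norm (case z of (x, y) \<Rightarrow> f x y)) \<partial>(lpos \<Otimes>\<^sub>M lpos)) < \<infinity>" .
  qed
  have e1: "(LINT y|lpos. f x y) = v x * (LINT y|lpos. u y * k x y)" for x
    unfolding f_def by (simp add: mult.assoc)
  have e2: "(LINT x|lpos. f x y) = u y * (LINT x|lpos. v x * k x y)" for y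
  proof -
    have "(LINT x|lpos. f x y) = (LINT x|lpos. u y * (v x * k x y))" unfolding f_def by (simp add: mult_ac)
    then show ?thesis by simp
  qed
  show "integrable lpos (\<lambda>x. v x * (LINT y|lpos. u y * k x y))"
    using LL.integrable_fst[OF int] by (simp only: e1)
  show "integrable lpos (\<lambda>y. u y * (LINT x|lpos. v x * k x y))"
    using LL.integrable_snd[OF int] by (simp only: e2)
  show "(LINT x|lpos. v x * (LINT y|lpos. u y * k x y)) = (LINT y|lpos. u y * (LINT x|lpos. v x * k x y))"
    using LL.Fubini_integral[OF int] by (simp only: e1 e2)
qed

text \<open>The two rays together bound a sector that does not contain the point. The vanishing sum
  is the coefficient of the unwanted resolvent term in \<open>Res_fun_calc\<close>.\<close>

lemma ray_weight_Cauchy_outside: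
  assumes \<theta>: "0 < \<theta>" "\<theta> < \<sigma>" "\<sigma> \<le> pi" "\<theta> < \<bar>\<beta>\<bar>" "\<bar>\<beta>\<bar> \<le> pi" "0 < m" and \<eta>: "decaying_on \<sigma> \<eta>"
  shows "\<And>\<alpha>. \<bar>\<alpha>\<bar> = \<theta> \<Longrightarrow> integrable lpos (\<lambda>r. ray_weight \<alpha> \<eta> r / (rcis r \<alpha> - rcis m \<beta>))"
    and "(LINT r|lpos. ray_weight (- \<theta>) \<eta> r / (rcis r (- \<theta>) - rcis m \<beta>))
      + (LINT r|lpos. ray_weight \<theta> \<eta> r / (rcis r \<theta> - rcis m \<beta>)) = 0"
proof -
  obtain K \<epsilon> where K: "0 \<le> K" "0 < \<epsilon>" "\<And>z. z \<in> sector \<sigma> \<Longrightarrow> cmod (\<eta> z) \<le> K * decay \<epsilon> (cmod z)"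
    and h: "\<eta> holomorphic_on sector \<sigma>" using \<eta> by (auto simp: decaying_on_def)
  obtain c where c: "0 < c" "\<And>r m' \<alpha>' \<beta>'. 0 < r \<Longrightarrow> 0 < m' \<Longrightarrow> \<bar>\<alpha>'\<bar> = \<theta> \<Longrightarrow> \<bar>\<beta>'\<bar> = \<bar>\<beta>\<bar> \<Longrightarrow>
    c * r \<le> cmod (rcis r \<alpha>' - rcis m' \<beta>') \<and> c * m' \<le> cmod (rcis r \<alpha>' - rcis m' \<beta>')"
    using ray_dist[OF \<theta>(1) \<theta>(4,5)] by metis
  define k where "k \<alpha> r = \<eta> (rcis r \<alpha>) / (rcis r \<alpha> - rcis m \<beta>) * cis \<alpha>" for \<alpha> r
  have eq: "ray_weight \<alpha> \<eta> r / (rcis r \<alpha> - rcis m \<beta>) = - of_real (sgn \<alpha>) / (2 * of_real pi * \<i>) * k \<alpha> r" for \<alpha> r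
    by (simp add: ray_weight_def k_def)
  have int: "integrable lpos (k \<alpha>)" if "\<bar>\<alpha>\<bar> = \<theta>" for \<alpha>
    unfolding k_def
    by (rule kernel_integrable(1)[OF _ \<theta>(3) _ c(1) K(2,1) holomorphic_on_imp_continuous_on[OF h] K(3)])
       (use that \<theta> c(2)[OF _ \<theta>(6) that refl] in auto)
  show "integrable lpos (\<lambda>r. ray_weight \<alpha> \<eta> r / (rcis r \<alpha> - rcis m \<beta>))" if "\<bar>\<alpha>\<bar> = \<theta>" for \<alpha>
    unfolding eq by (intro integrable_mult_right int that)
  have "(LINT r|lpos. k (- \<theta>) r) - (LINT r|lpos. k \<theta> r) = 0"
    unfolding k_def by (rule sector_Cauchy_outside[OF \<theta> K(2,1) h K(3)])
  then show "(LINT r|lpos. ray_weight (- \<theta>) \<eta> r / (rcis r (- \<theta>) - rcis m \<beta>))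
      + (LINT r|lpos. ray_weight \<theta> \<eta> r / (rcis r \<theta> - rcis m \<beta>)) = 0"
    unfolding eq using \<theta>(1) by (simp add: sgn_if)
qed

text \<open>Cauchy's formula in the normalisation of \<open>ray_weight\<close>. It is used for the
  outer contour, with the point on the inner one.\<close>

lemma ray_weight_Cauchy_inside:
  assumes \<theta>: "0 < \<theta>" "\<theta> < \<sigma>" "\<sigma> \<le> pi" "\<bar>\<alpha>\<bar> < \<theta>" "0 < m" "\<alpha> \<noteq> 0" and \<eta>: "decaying_on \<sigma> \<eta>"
  shows "(LINT r|lpos. ray_weight (- \<theta>) \<eta> r * (1 / (rcis r (- \<theta>) - rcis m \<alpha>)))
      + (LINT r|lpos. ray_weight \<theta> \<eta> r * (1 / (rcis r \<theta> - rcis m \<alpha>))) = \<eta> (rcis m \<alpha>)"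
proof -
  obtain K \<epsilon> where K: "0 \<le> K" "0 < \<epsilon>" "\<And>z. z \<in> sector \<sigma> \<Longrightarrow> cmod (\<eta> z) \<le> K * decay \<epsilon> (cmod z)"
    and h: "\<eta> holomorphic_on sector \<sigma>" using \<eta> by (auto simp: decaying_on_def)
  define k where "k \<beta> r = \<eta> (rcis r \<beta>) / (rcis r \<beta> - rcis m \<alpha>) * cis \<beta>" for \<beta> r
  have eq: "ray_weight \<beta> \<eta> r * (1 / (rcis r \<beta> - rcis m \<alpha>)) = - of_real (sgn \<beta>) / (2 * of_real pi * \<i>) * k \<beta> r" for \<beta> r
    by (simp add: ray_weight_def k_def)
  have "(LINT r|lpos. k (- \<theta>) r) - (LINT r|lpos. k \<theta> r) = 2 * of_real pi * \<i> * \<eta> (rcis m \<alpha>)"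
    unfolding k_def by (rule sector_Cauchy_inside[OF \<theta> K(2,1) h K(3)])
  moreover have "(LINT r|lpos. ray_weight (- \<theta>) \<eta> r * (1 / (rcis r (- \<theta>) - rcis m \<alpha>)))
      + (LINT r|lpos. ray_weight \<theta> \<eta> r * (1 / (rcis r \<theta> - rcis m \<alpha>)))
      = ((LINT r|lpos. k (- \<theta>) r) - (LINT r|lpos. k \<theta> r)) / (2 * of_real pi * \<i>)"
    unfolding eq using \<theta>(1) by (simp add: sgn_if diff_divide_distrib)
  ultimately show ?thesis by simp
qed

lemma integrable_lincomb3:
  fixes f g h :: "'r \<Rightarrow> complex"
  assumes "integrable N f" "integrable N g" "integrable N h"
  shows "(LINT r|N. f r + a * g r + b * h r) = (LINT r|N. f r) + a * (LINT r|N. g r) + b * (LINT r|N. h r)"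
  using assms by simp

context Rs_sectorial_op
begin

text \<open>On each ray \<open>Res_ray_int\<close> produces a multiple of the resolvent applied to
  \<open>x\<close> itself. Since the point lies outside the contour, Cauchy's theorem cancels these
  multiples, and what remains represents the function \<eta> / (\<mu> - z) of the operator, applied
  to \<open>x\<close>.\<close>

lemma Res_fun_calc:
  assumes \<theta>: "\<tau> < \<theta>" "\<theta> < \<sigma>" "\<sigma> \<le> pi" "\<theta> < \<bar>\<beta>\<bar>" "\<bar>\<beta>\<bar> \<le> pi" "0 < m" and x: "x \<in> bfs M \<rho>" and \<eta>: "decaying_on \<sigma> \<eta>"
  shows "AE w in M. Res (rcis m \<beta>) (fun_calc M \<rho> D A \<theta> \<eta> x) w
    = (\<Sum>\<alpha>\<in>{- \<theta>, \<theta>}. ray_int (\<lambda>r. ray_weight \<alpha> \<eta> r / (rcis m \<beta> - rcis r \<alpha>)) (ray_family 1 \<alpha> x) w)"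
proof -
  define \<mu> where "\<mu> = rcis m \<beta>"
  have \<theta>0: "0 < \<theta>" using \<theta> \<tau> by simp
  have \<mu>: "\<mu> \<notin> closure (sector \<tau>)" unfolding \<mu>_def using \<theta> by (intro ray_notin) auto
  define I where "I \<alpha> = ray_int (ray_weight \<alpha> \<eta>) (ray_family 1 \<alpha> x)" for \<alpha>
  have g: "good_weight (ray_weight \<alpha> \<eta>)" if "\<bar>\<alpha>\<bar> = \<theta>" for \<alpha> using that \<theta> by (intro good_weight_ray[OF \<eta>]) auto
  have Ib: "I \<alpha> \<in> bfs M \<rho>" if "\<bar>\<alpha>\<bar> = \<theta>" for \<alpha>
    unfolding I_def using that \<theta>
    by (intro ray_int_bfs[OF good_ray_family[OF zero_less_one _ _ x]] good_weight_measurable good_weight_finite g) auto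
  note y = fun_calc_eq[OF \<theta>(1-3) x \<eta>, folded I_def]
  have t: "\<bar>- \<theta>\<bar> = \<theta>" "\<bar>\<theta>\<bar> = \<theta>" using \<theta>0 by auto
  have 1: "AE w in M. Res \<mu> (fun_calc M \<rho> D A \<theta> \<eta> x) w = Res \<mu> (\<lambda>w. I (- \<theta>) w + I \<theta> w) w"
    by (rule bounded_ops_cong_AE[OF Res_bounded[OF \<mu>] y(1) bfs_add[OF Ib[OF t(1)] Ib[OF t(2)]] y(2)])
  have 2: "AE w in M. Res \<mu> (\<lambda>w. I (- \<theta>) w + I \<theta> w) w = Res \<mu> (I (- \<theta>)) w + Res \<mu> (I \<theta>) w"
    by (rule bounded_opsD(2)[OF Res_bounded[OF \<mu>] Ib[OF t(1)] Ib[OF t(2)]])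
  note out = ray_weight_Cauchy_outside[OF \<theta>0 \<theta>(2-6) \<eta>]
  have 3: "AE w in M. Res \<mu> (I \<alpha>) w = (LINT r|lpos. ray_weight \<alpha> \<eta> r / (rcis r \<alpha> - \<mu>)) * Res \<mu> x w
      + ray_int (\<lambda>r. ray_weight \<alpha> \<eta> r / (\<mu> - rcis r \<alpha>)) (ray_family 1 \<alpha> x) w" if "\<bar>\<alpha>\<bar> = \<theta>" for \<alpha>
    unfolding I_def \<mu>_def
    by (rule Res_ray_int[OF _ _ \<theta>(5,6) x g[OF that] out(1)[OF that]]) (use that \<theta> in auto)
  have "AE w in M. Res \<mu> (fun_calc M \<rho> D A \<theta> \<eta> x) w
      = ((LINT r|lpos. ray_weight (- \<theta>) \<eta> r / (rcis r (- \<theta>) - \<mu>)) + (LINT r|lpos. ray_weight \<theta> \<eta> r / (rcis r \<theta> - \<mu>))) * Res \<mu> x w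
      + (ray_int (\<lambda>r. ray_weight (- \<theta>) \<eta> r / (\<mu> - rcis r (- \<theta>))) (ray_family 1 (- \<theta>) x) w
      + ray_int (\<lambda>r. ray_weight \<theta> \<eta> r / (\<mu> - rcis r \<theta>)) (ray_family 1 \<theta> x) w)"
    using 1 2 3[OF t(1)] 3[OF t(2)] by eventually_elim (simp add: algebra_simps)
  then show ?thesis using out(2) \<theta>0 by (simp add: \<mu>_def)
qed

text \<open>Multiplicativity of the calculus for two decaying functions. The dilated
  \<open>g\<close> is integrated over the outer contour of angle \<theta>'; each resolvent of
  \<open>fun_calc\<close> there is an integral over the inner contour of angle \<theta>. After
  Fubini, Cauchy's formula on the outer contour evaluates \<open>g\<close> at the points of the
  inner one.\<close>

lemma ray_int_fun_calc:
  assumes \<theta>: "\<tau> < \<theta>" "\<theta> < \<theta>'" "\<theta>' < \<sigma>" "\<sigma> \<le> pi" and c0: "0 < c0" and x: "x \<in> bfs M \<rho>"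
    and \<eta>: "decaying_on \<sigma> \<eta>" and g: "decaying_on \<sigma> g"
  shows "AE w in M. (\<Sum>\<beta>\<in>{- \<theta>', \<theta>'}. ray_int (ray_weight \<beta> g) (ray_family c0 \<beta> (fun_calc M \<rho> D A \<theta> \<eta> x)) w)
    = (\<Sum>\<alpha>\<in>{- \<theta>, \<theta>}. ray_int (\<lambda>r. ray_weight \<alpha> \<eta> r * g (rcis (c0 * r) \<alpha>)) (ray_family 1 \<alpha> x) w)"
proof -
  interpret L: sigma_finite_measure lpos by (rule sigma_finite_lpos)
  define y where "y = fun_calc M \<rho> D A \<theta> \<eta> x"
  have \<theta>0: "0 < \<theta>" "0 < \<theta>'" using \<theta> \<tau> by auto
  have \<theta>\<sigma>: "\<theta> < \<sigma>" using \<theta> by simp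
  have y: "y \<in> bfs M \<rho>" unfolding y_def by (rule fun_calc_eq(1)[OF \<theta>(1) \<theta>\<sigma> \<theta>(4) x \<eta>])
  obtain c where c: "0 < c" "\<And>r m \<alpha>' \<beta>'. 0 < r \<Longrightarrow> 0 < m \<Longrightarrow> \<bar>\<alpha>'\<bar> = \<theta> \<Longrightarrow> \<bar>\<beta>'\<bar> = \<theta>' \<Longrightarrow>
    c * r \<le> cmod (rcis r \<alpha>' - rcis m \<beta>') \<and> c * m \<le> cmod (rcis r \<alpha>' - rcis m \<beta>')"
  proof (rule ray_dist[OF \<theta>0(1) \<theta>(2)])
    show "\<theta>' \<le> pi" using \<theta> by simp
  qed blast
  \<comment> \<open>\<open>t\<close> runs on the outer contour, \<open>r\<close> on the inner one,
    and \<open>c0\<close> is the dilation applied to \<open>g\<close>.\<close>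
  define k where "k \<alpha> \<beta> t r = 1 / (rcis t \<beta> - rcis (c0 * r) \<alpha>)" for \<alpha> \<beta> t r
  define F where "F \<alpha> = ray_family 1 \<alpha> x" for \<alpha>
  define H where "H \<beta> = ray_family c0 \<beta> y" for \<beta>
  define u where "u \<alpha> w r = ray_weight \<alpha> \<eta> r * rep (F \<alpha>) r w" for \<alpha> w r
  have F: "good_family (F \<alpha>) (B ^ 2 * enn2real (bfs_norm \<rho> x))" if "\<alpha> \<in> {- \<theta>, \<theta>}" for \<alpha>
    unfolding F_def using \<theta> that \<theta>0 by (intro good_ray_family x) auto
  have H: "good_family (H \<beta>) (B ^ 2 * enn2real (bfs_norm \<rho> y))" if "\<beta> \<in> {- \<theta>', \<theta>'}" for \<beta>
    unfolding H_def using \<theta> that \<theta>0 c0 by (intro good_ray_family y) auto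
  have gw: "good_weight (ray_weight \<alpha> \<eta>)" if "\<alpha> \<in> {- \<theta>, \<theta>}" for \<alpha>
    using that \<theta> \<theta>0 by (intro good_weight_ray[OF \<eta>]) auto
  have gg: "good_weight (ray_weight \<beta> g)" if "\<beta> \<in> {- \<theta>', \<theta>'}" for \<beta>
    using that \<theta> \<theta>0 by (intro good_weight_ray[OF g]) auto
  have km: "(\<lambda>(t, r). k \<alpha> \<beta> t r) \<in> borel_measurable (lpos \<Otimes>\<^sub>M lpos)" for \<alpha> \<beta>
  proof -
    have [measurable]: "(\<lambda>t. rcis t \<beta>) \<in> borel_measurable lpos" "(\<lambda>r. rcis (c0 * r) \<alpha>) \<in> borel_measurable lpos"
      unfolding rcis_def by (intro continuous_imp_measurable_lpos continuous_intros)+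
    show ?thesis unfolding k_def by measurable
  qed
  have kle: "cmod (k \<alpha> \<beta> t r) \<le> 1 / (c * t)" if "\<alpha> \<in> {- \<theta>, \<theta>}" "\<beta> \<in> {- \<theta>', \<theta>'}" "0 < t" "0 < r" for \<alpha> \<beta> t r
  proof -
    have "c * t \<le> cmod (rcis (c0 * r) \<alpha> - rcis t \<beta>)"
      using c(2)[of "c0 * r" t \<alpha> \<beta>] that c0 \<theta>0 by auto
    then show ?thesis
      using that c(1) unfolding k_def norm_divide norm_one norm_minus_commute[of "rcis t \<beta>"] by (intro frac_le) auto
  qed
  have ui: "AE w in M. \<forall>\<alpha>\<in>{- \<theta>, \<theta>}. integrable lpos (u \<alpha> w)"
  proof (rule AE_finite_allI)
    show "AE w in M. integrable lpos (u \<alpha> w)" if "\<alpha> \<in> {- \<theta>, \<theta>}" for \<alpha>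
      unfolding u_def
      by (rule ray_int_AE_integrable[OF F[OF that] good_weight_measurable[OF gw[OF that]] good_weight_finite[OF gw[OF that]]])
  qed simp
  \<comment> \<open>The resolvent of \<open>y\<close> along the outer contour, expressed by
    \<open>Res_fun_calc\<close> through the resolvent of \<open>x\<close> along the inner
    contour.\<close>
  have rH: "AE w in M. \<forall>\<beta>\<in>{- \<theta>', \<theta>'}. AE t in lpos. rep (H \<beta>) t w = (\<Sum>\<alpha>\<in>{- \<theta>, \<theta>}. LINT r|lpos. u \<alpha> w r * k \<alpha> \<beta> t r)"
  proof (rule AE_finite_allI)
    fix \<beta> assume \<beta>: "\<beta> \<in> {- \<theta>', \<theta>'}"
    show "AE w in M. AE t in lpos. rep (H \<beta>) t w = (\<Sum>\<alpha>\<in>{- \<theta>, \<theta>}. LINT r|lpos. u \<alpha> w r * k \<alpha> \<beta> t r)"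
    proof (rule AE_rays_commute)
      show "sigma_finite_measure M" by (rule sigma_finite_measure_axioms)
      have m1: "(\<lambda>z. rep (H \<beta>) (fst z) (snd z)) \<in> borel_measurable (lpos \<Otimes>\<^sub>M M)"
        using good_rep_measurable[OF H[OF \<beta>]] by (simp add: split_beta')
      have m2: "(\<lambda>z. LINT r|lpos. u \<alpha> (snd z) r * k \<alpha> \<beta> (fst z) r) \<in> borel_measurable (lpos \<Otimes>\<^sub>M M)" if \<alpha>: "\<alpha> \<in> {- \<theta>, \<theta>}" for \<alpha>
      proof (rule L.borel_measurable_lebesgue_integral)
        have a1: "(\<lambda>q. k \<alpha> \<beta> (fst (fst q)) (snd q)) \<in> borel_measurable ((lpos \<Otimes>\<^sub>M M) \<Otimes>\<^sub>M lpos)"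
          using measurable_compose[OF measurable_Pair[OF measurable_compose[OF measurable_fst measurable_fst] measurable_snd] km[of \<alpha> \<beta>]] by simp
        have a2: "(\<lambda>q. rep (F \<alpha>) (snd q) (snd (fst q))) \<in> borel_measurable ((lpos \<Otimes>\<^sub>M M) \<Otimes>\<^sub>M lpos)"
          using measurable_compose[OF measurable_Pair[OF measurable_snd measurable_compose[OF measurable_fst measurable_snd]] good_rep_measurable[OF F[OF \<alpha>]]] by simp
        have a3: "(\<lambda>q. ray_weight \<alpha> \<eta> (snd q)) \<in> borel_measurable ((lpos \<Otimes>\<^sub>M M) \<Otimes>\<^sub>M lpos)"
          by (rule measurable_compose[OF measurable_snd good_weight_measurable[OF gw[OF \<alpha>]]])
        show "(\<lambda>(z, r). u \<alpha> (snd z) r * k \<alpha> \<beta> (fst z) r) \<in> borel_measurable ((lpos \<Otimes>\<^sub>M M) \<Otimes>\<^sub>M lpos)"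
          unfolding u_def split_beta' by (intro borel_measurable_times a1 a2 a3)
      qed
      have m3: "(\<lambda>z. \<Sum>\<alpha>\<in>{- \<theta>, \<theta>}. LINT r|lpos. u \<alpha> (snd z) r * k \<alpha> \<beta> (fst z) r) \<in> borel_measurable (lpos \<Otimes>\<^sub>M M)"
        by (intro borel_measurable_sum m2)
      show "{z \<in> space (lpos \<Otimes>\<^sub>M M). rep (H \<beta>) (fst z) (snd z) = (\<Sum>\<alpha>\<in>{- \<theta>, \<theta>}. LINT r|lpos. u \<alpha> (snd z) r * k \<alpha> \<beta> (fst z) r)} \<in> sets (lpos \<Otimes>\<^sub>M M)"
        using m1 m3 by measurable
      fix t :: real assume t: "0 < t"
      have tc: "0 < t / c0" using t c0 by simp
      have b: "\<theta> < \<bar>\<beta>\<bar>" "\<bar>\<beta>\<bar> \<le> pi" using \<beta> \<theta> \<theta>0 by auto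
      show "AE w in M. rep (H \<beta>) t w = (\<Sum>\<alpha>\<in>{- \<theta>, \<theta>}. LINT r|lpos. u \<alpha> w r * k \<alpha> \<beta> t r)"
        using rep_eq_AE[OF H[OF \<beta>] t] Res_fun_calc[OF \<theta>(1) \<theta>\<sigma> \<theta>(4) b tc x \<eta>]
      proof eventually_elim
        case (elim w)
        \<comment> \<open>The prefactor \<open>1 / c0\<close> of \<open>ray_family\<close> moves the
          dilation from the outer variable to the inner one.\<close>
        have ker: "1 / of_real c0 * (1 / (rcis (t / c0) \<beta> - rcis r \<alpha>)) = k \<alpha> \<beta> t r" for r \<alpha>
        proof -
          have "of_real c0 * (rcis (t / c0) \<beta> - rcis r \<alpha>) = rcis t \<beta> - rcis (c0 * r) \<alpha>"
            using c0 by (simp add: right_diff_distrib rcis_mult_real)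
          then show ?thesis unfolding k_def by (metis mult.right_neutral times_divide_times_eq)
        qed
        have "rep (H \<beta>) t w = of_real (1 / c0) * Res (rcis (t / c0) \<beta>) y w"
          using elim(1) by (simp add: H_def ray_family_def)
        also have "\<dots> = (\<Sum>\<alpha>\<in>{- \<theta>, \<theta>}. of_real (1 / c0) * ray_int (\<lambda>r. ray_weight \<alpha> \<eta> r / (rcis (t / c0) \<beta> - rcis r \<alpha>)) (F \<alpha>) w)"
          unfolding y_def elim(2) F_def by (rule sum_distrib_left)
        also have "\<dots> = (\<Sum>\<alpha>\<in>{- \<theta>, \<theta>}. LINT r|lpos. u \<alpha> w r * k \<alpha> \<beta> t r)"
        proof (rule sum.cong[OF refl])
          fix \<alpha>
          have "of_real (1 / c0) * ray_int (\<lambda>r. ray_weight \<alpha> \<eta> r / (rcis (t / c0) \<beta> - rcis r \<alpha>)) (F \<alpha>) w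
            = (LINT r|lpos. of_real (1 / c0) * (ray_weight \<alpha> \<eta> r / (rcis (t / c0) \<beta> - rcis r \<alpha>) * rep (F \<alpha>) r w))"
            unfolding ray_int_def by (rule integral_mult_right_zero[symmetric])
          also have "\<dots> = (LINT r|lpos. u \<alpha> w r * k \<alpha> \<beta> t r)"
            by (rule Bochner_Integration.integral_cong[OF refl]) (simp add: u_def ker[symmetric])
          finally show "of_real (1 / c0) * ray_int (\<lambda>r. ray_weight \<alpha> \<eta> r / (rcis (t / c0) \<beta> - rcis r \<alpha>)) (F \<alpha>) w
            = (LINT r|lpos. u \<alpha> w r * k \<alpha> \<beta> t r)" .
        qed
        finally show ?case .
      qed
    qed
  qed simp
  show ?thesis
    using ui rH AE_space
  proof eventually_elim
    case (elim w)
    note Fub = kernel_Fubini[OF elim(1)[rule_format] good_weight_measurable[OF gg] good_weight_finite[OF gg] km c(1) kle]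
    have 1: "ray_int (ray_weight \<beta> g) (H \<beta>) w = (\<Sum>\<alpha>\<in>{- \<theta>, \<theta>}. LINT r|lpos. u \<alpha> w r * (LINT t|lpos. ray_weight \<beta> g t * k \<alpha> \<beta> t r))"
      if \<beta>: "\<beta> \<in> {- \<theta>', \<theta>'}" for \<beta>
    proof -
      have int: "integrable lpos (\<lambda>t. ray_weight \<beta> g t * (LINT r|lpos. u \<alpha> w r * k \<alpha> \<beta> t r))" if "\<alpha> \<in> {- \<theta>, \<theta>}" for \<alpha>
        by (rule Fub(1)[OF that \<beta> \<beta> that \<beta>])
      have "ray_int (ray_weight \<beta> g) (H \<beta>) w = (LINT t|lpos. (\<Sum>\<alpha>\<in>{- \<theta>, \<theta>}. ray_weight \<beta> g t * (LINT r|lpos. u \<alpha> w r * k \<alpha> \<beta> t r)))"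
        unfolding ray_int_def
      proof (rule integral_cong_AE)
        show "(\<lambda>t. ray_weight \<beta> g t * rep (H \<beta>) t w) \<in> borel_measurable lpos"
          by (intro borel_measurable_times good_weight_measurable gg \<beta> rep_measurable1[OF good_familyD(3)[OF H[OF \<beta>]] elim(3)])
        show "(\<lambda>t. \<Sum>\<alpha>\<in>{- \<theta>, \<theta>}. ray_weight \<beta> g t * (LINT r|lpos. u \<alpha> w r * k \<alpha> \<beta> t r)) \<in> borel_measurable lpos"
          by (intro borel_measurable_sum borel_measurable_integrable int)
        show "AE t in lpos. ray_weight \<beta> g t * rep (H \<beta>) t w = (\<Sum>\<alpha>\<in>{- \<theta>, \<theta>}. ray_weight \<beta> g t * (LINT r|lpos. u \<alpha> w r * k \<alpha> \<beta> t r))"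
          using bspec[OF elim(2) \<beta>] by eventually_elim (simp only: sum_distrib_left)
      qed
      also have "\<dots> = (\<Sum>\<alpha>\<in>{- \<theta>, \<theta>}. LINT t|lpos. ray_weight \<beta> g t * (LINT r|lpos. u \<alpha> w r * k \<alpha> \<beta> t r))"
        by (intro Bochner_Integration.integral_sum int)
      also have "\<dots> = (\<Sum>\<alpha>\<in>{- \<theta>, \<theta>}. LINT r|lpos. u \<alpha> w r * (LINT t|lpos. ray_weight \<beta> g t * k \<alpha> \<beta> t r))"
        by (rule sum.cong[OF refl]) (rule Fub(3)[OF _ \<beta> \<beta> _ \<beta>])
      finally show ?thesis .
    qed
    have "(\<Sum>\<beta>\<in>{- \<theta>', \<theta>'}. ray_int (ray_weight \<beta> g) (H \<beta>) w)
      = (\<Sum>\<beta>\<in>{- \<theta>', \<theta>'}. \<Sum>\<alpha>\<in>{- \<theta>, \<theta>}. LINT r|lpos. u \<alpha> w r * (LINT t|lpos. ray_weight \<beta> g t * k \<alpha> \<beta> t r))"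
      by (rule sum.cong[OF refl]) (rule 1)
    also have "\<dots> = (\<Sum>\<alpha>\<in>{- \<theta>, \<theta>}. \<Sum>\<beta>\<in>{- \<theta>', \<theta>'}. LINT r|lpos. u \<alpha> w r * (LINT t|lpos. ray_weight \<beta> g t * k \<alpha> \<beta> t r))"
      by (rule sum.swap)
    also have "\<dots> = (\<Sum>\<alpha>\<in>{- \<theta>, \<theta>}. ray_int (\<lambda>r. ray_weight \<alpha> \<eta> r * g (rcis (c0 * r) \<alpha>)) (F \<alpha>) w)"
    proof (rule sum.cong[OF refl])
      fix \<alpha> assume \<alpha>: "\<alpha> \<in> {- \<theta>, \<theta>}"
      have int: "integrable lpos (\<lambda>r. u \<alpha> w r * (LINT t|lpos. ray_weight \<beta> g t * k \<alpha> \<beta> t r))" if "\<beta> \<in> {- \<theta>', \<theta>'}" for \<beta>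
        by (rule Fub(2)[OF \<alpha> that that \<alpha> that])
      have "(\<Sum>\<beta>\<in>{- \<theta>', \<theta>'}. LINT r|lpos. u \<alpha> w r * (LINT t|lpos. ray_weight \<beta> g t * k \<alpha> \<beta> t r))
        = (LINT r|lpos. (\<Sum>\<beta>\<in>{- \<theta>', \<theta>'}. u \<alpha> w r * (LINT t|lpos. ray_weight \<beta> g t * k \<alpha> \<beta> t r)))"
        by (rule Bochner_Integration.integral_sum[symmetric]) (rule int)
      also have "\<dots> = (LINT r|lpos. ray_weight \<alpha> \<eta> r * g (rcis (c0 * r) \<alpha>) * rep (F \<alpha>) r w)"
      proof (rule Bochner_Integration.integral_cong[OF refl])
        fix r assume "r \<in> space lpos"
        then have r: "0 < c0 * r" using c0 by simp
        \<comment> \<open>The inner point \<open>rcis (c0 * r) \<alpha>\<close> has the angle of the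
          inner contour, hence lies inside the outer one.\<close>
        have "(\<Sum>\<beta>\<in>{- \<theta>', \<theta>'}. LINT t|lpos. ray_weight \<beta> g t * k \<alpha> \<beta> t r) = g (rcis (c0 * r) \<alpha>)"
          using ray_weight_Cauchy_inside[OF \<theta>0(2) \<theta>(3,4) _ r _ g, of \<alpha>] \<alpha> \<theta> \<theta>0 by (auto simp: k_def)
        then show "(\<Sum>\<beta>\<in>{- \<theta>', \<theta>'}. u \<alpha> w r * (LINT t|lpos. ray_weight \<beta> g t * k \<alpha> \<beta> t r)) = ray_weight \<alpha> \<eta> r * g (rcis (c0 * r) \<alpha>) * rep (F \<alpha>) r w"
          unfolding sum_distrib_left[symmetric] by (simp add: u_def mult_ac)
      qed
      finally show "(\<Sum>\<beta>\<in>{- \<theta>', \<theta>'}. LINT r|lpos. u \<alpha> w r * (LINT t|lpos. ray_weight \<beta> g t * k \<alpha> \<beta> t r))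
        = ray_int (\<lambda>r. ray_weight \<alpha> \<eta> r * g (rcis (c0 * r) \<alpha>)) (F \<alpha>) w"
        by (simp only: ray_int_def)
    qed
    finally show ?case by (simp only: F_def H_def y_def)
  qed
qed

end

section \<open>The comparison estimate\<close>

lemma max_powr_mult_le_imp_decay:
  assumes "0 < r" "max (r powr \<epsilon>) (r powr (- \<epsilon>)) * a \<le> K"
  shows "a \<le> K * decay \<epsilon> r"
proof -
  have "max (r powr \<epsilon>) (r powr (- \<epsilon>)) * decay \<epsilon> r = r powr \<epsilon> * r powr (- \<epsilon>)"
    unfolding decay_def by (simp add: max_def min_def)
  also have "\<dots> = 1" using assms(1) by (simp add: powr_add[symmetric])
  finally have 1: "max (r powr \<epsilon>) (r powr (- \<epsilon>)) * decay \<epsilon> r = 1" .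
  have "a = a * (max (r powr \<epsilon>) (r powr (- \<epsilon>)) * decay \<epsilon> r)" by (simp only: 1 mult_1_right)
  also have "\<dots> = (max (r powr \<epsilon>) (r powr (- \<epsilon>)) * a) * decay \<epsilon> r" by (simp only: mult_ac)
  also have "\<dots> \<le> K * decay \<epsilon> r" by (rule mult_right_mono[OF assms(2)]) simp
  finally show ?thesis .
qed

lemma H0inf_decaying_on:
  assumes "\<phi> \<in> H0inf \<sigma>" "0 < \<sigma>"
  shows "decaying_on \<sigma> \<phi>"
proof -
  obtain \<epsilon> K where e: "0 < \<epsilon>" and K: "\<And>z. z \<in> sector \<sigma> \<Longrightarrow> max (cmod z powr \<epsilon>) (cmod z powr (- \<epsilon>)) * cmod (\<phi> z) \<le> K"
    using assms(1) by (auto simp: H0inf_def)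
  have "cmod (\<phi> z) \<le> max K 0 * decay \<epsilon> (cmod z)" if "z \<in> sector \<sigma>" for z
  proof -
    have "0 < cmod z" using sector_nonzero[OF assms(2) that] by simp
    then show ?thesis using K[OF that] by (intro max_powr_mult_le_imp_decay) auto
  qed
  then show ?thesis
    using assms(1) e unfolding decaying_on_def H0inf_def Hinf_def
    by (intro conjI exI[of _ "max K 0"] exI[of _ \<epsilon>]) auto
qed

lemma decaying_on_dilate:
  assumes "decaying_on \<sigma> \<phi>" "0 < t" "0 < \<sigma>"
  shows "decaying_on \<sigma> (\<lambda>z. \<phi> (of_real t * z))"
proof -
  obtain K \<epsilon> where K: "0 \<le> K" "0 < \<epsilon>" "\<And>z. z \<in> sector \<sigma> \<Longrightarrow> cmod (\<phi> z) \<le> K * decay \<epsilon> (cmod z)"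
    and h: "\<phi> holomorphic_on sector \<sigma>" using assms(1) by (auto simp: decaying_on_def)
  have sec: "of_real t * z \<in> sector \<sigma>" if "z \<in> sector \<sigma>" for z by (rule sector_mult_pos[OF that assms(2,3)])
  have "(\<phi> \<circ> (\<lambda>z. of_real t * z)) holomorphic_on sector \<sigma>"
    by (rule holomorphic_on_compose_gen[OF _ h]) (use sec in \<open>auto intro!: holomorphic_intros\<close>)
  then have "(\<lambda>z. \<phi> (of_real t * z)) holomorphic_on sector \<sigma>" by (simp add: comp_def)
  moreover have "cmod (\<phi> (of_real t * z)) \<le> (K * max t (1 / t) powr \<epsilon>) * decay \<epsilon> (cmod z)" if z: "z \<in> sector \<sigma>" for z
  proof -
    have "0 < cmod z" using sector_nonzero[OF assms(3) z] by simp
    have "cmod (\<phi> (of_real t * z)) \<le> K * decay \<epsilon> (t * cmod z)"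
      using K(3)[OF sec[OF z]] assms(2) by (simp add: norm_mult)
    also have "\<dots> \<le> K * (max t (1 / t) powr \<epsilon> * decay \<epsilon> (cmod z))"
      using assms(2) K \<open>0 < cmod z\<close> by (intro mult_left_mono decay_mult_le) auto
    finally show ?thesis by (simp add: mult.assoc)
  qed
  ultimately show ?thesis
    unfolding decaying_on_def using K(1,2)
    by (intro conjI exI[of _ "K * max t (1 / t) powr \<epsilon>"] exI[of _ \<epsilon>]) auto
qed

lemma limit_value_bound:
  fixes a b :: complex
  assumes "0 < \<epsilon>" and le: "\<And>u. 0 < u \<Longrightarrow> u \<le> 1 \<Longrightarrow> cmod ((a + b * of_real u) / (1 + of_real u)) \<le> K + L * u powr \<epsilon>"
  shows "cmod a \<le> K"
proof (rule tendsto_le)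
  have "((\<lambda>u. cmod ((a + b * of_real u) / (1 + of_real u))) \<longlongrightarrow> cmod ((a + b * of_real 0) / (1 + of_real 0))) (at_right 0)"
    by (intro tendsto_intros) auto
  then show "((\<lambda>u. cmod ((a + b * of_real u) / (1 + of_real u))) \<longlongrightarrow> cmod a) (at_right (0::real))" by simp
  have "((\<lambda>u::real. u powr \<epsilon>) \<longlongrightarrow> 0) (at_right 0)"
  proof (intro tendsto_zero_powrI[where b = \<epsilon>] tendsto_const)
    show "\<forall>\<^sub>F u in at_right 0. 0 \<le> (u::real)"
      using eventually_at_right_less[of "0::real"] by (rule eventually_mono) simp
  qed (use assms(1) in \<open>auto intro: tendsto_ident_at\<close>)
  then have "((\<lambda>u. K + L * u powr \<epsilon>) \<longlongrightarrow> K + L * 0) (at_right 0)" by (intro tendsto_intros)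
  then show "((\<lambda>u. K + L * u powr \<epsilon>) \<longlongrightarrow> K) (at_right (0::real))" by simp
  have "\<forall>\<^sub>F u in at_right (0::real). u \<in> {0<..<1}" by (rule eventually_at_right_real) simp
  then show "\<forall>\<^sub>F u in at_right (0::real). cmod ((a + b * of_real u) / (1 + of_real u)) \<le> K + L * u powr \<epsilon>"
    by eventually_elim (auto intro: le)
qed simp

text \<open>On the positive axis the rational part is bounded by \<open>K\<close> up to a decaying
  error. Letting \<open>r\<close> tend to 0 isolates \<open>a\<close>, and letting
  \<open>1 / r\<close> tend to 0 isolates \<open>b\<close>. The values at 0 and infinity are thus
  bounded without evaluating the limits behind \<open>val_zero\<close> and
  \<open>val_infinity\<close>.\<close>

lemma limit_values_bound:
  fixes f :: "complex \<Rightarrow> complex"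
  assumes "0 < \<sigma>" "\<sigma> \<le> pi" "0 < \<epsilon>" "0 \<le> L" and K: "\<And>z. z \<in> sector \<sigma> \<Longrightarrow> cmod (f z) \<le> K"
    and L: "\<And>z. z \<in> sector \<sigma> \<Longrightarrow> cmod (f z - (a + b * z) / (1 + z)) \<le> L * decay \<epsilon> (cmod z)"
  shows "cmod a \<le> K" "cmod b \<le> K"
proof -
  have le: "cmod ((a + b * of_real r) / (1 + of_real r)) \<le> K + L * decay \<epsilon> r" if r: "0 < r" for r
  proof -
    have z: "of_real r \<in> sector \<sigma>" using rcis_in_sector[OF r, of 0 \<sigma>] assms by (simp add: rcis_def)
    have "cmod ((a + b * of_real r) / (1 + of_real r)) \<le> cmod (f (of_real r)) + cmod (f (of_real r) - (a + b * of_real r) / (1 + of_real r))"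
      using norm_triangle_ineq4[of "f (of_real r)" "f (of_real r) - (a + b * of_real r) / (1 + of_real r)"] by simp
    then show ?thesis using K[OF z] L[OF z] r by simp
  qed
  show "cmod a \<le> K"
  proof (rule limit_value_bound[OF assms(3)])
    fix u :: real assume u: "0 < u" "u \<le> 1"
    have "L * decay \<epsilon> u \<le> L * u powr \<epsilon>" using assms(4) by (intro mult_left_mono) (simp_all add: decay_def)
    then show "cmod ((a + b * of_real u) / (1 + of_real u)) \<le> K + L * u powr \<epsilon>" using le[OF u(1)] by simp
  qed
  show "cmod b \<le> K"
  proof (rule limit_value_bound[OF assms(3)])
    fix u :: real assume u: "0 < u" "u \<le> 1"
    have u': "0 < 1 / u" using u by simp
    have "decay \<epsilon> (1 / u) \<le> (1 / u) powr (- \<epsilon>)" by (simp add: decay_def)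
    also have "\<dots> = u powr \<epsilon>" using u by (simp add: powr_minus powr_divide)
    finally have "L * decay \<epsilon> (1 / u) \<le> L * u powr \<epsilon>" using assms(4) by (intro mult_left_mono)
    moreover have "(a + b * of_real (1 / u)) / (1 + of_real (1 / u)) = (b + a * of_real u) / (1 + of_real u :: complex)"
    proof -
      have "1 + of_real u \<noteq> (0::complex)" using u by (simp add: complex_eq_iff)
      moreover have "1 + 1 / of_real u \<noteq> (0::complex)" using u by (simp add: complex_eq_iff field_simps)
      ultimately show ?thesis using u by (simp add: divide_simps) (simp add: algebra_simps)
    qed
    ultimately show "cmod ((b + a * of_real u) / (1 + of_real u)) \<le> K + L * u powr \<epsilon>"
      using le[OF u'] by simp
  qed
qed

lemma Ealg_holomorphic:
  assumes "f \<in> Ealg \<sigma>" "0 < \<sigma>" "\<sigma> \<le> pi"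
  shows "f holomorphic_on sector \<sigma>"
proof -
  obtain g a b where g: "g \<in> H0inf \<sigma>" and f: "\<And>z. z \<in> sector \<sigma> \<Longrightarrow> f z = g z + a * (1 / (1 + z)) + b"
    using assms(1) by (auto simp: Ealg_def)
  have nz: "1 + z \<noteq> 0" if "z \<in> sector \<sigma>" for z
  proof
    assume "1 + z = 0"
    then have "z = - 1" by (simp add: add_eq_0_iff)
    then show False using that assms by (auto simp: sector_def)
  qed
  have "g holomorphic_on sector \<sigma>" using g by (simp add: H0inf_def Hinf_def)
  then have "(\<lambda>z. g z + a * (1 / (1 + z)) + b) holomorphic_on sector \<sigma>"
    using nz by (intro holomorphic_intros) auto
  then show ?thesis by (rule holomorphic_transform) (simp add: f)
qed

lemma one_plus_sector_nz:
  assumes "z \<in> sector \<sigma>" "0 < \<sigma>"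
  shows "1 + z \<noteq> 0"
proof
  assume "1 + z = 0"
  then have "z = - 1" by (simp add: add_eq_0_iff)
  then show False using assms by (auto simp: sector_def)
qed

context Rs_sectorial_op
begin

text \<open>The rational part equals \<open>b + (a - b) / (1 + c0 * z)\<close>, and
  \<open>1 / (1 + c0 * z)\<close> is \<open>\<mu> / (\<mu> - z)\<close> for
  \<open>\<mu> = - 1 / c0\<close>, a point of the negative axis. Hence it acts on \<open>y\<close>
  as a multiple of the identity plus a multiple of one resolvent, and the decaying part
  \<open>g\<close> acts by the contour integral of \<open>ray_int_fun_calc\<close>.\<close>

lemma fun_calc_factor:
  assumes \<theta>: "\<tau> < \<theta>" "\<theta> < \<theta>'" "\<theta>' < \<sigma>" "\<sigma> \<le> pi" and c0: "0 < c0" and x: "x \<in> bfs M \<rho>"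
    and \<eta>: "decaying_on \<sigma> \<eta>" and g: "decaying_on \<sigma> g" and \<psi>: "decaying_on \<sigma> \<psi>"
    and eq: "\<And>z. z \<in> sector \<sigma> \<Longrightarrow> \<psi> z = (g (of_real c0 * z) + (a + b * (of_real c0 * z)) / (1 + of_real c0 * z)) * \<eta> z"
  defines "y \<equiv> fun_calc M \<rho> D A \<theta> \<eta> x" and "\<mu> \<equiv> rcis (1 / c0) pi"
  shows "AE w in M. fun_calc M \<rho> D A \<theta> \<psi> x w
    = (\<Sum>\<beta>\<in>{- \<theta>', \<theta>'}. ray_int (ray_weight \<beta> g) (ray_family c0 \<beta> y) w) + b * y w + (a - b) * (\<mu> * Res \<mu> y w)"
proof -
  have \<theta>0: "0 < \<theta>" "0 < \<theta>'" using \<theta> \<tau> by auto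
  have \<theta>\<sigma>: "\<theta> < \<sigma>" "\<theta> < \<bar>pi\<bar>" "\<bar>pi\<bar> \<le> pi" "0 < 1 / c0" using \<theta> c0 by auto
  have \<sigma>0: "0 < \<sigma>" using \<theta>0 \<theta>\<sigma> by simp
  define F where "F \<alpha> = ray_family 1 \<alpha> x" for \<alpha>
  define J1 where "J1 \<alpha> = ray_int (\<lambda>r. ray_weight \<alpha> \<eta> r * g (rcis (c0 * r) \<alpha>)) (F \<alpha>)" for \<alpha>
  define J2 where "J2 \<alpha> = ray_int (ray_weight \<alpha> \<eta>) (F \<alpha>)" for \<alpha>
  define J3 where "J3 \<alpha> = ray_int (\<lambda>r. ray_weight \<alpha> \<eta> r / (\<mu> - rcis r \<alpha>)) (F \<alpha>)" for \<alpha>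
  have F: "good_family (F \<alpha>) (B ^ 2 * enn2real (bfs_norm \<rho> x))" if "\<alpha> \<in> {- \<theta>, \<theta>}" for \<alpha>
    unfolding F_def using \<theta> that \<theta>0 by (intro good_ray_family x) auto
  have \<alpha>\<sigma>: "\<bar>\<alpha>\<bar> < \<sigma>" if "\<alpha> \<in> {- \<theta>, \<theta>}" for \<alpha> using that \<theta> \<theta>0 by auto
  have gw: "good_weight (ray_weight \<alpha> \<eta>)" if "\<alpha> \<in> {- \<theta>, \<theta>}" for \<alpha>
    by (rule good_weight_ray[OF \<eta> \<alpha>\<sigma>[OF that] \<theta>(4)])
  have gw1: "good_weight (\<lambda>r. ray_weight \<alpha> \<eta> r * g (rcis (c0 * r) \<alpha>))" if \<alpha>: "\<alpha> \<in> {- \<theta>, \<theta>}" for \<alpha>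
  proof -
    obtain K \<epsilon> where K: "0 \<le> K" "0 < \<epsilon>" "\<And>z. z \<in> sector \<sigma> \<Longrightarrow> cmod (g z) \<le> K * decay \<epsilon> (cmod z)"
      and h: "g holomorphic_on sector \<sigma>" using g by (auto simp: decaying_on_def)
    have sec: "rcis (c0 * r) \<alpha> \<in> sector \<sigma>" if "0 < r" for r
      using that c0 by (intro rcis_in_sector \<alpha>\<sigma>[OF \<alpha>] \<theta>(4)) simp
    show ?thesis
    proof (rule good_weight_mult_bounded[OF gw[OF \<alpha>]])
      have "continuous_on {0<..} (\<lambda>r. rcis (c0 * r) \<alpha>)" unfolding rcis_def by (intro continuous_intros)
      then show "continuous_on {0<..} (\<lambda>r. g (rcis (c0 * r) \<alpha>))"
        by (rule continuous_on_compose2[OF holomorphic_on_imp_continuous_on[OF h]]) (use sec in auto)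
      show "0 \<le> K" by fact
      fix r :: real assume r: "0 < r"
      have "cmod (g (rcis (c0 * r) \<alpha>)) \<le> K * decay \<epsilon> (cmod (rcis (c0 * r) \<alpha>))" by (rule K(3)[OF sec[OF r]])
      also have "\<dots> \<le> K * 1" using r c0 K by (intro mult_left_mono decay_le_1) auto
      finally show "cmod (g (rcis (c0 * r) \<alpha>)) \<le> K" by simp
    qed
  qed
  have gw3: "good_weight (\<lambda>r. ray_weight \<alpha> \<eta> r / (\<mu> - rcis r \<alpha>))" if "\<alpha> \<in> {- \<theta>, \<theta>}" for \<alpha>
    unfolding \<mu>_def using that \<theta>0 \<theta> c0 by (intro good_weight_kernel gw) auto
  have wt: "ray_weight \<alpha> \<psi> r = ray_weight \<alpha> \<eta> r * g (rcis (c0 * r) \<alpha>) + b * ray_weight \<alpha> \<eta> r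
      + ((a - b) * \<mu>) * (ray_weight \<alpha> \<eta> r / (\<mu> - rcis r \<alpha>))" if \<alpha>: "\<alpha> \<in> {- \<theta>, \<theta>}" and r: "0 < r" for \<alpha> r
  proof -
    define z where "z = rcis r \<alpha>"
    have z: "z \<in> sector \<sigma>" unfolding z_def by (rule rcis_in_sector[OF r \<alpha>\<sigma>[OF \<alpha>] \<theta>(4)])
    have cz: "of_real c0 * z = rcis (c0 * r) \<alpha>" unfolding z_def by (rule rcis_mult_real)
    have nz: "1 + of_real c0 * z \<noteq> 0" by (rule one_plus_sector_nz[OF sector_mult_pos[OF z c0 \<sigma>0] \<sigma>0])
    have mu: "\<mu> = - 1 / of_real c0" using c0 by (simp add: \<mu>_def rcis_def)
    have mz: "\<mu> - z = - (1 + of_real c0 * z) / of_real c0" using c0 by (simp add: mu field_simps)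
    have mznz: "\<mu> - z \<noteq> 0"
      unfolding mz divide_eq_0_iff neg_equal_0_iff_equal of_real_eq_0_iff using nz c0 by simp
    have q: "\<mu> / (\<mu> - z) = 1 / (1 + of_real c0 * z)" 
    proof -
      have "\<mu> * (1 + of_real c0 * z) = 1 * (\<mu> - z)" using c0 by (simp add: mu field_simps)
      then show ?thesis by (simp only: frac_eq_eq[OF mznz nz])
    qed
    have "(a + b * (of_real c0 * z)) / (1 + of_real c0 * z) = b + (a - b) * (1 / (1 + of_real c0 * z))"
      using nz by (simp add: divide_simps) (simp add: algebra_simps)
    then have "\<psi> z = (g (rcis (c0 * r) \<alpha>) + b + (a - b) * (\<mu> / (\<mu> - z))) * \<eta> z"
      using eq[OF z] unfolding q cz by (simp add: add.assoc)
    then show ?thesis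
      unfolding ray_weight_def z_def by (simp add: ring_distribs mult_ac add_divide_distrib diff_divide_distrib)
  qed
  have AEint: "AE w in M. integrable lpos (\<lambda>r. v r * rep (F \<alpha>) r w)" if "\<alpha> \<in> {- \<theta>, \<theta>}" "good_weight v" for \<alpha> v
    by (rule ray_int_AE_integrable[OF F[OF that(1)] good_weight_measurable[OF that(2)] good_weight_finite[OF that(2)]])
  have lin: "AE w in M. ray_int (ray_weight \<alpha> \<psi>) (F \<alpha>) w = J1 \<alpha> w + b * J2 \<alpha> w + ((a - b) * \<mu>) * J3 \<alpha> w"
    if \<alpha>: "\<alpha> \<in> {- \<theta>, \<theta>}" for \<alpha>
    using AEint[OF \<alpha> gw1[OF \<alpha>]] AEint[OF \<alpha> gw[OF \<alpha>]] AEint[OF \<alpha> gw3[OF \<alpha>]]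
  proof eventually_elim
    case (elim w)
    have "ray_int (ray_weight \<alpha> \<psi>) (F \<alpha>) w = (LINT r|lpos. ray_weight \<alpha> \<eta> r * g (rcis (c0 * r) \<alpha>) * rep (F \<alpha>) r w
        + b * (ray_weight \<alpha> \<eta> r * rep (F \<alpha>) r w) + ((a - b) * \<mu>) * (ray_weight \<alpha> \<eta> r / (\<mu> - rcis r \<alpha>) * rep (F \<alpha>) r w))"
      unfolding ray_int_def
      by (rule Bochner_Integration.integral_cong[OF refl]) (simp add: wt[OF \<alpha>] ring_distribs mult.assoc)
    also have "\<dots> = J1 \<alpha> w + b * J2 \<alpha> w + ((a - b) * \<mu>) * J3 \<alpha> w"
      unfolding J1_def J2_def J3_def ray_int_def by (rule integrable_lincomb3[OF elim])
    finally show ?case .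
  qed
  have t: "- \<theta> \<in> {- \<theta>, \<theta>}" "\<theta> \<in> {- \<theta>, \<theta>}" by auto
  have ne: "- \<theta> \<noteq> \<theta>" using \<theta>0 by simp
  note fc = fun_calc_eq(2)[OF \<theta>(1) \<theta>\<sigma>(1) \<theta>(4) x \<psi>, folded F_def]
  note fy = fun_calc_eq(2)[OF \<theta>(1) \<theta>\<sigma>(1) \<theta>(4) x \<eta>, folded F_def y_def, folded J2_def]
  note R = Res_fun_calc[OF \<theta>(1) \<theta>\<sigma>(1) \<theta>(4) \<theta>\<sigma>(2-4) x \<eta>, folded F_def y_def \<mu>_def, folded J3_def]
  note T = ray_int_fun_calc[OF \<theta> c0 x \<eta> g, folded F_def y_def, folded J1_def]
  show ?thesis
    using fc fy R T lin[OF t(1)] lin[OF t(2)]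
  proof eventually_elim
    case (elim w)
    show ?case
      unfolding elim(1,2,3,4,5,6) using ne by (simp add: algebra_simps)
  qed
qed

text \<open>Up to a factor of modulus 1, \<open>ray_family (c j) \<beta> (y j) r\<close> is
  \<open>1 / r\<close> times \<open>z j * Res (z j) (y j)\<close> with
  \<open>z j = rcis (r / c j) \<beta>\<close>. Different dilations merely select different points of
  the same ray, so a single \<open>\<R>\<^sub>s\<close> bound covers them all.\<close>

lemma ray_family_Rs:
  fixes n :: nat
  assumes \<beta>: "\<tau> < \<bar>\<beta>\<bar>" "\<bar>\<beta>\<bar> \<le> pi" and c: "\<And>j. j < n \<Longrightarrow> 0 < c j" and y: "\<And>j. j < n \<Longrightarrow> y j \<in> bfs M \<rho>" and r: "0 < r"
  shows "\<rho> (\<lambda>w. ls_norm s {..<n} (\<lambda>j. ennreal (cmod (ray_family (c j) \<beta> (y j) r w))))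
    \<le> (ennreal B * \<rho> (\<lambda>w. ls_norm s {..<n} (\<lambda>j. ennreal (cmod (y j w))))) * ennreal (1 / r)"
proof -
  define z where "z j = rcis (r / c j) \<beta>" for j
  have z: "z j \<notin> closure (sector \<tau>)" if "j < n" for j unfolding z_def using c[OF that] r by (intro ray_notin \<beta>) simp
  have zRm: "(\<lambda>w. ennreal (cmod (z j * Res (z j) (y j) w))) \<in> borel_measurable M" if "j < n" for j
    by (intro measurable_ennreal_cmod borel_measurable_times borel_measurable_const bfs_measurable Res_bfs z y that)
  have "\<rho> (\<lambda>w. ls_norm s {..<n} (\<lambda>j. ennreal (cmod (ray_family (c j) \<beta> (y j) r w))))
    = \<rho> (\<lambda>w. ennreal (1 / r) * ls_norm s {..<n} (\<lambda>j. ennreal (cmod (z j * Res (z j) (y j) w))))"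
  proof (rule arg_cong[where f = \<rho>], rule ext)
    fix w
    have "ls_norm s {..<n} (\<lambda>j. ennreal (cmod (ray_family (c j) \<beta> (y j) r w))) = ls_norm s {..<n} (\<lambda>j. ennreal (1 / r) * ennreal (cmod (z j * Res (z j) (y j) w)))"
    proof (rule ls_norm_cong)
      fix j assume "j \<in> {..<n}"
      then have cj: "0 < c j" using c by simp
      have "cmod (ray_family (c j) \<beta> (y j) r w) = 1 / r * cmod (z j * Res (z j) (y j) w)"
        using cj r by (simp add: ray_family_def z_def norm_mult norm_divide)
      then show "ennreal (cmod (ray_family (c j) \<beta> (y j) r w)) = ennreal (1 / r) * ennreal (cmod (z j * Res (z j) (y j) w))"
        using r by (simp only: ennreal_mult[symmetric] norm_ge_zero zero_le_divide_1_iff less_imp_le)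
    qed
    also have "\<dots> = ennreal (1 / r) * ls_norm s {..<n} (\<lambda>j. ennreal (cmod (z j * Res (z j) (y j) w)))"
      by (rule ls_norm_cmult[OF _ s]) simp
    finally show "ls_norm s {..<n} (\<lambda>j. ennreal (cmod (ray_family (c j) \<beta> (y j) r w)))
      = ennreal (1 / r) * ls_norm s {..<n} (\<lambda>j. ennreal (cmod (z j * Res (z j) (y j) w)))" .
  qed
  also have "\<dots> = ennreal (1 / r) * \<rho> (\<lambda>w. ls_norm s {..<n} (\<lambda>j. ennreal (cmod (z j * Res (z j) (y j) w))))"
    by (rule rho_cmult, rule ls_norm_measurable) (use zRm in auto)
  also have "\<dots> \<le> ennreal (1 / r) * (ennreal B * \<rho> (\<lambda>w. ls_norm s {..<n} (\<lambda>j. ennreal (cmod (y j w)))))"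
    by (rule mult_left_mono, rule Rs) (use z y in auto)
  finally show ?thesis by (simp only: mult.commute)
qed

text \<open>The \<open>\<R>\<^sub>s\<close>-bound for the whole family of functions of the operator.
  The constant is fixed before the dilations, the functions and the elements are given; only the
  common majorant of the \<open>g j\<close> and the common bound of the limit values enter
  it.\<close>

lemma Rs_factor_bound:
  assumes \<theta>': "\<tau> < \<theta>'" "\<theta>' < \<sigma>" "\<sigma> \<le> pi" and "0 < \<epsilon>" "0 \<le> K" "0 \<le> L"
  obtains C :: real where "0 < C"
    "\<And>(n::nat) c y g a b u. (\<And>j. j < n \<Longrightarrow> 0 < c j) \<Longrightarrow> (\<And>j. j < n \<Longrightarrow> y j \<in> bfs M \<rho>) \<Longrightarrow>
      (\<And>j z. j < n \<Longrightarrow> z \<in> sector \<sigma> \<Longrightarrow> cmod (g j z) \<le> K * decay \<epsilon> (cmod z)) \<Longrightarrow>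
      (\<And>j. j < n \<Longrightarrow> cmod (a j) \<le> L) \<Longrightarrow> (\<And>j. j < n \<Longrightarrow> cmod (b j) \<le> L) \<Longrightarrow>
      (\<And>j. j < n \<Longrightarrow> u j \<in> borel_measurable M) \<Longrightarrow>
      (\<And>j. j < n \<Longrightarrow> AE w in M. u j w = (\<Sum>\<beta>\<in>{- \<theta>', \<theta>'}. ray_int (ray_weight \<beta> (g j)) (ray_family (c j) \<beta> (y j)) w)
          + b j * y j w + (a j - b j) * (rcis (1 / c j) pi * Res (rcis (1 / c j) pi) (y j) w)) \<Longrightarrow>
      \<rho> (\<lambda>w. ls_norm s {..<n} (\<lambda>j. ennreal (cmod (u j w)))) \<le> ennreal C * \<rho> (\<lambda>w. ls_norm s {..<n} (\<lambda>j. ennreal (cmod (y j w))))"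
proof -
  define W where "W = (\<integral>\<^sup>+r. ennreal (K * decay \<epsilon> r) * ennreal (1 / r) \<partial>lpos)"
  have Wfin: "W < top"
    using nn_integral_decaying_finite[of "\<lambda>r. of_real (K * decay \<epsilon> r)" K \<epsilon>] assms(4,5)
    by (simp add: W_def norm_mult)
  \<comment> \<open>Each of the two rays contributes \<open>W * B\<close>; the multiples
    \<open>b j\<close> of the identity contribute \<open>L\<close>, the resolvent terms with
    \<open>cmod (a j - b j) \<le> 2 * L\<close> contribute \<open>2 * L * B\<close>. The summand 1
    ensures positivity.\<close>
  define C where "C = 2 * enn2real W * B + L + 2 * L * B + 1"
  have W: "W = ennreal (enn2real W)" using Wfin by simp
  have Cpos: "0 < C" using B \<open>0 \<le> L\<close> by (simp add: C_def add_nonneg_pos)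
  show thesis
  proof (rule that[OF Cpos])
    fix n :: nat and c :: "nat \<Rightarrow> real" and y :: "nat \<Rightarrow> 'a \<Rightarrow> complex" and g :: "nat \<Rightarrow> complex \<Rightarrow> complex"
      and a b :: "nat \<Rightarrow> complex" and u :: "nat \<Rightarrow> 'a \<Rightarrow> complex"
    assume c: "\<And>j. j < n \<Longrightarrow> 0 < c j" and y: "\<And>j. j < n \<Longrightarrow> y j \<in> bfs M \<rho>"
      and g: "\<And>j z. j < n \<Longrightarrow> z \<in> sector \<sigma> \<Longrightarrow> cmod (g j z) \<le> K * decay \<epsilon> (cmod z)"
      and a: "\<And>j. j < n \<Longrightarrow> cmod (a j) \<le> L" and b: "\<And>j. j < n \<Longrightarrow> cmod (b j) \<le> L"
      and um: "\<And>j. j < n \<Longrightarrow> u j \<in> borel_measurable M"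
      and u: "\<And>j. j < n \<Longrightarrow> AE w in M. u j w = (\<Sum>\<beta>\<in>{- \<theta>', \<theta>'}. ray_int (ray_weight \<beta> (g j)) (ray_family (c j) \<beta> (y j)) w)
          + b j * y j w + (a j - b j) * (rcis (1 / c j) pi * Res (rcis (1 / c j) pi) (y j) w)"
    define Y where "Y = \<rho> (\<lambda>w. ls_norm s {..<n} (\<lambda>j. ennreal (cmod (y j w))))"
    define wt where "wt r = ennreal (K * decay \<epsilon> r)" for r
    have wtm: "wt \<in> borel_measurable lpos" unfolding wt_def by (rule borel_measurable_lpos) measurable
    define N where "N \<beta> j w = (\<integral>\<^sup>+r. wt r * ennreal (cmod (rep (ray_family (c j) \<beta> (y j)) r w)) \<partial>lpos)" for \<beta> j w
    define \<mu> where "\<mu> j = rcis (1 / c j) pi" for j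
    define P where "P j w = ennreal L * ennreal (cmod (y j w))" for j w
    define Q where "Q j w = ennreal (2 * L) * ennreal (cmod (\<mu> j * Res (\<mu> j) (y j) w))" for j w
    have \<theta>0: "0 < \<theta>'" "\<theta>' \<le> pi" using \<theta>' \<tau> by auto
    have \<beta>: "\<tau> < \<bar>\<beta>\<bar>" "\<bar>\<beta>\<bar> \<le> pi" "\<bar>\<beta>\<bar> < \<sigma>" if "\<beta> \<in> {- \<theta>', \<theta>'}" for \<beta> using that \<theta>0 \<theta>' by auto
    have \<mu>: "\<mu> j \<notin> closure (sector \<tau>)" if "j < n" for j unfolding \<mu>_def using \<tau> c[OF that] by (intro ray_notin) auto
    have F: "good_family (ray_family (c j) \<beta> (y j)) (B ^ 2 * enn2real (bfs_norm \<rho> (y j)))" if "\<beta> \<in> {- \<theta>', \<theta>'}" "j < n" for \<beta> j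
      by (rule good_ray_family[OF c[OF that(2)] \<beta>(1,2)[OF that(1)] y[OF that(2)]])
    have Nm: "N \<beta> j \<in> borel_measurable M" if "\<beta> \<in> {- \<theta>', \<theta>'}" "j < n" for \<beta> j
      unfolding N_def[abs_def] by (rule nn_ray_int_measurable[OF F[OF that] wtm])
    have Rm: "(\<lambda>w. \<mu> j * Res (\<mu> j) (y j) w) \<in> borel_measurable M" if "j < n" for j
      by (intro bfs_measurable bfs_cmult Res_bfs \<mu> y that)
    have Pm: "P j \<in> borel_measurable M" if "j < n" for j
      unfolding P_def[abs_def] by (intro borel_measurable_times_ennreal borel_measurable_const measurable_ennreal_cmod bfs_measurable y that)
    have Qm: "Q j \<in> borel_measurable M" if "j < n" for j
      unfolding Q_def[abs_def] by (intro borel_measurable_times_ennreal borel_measurable_const measurable_ennreal_cmod Rm that)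
    have rN: "ennreal (cmod (ray_int (ray_weight \<beta> (g j)) (ray_family (c j) \<beta> (y j)) w)) \<le> N \<beta> j w"
      if \<beta>': "\<beta> \<in> {- \<theta>', \<theta>'}" and j: "j < n" for \<beta> j w
    proof -
      have "ennreal (cmod (ray_int (ray_weight \<beta> (g j)) (ray_family (c j) \<beta> (y j)) w))
        \<le> (\<integral>\<^sup>+r. ennreal (cmod (ray_weight \<beta> (g j) r)) * ennreal (cmod (rep (ray_family (c j) \<beta> (y j)) r w)) \<partial>lpos)"
        by (rule norm_ray_int_le)
      also have "\<dots> \<le> N \<beta> j w"
        unfolding N_def
      proof (intro nn_integral_mono mult_right_mono)
        fix r assume "r \<in> space lpos"
        then have r: "0 < r" by simp
        have "cmod (ray_weight \<beta> (g j) r) \<le> cmod (g j (rcis r \<beta>))" by (rule norm_ray_weight)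
        also have "\<dots> \<le> K * decay \<epsilon> (cmod (rcis r \<beta>))"
          by (rule g[OF j]) (rule rcis_in_sector[OF r \<beta>(3)[OF \<beta>'] \<theta>'(3)])
        finally show "ennreal (cmod (ray_weight \<beta> (g j) r)) \<le> wt r" using r by (simp add: wt_def ennreal_leI)
      qed simp
      finally show ?thesis .
    qed
    have t: "- \<theta>' \<in> {- \<theta>', \<theta>'}" "\<theta>' \<in> {- \<theta>', \<theta>'}" by auto
    have ne: "- \<theta>' \<noteq> \<theta>'" using \<theta>0 by simp
    have le: "AE w in M. \<forall>j\<in>{..<n}. ennreal (cmod (u j w)) \<le> N (- \<theta>') j w + (N \<theta>' j w + (P j w + Q j w))"
    proof (rule AE_finite_allI)
      fix j assume "j \<in> {..<n}"
      then have j: "j < n" by simp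
      show "AE w in M. ennreal (cmod (u j w)) \<le> N (- \<theta>') j w + (N \<theta>' j w + (P j w + Q j w))"
        using u[OF j]
      proof eventually_elim
        case (elim w)
        define X1 where "X1 = ray_int (ray_weight (- \<theta>') (g j)) (ray_family (c j) (- \<theta>') (y j)) w"
        define X2 where "X2 = ray_int (ray_weight \<theta>' (g j)) (ray_family (c j) \<theta>' (y j)) w"
        define X4 where "X4 = \<mu> j * Res (\<mu> j) (y j) w"
        have eq: "u j w = X1 + (X2 + (b j * y j w + (a j - b j) * X4))"
          using elim ne by (simp add: X1_def X2_def X4_def \<mu>_def add.assoc)
        have "cmod (b j * y j w) \<le> L * cmod (y j w)" unfolding norm_mult by (rule mult_right_mono[OF b[OF j]]) simp
        moreover have "cmod (a j - b j) \<le> 2 * L" using norm_triangle_ineq4[of "a j" "b j"] a[OF j] b[OF j] by linarith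
        then have "cmod ((a j - b j) * X4) \<le> 2 * L * cmod X4" unfolding norm_mult by (rule mult_right_mono) simp
        ultimately have "cmod (u j w) \<le> cmod X1 + (cmod X2 + (L * cmod (y j w) + 2 * L * cmod X4))"
          unfolding eq by (intro order_trans[OF norm_triangle_ineq] add_left_mono add_mono)
        then have "ennreal (cmod (u j w)) \<le> ennreal (cmod X1) + (ennreal (cmod X2) + (ennreal L * ennreal (cmod (y j w)) + ennreal (2 * L) * ennreal (cmod X4)))"
          using \<open>0 \<le> L\<close> by (simp add: ennreal_mult[symmetric] ennreal_plus[symmetric] ennreal_leI del: ennreal_plus)
        also have "\<dots> \<le> N (- \<theta>') j w + (N \<theta>' j w + (P j w + Q j w))"
          unfolding P_def Q_def X1_def X2_def X4_def by (intro add_mono rN t j order_refl)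
        finally show ?case .
      qed
    qed simp
    have add: "\<rho> (\<lambda>w. ls_norm s {..<n} (\<lambda>j. f j w + h j w)) \<le> \<rho> (\<lambda>w. ls_norm s {..<n} (\<lambda>j. f j w)) + \<rho> (\<lambda>w. ls_norm s {..<n} (\<lambda>j. h j w))"
      if f: "\<And>j. j < n \<Longrightarrow> f j \<in> borel_measurable M" and h: "\<And>j. j < n \<Longrightarrow> h j \<in> borel_measurable M" for f h :: "nat \<Rightarrow> 'a \<Rightarrow> ennreal"
    proof -
      have m: "(\<lambda>w. ls_norm s {..<n} (\<lambda>j. f j w)) \<in> borel_measurable M" "(\<lambda>w. ls_norm s {..<n} (\<lambda>j. h j w)) \<in> borel_measurable M"
        "(\<lambda>w. ls_norm s {..<n} (\<lambda>j. f j w + h j w)) \<in> borel_measurable M"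
        using f h by (auto intro!: ls_norm_measurable)
      have "\<rho> (\<lambda>w. ls_norm s {..<n} (\<lambda>j. f j w + h j w)) \<le> \<rho> (\<lambda>w. ls_norm s {..<n} (\<lambda>j. f j w) + ls_norm s {..<n} (\<lambda>j. h j w))"
        by (rule rho_mono') (use m s in \<open>auto intro: ls_norm_triangle\<close>)
      also have "\<dots> \<le> \<rho> (\<lambda>w. ls_norm s {..<n} (\<lambda>j. f j w)) + \<rho> (\<lambda>w. ls_norm s {..<n} (\<lambda>j. h j w))"
        by (rule rho_triangle[OF m(1,2)])
      finally show ?thesis .
    qed
    have "\<rho> (\<lambda>w. ls_norm s {..<n} (\<lambda>j. ennreal (cmod (u j w))))
      \<le> \<rho> (\<lambda>w. ls_norm s {..<n} (\<lambda>j. N (- \<theta>') j w + (N \<theta>' j w + (P j w + Q j w))))"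
    proof (rule rho_mono)
      show "AE w in M. ls_norm s {..<n} (\<lambda>j. ennreal (cmod (u j w))) \<le> ls_norm s {..<n} (\<lambda>j. N (- \<theta>') j w + (N \<theta>' j w + (P j w + Q j w)))"
        using le by eventually_elim (rule ls_norm_mono[OF _ s], auto)
      show "(\<lambda>w. ls_norm s {..<n} (\<lambda>j. N (- \<theta>') j w + (N \<theta>' j w + (P j w + Q j w)))) \<in> borel_measurable M"
        by (rule ls_norm_measurable) (use Nm[OF t(1)] Nm[OF t(2)] Pm Qm in auto)
      show "(\<lambda>w. ls_norm s {..<n} (\<lambda>j. ennreal (cmod (u j w)))) \<in> borel_measurable M"
        by (rule ls_norm_measurable) (use um in auto)
    qed
    also have "\<dots> \<le> \<rho> (\<lambda>w. ls_norm s {..<n} (\<lambda>j. N (- \<theta>') j w)) + (\<rho> (\<lambda>w. ls_norm s {..<n} (\<lambda>j. N \<theta>' j w))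
      + (\<rho> (\<lambda>w. ls_norm s {..<n} (\<lambda>j. P j w)) + \<rho> (\<lambda>w. ls_norm s {..<n} (\<lambda>j. Q j w))))"
      by (intro order_trans[OF add] add_left_mono add borel_measurable_add Nm t Pm Qm order_refl)
    also have "\<dots> \<le> W * (ennreal B * Y) + (W * (ennreal B * Y) + (ennreal L * Y + ennreal (2 * L) * (ennreal B * Y)))"
    proof (intro add_mono)
      have NW: "\<rho> (\<lambda>w. ls_norm s {..<n} (\<lambda>j. N \<beta> j w)) \<le> W * (ennreal B * Y)" if \<beta>': "\<beta> \<in> {- \<theta>', \<theta>'}" for \<beta>
        unfolding N_def W_def wt_def[symmetric] Y_def
        by (rule rho_ls_rep_le[OF _ s F[OF \<beta>'] wtm ray_family_Rs[OF \<beta>(1,2)[OF \<beta>'] c y]]) auto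
      show "\<rho> (\<lambda>w. ls_norm s {..<n} (\<lambda>j. N (- \<theta>') j w)) \<le> W * (ennreal B * Y)" by (rule NW[OF t(1)])
      show "\<rho> (\<lambda>w. ls_norm s {..<n} (\<lambda>j. N \<theta>' j w)) \<le> W * (ennreal B * Y)" by (rule NW[OF t(2)])
      have "\<rho> (\<lambda>w. ls_norm s {..<n} (\<lambda>j. P j w)) = \<rho> (\<lambda>w. ennreal L * ls_norm s {..<n} (\<lambda>j. ennreal (cmod (y j w))))"
        unfolding P_def by (simp add: ls_norm_cmult[OF _ s])
      also have "\<dots> = ennreal L * Y" unfolding Y_def
        by (rule rho_cmult, rule ls_norm_measurable) (use bfs_measurable[OF y] in auto)
      finally show "\<rho> (\<lambda>w. ls_norm s {..<n} (\<lambda>j. P j w)) \<le> ennreal L * Y" by simp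
      have "\<rho> (\<lambda>w. ls_norm s {..<n} (\<lambda>j. Q j w)) = \<rho> (\<lambda>w. ennreal (2 * L) * ls_norm s {..<n} (\<lambda>j. ennreal (cmod (\<mu> j * Res (\<mu> j) (y j) w))))"
        unfolding Q_def by (subst ls_norm_cmult[OF _ s]) auto
      also have "\<dots> = ennreal (2 * L) * \<rho> (\<lambda>w. ls_norm s {..<n} (\<lambda>j. ennreal (cmod (\<mu> j * Res (\<mu> j) (y j) w))))"
        by (rule rho_cmult, rule ls_norm_measurable) (use measurable_ennreal_cmod[OF Rm] in auto)
      also have "\<dots> \<le> ennreal (2 * L) * (ennreal B * Y)"
        unfolding Y_def by (rule mult_left_mono, rule Rs) (use \<mu> y in auto)
      finally show "\<rho> (\<lambda>w. ls_norm s {..<n} (\<lambda>j. Q j w)) \<le> ennreal (2 * L) * (ennreal B * Y)" .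
    qed
    also have "\<dots> = ennreal (2 * enn2real W * B + L + 2 * L * B) * Y"
    proof -
      define V where "V = enn2real W"
      have V: "0 \<le> V" "W = ennreal V" using W by (auto simp: V_def)
      have "ennreal (2 * V * B + L + 2 * L * B) = W * ennreal B + (W * ennreal B + (ennreal L + ennreal (2 * L) * ennreal B))"
        using V B \<open>0 \<le> L\<close> by (simp add: ennreal_mult[symmetric] ennreal_plus[symmetric] del: ennreal_plus)
      then show ?thesis unfolding V_def[symmetric] by (simp add: ring_distribs mult.assoc)
    qed
    also have "\<dots> \<le> ennreal C * Y" by (intro mult_right_mono ennreal_leI) (simp_all add: C_def)
    finally show "\<rho> (\<lambda>w. ls_norm s {..<n} (\<lambda>j. ennreal (cmod (u j w)))) \<le> ennreal C * \<rho> (\<lambda>w. ls_norm s {..<n} (\<lambda>j. ennreal (cmod (y j w))))"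
      by (simp only: Y_def)
  qed
qed

text \<open>\<open>fun_calc_factor\<close> is used with \<phi> dilated by \<open>t' j\<close> in the
  role of \<eta> and \<phi> dilated by \<open>t j\<close> in the role of \<psi>. The quotient
  relation supplies the factor between them, and \<open>Rs_factor_bound\<close> is uniform over all
  such factors.\<close>

lemma fun_calc_dil_comparison:
  assumes \<theta>: "\<tau> < \<theta>" "\<theta> < \<sigma>" "\<sigma> \<le> pi" and \<phi>: "decaying_on \<sigma> \<phi>" "0 \<notin> \<phi> ` sector \<sigma>"
    and \<F>: "\<F> \<subseteq> Ealg \<sigma>" and "0 < \<epsilon>"
    and K: "\<And>f z. f \<in> \<F> \<Longrightarrow> z \<in> sector \<sigma> \<Longrightarrow> cmod (f z) \<le> K"
    and L: "\<And>f z. f \<in> \<F> \<Longrightarrow> z \<in> sector \<sigma> \<Longrightarrow>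
      max (cmod z powr \<epsilon>) (cmod z powr (- \<epsilon>)) * cmod (f z - (val_zero \<sigma> f + val_infinity \<sigma> f * z) / (1 + z)) \<le> L"
  obtains C :: real where "0 < C"
    "\<And>(n::nat) t t' x. x \<in> bfs M \<rho> \<Longrightarrow> (\<And>j. j < n \<Longrightarrow> 0 < t j \<and> 0 < t' j \<and>
        (\<exists>f\<in>\<F>. \<exists>r::real. r > 0 \<and> (\<forall>z\<in>sector \<sigma>. \<phi> (of_real (t j) * z) / \<phi> (of_real (t' j) * z) = f (of_real r * z)))) \<Longrightarrow>
      \<rho> (\<lambda>w. ls_norm s {..<n} (\<lambda>j. ennreal (cmod (fun_calc_dil M \<rho> D A \<theta> \<phi> (t j) x w))))
        \<le> ennreal C * \<rho> (\<lambda>w. ls_norm s {..<n} (\<lambda>j. ennreal (cmod (fun_calc_dil M \<rho> D A \<theta> \<phi> (t' j) x w))))"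
proof -
  \<comment> \<open>Any angle strictly between \<theta> and \<sigma> would do for the outer
    contour.\<close>
  define \<theta>' where "\<theta>' = (\<theta> + \<sigma>) / 2"
  have \<theta>': "\<theta> < \<theta>'" "\<theta>' < \<sigma>" "\<tau> < \<theta>'" using \<theta> by (auto simp: \<theta>'_def)
  have \<sigma>0: "0 < \<sigma>" using \<theta> \<tau> by simp
  define K' where "K' = max K 0"
  define L' where "L' = max L 0"
  have dec: "cmod (f z - (val_zero \<sigma> f + val_infinity \<sigma> f * z) / (1 + z)) \<le> L' * decay \<epsilon> (cmod z)" if "f \<in> \<F>" "z \<in> sector \<sigma>" for f z
    using L[OF that] sector_nonzero[OF \<sigma>0 that(2)] by (intro max_powr_mult_le_imp_decay) (auto simp: L'_def)
  have bd: "cmod (f z) \<le> K'" if "f \<in> \<F>" "z \<in> sector \<sigma>" for f z using K[OF that] by (simp add: K'_def)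
  have nn: "0 \<le> K'" "0 \<le> L'" by (auto simp: K'_def L'_def)
  obtain C where C: "0 < C"
    "\<And>(n::nat) c y g a b u. (\<And>j. j < n \<Longrightarrow> 0 < c j) \<Longrightarrow> (\<And>j. j < n \<Longrightarrow> y j \<in> bfs M \<rho>) \<Longrightarrow>
      (\<And>j z. j < n \<Longrightarrow> z \<in> sector \<sigma> \<Longrightarrow> cmod (g j z) \<le> L' * decay \<epsilon> (cmod z)) \<Longrightarrow>
      (\<And>j. j < n \<Longrightarrow> cmod (a j) \<le> K') \<Longrightarrow> (\<And>j. j < n \<Longrightarrow> cmod (b j) \<le> K') \<Longrightarrow>
      (\<And>j. j < n \<Longrightarrow> u j \<in> borel_measurable M) \<Longrightarrow>
      (\<And>j. j < n \<Longrightarrow> AE w in M. u j w = (\<Sum>\<beta>\<in>{- \<theta>', \<theta>'}. ray_int (ray_weight \<beta> (g j)) (ray_family (c j) \<beta> (y j)) w)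
          + b j * y j w + (a j - b j) * (rcis (1 / c j) pi * Res (rcis (1 / c j) pi) (y j) w)) \<Longrightarrow>
      \<rho> (\<lambda>w. ls_norm s {..<n} (\<lambda>j. ennreal (cmod (u j w)))) \<le> ennreal C * \<rho> (\<lambda>w. ls_norm s {..<n} (\<lambda>j. ennreal (cmod (y j w))))"
    by (rule Rs_factor_bound[OF \<theta>'(3,2) \<theta>(3) \<open>0 < \<epsilon>\<close> nn(2,1)]) blast
  show thesis
  proof (rule that[OF C(1)])
    fix n :: nat and t t' :: "nat \<Rightarrow> real" and x
    assume x: "x \<in> bfs M \<rho>" and rel: "\<And>j. j < n \<Longrightarrow> 0 < t j \<and> 0 < t' j \<and>
        (\<exists>f\<in>\<F>. \<exists>r::real. r > 0 \<and> (\<forall>z\<in>sector \<sigma>. \<phi> (of_real (t j) * z) / \<phi> (of_real (t' j) * z) = f (of_real r * z)))"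
    have "\<forall>j. \<exists>f r. j < n \<longrightarrow> f \<in> \<F> \<and> r > 0 \<and> (\<forall>z\<in>sector \<sigma>. \<phi> (of_real (t j) * z) / \<phi> (of_real (t' j) * z) = f (of_real r * z))"
      using rel by blast
    then obtain f c where fc: "\<And>j. j < n \<Longrightarrow> f j \<in> \<F>" "\<And>j. j < n \<Longrightarrow> (0::real) < c j"
      "\<And>j z. j < n \<Longrightarrow> z \<in> sector \<sigma> \<Longrightarrow> \<phi> (of_real (t j) * z) / \<phi> (of_real (t' j) * z) = f j (of_real (c j) * z)"
      by metis
    have t: "0 < t j" "0 < t' j" if "j < n" for j using rel[OF that] by auto
    define a where "a j = val_zero \<sigma> (f j)" for j
    define b where "b j = val_infinity \<sigma> (f j)" for j
    define g where "g j z = f j z - (a j + b j * z) / (1 + z)" for j z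
    have gd: "cmod (g j z) \<le> L' * decay \<epsilon> (cmod z)" if "j < n" "z \<in> sector \<sigma>" for j z
      using dec[OF fc(1)[OF that(1)] that(2)] by (simp add: g_def a_def b_def)
    have ab: "cmod (a j) \<le> K'" "cmod (b j) \<le> K'" if "j < n" for j
      using limit_values_bound[OF \<sigma>0 \<theta>(3) \<open>0 < \<epsilon>\<close> nn(2) bd[OF fc(1)[OF that]] dec[OF fc(1)[OF that]]]
      by (auto simp: a_def b_def)
    have gdec: "decaying_on \<sigma> (g j)" if "j < n" for j
    proof -
      have "f j holomorphic_on sector \<sigma>" using Ealg_holomorphic[OF _ \<sigma>0 \<theta>(3)] fc(1)[OF that] \<F> by blast
      then have "g j holomorphic_on sector \<sigma>"
        unfolding g_def[abs_def] by (intro holomorphic_intros) (auto dest: one_plus_sector_nz[OF _ \<sigma>0])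
      then show ?thesis unfolding decaying_on_def using gd[OF that] nn \<open>0 < \<epsilon>\<close> by blast
    qed
    have dil: "decaying_on \<sigma> (\<lambda>z. \<phi> (of_real (t j) * z))" "decaying_on \<sigma> (\<lambda>z. \<phi> (of_real (t' j) * z))" if "j < n" for j
      by (intro decaying_on_dilate[OF \<phi>(1)] t that \<sigma>0)+
    have yb: "fun_calc_dil M \<rho> D A \<theta> \<phi> (t j) x \<in> bfs M \<rho>" "fun_calc_dil M \<rho> D A \<theta> \<phi> (t' j) x \<in> bfs M \<rho>" if "j < n" for j
      unfolding fun_calc_dil_def by (rule fun_calc_eq(1)[OF \<theta> x dil(1)[OF that]], rule fun_calc_eq(1)[OF \<theta> x dil(2)[OF that]])
    show "\<rho> (\<lambda>w. ls_norm s {..<n} (\<lambda>j. ennreal (cmod (fun_calc_dil M \<rho> D A \<theta> \<phi> (t j) x w))))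
        \<le> ennreal C * \<rho> (\<lambda>w. ls_norm s {..<n} (\<lambda>j. ennreal (cmod (fun_calc_dil M \<rho> D A \<theta> \<phi> (t' j) x w))))"
    proof (rule C(2)[where c = c and g = g and a = a and b = b])
      fix j assume j: "j < n"
      show "0 < c j" by (rule fc(2)[OF j])
      show "fun_calc_dil M \<rho> D A \<theta> \<phi> (t' j) x \<in> bfs M \<rho>" by (rule yb(2)[OF j])
      show "cmod (g j z) \<le> L' * decay \<epsilon> (cmod z)" if "z \<in> sector \<sigma>" for z by (rule gd[OF j that])
      show "cmod (a j) \<le> K'" "cmod (b j) \<le> K'" by (rule ab[OF j])+
      show "fun_calc_dil M \<rho> D A \<theta> \<phi> (t j) x \<in> borel_measurable M" by (rule bfs_measurable[OF yb(1)[OF j]])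
      show "AE w in M. fun_calc_dil M \<rho> D A \<theta> \<phi> (t j) x w =
          (\<Sum>\<beta>\<in>{- \<theta>', \<theta>'}. ray_int (ray_weight \<beta> (g j)) (ray_family (c j) \<beta> (fun_calc_dil M \<rho> D A \<theta> \<phi> (t' j) x)) w)
          + b j * fun_calc_dil M \<rho> D A \<theta> \<phi> (t' j) x w
          + (a j - b j) * (rcis (1 / c j) pi * Res (rcis (1 / c j) pi) (fun_calc_dil M \<rho> D A \<theta> \<phi> (t' j) x) w)"
        unfolding fun_calc_dil_def
      proof (rule fun_calc_factor[OF \<theta>(1) \<theta>'(1,2) \<theta>(3) fc(2)[OF j] x dil(2)[OF j] gdec[OF j] dil(1)[OF j]])
        fix z assume z: "z \<in> sector \<sigma>"
        \<comment> \<open>Without zeros of \<phi> the quotient relation can be multiplied out to the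
          factorisation.\<close>
        have "\<phi> (of_real (t' j) * z) \<noteq> 0" using \<phi>(2) sector_mult_pos[OF z t(2)[OF j] \<sigma>0] by force
        then have "\<phi> (of_real (t j) * z) = f j (of_real (c j) * z) * \<phi> (of_real (t' j) * z)"
          using fc(3)[OF j z] by (simp add: field_simps)
        then show "\<phi> (of_real (t j) * z) = (g j (of_real (c j) * z) + (a j + b j * (of_real (c j) * z)) / (1 + of_real (c j) * z)) * \<phi> (of_real (t' j) * z)"
          by (simp add: g_def)
      qed
    qed
  qed
qed

end

section \<open>Discrete and continuous square functions\<close>

text \<open>Cells of equal length matter: the common factor \<open>1 / Suc n\<close> can be taken
  out of an \<open>\<ell>\<^sup>s\<close> norm later on.\<close>

lemma riemann_sum_unit:
  fixes f :: "real \<Rightarrow> real"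
  assumes f: "continuous_on {1..2} f"
  shows "(\<lambda>n. (1 / real (Suc n)) * (\<Sum>k<Suc n. f (1 + real k / real (Suc n)))) \<longlonglongrightarrow> integral {1..2} f"
proof (rule LIMSEQ_I)
  fix e :: real assume e: "0 < e"
  have "uniformly_continuous_on {1..2} f" by (rule compact_uniformly_continuous[OF f]) simp
  then obtain d where d: "0 < d" "\<And>x x'. x \<in> {1..2} \<Longrightarrow> x' \<in> {1..2} \<Longrightarrow> dist x' x < d \<Longrightarrow> dist (f x') (f x) < e / 2"
    using e unfolding uniformly_continuous_on_def by (metis half_gt_zero)
  obtain n0 where n0: "1 / real (Suc n0) < d" using d(1) reals_Archimedean by (auto simp: inverse_eq_divide)
  show "\<exists>n0. \<forall>n\<ge>n0. norm ((1 / real (Suc n)) * (\<Sum>k<Suc n. f (1 + real k / real (Suc n))) - integral {1..2} f) < e"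
  proof (intro exI[of _ n0] allI impI)
    fix n assume n: "n0 \<le> n"
    define N where "N = real (Suc n)"
    have N: "0 < N" "1 / N < d"
    proof -
      show "0 < N" by (simp add: N_def)
      have "1 / N \<le> 1 / real (Suc n0)" unfolding N_def using n by (intro divide_left_mono) auto
      then show "1 / N < d" using n0 by linarith
    qed
    define x where "x k = 1 + real k / N" for k
    have xm: "x k \<le> x (Suc k)" for k unfolding x_def using N by (simp add: divide_right_mono)
    have x1: "1 \<le> x k" for k unfolding x_def using N by simp
    have x2: "x k \<le> 2" if "k \<le> Suc n" for k unfolding x_def N_def using that by (simp add: divide_le_eq_1)
    have fi: "f integrable_on {a..b}" if "1 \<le> a" "b \<le> 2" for a b
      by (rule integrable_continuous_real, rule continuous_on_subset[OF f]) (use that in auto)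
    have split: "integral {1..x m} f = (\<Sum>k<m. integral {x k..x (Suc k)} f)" if "m \<le> Suc n" for m
      using that
    proof (induction m)
      case 0
      then show ?case by (simp add: x_def)
    next
      case (Suc m)
      have "integral {1..x (Suc m)} f = integral {1..x m} f + integral {x m..x (Suc m)} f"
        by (rule Henstock_Kurzweil_Integration.integral_combine[symmetric]) (use x1 xm x2[OF Suc.prems] fi in auto)
      then show ?case using Suc by simp
    qed
    have xl: "x (Suc n) = 2" by (simp add: x_def N_def)
    have each: "\<bar>f (x k) / N - integral {x k..x (Suc k)} f\<bar> \<le> e / 2 / N" if k: "k < Suc n" for k
    proof -
      have len: "x (Suc k) - x k = 1 / N" by (simp add: x_def add_divide_distrib)
      have k2: "x (Suc k) \<le> 2" using k by (intro x2) simp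
      have hi: "((\<lambda>y. f y - f (x k)) has_integral (integral {x k..x (Suc k)} f - (x (Suc k) - x k) * f (x k))) {x k..x (Suc k)}"
        using has_integral_diff[OF integrable_integral[OF fi[OF x1[of k] k2]] has_integral_const_real[of "f (x k)" "x k" "x (Suc k)"]] xm by simp
      have "norm (integral {x k..x (Suc k)} f - (x (Suc k) - x k) * f (x k)) \<le> e / 2 * measure lborel {x k..x (Suc k)}"
      proof (rule has_integral_bound_real[OF _ _ hi])
        show "0 \<le> e / 2" using e by simp
        show "finite {}" by simp
        fix y assume y: "y \<in> {x k..x (Suc k)} - {}"
        have "dist y (x k) < d" using y len N(2) by (auto simp: dist_real_def)
        then have "dist (f y) (f (x k)) < e / 2" using y x1[of k] k2 xm[of k] by (intro d(2)) auto
        then show "norm (f y - f (x k)) \<le> e / 2" by (simp add: dist_real_def)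
      qed
      then show ?thesis using xm[of k] by (simp add: len abs_minus_commute)
    qed
    have "(1 / N) * (\<Sum>k<Suc n. f (x k)) - integral {1..2} f = (\<Sum>k<Suc n. f (x k) / N - integral {x k..x (Suc k)} f)"
      using split[of "Suc n"] unfolding xl
      by (simp only: order_refl sum_subtractf sum_divide_distrib[symmetric] mult_1 times_divide_eq_left)
    then have "norm ((1 / N) * (\<Sum>k<Suc n. f (x k)) - integral {1..2} f) \<le> (\<Sum>k<Suc n. \<bar>f (x k) / N - integral {x k..x (Suc k)} f\<bar>)"
      using norm_sum[of "\<lambda>k. f (x k) / N - integral {x k..x (Suc k)} f" "{..<Suc n}"] by (simp only: real_norm_def)
    also have "\<dots> \<le> (\<Sum>k<Suc n. e / 2 / N)" by (rule sum_mono) (use each in auto)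
    also have "\<dots> = N * (e / 2 / N)" by (simp only: sum_constant card_lessThan N_def)
    also have "\<dots> = e / 2" using N(1) by simp
    also have "\<dots> < e" using e by simp
    finally show "norm ((1 / real (Suc n)) * (\<Sum>k<Suc n. f (1 + real k / real (Suc n))) - integral {1..2} f) < e"
      by (simp only: x_def N_def)
  qed
qed

lemma powi_2_less: "i < j \<Longrightarrow> (2::real) powi i < 2 powi j"
  by (rule power_int_strict_increasing) auto

lemma powi_2_le: "i \<le> j \<Longrightarrow> (2::real) powi i \<le> 2 powi j"
  by (rule power_int_increasing) auto

lemma indicator_dyadic_sum:
  fixes t :: real
  shows "a \<le> b \<Longrightarrow> (\<Sum>j\<in>{a..<b}. indicator {2 powi j..<2 powi (j + 1)} t :: ennreal) = indicator {2 powi a..<2 powi b} t"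
proof (induction b rule: int_ge_induct)
  case (step b)
  have "{a..<b + 1} = insert b {a..<b}" using step by auto
  then have "(\<Sum>j\<in>{a..<b + 1}. indicator {2 powi j..<2 powi (j + 1)} t :: ennreal)
    = indicator {2 powi b..<2 powi (b + 1)} t + indicator {2 powi a..<2 powi b} t"
    using step by simp
  also have "\<dots> = indicator {2 powi a..<2 powi (b + 1)} t"
    using powi_2_le[OF step(1)] powi_2_less[of b "b + 1"] by (auto simp: indicator_def)
  finally show ?case .
qed simp

definition dyadic_part :: "(real \<Rightarrow> ennreal) \<Rightarrow> int \<Rightarrow> ennreal" where
  "dyadic_part k j = (\<integral>\<^sup>+t. k t * ennreal (1 / t) * indicator {2 powi j..<2 powi (j + 1)} t \<partial>lborel)"

text \<open>The integral over one dyadic interval after rescaling to the unit scale, with the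
  bounded weight \<open>1 / u\<close> dropped so that Riemann sums have equal weights.\<close>

definition unit_part :: "(real \<Rightarrow> ennreal) \<Rightarrow> int \<Rightarrow> ennreal" where
  "unit_part k j = (\<integral>\<^sup>+u. k (2 powi j * u) * indicator {1..2} u \<partial>lborel)"

text \<open>The measure dt / t is invariant under the rescaling, and on the rescaled interval the
  density \<open>1 / u\<close> lies between 1/2 and 1. This is the origin of the factor 2 in the
  final constant.\<close>

lemma dyadic_part_unit_part:
  assumes [measurable]: "k \<in> borel_measurable borel"
  shows "dyadic_part k j \<le> unit_part k j" "unit_part k j \<le> 2 * dyadic_part k j"
proof -
  define c :: real where "c = 2 powi j"
  have c: "0 < c" by (simp add: c_def)
  have c2: "2 powi (j + 1) = c * 2" by (simp add: c_def power_int_add)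
  have "dyadic_part k j = ennreal \<bar>c\<bar> * (\<integral>\<^sup>+u. k (0 + c * u) * ennreal (1 / (0 + c * u)) * indicator {c..<c * 2} (0 + c * u) \<partial>lborel)"
    unfolding dyadic_part_def c2 c_def[symmetric] using c by (intro nn_integral_real_affine) auto
  also have "\<dots> = (\<integral>\<^sup>+u. ennreal c * (k (c * u) * ennreal (1 / (c * u)) * indicator {c..<c * 2} (c * u)) \<partial>lborel)"
    using c by (subst nn_integral_cmult) auto
  also have "\<dots> = (\<integral>\<^sup>+u. k (c * u) * ennreal (1 / u) * indicator {1..<2} u \<partial>lborel)"
  proof (rule nn_integral_cong)
    fix u :: real
    have ind: "indicator {c..<c * 2} (c * u) = (indicator {1..<2} u :: ennreal)"
      using c by (auto simp: indicator_def)
    show "ennreal c * (k (c * u) * ennreal (1 / (c * u)) * indicator {c..<c * 2} (c * u)) = k (c * u) * ennreal (1 / u) * indicator {1..<2} u"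
    proof (cases "u \<in> {1..<2}")
      case True
      then have "ennreal c * ennreal (1 / (c * u)) = ennreal (1 / u)" using c by (simp add: ennreal_mult[symmetric])
      then have "k (c * u) * (ennreal c * ennreal (1 / (c * u))) = k (c * u) * ennreal (1 / u)" by simp
      then show ?thesis unfolding ind using True by (simp add: mult_ac)
    qed (simp add: ind)
  qed
  finally have eq: "dyadic_part k j = (\<integral>\<^sup>+u. k (c * u) * ennreal (1 / u) * indicator {1..<2} u \<partial>lborel)" .
  show "dyadic_part k j \<le> unit_part k j"
    unfolding eq unit_part_def c_def[symmetric]
  proof (rule nn_integral_mono)
    fix u :: real
    show "k (c * u) * ennreal (1 / u) * indicator {1..<2} u \<le> k (c * u) * indicator {1..2} u"
    proof (cases "u \<in> {1..<2}")
      case True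
      then have "ennreal (1 / u) \<le> 1" by (simp add: ennreal_le_1)
      then have "k (c * u) * ennreal (1 / u) \<le> k (c * u) * 1" by (rule mult_left_mono) simp
      then show ?thesis using True by simp
    qed simp
  qed
  have "unit_part k j \<le> (\<integral>\<^sup>+u. 2 * (k (c * u) * ennreal (1 / u) * indicator {1..<2} u) \<partial>lborel)"
    unfolding unit_part_def c_def[symmetric]
  proof (rule nn_integral_mono_AE)
    \<comment> \<open>The rescaled dyadic interval is half-open and \<open>unit_part\<close> uses
      the closed one; they differ by a null set.\<close>
    have "AE u in lborel. u \<noteq> (2::real)" by (rule AE_lborel_singleton)
    then show "AE u in lborel. k (c * u) * indicator {1..2} u \<le> 2 * (k (c * u) * ennreal (1 / u) * indicator {1..<2} u)"
    proof eventually_elim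
      case (elim u)
      show ?case
      proof (cases "u \<in> {1..<2}")
        case True
        have "1 \<le> ennreal (2 * (1 / u))" using True by (simp add: ennreal_ge_1)
        also have "\<dots> = 2 * ennreal (1 / u)" using True by (subst ennreal_mult) auto
        finally have "k (c * u) * 1 \<le> k (c * u) * (2 * ennreal (1 / u))" by (rule mult_left_mono) simp
        then show ?thesis using True by (simp add: mult_ac)
      next
        case False
        then show ?thesis using elim by (auto simp: indicator_def)
      qed
    qed
  qed
  also have "\<dots> = 2 * dyadic_part k j" unfolding eq by (rule nn_integral_cmult) measurable
  finally show "unit_part k j \<le> 2 * dyadic_part k j" .
qed

text \<open>The half-open dyadic intervals partition the half-line; symmetric unions of them give an
  increasing limit, as the Fatou property requires.\<close>

lemma dyadic_decomposition:
  assumes [measurable]: "k \<in> borel_measurable borel"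
  shows "(\<integral>\<^sup>+t\<in>{0<..}. k t * ennreal (1 / t) \<partial>lborel) = (SUP J::nat. \<Sum>j\<in>{- int J..<int J}. dyadic_part k j)"
proof -
  have ind: "(SUP J::nat. indicator {2 powi (- int J)..<2 powi int J} t) = (indicator {0<..} t :: ennreal)" for t :: real
  proof (cases "0 < t")
    case True
    obtain n :: nat where n: "t < 2 ^ n" using real_arch_pow[of 2 t] by auto
    obtain m :: nat where m: "(1 / 2) ^ m < t" using real_arch_pow_inv[OF True, of "1/2"] by auto
    define J where "J = max n m"
    have "(2::real) ^ n \<le> 2 ^ J" by (rule power_increasing) (auto simp: J_def)
    then have "t < 2 powi int J" unfolding power_int_of_nat using n by linarith
    moreover have "2 powi (- int J) \<le> t"
    proof -
      have "(2::real) powi (- int J) = (1 / 2) ^ J" by (simp add: power_int_minus power_one_over inverse_eq_divide)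
      also have "\<dots> \<le> (1 / 2 :: real) ^ m" by (rule power_decreasing) (auto simp: J_def)
      finally show ?thesis using m by simp
    qed
    ultimately have "(1::ennreal) \<le> (SUP J::nat. indicator {2 powi (- int J)..<2 powi int J} t)"
      by (intro SUP_upper2[of J]) auto
    moreover have "(SUP J::nat. indicator {2 powi (- int J)..<2 powi int J} t) \<le> (1::ennreal)"
      by (intro SUP_least) (auto simp: indicator_def)
    ultimately show ?thesis using True by (intro antisym) auto
  next
    case False
    have "t \<notin> {2 powi (- int J)..<2 powi int J}" for J
    proof -
      have "(0::real) < 2 powi (- int J)" by (rule zero_less_power_int) simp
      then show ?thesis using False by (simp only: atLeastLessThan_iff) linarith
    qed
    then have "indicator {2 powi (- int J)..<2 powi int J} t = (0::ennreal)" for J by (rule indicator_simps(2))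
    then have "(SUP J::nat. indicator {2 powi (- int J)..<2 powi int J} t) = (SUP J::nat. 0 :: ennreal)"
      by (intro SUP_cong refl)
    then show ?thesis using False by simp
  qed
  have "(\<integral>\<^sup>+t\<in>{0<..}. k t * ennreal (1 / t) \<partial>lborel)
    = (\<integral>\<^sup>+t. (SUP J::nat. k t * ennreal (1 / t) * indicator {2 powi (- int J)..<2 powi int J} t) \<partial>lborel)"
    by (simp only: ind[symmetric] SUP_mult_left_ennreal)
  also have "\<dots> = (SUP J::nat. \<integral>\<^sup>+t. k t * ennreal (1 / t) * indicator {2 powi (- int J)..<2 powi int J} t \<partial>lborel)"
  proof (rule nn_integral_monotone_convergence_SUP)
    show "incseq (\<lambda>(J::nat) t. k t * ennreal (1 / t) * indicator {2 powi (- int J)..<2 powi int J} t)"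
    proof (intro incseq_SucI le_funI mult_left_mono)
      fix J :: nat and t :: real
      have "{2 powi (- int J)..<2 powi int J} \<subseteq> {2 powi (- int (Suc J))..<2 powi int (Suc J) :: real}"
        using powi_2_le[of "- int (Suc J)" "- int J"] powi_2_le[of "int J" "int (Suc J)"] by auto
      then show "indicator {2 powi (- int J)..<2 powi int J} t \<le> (indicator {2 powi (- int (Suc J))..<2 powi int (Suc J)} t :: ennreal)"
        by (auto simp: indicator_def)
    qed simp
  qed measurable
  also have "\<dots> = (SUP J::nat. \<Sum>j\<in>{- int J..<int J}. dyadic_part k j)"
  proof (intro SUP_cong refl)
    fix J :: nat
    have "(\<integral>\<^sup>+t. k t * ennreal (1 / t) * indicator {2 powi (- int J)..<2 powi int J} t \<partial>lborel)
      = (\<integral>\<^sup>+t. (\<Sum>j\<in>{- int J..<int J}. k t * ennreal (1 / t) * indicator {2 powi j..<2 powi (j + 1)} t) \<partial>lborel)"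
      by (simp add: indicator_dyadic_sum sum_distrib_left[symmetric])
    also have "\<dots> = (\<Sum>j\<in>{- int J..<int J}. dyadic_part k j)"
      unfolding dyadic_part_def by (rule nn_integral_sum) measurable
    finally show "(\<integral>\<^sup>+t. k t * ennreal (1 / t) * indicator {2 powi (- int J)..<2 powi int J} t \<partial>lborel)
      = (\<Sum>j\<in>{- int J..<int J}. dyadic_part k j)" .
  qed
  finally show ?thesis .
qed

lemma finite_int_subset: 
  assumes "finite (I :: int set)"
  obtains J :: nat where "I \<subseteq> {- int J..<int J}"
proof
  define J where "J = nat (Max (abs ` insert 0 I) + 1)"
  show "I \<subseteq> {- int J..<int J}"
  proof
    fix j assume "j \<in> I"
    then have "\<bar>j\<bar> \<le> Max (abs ` insert 0 I)" using assms by (intro Max_ge) auto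
    then show "j \<in> {- int J..<int J}" by (auto simp: J_def)
  qed
qed

lemma sum_dyadic_part_le:
  assumes "k \<in> borel_measurable borel" "finite I"
  shows "(\<Sum>j\<in>I. dyadic_part k j) \<le> (\<integral>\<^sup>+t\<in>{0<..}. k t * ennreal (1 / t) \<partial>lborel)"
proof -
  obtain J :: nat where "I \<subseteq> {- int J..<int J}" using finite_int_subset[OF assms(2)] .
  then have "(\<Sum>j\<in>I. dyadic_part k j) \<le> (\<Sum>j\<in>{- int J..<int J}. dyadic_part k j)" by (intro sum_mono2) auto
  also have "\<dots> \<le> (\<integral>\<^sup>+t\<in>{0<..}. k t * ennreal (1 / t) \<partial>lborel)"
    unfolding dyadic_decomposition[OF assms(1)] by (rule SUP_upper) simp
  finally show ?thesis .
qed

lemma ls_norm_le_UNIV: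
  assumes "1 \<le> s" "finite (I :: int set)"
  shows "ls_norm s I a \<le> ls_norm s UNIV a"
proof -
  obtain J :: nat where "I \<subseteq> {- int J..<int J}" using finite_int_subset[OF assms(2)] .
  then have "ls_norm s I a \<le> ls_norm s {- int J..<int J} a" using assms by (intro ls_norm_mono_set) auto
  also have "\<dots> \<le> ls_norm s UNIV a"
    unfolding ls_norm_int_SUP[OF assms(1)] by (rule SUP_upper) simp
  finally show ?thesis .
qed

lemma ls_norm_UNIV_measurable:
  assumes "1 \<le> s" "\<And>j. a j \<in> borel_measurable M"
  shows "(\<lambda>w. ls_norm s (UNIV :: int set) (\<lambda>j. a j w)) \<in> borel_measurable M"
  unfolding ls_norm_int_SUP[OF assms(1)] using assms by (intro borel_measurable_SUP ls_norm_measurable) auto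

text \<open>Repeating every entry \<open>Suc n\<close> times and normalising changes nothing. In a
  comparison between \<open>Suc n\<close> sample points per dyadic interval and a single value per
  interval, this evaluates the side with the single values.\<close>

lemma ls_norm_times_nat:
  assumes "1 \<le> s" "s \<noteq> top" "finite I"
  shows "ennpow (ennreal (1 / real (Suc n))) (1 / enn2real s) * ls_norm s (I \<times> {..<Suc n}) (\<lambda>i. a (fst i)) = ls_norm s I a"
proof -
  define p where "p = enn2real s"
  have p: "0 < 1 / p" using enn2real_ge_1[OF assms(1,2)] by (simp add: p_def)
  have "ennpow (ennreal (1 / real (Suc n))) (1 / p) * ls_norm s (I \<times> {..<Suc n}) (\<lambda>i. a (fst i))
    = ennpow (ennreal (1 / real (Suc n)) * (\<Sum>i\<in>I \<times> {..<Suc n}. ennpow (a (fst i)) p)) (1 / p)"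
    using assms by (simp add: ls_norm_finite p_def[symmetric] ennpow_mult[OF p])
  also have "(\<Sum>i\<in>I \<times> {..<Suc n}. ennpow (a (fst i)) p) = of_nat (Suc n) * (\<Sum>j\<in>I. ennpow (a j) p)"
    by (simp only: sum.cartesian_product' fst_conv sum_constant card_lessThan sum_distrib_left)
  also have "ennreal (1 / real (Suc n)) * (of_nat (Suc n) * (\<Sum>j\<in>I. ennpow (a j) p)) = (\<Sum>j\<in>I. ennpow (a j) p)"
  proof -
    have "ennreal (1 / real (Suc n)) * of_nat (Suc n) = ennreal (1 / real (Suc n)) * ennreal (real (Suc n))"
      by (simp only: ennreal_of_nat_eq_real_of_nat)
    also have "\<dots> = 1" by (subst ennreal_mult[symmetric]) auto
    finally show ?thesis by (simp only: mult.assoc[symmetric] mult_1)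
  qed
  finally show ?thesis using assms by (simp add: ls_norm_finite p_def)
qed

text \<open>Raised to the power \<open>s\<close>, the normalised norm over all sample points is a
  sum of equidistant Riemann sums, one for each dyadic interval.\<close>

lemma ls_norm_riemann_sum:
  fixes G :: "real \<Rightarrow> complex"
  assumes s: "1 \<le> s" "s \<noteq> top" and "finite I" and G: "continuous_on {0<..} G"
  shows "(\<lambda>n. ennpow (ennreal (1 / real (Suc n))) (1 / enn2real s) *
      ls_norm s (I \<times> {..<Suc n}) (\<lambda>i. ennreal (cmod (G (2 powi fst i * (1 + real (snd i) / real (Suc n)))))))
    \<longlonglongrightarrow> ennpow (\<Sum>j\<in>I. unit_part (\<lambda>t. ennpow (ennreal (cmod (G t))) (enn2real s)) j) (1 / enn2real s)"
proof -
  define p where "p = enn2real s"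
  have p: "1 \<le> p" "0 < p" "0 < 1 / p" using enn2real_ge_1[OF s] by (auto simp: p_def)
  define h where "h j u = cmod (G (2 powi j * u)) powr p" for j :: int and u
  have hc: "continuous_on {1..2} (h j)" for j
    unfolding h_def using p
  proof (intro continuous_on_powr' continuous_intros continuous_on_compose2[OF G] image_subsetI)
    fix u :: real assume "u \<in> {1..2}"
    then show "2 powi j * u \<in> {0<..}" by (simp add: mult_pos_pos)
  qed auto
  have hn: "0 \<le> h j u" for j u by (simp add: h_def)
  have up: "unit_part (\<lambda>t. ennpow (ennreal (cmod (G t))) p) j = ennreal (integral {1..2} (h j))" for j
  proof -
    have "unit_part (\<lambda>t. ennpow (ennreal (cmod (G t))) p) j = (\<integral>\<^sup>+u. ennreal (indicator {1..2} u * h j u) \<partial>lborel)"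
      unfolding unit_part_def by (intro nn_integral_cong) (auto simp: indicator_def ennpow_ennreal h_def)
    also have "\<dots> = ennreal (integral {1..2} (h j))"
      by (rule nn_integral_has_integral_lebesgue[OF hn]) (intro integrable_integral integrable_continuous_real hc)
    finally show ?thesis .
  qed
  define R where "R n = (\<Sum>j\<in>I. (1 / real (Suc n)) * (\<Sum>k<Suc n. h j (1 + real k / real (Suc n))))" for n
  have Rn: "0 \<le> R n" for n unfolding R_def by (intro sum_nonneg mult_nonneg_nonneg hn) auto
  have "R \<longlonglongrightarrow> (\<Sum>j\<in>I. integral {1..2} (h j))"
    unfolding R_def[abs_def] by (intro tendsto_sum riemann_sum_unit hc)
  then have "(\<lambda>n. R n powr (1 / p)) \<longlonglongrightarrow> (\<Sum>j\<in>I. integral {1..2} (h j)) powr (1 / p)"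
    by (rule tendsto_powr') (use p Rn in auto)
  then have lim: "(\<lambda>n. ennreal (R n powr (1 / p))) \<longlonglongrightarrow> ennreal ((\<Sum>j\<in>I. integral {1..2} (h j)) powr (1 / p))"
    by (rule tendsto_ennrealI)
  have 1: "ennpow (ennreal (1 / real (Suc n))) (1 / p) *
      ls_norm s (I \<times> {..<Suc n}) (\<lambda>i. ennreal (cmod (G (2 powi fst i * (1 + real (snd i) / real (Suc n)))))) = ennreal (R n powr (1 / p))" for n
  proof -
    have "(\<Sum>i\<in>I \<times> {..<Suc n}. ennpow (ennreal (cmod (G (2 powi fst i * (1 + real (snd i) / real (Suc n)))))) p)
      = (\<Sum>i\<in>I \<times> {..<Suc n}. ennreal (h (fst i) (1 + real (snd i) / real (Suc n))))"
      by (simp add: ennpow_ennreal h_def)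
    also have "\<dots> = ennreal (\<Sum>i\<in>I \<times> {..<Suc n}. h (fst i) (1 + real (snd i) / real (Suc n)))"
      by (rule sum_ennreal) (rule hn)
    finally have sum: "(\<Sum>i\<in>I \<times> {..<Suc n}. ennpow (ennreal (cmod (G (2 powi fst i * (1 + real (snd i) / real (Suc n)))))) p)
      = ennreal (\<Sum>i\<in>I \<times> {..<Suc n}. h (fst i) (1 + real (snd i) / real (Suc n)))" .
    have "ennpow (ennreal (1 / real (Suc n))) (1 / p) *
      ls_norm s (I \<times> {..<Suc n}) (\<lambda>i. ennreal (cmod (G (2 powi fst i * (1 + real (snd i) / real (Suc n))))))
      = ennpow (ennreal (1 / real (Suc n)) * ennreal (\<Sum>i\<in>I \<times> {..<Suc n}. h (fst i) (1 + real (snd i) / real (Suc n)))) (1 / p)"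
      using assms(3) s by (subst ls_norm_finite[OF _ s(2)]) (simp_all only: p_def[symmetric] sum ennpow_mult[OF p(3)] finite_cartesian_product finite_lessThan)
    also have "ennreal (1 / real (Suc n)) * ennreal (\<Sum>i\<in>I \<times> {..<Suc n}. h (fst i) (1 + real (snd i) / real (Suc n)))
      = ennreal ((1 / real (Suc n)) * (\<Sum>i\<in>I \<times> {..<Suc n}. h (fst i) (1 + real (snd i) / real (Suc n))))"
      by (rule ennreal_mult[symmetric]) (auto intro!: sum_nonneg hn)
    also have "(1 / real (Suc n)) * (\<Sum>i\<in>I \<times> {..<Suc n}. h (fst i) (1 + real (snd i) / real (Suc n))) = R n"
      unfolding R_def sum_distrib_left[symmetric] by (simp only: sum.cartesian_product' fst_conv snd_conv)
    finally show ?thesis by (simp add: ennpow_ennreal Rn)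
  qed
  have 2: "ennpow (\<Sum>j\<in>I. unit_part (\<lambda>t. ennpow (ennreal (cmod (G t))) p) j) (1 / p) = ennreal ((\<Sum>j\<in>I. integral {1..2} (h j)) powr (1 / p))"
  proof -
    have nn: "0 \<le> integral {1..2} (h j)" for j by (rule integral_nonneg[OF integrable_continuous_real[OF hc]]) (rule hn)
    show ?thesis unfolding up by (simp add: sum_ennreal nn ennpow_ennreal sum_nonneg)
  qed
  show ?thesis using lim unfolding p_def[symmetric] 1 2 .
qed

lemma ls_norm_ennreal_finite:
  assumes "finite I" "1 \<le> s" "s \<noteq> top"
  shows "ls_norm s I (\<lambda>j. ennreal (K j)) < top"
proof -
  have "ls_norm s I (\<lambda>j. ennreal (K j)) = ls_norm s I (\<lambda>j. ennreal (max 0 (K j)))"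
    by (rule ls_norm_cong) (auto simp: max_def ennreal_neg)
  also have "\<dots> < top"
    using assms by (simp add: ls_norm_finite ennpow_ennreal sum_ennreal sum_nonneg)
  finally show ?thesis .
qed

lemma measurable_section:
  assumes "(\<lambda>(t, w). G t w) \<in> borel_measurable (lborel \<Otimes>\<^sub>M M)" "w \<in> space M"
  shows "(\<lambda>t. G t w) \<in> borel_measurable borel"
  using measurable_compose[OF measurable_Pair2'[OF assms(2)] assms(1)] by simp

section \<open>The comparison for finite exponents\<close>

context banach_function_norm
begin

definition cont_sq :: "real \<Rightarrow> (real \<Rightarrow> 'a \<Rightarrow> complex) \<Rightarrow> 'a \<Rightarrow> ennreal" where
  "cont_sq p G w = ennpow (\<integral>\<^sup>+t\<in>{0<..}. ennpow (ennreal (cmod (G t w))) p * ennreal (1 / t) \<partial>lborel) (1 / p)"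

lemma joint_measurable_swap:
  fixes f :: "real \<Rightarrow> 'a \<Rightarrow> ennreal"
  assumes "(\<lambda>(t, w). f t w) \<in> borel_measurable (lborel \<Otimes>\<^sub>M M)"
  shows "(\<lambda>w. \<integral>\<^sup>+t. f t w \<partial>lborel) \<in> borel_measurable M"
proof (rule lborel.borel_measurable_nn_integral)
  show "(\<lambda>(w, t). f t w) \<in> borel_measurable (M \<Otimes>\<^sub>M lborel)"
    using measurable_compose[OF measurable_pair_swap' assms] by (simp add: split_beta')
qed

lemma cont_sq_measurable:
  assumes G: "(\<lambda>(t, w). G t w) \<in> borel_measurable (lborel \<Otimes>\<^sub>M M)"
  shows "cont_sq p G \<in> borel_measurable M"
  unfolding cont_sq_def[abs_def]
proof (rule measurable_ennpow, rule joint_measurable_swap)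
  have [measurable]: "(\<lambda>x. G (fst x) (snd x)) \<in> borel_measurable (lborel \<Otimes>\<^sub>M M)"
    using G by (simp add: split_beta')
  show "(\<lambda>(t, w). ennpow (ennreal (cmod (G t w))) p * ennreal (1 / t) * indicator {0<..} t) \<in> borel_measurable (lborel \<Otimes>\<^sub>M M)"
    unfolding split_beta' by (intro borel_measurable_times_ennreal measurable_ennpow) measurable
qed

text \<open>Two jointly measurable representatives agree, off a null set of points \<open>w\<close>,
  for almost all \<open>t\<close>. Therefore the representative chosen in
  \<open>continuous_sq_fun\<close> is immaterial.\<close>

lemma cont_sq_cong_AE:
  assumes G: "(\<lambda>(t, w). G t w) \<in> borel_measurable (lborel \<Otimes>\<^sub>M M)"
    and G': "(\<lambda>(t, w). G' t w) \<in> borel_measurable (lborel \<Otimes>\<^sub>M M)"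
    and eq: "\<And>t. 0 < t \<Longrightarrow> AE w in M. G t w = G' t w"
  shows "AE w in M. cont_sq p G w = cont_sq p G' w"
proof -
  interpret LM: pair_sigma_finite lborel M ..
  have "AE w in M. AE t in lborel. 0 < t \<longrightarrow> G t w = G' t w"
  proof (subst LM.AE_commute[symmetric])
    have [measurable]: "(\<lambda>x. G (fst x) (snd x)) \<in> borel_measurable (lborel \<Otimes>\<^sub>M M)"
      "(\<lambda>x. G' (fst x) (snd x)) \<in> borel_measurable (lborel \<Otimes>\<^sub>M M)"
      using G G' by (simp_all add: split_beta')
    show "{x \<in> space (lborel \<Otimes>\<^sub>M M). 0 < fst x \<longrightarrow> G (fst x) (snd x) = G' (fst x) (snd x)} \<in> sets (lborel \<Otimes>\<^sub>M M)"
      by measurable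
    show "AE t in lborel. AE w in M. 0 < t \<longrightarrow> G t w = G' t w"
    proof (rule AE_I2)
      fix t :: real
      show "AE w in M. 0 < t \<longrightarrow> G t w = G' t w" by (cases "0 < t") (use eq in auto)
    qed
  qed
  then show ?thesis
  proof eventually_elim
    case (elim w)
    have "(\<integral>\<^sup>+t\<in>{0<..}. ennpow (ennreal (cmod (G t w))) p * ennreal (1 / t) \<partial>lborel)
      = (\<integral>\<^sup>+t\<in>{0<..}. ennpow (ennreal (cmod (G' t w))) p * ennreal (1 / t) \<partial>lborel)"
      by (rule nn_integral_cong_AE) (use elim in \<open>eventually_elim, auto simp: indicator_def\<close>)
    then show ?case by (simp only: cont_sq_def)
  qed
qed

text \<open>\<open>comp1\<close> and \<open>comp2\<close> allow repeated dyadic exponents with free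
  sample points, so they apply directly to Riemann sums with \<open>Suc n\<close> points in each
  dyadic interval; the pairs index the interval and the point. The shifts by \<open>d\<close> do no
  harm, because the discrete norm runs over all integers.\<close>

lemma square_function_equivalence:
  assumes ac: "abs_continuous_norm M \<rho>" and s: "1 \<le> s" "s \<noteq> top"
    and v: "\<And>t. 0 < t \<Longrightarrow> v t \<in> borel_measurable M"
    and G: "(\<lambda>(t, w). G t w) \<in> borel_measurable (lborel \<Otimes>\<^sub>M M)"
    and Gv: "\<And>t. 0 < t \<Longrightarrow> AE w in M. G t w = v t w"
    and Gc: "AE w in M. continuous_on {0<..} (\<lambda>t. G t w)"
    and g: "g \<in> borel_measurable M" "\<rho> g < \<infinity>"
    and Gg: "\<And>j u w. u \<in> {1..2} \<Longrightarrow> ennreal (cmod (G (2 powi j * u) w)) \<le> ennreal (K j) * g w"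
    and comp1: "\<And>(I :: (int \<times> nat) set) t. finite I \<Longrightarrow> (\<And>i. i \<in> I \<Longrightarrow> t i \<in> {1..2}) \<Longrightarrow>
      \<rho> (\<lambda>w. ls_norm s I (\<lambda>i. ennreal (cmod (v (2 powi fst i * t i) w))))
        \<le> ennreal C * \<rho> (\<lambda>w. ls_norm s I (\<lambda>i. ennreal (cmod (v (2 powi (fst i - d)) w))))"
    and comp2: "\<And>(I :: (int \<times> nat) set) t. finite I \<Longrightarrow> (\<And>i. i \<in> I \<Longrightarrow> t i \<in> {1..2}) \<Longrightarrow>
      \<rho> (\<lambda>w. ls_norm s I (\<lambda>i. ennreal (cmod (v (2 powi (fst i + d)) w))))
        \<le> ennreal C * \<rho> (\<lambda>w. ls_norm s I (\<lambda>i. ennreal (cmod (v (2 powi fst i * t i) w))))"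
  shows "\<rho> (cont_sq (enn2real s) G) \<le> ennreal C * \<rho> (\<lambda>w. ls_norm s UNIV (\<lambda>j::int. ennreal (cmod (v (2 powi j) w))))"
    and "\<rho> (\<lambda>w. ls_norm s UNIV (\<lambda>j::int. ennreal (cmod (v (2 powi j) w)))) \<le> ennreal C * (2 * \<rho> (cont_sq (enn2real s) G))"
proof -
  define p where "p = enn2real s"
  have p: "1 \<le> p" "0 < p" "0 < 1 / p" using enn2real_ge_1[OF s] by (auto simp: p_def)
  define b where "b w t = ennpow (ennreal (cmod (G t w))) p" for w t
  have bm: "b w \<in> borel_measurable borel" if "w \<in> space M" for w
    unfolding b_def[abs_def] using measurable_section[OF G that]
    by (intro measurable_ennpow measurable_ennreal_cmod)
  have Gt: "G t \<in> borel_measurable M" for t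
  proof -
    have "(\<lambda>w. (\<lambda>(t, w). G t w) (t, w)) \<in> borel_measurable M"
      by (rule measurable_compose[OF measurable_Pair1' G]) simp
    then show ?thesis by simp
  qed
  \<comment> \<open>The width of a cell, after the root has been taken, so that it can stand in
    front of the norm.\<close>
  define \<kappa> where "\<kappa> n = ennpow (ennreal (1 / real (Suc n))) (1 / p)" for n
  define tt where "tt n i = 1 + real (snd i) / real (Suc n)" for n and i :: "int \<times> nat"
  have tt: "tt n i \<in> {1..2}" if "i \<in> I \<times> {..<Suc n}" for n i I
    using that by (auto simp: tt_def divide_le_eq_1)
  have tpos: "0 < 2 powi j * tt n i" if "i \<in> I \<times> {..<Suc n}" for n i I j
    using tt[OF that] by (intro mult_pos_pos) auto
  define R where "R I n w = \<kappa> n * ls_norm s (I \<times> {..<Suc n}) (\<lambda>i. ennreal (cmod (G (2 powi fst i * tt n i) w)))" for I n w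
  define U where "U I w = ennpow (\<Sum>j\<in>I. unit_part (b w) j) (1 / p)" for I w
  have Rm: "R I n \<in> borel_measurable M" if "finite I" for I n
    unfolding R_def[abs_def] using that
    by (intro borel_measurable_times_ennreal borel_measurable_const ls_norm_measurable measurable_ennreal_cmod Gt) auto
  have Um: "U I \<in> borel_measurable M" for I
    unfolding U_def[abs_def]
  proof (rule measurable_ennpow, rule borel_measurable_sum)
    fix j
    have "(\<lambda>(t, w). G (2 powi j * t) w) \<in> borel_measurable (lborel \<Otimes>\<^sub>M M)"
    proof -
      have "(\<lambda>t::real. 2 powi j * t) \<in> measurable lborel lborel" by simp
      then have "(\<lambda>x. ((2::real) powi j * fst x, snd x)) \<in> measurable (lborel \<Otimes>\<^sub>M M) (lborel \<Otimes>\<^sub>M M)"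
        by (intro measurable_Pair measurable_snd measurable_compose[OF measurable_fst])
      from measurable_compose[OF this G] show ?thesis by (simp add: split_beta')
    qed
    then have [measurable]: "(\<lambda>x. G (2 powi j * fst x) (snd x)) \<in> borel_measurable (lborel \<Otimes>\<^sub>M M)" by (simp add: split_beta')
    show "(\<lambda>w. unit_part (b w) j) \<in> borel_measurable M"
      unfolding unit_part_def b_def
    proof (rule joint_measurable_swap)
      show "(\<lambda>(t, w). ennpow (ennreal (cmod (G (2 powi j * t) w))) p * indicator {1..2} t) \<in> borel_measurable (lborel \<Otimes>\<^sub>M M)"
        unfolding split_beta' by (intro borel_measurable_times_ennreal measurable_ennpow) measurable
    qed
  qed
  have RU: "AE w in M. (\<lambda>n. R I n w) \<longlonglongrightarrow> U I w" if "finite I" for I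
    using Gc
  proof eventually_elim
    case (elim w)
    show ?case
      unfolding R_def \<kappa>_def tt_def U_def b_def p_def by (rule ls_norm_riemann_sum[OF s that elim])
  qed
  have vls: "(\<lambda>w. ls_norm s I (\<lambda>i. ennreal (cmod (v (t i) w)))) \<in> borel_measurable M" if "finite I" "\<And>i. i \<in> I \<Longrightarrow> 0 < t i" for I and t :: "'i \<Rightarrow> real"
    using that by (intro ls_norm_measurable measurable_ennreal_cmod v) auto
  have Rv: "\<rho> (R I n) = \<kappa> n * \<rho> (\<lambda>w. ls_norm s (I \<times> {..<Suc n}) (\<lambda>i. ennreal (cmod (v (2 powi fst i * tt n i) w))))"
    if I: "finite I" for I n
  proof -
    have "AE w in M. \<forall>i\<in>I \<times> {..<Suc n}. G (2 powi fst i * tt n i) w = v (2 powi fst i * tt n i) w"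
      by (rule AE_finite_allI) (use I Gv[OF tpos] in auto)
    then have "AE w in M. R I n w = \<kappa> n * ls_norm s (I \<times> {..<Suc n}) (\<lambda>i. ennreal (cmod (v (2 powi fst i * tt n i) w)))"
    proof eventually_elim
      case (elim w)
      have "ls_norm s (I \<times> {..<Suc n}) (\<lambda>i. ennreal (cmod (G (2 powi fst i * tt n i) w)))
        = ls_norm s (I \<times> {..<Suc n}) (\<lambda>i. ennreal (cmod (v (2 powi fst i * tt n i) w)))"
        by (rule ls_norm_cong) (simp only: elim[rule_format])
      then show ?case by (simp only: R_def)
    qed
    moreover have m: "(\<lambda>w. ls_norm s (I \<times> {..<Suc n}) (\<lambda>i. ennreal (cmod (v (2 powi fst i * tt n i) w)))) \<in> borel_measurable M"
      by (rule vls) (use I tpos in auto)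
    ultimately have "\<rho> (R I n) = \<rho> (\<lambda>w. \<kappa> n * ls_norm s (I \<times> {..<Suc n}) (\<lambda>i. ennreal (cmod (v (2 powi fst i * tt n i) w))))"
      by (intro rho_cong_AE Rm I borel_measurable_times_ennreal borel_measurable_const)
    then show ?thesis using rho_cmult[OF m] by simp
  qed
  have avg: "\<kappa> n * \<rho> (\<lambda>w. ls_norm s (I \<times> {..<Suc n}) (\<lambda>i. ennreal (cmod (v (2 powi (fst i + e)) w))))
    = \<rho> (\<lambda>w. ls_norm s I (\<lambda>j. ennreal (cmod (v (2 powi (j + e)) w))))" if I: "finite I" for I n e
  proof -
    have m: "(\<lambda>w. ls_norm s (I \<times> {..<Suc n}) (\<lambda>i. ennreal (cmod (v (2 powi (fst i + e)) w)))) \<in> borel_measurable M"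
      by (rule vls) (use I in auto)
    show ?thesis
      unfolding rho_cmult[OF m, symmetric] \<kappa>_def p_def
      by (subst ls_norm_times_nat[OF s I, where a = "\<lambda>j. ennreal (cmod (v (2 powi (j + e)) _))"]) (rule refl)
  qed
  define S where "S w = ls_norm s UNIV (\<lambda>j::int. ennreal (cmod (v (2 powi j) w)))" for w
  have Sm: "S \<in> borel_measurable M"
    unfolding S_def[abs_def] by (intro ls_norm_UNIV_measurable s measurable_ennreal_cmod v) simp
  have shift: "ls_norm s ((\<lambda>j. j + e) ` I) a = ls_norm s I (\<lambda>j. a (j + e))" if "finite I" for I :: "int set" and e a
    by (rule ls_norm_reindex) (use that in \<open>auto simp: bij_betw_def inj_on_def\<close>)
  have R_le: "\<rho> (R I n) \<le> ennreal C * \<rho> S" if I: "finite I" for I n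
  proof -
    have "\<rho> (R I n) \<le> \<kappa> n * (ennreal C * \<rho> (\<lambda>w. ls_norm s (I \<times> {..<Suc n}) (\<lambda>i. ennreal (cmod (v (2 powi (fst i + - d)) w)))))"
      unfolding Rv[OF I] using comp1[of "I \<times> {..<Suc n}" "tt n"] I tt by (intro mult_left_mono) auto
    also have "\<dots> = ennreal C * \<rho> (\<lambda>w. ls_norm s I (\<lambda>j. ennreal (cmod (v (2 powi (j + - d)) w))))"
      unfolding avg[OF I, of n, symmetric] by (rule mult.left_commute)
    also have "\<dots> \<le> ennreal C * \<rho> S"
    proof (rule mult_left_mono)
      show "\<rho> (\<lambda>w. ls_norm s I (\<lambda>j. ennreal (cmod (v (2 powi (j + - d)) w)))) \<le> \<rho> S"
      proof (rule rho_mono'[OF Sm])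
        show "(\<lambda>w. ls_norm s I (\<lambda>j. ennreal (cmod (v (2 powi (j + - d)) w)))) \<in> borel_measurable M"
          by (rule vls[OF I]) simp
        show "ls_norm s I (\<lambda>j. ennreal (cmod (v (2 powi (j + - d)) w))) \<le> S w" for w
          unfolding S_def shift[OF I, symmetric, where a = "\<lambda>j. ennreal (cmod (v (2 powi j) w))"]
          by (rule ls_norm_le_UNIV[OF s(1)]) (use I in simp)
      qed
    qed simp
    finally show ?thesis .
  qed
  have csm: "cont_sq p G \<in> borel_measurable M" by (rule cont_sq_measurable[OF G])
  define J where "J n = {- int n..<int n}" for n :: nat
  have Jf: "finite (J n)" for n by (simp add: J_def)
  have "\<rho> (cont_sq p G) \<le> \<rho> (\<lambda>w. SUP n. U (J n) w)"
  proof (rule rho_mono'[OF borel_measurable_SUP csm])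
    fix w assume w: "w \<in> space M"
    have "cont_sq p G w = (SUP n. ennpow (\<Sum>j\<in>J n. dyadic_part (b w) j) (1 / p))"
      unfolding cont_sq_def J_def using dyadic_decomposition[OF bm[OF w]]
      by (simp only: b_def ennpow_SUP[OF p(3)])
    also have "\<dots> \<le> (SUP n. U (J n) w)"
      unfolding U_def by (intro SUP_mono' ennpow_mono p sum_mono dyadic_part_unit_part bm w)
    finally show "cont_sq p G w \<le> (SUP n. U (J n) w)" .
  qed (auto intro: Um)
  also have "\<dots> = (SUP n. \<rho> (U (J n)))"
  proof (rule rho_SUP[OF Um])
    fix w
    show "incseq (\<lambda>n. U (J n) w)"
      unfolding U_def J_def by (intro monoI ennpow_mono p sum_mono2) auto
  qed
  also have "\<dots> \<le> ennreal C * \<rho> S"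
  proof (rule SUP_least)
    fix n
    have "\<rho> (U (J n)) \<le> \<rho> (\<lambda>w. liminf (\<lambda>m. R (J n) m w))"
    proof (rule rho_mono[OF borel_measurable_liminf Um])
      show "AE w in M. U (J n) w \<le> liminf (\<lambda>m. R (J n) m w)"
        using RU[OF Jf[of n]] by eventually_elim (simp add: lim_imp_Liminf)
    qed (rule Rm[OF Jf])
    also have "\<dots> \<le> liminf (\<lambda>m. \<rho> (R (J n) m))" by (rule rho_liminf) (rule Rm[OF Jf])
    also have "\<dots> \<le> liminf (\<lambda>m::nat. ennreal C * \<rho> S)" by (intro Liminf_mono always_eventually allI R_le Jf)
    also have "\<dots> = ennreal C * \<rho> S" by (simp add: Liminf_const)
    finally show "\<rho> (U (J n)) \<le> ennreal C * \<rho> S" .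
  qed
  finally show "\<rho> (cont_sq (enn2real s) G) \<le> ennreal C * \<rho> (\<lambda>w. ls_norm s UNIV (\<lambda>j::int. ennreal (cmod (v (2 powi j) w))))"
    by (simp only: S_def[abs_def] p_def)
  have U_le: "U I w \<le> 2 * cont_sq p G w" if I: "finite I" and w: "w \<in> space M" for I w
  proof -
    have "(\<Sum>j\<in>I. unit_part (b w) j) \<le> (\<Sum>j\<in>I. 2 * dyadic_part (b w) j)"
      by (intro sum_mono dyadic_part_unit_part bm w)
    also have "\<dots> = 2 * (\<Sum>j\<in>I. dyadic_part (b w) j)" by (rule sum_distrib_left[symmetric])
    also have "\<dots> \<le> 2 * (\<integral>\<^sup>+t\<in>{0<..}. b w t * ennreal (1 / t) \<partial>lborel)"
      by (intro mult_left_mono sum_dyadic_part_le bm w I) simp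
    finally have "U I w \<le> ennpow (2 * (\<integral>\<^sup>+t\<in>{0<..}. b w t * ennreal (1 / t) \<partial>lborel)) (1 / p)"
      unfolding U_def by (rule ennpow_mono[OF p(3)])
    also have "\<dots> = ennpow 2 (1 / p) * cont_sq p G w" by (simp only: cont_sq_def b_def ennpow_mult[OF p(3)])
    also have "\<dots> \<le> 2 * cont_sq p G w"
    proof (rule mult_right_mono)
      have "ennpow 2 (1 / p) = ennreal (2 powr (1 / p))" using ennpow_ennreal[of 2 "1 / p"] by simp
      also have "\<dots> \<le> ennreal (2 powr 1)" using p by (intro ennreal_leI powr_mono) (auto simp: divide_le_eq_1)
      finally show "ennpow 2 (1 / p) \<le> 2" by simp
    qed simp
    finally show ?thesis .
  qed
  have part: "\<rho> (\<lambda>w. ls_norm s (J m) (\<lambda>j. ennreal (cmod (v (2 powi j) w)))) \<le> ennreal C * (2 * \<rho> (cont_sq p G))" for m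
  proof -
    \<comment> \<open>Shifting the window by \<open>- d\<close> makes the left-hand side of
      \<open>comp2\<close> run over \<open>J m\<close> itself.\<close>
    define I where "I = (\<lambda>j. j - d) ` J m"
    have I: "finite I" unfolding I_def using Jf by simp
    have img: "J m = (\<lambda>j. j + d) ` I" unfolding I_def image_image by simp
    define q where "q = \<rho> (\<lambda>w. ls_norm s (J m) (\<lambda>j. ennreal (cmod (v (2 powi j) w))))"
    \<comment> \<open>The number \<open>q\<close> does not depend on \<open>n\<close>: repeated
      entries with normalisation give back the norm over \<open>I\<close>. Thus it bounds from below
      every member of a sequence of Riemann sums.\<close>
    have q: "q \<le> \<rho> (\<lambda>w. ennreal C * R I n w)" for n
    proof -
      have "q = \<rho> (\<lambda>w. ls_norm s I (\<lambda>j. ennreal (cmod (v (2 powi (j + d)) w))))"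
        unfolding q_def img shift[OF I] ..
      also have "\<dots> = \<kappa> n * \<rho> (\<lambda>w. ls_norm s (I \<times> {..<Suc n}) (\<lambda>i. ennreal (cmod (v (2 powi (fst i + d)) w))))"
        by (rule avg[OF I, symmetric])
      also have "\<dots> \<le> \<kappa> n * (ennreal C * \<rho> (\<lambda>w. ls_norm s (I \<times> {..<Suc n}) (\<lambda>i. ennreal (cmod (v (2 powi fst i * tt n i) w)))))"
        using comp2[of "I \<times> {..<Suc n}" "tt n"] I tt by (intro mult_left_mono) auto
      also have "\<dots> = ennreal C * \<rho> (R I n)" unfolding Rv[OF I] by (simp only: mult_ac)
      finally show ?thesis by (simp only: rho_cmult[OF Rm[OF I]])
    qed
    \<comment> \<open>On finitely many dyadic intervals all Riemann sums lie below one finite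
      multiple of \<open>g\<close>, the majorant needed for
      \<open>rho_dominated_limsup\<close>.\<close>
    define Z where "Z = ls_norm s I (\<lambda>j. ennreal (K j))"
    have Z: "Z < top" unfolding Z_def by (rule ls_norm_ennreal_finite[OF I s])
    have R_g: "R I n w \<le> Z * g w" for n w
    proof -
      have "R I n w \<le> \<kappa> n * ls_norm s (I \<times> {..<Suc n}) (\<lambda>i. g w * ennreal (K (fst i)))"
        unfolding R_def using I Gg[OF tt] by (intro mult_left_mono ls_norm_mono s) (auto simp: mult.commute)
      also have "\<dots> = ls_norm s I (\<lambda>j. g w * ennreal (K j))"
        unfolding \<kappa>_def p_def by (rule ls_norm_times_nat[OF s I, where a = "\<lambda>j. g w * ennreal (K j)"])
      also have "\<dots> = Z * g w" unfolding Z_def by (simp only: ls_norm_cmult[OF I s(1)] mult.commute)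
      finally show ?thesis .
    qed
    have "q = limsup (\<lambda>n::nat. q)" by (simp add: Limsup_const)
    also have "\<dots> \<le> limsup (\<lambda>n. \<rho> (\<lambda>w. ennreal C * R I n w))" by (intro Limsup_mono always_eventually allI q)
    also have "\<dots> \<le> \<rho> (\<lambda>w. ennreal C * U I w)"
    proof (rule rho_dominated_limsup[OF ac, where g = "\<lambda>w. ennreal C * (Z * g w)"])
      show "(\<lambda>w. ennreal C * R I n w) \<in> borel_measurable M" for n by (intro borel_measurable_times_ennreal borel_measurable_const Rm I)
      show "(\<lambda>w. ennreal C * U I w) \<in> borel_measurable M" by (intro borel_measurable_times_ennreal borel_measurable_const Um)
      show "(\<lambda>w. ennreal C * (Z * g w)) \<in> borel_measurable M" by (intro borel_measurable_times_ennreal borel_measurable_const g)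
      show "AE w in M. (\<lambda>n. ennreal C * R I n w) \<longlonglongrightarrow> ennreal C * U I w"
        using RU[OF I] by eventually_elim (rule ennreal_tendsto_cmult, simp)
      show "AE w in M. ennreal C * R I n w \<le> ennreal C * (Z * g w)" for n
        by (rule AE_I2) (intro mult_left_mono R_g, simp)
      have "(\<lambda>w. Z * g w) \<in> borel_measurable M" by (intro borel_measurable_times_ennreal borel_measurable_const g)
      from rho_cmult[OF this, of "ennreal C"] show "\<rho> (\<lambda>w. ennreal C * (Z * g w)) < \<infinity>"
        using rho_cmult[OF g(1), of Z] Z g(2) by (simp add: ennreal_mult_less_top)
    qed
    also have "\<dots> = ennreal C * \<rho> (U I)" by (rule rho_cmult[OF Um])
    also have "\<dots> \<le> ennreal C * \<rho> (\<lambda>w. 2 * cont_sq p G w)"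
      by (intro mult_left_mono rho_mono' U_le I Um borel_measurable_times_ennreal borel_measurable_const csm) simp_all
    also have "\<dots> = ennreal C * (2 * \<rho> (cont_sq p G))" by (simp only: rho_cmult[OF csm])
    finally show ?thesis by (simp only: q_def)
  qed
  have "\<rho> S = (SUP m. \<rho> (\<lambda>w. ls_norm s (J m) (\<lambda>j. ennreal (cmod (v (2 powi j) w)))))"
    unfolding S_def[abs_def] ls_norm_int_SUP[OF s(1)] J_def
  proof (rule rho_SUP)
    show "(\<lambda>w. ls_norm s {- int n..<int n} (\<lambda>j. ennreal (cmod (v (2 powi j) w)))) \<in> borel_measurable M" for n
      by (rule vls) auto
    show "incseq (\<lambda>n. ls_norm s {- int n..<int n} (\<lambda>j. ennreal (cmod (v (2 powi j) w))))" for w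
      by (intro monoI ls_norm_mono_set s) auto
  qed
  also have "\<dots> \<le> ennreal C * (2 * \<rho> (cont_sq p G))" by (rule SUP_least) (rule part)
  finally show "\<rho> (\<lambda>w. ls_norm s UNIV (\<lambda>j::int. ennreal (cmod (v (2 powi j) w)))) \<le> ennreal C * (2 * \<rho> (cont_sq (enn2real s) G))"
    by (simp only: S_def[abs_def] p_def)
qed

end

section \<open>Representatives continuous in the dilation, and the case of suprema\<close>

lemma positive_dyadic:
  fixes q :: real
  assumes "0 < q"
  obtains j :: int and u where "u \<in> {1..2}" "q = 2 powi j * u"
proof
  define j where "j = \<lfloor>log 2 q\<rfloor>"
  have pj: "2 powi j = 2 powr real_of_int j" by (simp add: powr_real_of_int')
  have "2 powr real_of_int j \<le> 2 powr (log 2 q)" by (intro powr_mono) (auto simp: j_def)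
  then have 1: "2 powi j \<le> q" using assms by (simp add: pj)
  have "2 powr (log 2 q) \<le> 2 powr (real_of_int j + 1)" by (intro powr_mono) (auto simp: j_def)
  then have 2: "q \<le> 2 powi j * 2" using assms by (simp add: pj powr_add)
  have pos: "(0::real) < 2 powi j" by simp
  show "q / 2 powi j \<in> {1..2}" using 1 2 pos by (simp add: pos_le_divide_eq pos_divide_le_eq mult.commute)
  show "q = 2 powi j * (q / 2 powi j)" by simp
qed

lemma convergent_pos_bounded:
  fixes x :: "nat \<Rightarrow> real"
  assumes "x \<longlonglongrightarrow> a" "0 < a" "\<And>n. 0 < x n"
  obtains m where "\<And>n. x n \<le> m" "\<And>n. 1 / x n \<le> m"
proof -
  have "(\<lambda>n. 1 / x n) \<longlonglongrightarrow> 1 / a" using assms by (intro tendsto_intros) auto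
  then have "Bseq (\<lambda>n. 1 / x n)" "Bseq x" using assms(1) convergentI convergent_imp_Bseq by blast+
  then obtain m1 m2 where "\<And>n. norm (1 / x n) \<le> m1" "\<And>n. norm (x n) \<le> m2" by (auto simp: Bseq_def)
  then have "x n \<le> max m1 m2" "1 / x n \<le> max m1 m2" for n
    by (metis max.coboundedI1 max.coboundedI2 order_trans abs_ge_self real_norm_def)+
  then show thesis by (rule that)
qed

context banach_function_norm
begin

text \<open>A least upper bound is determined up to null sets, so any measurable \<open>g\<close>
  with the defining property may replace the chosen one.\<close>

lemma lattice_sup_AE:
  assumes g: "g \<in> borel_measurable M" and ub: "\<And>f. f \<in> \<F> \<Longrightarrow> AE w in M. f w \<le> g w"
    and least: "\<And>h. h \<in> borel_measurable M \<Longrightarrow> (\<forall>f\<in>\<F>. AE w in M. f w \<le> h w) \<Longrightarrow> AE w in M. g w \<le> h w"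
  shows "lattice_sup M \<F> \<in> borel_measurable M" "AE w in M. lattice_sup M \<F> w = g w"
proof -
  define P where "P g' \<longleftrightarrow> g' \<in> borel_measurable M \<and> (\<forall>f\<in>\<F>. AE w in M. f w \<le> g' w) \<and>
     (\<forall>h\<in>borel_measurable M. (\<forall>f\<in>\<F>. AE w in M. f w \<le> h w) \<longrightarrow> (AE w in M. g' w \<le> h w))" for g'
  have "P g" unfolding P_def using g ub least by blast
  moreover have "lattice_sup M \<F> = (SOME g'. P g')" by (simp only: lattice_sup_def P_def)
  ultimately have L: "P (lattice_sup M \<F>)" using someI[of P g] by simp
  then show m: "lattice_sup M \<F> \<in> borel_measurable M" by (simp add: P_def)
  have "AE w in M. lattice_sup M \<F> w \<le> g w" using L g ub by (auto simp: P_def)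
  moreover have "AE w in M. g w \<le> lattice_sup M \<F> w" using L least[OF m] by (auto simp: P_def)
  ultimately show "AE w in M. lattice_sup M \<F> w = g w" by eventually_elim (rule antisym)
qed

end

context Rs_sectorial_op
begin

text \<open>In the contour integral for the dilated function, \<open>t\<close> enters only through
  the scalar weight, while the resolvent part is fixed. Off the null set where the majorant
  \<open>g\<close> is infinite, dominated convergence gives continuity in all \<open>t\<close> at
  once. The same \<open>g\<close> bounds \<open>G t\<close> locally uniformly in
  \<open>t\<close>.\<close>

lemma joint_representative:
  assumes \<theta>: "\<tau> < \<theta>" "\<theta> < \<sigma>" "\<sigma> \<le> pi" and x: "x \<in> bfs M \<rho>" and \<phi>: "decaying_on \<sigma> \<phi>"
  obtains G :: "real \<Rightarrow> 'a \<Rightarrow> complex" and g :: "'a \<Rightarrow> ennreal" and K :: "int \<Rightarrow> real"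
  where "(\<lambda>(t, w). G t w) \<in> borel_measurable (lborel \<Otimes>\<^sub>M M)"
    "\<And>t. 0 < t \<Longrightarrow> AE w in M. G t w = fun_calc_dil M \<rho> D A \<theta> \<phi> t x w"
    "AE w in M. continuous_on {0<..} (\<lambda>t. G t w)"
    "g \<in> borel_measurable M" "\<rho> g < \<infinity>"
    "\<And>j u w. u \<in> {1..2} \<Longrightarrow> ennreal (cmod (G (2 powi j * u) w)) \<le> ennreal (K j) * g w"
proof -
  interpret L: sigma_finite_measure lpos by (rule sigma_finite_lpos)
  have \<theta>0: "0 < \<theta>" using \<theta> \<tau> by simp
  have \<sigma>0: "0 < \<sigma>" using \<theta> \<theta>0 by simp
  define F where "F \<alpha> = ray_family 1 \<alpha> x" for \<alpha>
  \<comment> \<open>Extension by 0 makes the weight Borel on the whole line, so that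
    \<open>G\<close> is jointly measurable over \<open>lborel\<close>, including nonpositive
    \<open>t\<close>.\<close>
  define wt where "wt \<alpha> r = indicator {0<..} r *\<^sub>R ray_weight \<alpha> \<phi> r" for \<alpha> r
  define G where "G t w = (\<Sum>\<alpha>\<in>{- \<theta>, \<theta>}. LINT r|lpos. wt \<alpha> (t * r) * rep (F \<alpha>) r w)" for t w
  obtain K0 \<epsilon> where K0: "0 \<le> K0" "0 < \<epsilon>" "\<And>z. z \<in> sector \<sigma> \<Longrightarrow> cmod (\<phi> z) \<le> K0 * decay \<epsilon> (cmod z)"
    and h: "\<phi> holomorphic_on sector \<sigma>" using \<phi> by (auto simp: decaying_on_def)
  define g where "g w = (\<Sum>\<alpha>\<in>{- \<theta>, \<theta>}. \<integral>\<^sup>+r. ennreal (decay \<epsilon> r) * ennreal (cmod (rep (F \<alpha>) r w)) \<partial>lpos)" for w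
  have F: "good_family (F \<alpha>) (B ^ 2 * enn2real (bfs_norm \<rho> x))" if "\<alpha> \<in> {- \<theta>, \<theta>}" for \<alpha>
    unfolding F_def using \<theta> that \<theta>0 by (intro good_ray_family x) auto
  have \<alpha>\<sigma>: "\<bar>\<alpha>\<bar> < \<sigma>" if "\<alpha> \<in> {- \<theta>, \<theta>}" for \<alpha> using that \<theta> \<theta>0 by auto
  have rwc: "continuous_on {0<..} (ray_weight \<alpha> \<phi>)" if "\<alpha> \<in> {- \<theta>, \<theta>}" for \<alpha>
    by (rule continuous_ray_weight[OF holomorphic_on_imp_continuous_on[OF h] \<alpha>\<sigma>[OF that] \<theta>(3)])
  have wtm: "wt \<alpha> \<in> borel_measurable borel" if "\<alpha> \<in> {- \<theta>, \<theta>}" for \<alpha>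
    unfolding wt_def[abs_def] by (rule borel_measurable_continuous_on_indicator[OF _ rwc[OF that]]) simp
  have dm: "(\<lambda>r. ennreal (decay \<epsilon> r)) \<in> borel_measurable lpos" by (rule borel_measurable_lpos) measurable
  have Gm: "(\<lambda>(t, w). G t w) \<in> borel_measurable (lborel \<Otimes>\<^sub>M M)"
    unfolding G_def split_beta'
  proof (rule borel_measurable_sum, rule L.borel_measurable_lebesgue_integral)
    fix \<alpha> assume \<alpha>: "\<alpha> \<in> {- \<theta>, \<theta>}"
    have i: "(\<lambda>r. r) \<in> measurable lpos borel" by (rule borel_measurable_lpos) simp
    have "(\<lambda>q. fst (fst q) * snd q) \<in> borel_measurable ((lborel \<Otimes>\<^sub>M M) \<Otimes>\<^sub>M lpos)"
    proof (rule borel_measurable_times)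
      have "(\<lambda>z. fst z) \<in> measurable (lborel \<Otimes>\<^sub>M M) borel" using measurable_fst[of lborel M] by simp
      then show "(\<lambda>q. fst (fst q)) \<in> borel_measurable ((lborel \<Otimes>\<^sub>M M) \<Otimes>\<^sub>M lpos)" by (rule measurable_compose[OF measurable_fst])
      show "(\<lambda>q. snd q) \<in> borel_measurable ((lborel \<Otimes>\<^sub>M M) \<Otimes>\<^sub>M lpos)" by (rule measurable_compose[OF measurable_snd i])
    qed
    then have a1: "(\<lambda>q. wt \<alpha> (fst (fst q) * snd q)) \<in> borel_measurable ((lborel \<Otimes>\<^sub>M M) \<Otimes>\<^sub>M lpos)"
      by (rule measurable_compose[OF _ wtm[OF \<alpha>]])
    have a2: "(\<lambda>q. rep (F \<alpha>) (snd q) (snd (fst q))) \<in> borel_measurable ((lborel \<Otimes>\<^sub>M M) \<Otimes>\<^sub>M lpos)"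
      using measurable_compose[OF measurable_Pair[OF measurable_snd measurable_compose[OF measurable_fst measurable_snd]] good_rep_measurable[OF F[OF \<alpha>]]] by simp
    show "(\<lambda>(z, r). wt \<alpha> (fst z * r) * rep (F \<alpha>) r (snd z)) \<in> borel_measurable ((lborel \<Otimes>\<^sub>M M) \<Otimes>\<^sub>M lpos)"
      unfolding split_beta' by (intro borel_measurable_times a1 a2)
  qed
  have Gv: "AE w in M. G t w = fun_calc_dil M \<rho> D A \<theta> \<phi> t x w" if t: "0 < t" for t
    using fun_calc_eq(2)[OF \<theta> x decaying_on_dilate[OF \<phi> t \<sigma>0]]
  proof eventually_elim
    case (elim w)
    have rw: "ray_int (ray_weight \<alpha> (\<lambda>z. \<phi> (of_real t * z))) (F \<alpha>) w = (LINT r|lpos. wt \<alpha> (t * r) * rep (F \<alpha>) r w)" for \<alpha>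
      unfolding ray_int_def
    proof (rule Bochner_Integration.integral_cong[OF refl])
      fix r assume "r \<in> space lpos"
      then have "0 < t * r" using t by simp
      then show "ray_weight \<alpha> (\<lambda>z. \<phi> (of_real t * z)) r * rep (F \<alpha>) r w = wt \<alpha> (t * r) * rep (F \<alpha>) r w"
        by (simp add: wt_def ray_weight_def rcis_mult_real)
    qed
    show ?case using elim \<theta>0 unfolding fun_calc_dil_def F_def[symmetric] by (simp add: rw G_def)
  qed
  have wt_le: "cmod (wt \<alpha> (t * r)) \<le> K0 * m powr \<epsilon> * decay \<epsilon> r"
    if "\<alpha> \<in> {- \<theta>, \<theta>}" "0 < t" "0 < r" "t \<le> m" "1 / t \<le> m" for \<alpha> t r m
  proof -
    have tr: "0 < t * r" using that by simp
    have "cmod (wt \<alpha> (t * r)) \<le> cmod (\<phi> (rcis (t * r) \<alpha>))"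
      using tr norm_ray_weight[of \<alpha> \<phi> "t * r"] by (simp add: wt_def)
    also have "\<dots> \<le> K0 * decay \<epsilon> (t * r)"
      using K0(3)[OF rcis_in_sector[OF tr \<alpha>\<sigma>[OF that(1)] \<theta>(3)]] tr by simp
    also have "\<dots> \<le> K0 * (m powr \<epsilon> * decay \<epsilon> r)"
      using that K0 by (intro mult_left_mono decay_mult_le) auto
    finally show ?thesis by simp
  qed
  have G_le: "ennreal (cmod (G t w)) \<le> ennreal (K0 * m powr \<epsilon>) * g w" if t: "0 < t" "t \<le> m" "1 / t \<le> m" and w: "w \<in> space M" for t m w
  proof -
    have "ennreal (cmod (G t w)) \<le> ennreal (\<Sum>\<alpha>\<in>{- \<theta>, \<theta>}. cmod (ray_int (\<lambda>r. wt \<alpha> (t * r)) (F \<alpha>) w))"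
      unfolding G_def ray_int_def[symmetric] by (intro ennreal_leI norm_sum)
    also have "\<dots> = (\<Sum>\<alpha>\<in>{- \<theta>, \<theta>}. ennreal (cmod (ray_int (\<lambda>r. wt \<alpha> (t * r)) (F \<alpha>) w)))"
      by (rule sum_ennreal[symmetric]) simp
    also have "\<dots> \<le> (\<Sum>\<alpha>\<in>{- \<theta>, \<theta>}. ennreal (K0 * m powr \<epsilon>) * (\<integral>\<^sup>+r. ennreal (decay \<epsilon> r) * ennreal (cmod (rep (F \<alpha>) r w)) \<partial>lpos))"
    proof (rule sum_mono)
      fix \<alpha> assume \<alpha>: "\<alpha> \<in> {- \<theta>, \<theta>}"
      have "ennreal (cmod (ray_int (\<lambda>r. wt \<alpha> (t * r)) (F \<alpha>) w)) \<le> (\<integral>\<^sup>+r. ennreal (cmod (wt \<alpha> (t * r))) * ennreal (cmod (rep (F \<alpha>) r w)) \<partial>lpos)"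
        by (rule norm_ray_int_le)
      also have "\<dots> \<le> (\<integral>\<^sup>+r. ennreal (K0 * m powr \<epsilon>) * (ennreal (decay \<epsilon> r) * ennreal (cmod (rep (F \<alpha>) r w))) \<partial>lpos)"
      proof (rule nn_integral_mono)
        fix r assume "r \<in> space lpos"
        then have "cmod (wt \<alpha> (t * r)) \<le> K0 * m powr \<epsilon> * decay \<epsilon> r" using wt_le[OF \<alpha>] t by simp
        then have "ennreal (cmod (wt \<alpha> (t * r))) \<le> ennreal (K0 * m powr \<epsilon>) * ennreal (decay \<epsilon> r)"
          using K0(1) by (simp add: ennreal_mult[symmetric] ennreal_leI)
        then show "ennreal (cmod (wt \<alpha> (t * r))) * ennreal (cmod (rep (F \<alpha>) r w))
          \<le> ennreal (K0 * m powr \<epsilon>) * (ennreal (decay \<epsilon> r) * ennreal (cmod (rep (F \<alpha>) r w)))"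
          unfolding mult.assoc[symmetric] by (rule mult_right_mono) simp
      qed
      also have "\<dots> = ennreal (K0 * m powr \<epsilon>) * (\<integral>\<^sup>+r. ennreal (decay \<epsilon> r) * ennreal (cmod (rep (F \<alpha>) r w)) \<partial>lpos)"
        by (intro nn_integral_cmult borel_measurable_times_ennreal dm measurable_ennreal_cmod rep_measurable1[OF good_familyD(3)[OF F[OF \<alpha>]] w])
      finally show "ennreal (cmod (ray_int (\<lambda>r. wt \<alpha> (t * r)) (F \<alpha>) w))
        \<le> ennreal (K0 * m powr \<epsilon>) * (\<integral>\<^sup>+r. ennreal (decay \<epsilon> r) * ennreal (cmod (rep (F \<alpha>) r w)) \<partial>lpos)" .
    qed
    also have "\<dots> = ennreal (K0 * m powr \<epsilon>) * g w" unfolding g_def by (rule sum_distrib_left[symmetric])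
    finally show ?thesis .
  qed
  have g\<alpha>m: "(\<lambda>w. \<integral>\<^sup>+r. ennreal (decay \<epsilon> r) * ennreal (cmod (rep (F \<alpha>) r w)) \<partial>lpos) \<in> borel_measurable M" if "\<alpha> \<in> {- \<theta>, \<theta>}" for \<alpha>
    by (rule nn_ray_int_measurable[OF F[OF that] dm])
  have gm: "g \<in> borel_measurable M" unfolding g_def[abs_def] by (intro borel_measurable_sum g\<alpha>m)
  have gfin: "\<rho> g < \<infinity>"
  proof -
    have W: "(\<integral>\<^sup>+r. ennreal (decay \<epsilon> r) * ennreal (1 / r) \<partial>lpos) < \<infinity>"
      using nn_integral_decaying_finite[of "\<lambda>r. of_real (decay \<epsilon> r)" 1 \<epsilon>] K0(2) by simp
    have "\<rho> g \<le> (\<Sum>\<alpha>\<in>{- \<theta>, \<theta>}. \<rho> (\<lambda>w. \<integral>\<^sup>+r. ennreal (decay \<epsilon> r) * ennreal (cmod (rep (F \<alpha>) r w)) \<partial>lpos))"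
      unfolding g_def[abs_def] by (rule rho_sum) (auto intro: g\<alpha>m)
    also have "\<dots> \<le> (\<Sum>\<alpha>\<in>{- \<theta>, \<theta>}. (\<integral>\<^sup>+r. ennreal (decay \<epsilon> r) * ennreal (1 / r) \<partial>lpos) * ennreal (B ^ 2 * enn2real (bfs_norm \<rho> x)))"
      by (intro sum_mono rho_rep_le F dm)
    also have "\<dots> < \<infinity>" using W by (simp add: ennreal_mult_less_top of_nat_less_top)
    finally show ?thesis .
  qed
  have Gc: "AE w in M. continuous_on {0<..} (\<lambda>t. G t w)"
    using rho_finite_AE[OF gm gfin] AE_space
  proof eventually_elim
    case (elim w)
    have int: "integrable lpos (\<lambda>r. decay \<epsilon> r * cmod (rep (F \<alpha>) r w))" if \<alpha>: "\<alpha> \<in> {- \<theta>, \<theta>}" for \<alpha>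
    proof (rule integrableI_bounded)
      show "(\<lambda>r. decay \<epsilon> r * cmod (rep (F \<alpha>) r w)) \<in> borel_measurable lpos"
        by (rule borel_measurable_times[OF borel_measurable_lpos[OF decay_measurable]
          measurable_compose[OF rep_measurable1[OF good_familyD(3)[OF F[OF \<alpha>]] elim(2)] borel_measurable_norm]])
      have "(\<integral>\<^sup>+r. ennreal (norm (decay \<epsilon> r * cmod (rep (F \<alpha>) r w))) \<partial>lpos) = (\<integral>\<^sup>+r. ennreal (decay \<epsilon> r) * ennreal (cmod (rep (F \<alpha>) r w)) \<partial>lpos)"
        by (simp add: abs_mult ennreal_mult)
      also have "\<dots> \<le> g w" unfolding g_def by (rule member_le_sum[OF \<alpha>]) auto
      also have "\<dots> < \<infinity>" by (rule elim(1))
      finally show "(\<integral>\<^sup>+r. ennreal (norm (decay \<epsilon> r * cmod (rep (F \<alpha>) r w))) \<partial>lpos) < \<infinity>" .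
    qed
    show ?case
      unfolding continuous_on_sequentially
    proof (intro allI ballI impI)
      fix y :: "nat \<Rightarrow> real" and a
      assume y: "a \<in> {0<..}" "(\<forall>n. y n \<in> {0<..}) \<and> y \<longlonglongrightarrow> a"
      then have ya: "y \<longlonglongrightarrow> a" "0 < a" "\<And>n. 0 < y n" by auto
      \<comment> \<open>The sequence and its reciprocals have a common bound, so a single integrable
        majorant serves all \<open>n\<close>.\<close>
      obtain m where m: "\<And>n. y n \<le> m" "\<And>n. 1 / y n \<le> m" using convergent_pos_bounded[OF ya] by blast
      have "(\<lambda>n. \<Sum>\<alpha>\<in>{- \<theta>, \<theta>}. LINT r|lpos. wt \<alpha> (y n * r) * rep (F \<alpha>) r w)
        \<longlonglongrightarrow> (\<Sum>\<alpha>\<in>{- \<theta>, \<theta>}. LINT r|lpos. wt \<alpha> (a * r) * rep (F \<alpha>) r w)"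
      proof (rule tendsto_sum)
        fix \<alpha> assume \<alpha>: "\<alpha> \<in> {- \<theta>, \<theta>}"
        have mm: "(\<lambda>r. wt \<alpha> (t * r) * rep (F \<alpha>) r w) \<in> borel_measurable lpos" for t
        proof (intro borel_measurable_times rep_measurable1[OF good_familyD(3)[OF F[OF \<alpha>]] elim(2)])
          have "(\<lambda>r. t * r) \<in> measurable borel borel" by simp
          from measurable_compose[OF this wtm[OF \<alpha>]] show "(\<lambda>r. wt \<alpha> (t * r)) \<in> borel_measurable lpos" by (rule borel_measurable_lpos)
        qed
        show "(\<lambda>n. LINT r|lpos. wt \<alpha> (y n * r) * rep (F \<alpha>) r w) \<longlonglongrightarrow> (LINT r|lpos. wt \<alpha> (a * r) * rep (F \<alpha>) r w)"
        proof (rule integral_dominated_convergence[where w = "\<lambda>r. (K0 * m powr \<epsilon>) * (decay \<epsilon> r * cmod (rep (F \<alpha>) r w))"])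
          show "integrable lpos (\<lambda>r. (K0 * m powr \<epsilon>) * (decay \<epsilon> r * cmod (rep (F \<alpha>) r w)))" by (rule integrable_mult_right[OF int[OF \<alpha>]])
          show "AE r in lpos. norm (wt \<alpha> (y n * r) * rep (F \<alpha>) r w) \<le> (K0 * m powr \<epsilon>) * (decay \<epsilon> r * cmod (rep (F \<alpha>) r w))" for n
          proof (rule AE_I2)
            fix r assume "r \<in> space lpos"
            then have "cmod (wt \<alpha> (y n * r)) \<le> K0 * m powr \<epsilon> * decay \<epsilon> r" using wt_le[OF \<alpha> ya(3)] m by simp
            then have "cmod (wt \<alpha> (y n * r)) * cmod (rep (F \<alpha>) r w) \<le> (K0 * m powr \<epsilon> * decay \<epsilon> r) * cmod (rep (F \<alpha>) r w)"
              by (rule mult_right_mono) simp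
            then show "norm (wt \<alpha> (y n * r) * rep (F \<alpha>) r w) \<le> (K0 * m powr \<epsilon>) * (decay \<epsilon> r * cmod (rep (F \<alpha>) r w))"
              by (simp only: norm_mult mult.assoc)
          qed
          show "AE r in lpos. (\<lambda>n. wt \<alpha> (y n * r) * rep (F \<alpha>) r w) \<longlonglongrightarrow> wt \<alpha> (a * r) * rep (F \<alpha>) r w"
          proof (rule AE_I2)
            fix r assume "r \<in> space lpos"
            then have r: "0 < r" by simp
            have "(\<lambda>n. ray_weight \<alpha> \<phi> (y n * r)) \<longlonglongrightarrow> ray_weight \<alpha> \<phi> (a * r)"
              using ya r by (intro continuous_on_tendsto_compose[OF rwc[OF \<alpha>]] tendsto_intros) auto
            then have "(\<lambda>n. wt \<alpha> (y n * r)) \<longlonglongrightarrow> wt \<alpha> (a * r)" using ya r by (simp add: wt_def)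
            then show "(\<lambda>n. wt \<alpha> (y n * r) * rep (F \<alpha>) r w) \<longlonglongrightarrow> wt \<alpha> (a * r) * rep (F \<alpha>) r w" by (rule tendsto_mult_right)
          qed
        qed (rule mm)+
      qed
      then show "((\<lambda>t. G t w) \<circ> y) \<longlonglongrightarrow> G a w" by (simp only: comp_def G_def)
    qed
  qed
  \<comment> \<open>The bound by \<open>g\<close> is required at every \<open>w\<close>, also
    outside \<open>space M\<close>, where nothing is known about \<open>G\<close>.\<close>
  define G' where "G' t w = (if w \<in> space M then G t w else 0)" for t w
  have eq: "G' t w = G t w" if "w \<in> space M" for t w using that by (simp add: G'_def)
  \<comment> \<open>The maximum bounds both \<open>t\<close> and \<open>1 / t\<close> for
    \<open>t = 2 powi j * u\<close> with \<open>u\<close> between 1 and 2.\<close>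
  define K where "K j = K0 * (max (2 * 2 powi j) (1 / 2 powi j)) powr \<epsilon>" for j :: int
  show thesis
  proof (rule that[of G' g K])
    have "(\<lambda>z. G' (fst z) (snd z)) \<in> borel_measurable (lborel \<Otimes>\<^sub>M M) \<longleftrightarrow> (\<lambda>z. G (fst z) (snd z)) \<in> borel_measurable (lborel \<Otimes>\<^sub>M M)"
      by (rule measurable_cong) (auto simp: eq space_pair_measure)
    then show "(\<lambda>(t, w). G' t w) \<in> borel_measurable (lborel \<Otimes>\<^sub>M M)" using Gm by (simp add: split_beta')
    show "AE w in M. G' t w = fun_calc_dil M \<rho> D A \<theta> \<phi> t x w" if "0 < t" for t
      using Gv[OF that] AE_space by eventually_elim (simp add: eq)
    show "AE w in M. continuous_on {0<..} (\<lambda>t. G' t w)"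
      using Gc AE_space by eventually_elim (simp add: eq)
    show "g \<in> borel_measurable M" "\<rho> g < \<infinity>" by fact+
    fix j :: int and u :: real and w assume u: "u \<in> {1..2}"
    have pos: "(0::real) < 2 powi j" by simp
    have "2 powi j * u \<le> max (2 * 2 powi j) (1 / 2 powi j)" using u pos by (intro max.coboundedI1) simp
    moreover have "1 / (2 powi j * u) \<le> max (2 * 2 powi j) (1 / 2 powi j)"
      using u pos by (intro max.coboundedI2 divide_left_mono) auto
    ultimately show "ennreal (cmod (G' (2 powi j * u) w)) \<le> ennreal (K j) * g w"
      using G_le[of "2 powi j * u" "max (2 * 2 powi j) (1 / 2 powi j)" w] u pos by (simp add: G'_def K_def)
  qed
qed

end

lemma sector_mono_strict:
  assumes "0 \<le> a" "a < b" "b \<le> pi"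
  shows "sector a \<subseteq> sector b"
proof
  fix z assume z: "z \<in> sector a"
  show "z \<in> sector b"
  proof (cases "a = 0")
    case True
    then obtain r where "0 < r" "z = complex_of_real r" using z by (auto simp: sector_def)
    then show ?thesis using True assms by (auto simp: sector_def nonpos_Reals_of_real_iff Arg_of_real)
  next
    case False
    then show ?thesis using z assms by (auto simp: sector_def)
  qed
qed

context banach_function_norm
begin

lemma continuous_sq_fun_eq_cont_sq:
  assumes s: "s \<noteq> \<infinity>" and G: "(\<lambda>(t, w). G t w) \<in> borel_measurable (lborel \<Otimes>\<^sub>M M)"
    and Gv: "\<And>t. 0 < t \<Longrightarrow> AE w in M. G t w = fun_calc_dil M \<rho> D A \<theta> \<phi> t x w"
  shows "\<rho> (continuous_sq_fun M \<rho> s D A \<theta> \<phi> x) = \<rho> (cont_sq (enn2real s) G)"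
proof -
  define P where "P g \<longleftrightarrow> (\<exists>H :: real \<Rightarrow> 'a \<Rightarrow> complex.
           (\<lambda>(t, w). H t w) \<in> borel_measurable (lborel \<Otimes>\<^sub>M M) \<and>
           (\<forall>t>0. AE w in M. H t w = fun_calc_dil M \<rho> D A \<theta> \<phi> t x w) \<and>
           g = cont_sq (enn2real s) H)" for g
  have c: "continuous_sq_fun M \<rho> s D A \<theta> \<phi> x = (SOME g. P g)"
    using s by (simp only: continuous_sq_fun_def P_def cont_sq_def[abs_def] if_False)
  have "P (cont_sq (enn2real s) G)" unfolding P_def using G Gv by blast
  then have "P (SOME g. P g)" by (rule someI[of P])
  then obtain H where H: "(\<lambda>(t, w). H t w) \<in> borel_measurable (lborel \<Otimes>\<^sub>M M)"
    "\<And>t. 0 < t \<Longrightarrow> AE w in M. H t w = fun_calc_dil M \<rho> D A \<theta> \<phi> t x w"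
    "(SOME g. P g) = cont_sq (enn2real s) H" unfolding P_def by blast
  have "AE w in M. H t w = G t w" if "0 < t" for t
    using H(2)[OF that] Gv[OF that] by eventually_elim simp
  then have "AE w in M. cont_sq (enn2real s) H w = cont_sq (enn2real s) G w"
    by (rule cont_sq_cong_AE[OF H(1) G])
  then have "\<rho> (cont_sq (enn2real s) H) = \<rho> (cont_sq (enn2real s) G)"
    by (rule rho_cong_AE[OF cont_sq_measurable[OF H(1)] cont_sq_measurable[OF G]])
  then show ?thesis by (simp only: c H(3))
qed

text \<open>Continuity in \<open>t\<close> reduces the lattice supremum to a countable one over the
  positive rationals, a monotone limit of finite maxima to which \<open>comp\<close> applies. The
  reverse bound needs no comparison, since every power of 2 is among these rationals.\<close>

lemma maximal_function_equivalence:
  fixes v G :: "real \<Rightarrow> 'a \<Rightarrow> complex"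
  assumes v: "\<And>t. 0 < t \<Longrightarrow> v t \<in> borel_measurable M"
    and Gv: "\<And>t. 0 < t \<Longrightarrow> AE w in M. G t w = v t w"
    and Gc: "AE w in M. continuous_on {0<..} (\<lambda>t. G t w)"
    and comp: "\<And>n (j :: nat \<Rightarrow> int) t. (\<And>i. i < n \<Longrightarrow> t i \<in> {1..2}) \<Longrightarrow>
      \<rho> (\<lambda>w. ls_norm top {..<n} (\<lambda>i. ennreal (cmod (v (2 powi j i * t i) w))))
        \<le> ennreal C * \<rho> (\<lambda>w. ls_norm top {..<n} (\<lambda>i. ennreal (cmod (v (2 powi (j i - d)) w))))"
  shows "\<rho> (lattice_sup M ((\<lambda>t w. ennreal (cmod (v t w))) ` {0<..}))
      \<le> ennreal C * \<rho> (\<lambda>w. ls_norm top UNIV (\<lambda>j::int. ennreal (cmod (v (2 powi j) w))))"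
    and "\<rho> (\<lambda>w. ls_norm top UNIV (\<lambda>j::int. ennreal (cmod (v (2 powi j) w))))
      \<le> \<rho> (lattice_sup M ((\<lambda>t w. ennreal (cmod (v t w))) ` {0<..}))"
proof -
  define Q :: "real set" where "Q = {q \<in> \<rat>. 0 < q}"
  define q where "q = from_nat_into Q"
  have "1 \<in> Q" by (simp add: Q_def)
  then have Qne: "Q \<noteq> {}" by blast
  have Qc: "countable Q" unfolding Q_def using countable_rat by (rule countable_subset[rotated]) auto
  have rq: "range q = Q" unfolding q_def by (rule range_from_nat_into[OF Qne Qc])
  have qQ: "q n \<in> Q" for n using rq by blast
  have q0: "0 < q n" for n using qQ[of n] by (simp add: Q_def)
  define gs where "gs w = (SUP n. ennreal (cmod (v (q n) w)))" for w
  have vm: "(\<lambda>w. ennreal (cmod (v t w))) \<in> borel_measurable M" if "0 < t" for t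
    by (intro measurable_ennreal_cmod v that)
  have gsm: "gs \<in> borel_measurable M" unfolding gs_def[abs_def] by (intro borel_measurable_SUP vm q0) simp
  let ?F = "(\<lambda>t w. ennreal (cmod (v t w))) ` {0<..}"
  have Gq: "AE w in M. \<forall>n. G (q n) w = v (q n) w"
    unfolding AE_all_countable using Gv q0 by blast
  have ub: "AE w in M. ennreal (cmod (v t w)) \<le> gs w" if t: "0 < t" for t
    using Gc Gv[OF t] Gq
  proof eventually_elim
    case (elim w)
    \<comment> \<open>Rationals approaching \<open>t\<close> from the right stay positive, and the
      values of \<open>G\<close> at them converge to the value at \<open>t\<close>.\<close>
    have "\<exists>r\<in>\<rat>. t < r \<and> r < t + 1 / real (Suc n)" for n by (rule Rats_dense_in_real) simp
    then obtain r where r: "\<And>n. r n \<in> \<rat>" "\<And>n. t < r n" "\<And>n. r n < t + 1 / real (Suc n)" by metis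
    have r0: "0 < r n" for n using r(2)[of n] t by simp
    have rt: "r \<longlonglongrightarrow> t"
    proof (rule tendsto_sandwich[OF always_eventually always_eventually])
      show "\<forall>n. t \<le> r n" "\<forall>n. r n \<le> t + 1 / real (Suc n)" using r(2,3) by (auto intro: less_imp_le)
      have "(\<lambda>n. t + 1 / real (Suc n)) \<longlonglongrightarrow> t + 0" by (intro tendsto_intros LIMSEQ_Suc lim_1_over_n)
      then show "(\<lambda>n. t + 1 / real (Suc n)) \<longlonglongrightarrow> t" by simp
    qed simp
    have "(\<lambda>n. G (r n) w) \<longlonglongrightarrow> G t w"
      using r0 t by (intro continuous_on_tendsto_compose[OF elim(1) rt]) auto
    then have lim: "(\<lambda>n. ennreal (cmod (G (r n) w))) \<longlonglongrightarrow> ennreal (cmod (G t w))" by (intro tendsto_intros)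
    have "ennreal (cmod (G t w)) \<le> gs w"
    proof (rule LIMSEQ_le_const2[OF lim], intro exI allI impI)
      fix n :: nat
      have "r n \<in> range q" unfolding rq Q_def using r(1) r0 by simp
      then obtain k where k: "r n = q k" by blast
      have "ennreal (cmod (G (r n) w)) = ennreal (cmod (v (q k) w))" using elim(3) by (simp add: k)
      also have "\<dots> \<le> gs w" unfolding gs_def by (rule SUP_upper) simp
      finally show "ennreal (cmod (G (r n) w)) \<le> gs w" .
    qed
    then show ?case using elim(2) by simp
  qed
  have least: "AE w in M. gs w \<le> h w" if "\<forall>f\<in>?F. AE w in M. f w \<le> h w" for h
  proof -
    have "AE w in M. \<forall>n. ennreal (cmod (v (q n) w)) \<le> h w"
      unfolding AE_all_countable using that q0 by auto
    then show ?thesis by eventually_elim (simp add: gs_def SUP_least)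
  qed
  note L = lattice_sup_AE[OF gsm, of ?F]
  have Lm: "lattice_sup M ?F \<in> borel_measurable M" and Le: "AE w in M. lattice_sup M ?F w = gs w"
    using ub least by (auto intro!: L)
  have eq: "\<rho> (lattice_sup M ?F) = \<rho> gs" by (rule rho_cong_AE[OF Lm gsm Le])
  define S where "S w = ls_norm top UNIV (\<lambda>j::int. ennreal (cmod (v (2 powi j) w)))" for w
  have Sm: "S \<in> borel_measurable M"
    unfolding S_def[abs_def] by (intro ls_norm_UNIV_measurable vm) auto
  have "\<rho> gs \<le> ennreal C * \<rho> S"
  proof -
    \<comment> \<open>Each rational is written as a power of 2 times a number between 1 and 2, the
      form that \<open>comp\<close> expects; the same power may occur repeatedly.\<close>
    have "\<exists>j u. u \<in> {1..2} \<and> q n = 2 powi j * u" for n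
      using positive_dyadic[OF q0[of n]] by blast
    then obtain j u where ju: "\<And>n. u n \<in> {1..2}" "\<And>n. q n = 2 powi j n * u n" by metis
    define H where "H n w = ls_norm top {..<n} (\<lambda>i. ennreal (cmod (v (q i) w)))" for n w
    have Hm: "H n \<in> borel_measurable M" for n
      unfolding H_def[abs_def] by (intro ls_norm_measurable vm q0) simp
    have "gs w = (SUP n. H n w)" for w
    proof (rule antisym)
      show "gs w \<le> (SUP n. H n w)" unfolding gs_def
      proof (rule SUP_least)
        fix n
        have "ennreal (cmod (v (q n) w)) \<le> H (Suc n) w" unfolding H_def by (rule ls_norm_upper) auto
        also have "\<dots> \<le> (SUP n. H n w)" by (rule SUP_upper) simp
        finally show "ennreal (cmod (v (q n) w)) \<le> (SUP n. H n w)" .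
      qed
      show "(SUP n. H n w) \<le> gs w"
        unfolding gs_def H_def ls_norm_top by (intro SUP_least SUP_upper) simp
    qed
    then have "\<rho> gs = \<rho> (\<lambda>w. SUP n. H n w)" by presburger
    also have "\<dots> = (SUP n. \<rho> (H n))"
      by (rule rho_SUP[OF Hm]) (auto simp: H_def intro!: monoI ls_norm_mono_set)
    also have "\<dots> \<le> ennreal C * \<rho> S"
    proof (rule SUP_least)
      fix n
      have "\<rho> (H n) = \<rho> (\<lambda>w. ls_norm top {..<n} (\<lambda>i. ennreal (cmod (v (2 powi j i * u i) w))))"
        by (simp only: H_def[abs_def] ju(2))
      also have "\<dots> \<le> ennreal C * \<rho> (\<lambda>w. ls_norm top {..<n} (\<lambda>i. ennreal (cmod (v (2 powi (j i - d)) w))))"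
        by (rule comp) (rule ju(1))
      also have "\<dots> \<le> ennreal C * \<rho> S"
      proof (intro mult_left_mono rho_mono' Sm ls_norm_measurable vm)
        fix w
        show "ls_norm top {..<n} (\<lambda>i. ennreal (cmod (v (2 powi (j i - d)) w))) \<le> S w"
          unfolding S_def ls_norm_top
        proof (rule SUP_least)
          fix i
          show "ennreal (cmod (v (2 powi (j i - d)) w)) \<le> (SUP k. ennreal (cmod (v (2 powi k) w)))"
            by (rule SUP_upper[of "j i - d" UNIV]) simp
        qed
      qed auto
      finally show "\<rho> (H n) \<le> ennreal C * \<rho> S" .
    qed
    finally show ?thesis .
  qed
  then show "\<rho> (lattice_sup M ?F) \<le> ennreal C * \<rho> (\<lambda>w. ls_norm top UNIV (\<lambda>j::int. ennreal (cmod (v (2 powi j) w))))"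
    by (simp only: eq S_def[abs_def])
  have "\<rho> S \<le> \<rho> gs"
  proof (rule rho_mono'[OF gsm Sm])
    fix w
    show "S w \<le> gs w"
      unfolding S_def ls_norm_top
    proof (rule SUP_least)
      fix j :: int
      have "2 powi j \<in> range q" unfolding rq Q_def by (simp add: power_int_def)
      then obtain n where n: "2 powi j = q n" by blast
      show "ennreal (cmod (v (2 powi j) w)) \<le> gs w" unfolding gs_def n by (rule SUP_upper) simp
    qed
  qed
  then show "\<rho> (\<lambda>w. ls_norm top UNIV (\<lambda>j::int. ennreal (cmod (v (2 powi j) w)))) \<le> \<rho> (lattice_sup M ?F)"
    by (simp only: eq S_def[abs_def])
qed

end

context Rs_sectorial_op
begin

lemma square_functions_equivalent:
  assumes ac: "abs_continuous_norm M \<rho>" and \<theta>: "\<tau> < \<theta>" "\<theta> < \<sigma>" "\<sigma> \<le> pi" and \<phi>: "\<phi> \<in> Phi_class \<sigma>"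
  obtains C :: real where "0 < C"
    "\<And>x. x \<in> bfs M \<rho> \<Longrightarrow> \<rho> (discrete_sq_fun M \<rho> s D A \<theta> \<phi> x) \<le> ennreal C * \<rho> (continuous_sq_fun M \<rho> s D A \<theta> \<phi> x)"
    "\<And>x. x \<in> bfs M \<rho> \<Longrightarrow> \<rho> (continuous_sq_fun M \<rho> s D A \<theta> \<phi> x) \<le> ennreal C * \<rho> (discrete_sq_fun M \<rho> s D A \<theta> \<phi> x)"
proof -
  have \<sigma>0: "0 < \<sigma>" using \<theta> \<tau> by simp
  \<comment> \<open>A name for the quotient condition of the class, so that membership in it can be
    taken apart without opening the inner quantifiers.\<close>
  define rel where "rel \<F> a b \<longleftrightarrow> (\<exists>f\<in>\<F>. \<exists>r::real. r > 0 \<and> (\<forall>z\<in>sector \<sigma>. \<phi> (a * z) / \<phi> (b * z) = f (of_real r * z)))" for \<F> a b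
  from \<phi> obtain d \<F> \<epsilon> K L where \<phi>0: "\<phi> \<in> H0inf \<sigma>" "0 \<notin> \<phi> ` sector \<sigma>" and \<F>: "\<F> \<subseteq> Ealg \<sigma>" "0 < \<epsilon>"
    and K: "\<forall>f\<in>\<F>. \<forall>z\<in>sector \<sigma>. cmod (f z) \<le> K"
    and L: "\<forall>f\<in>\<F>. \<forall>z\<in>sector \<sigma>.
       max (cmod z powr \<epsilon>) (cmod z powr (- \<epsilon>)) * cmod (f z - (val_zero \<sigma> f + val_infinity \<sigma> f * z) / (1 + z)) \<le> L"
    and rel: "\<forall>j::int. \<forall>t\<in>{1..2::real}. rel \<F> (2 powi j * of_real t) (2 powi (j - d)) \<and> rel \<F> (2 powi (j + d)) (2 powi j * of_real t)"
    unfolding Phi_class_def mem_Collect_eq rel_def[symmetric] by (elim conjE exE) (rule that)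
  have dec: "decaying_on \<sigma> \<phi>" by (rule H0inf_decaying_on[OF \<phi>0(1) \<sigma>0])
  define v where "v x t = fun_calc_dil M \<rho> D A \<theta> \<phi> t x" for x and t :: real
  obtain C where C: "0 < C"
    "\<And>(n::nat) t t' x. x \<in> bfs M \<rho> \<Longrightarrow> (\<And>j. j < n \<Longrightarrow> 0 < t j \<and> 0 < t' j \<and> rel \<F> (of_real (t j)) (of_real (t' j))) \<Longrightarrow>
      \<rho> (\<lambda>w. ls_norm s {..<n} (\<lambda>j. ennreal (cmod (v x (t j) w))))
        \<le> ennreal C * \<rho> (\<lambda>w. ls_norm s {..<n} (\<lambda>j. ennreal (cmod (v x (t' j) w))))"
  proof (rule fun_calc_dil_comparison[OF \<theta> dec \<phi>0(2) \<F>, where K = K and L = L])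
    fix C :: real assume C0: "0 < C" and C1: "\<And>(n::nat) t t' x. x \<in> bfs M \<rho> \<Longrightarrow> (\<And>j. j < n \<Longrightarrow> 0 < t j \<and> 0 < t' j \<and>
        (\<exists>f\<in>\<F>. \<exists>r::real. r > 0 \<and> (\<forall>z\<in>sector \<sigma>. \<phi> (of_real (t j) * z) / \<phi> (of_real (t' j) * z) = f (of_real r * z)))) \<Longrightarrow>
      \<rho> (\<lambda>w. ls_norm s {..<n} (\<lambda>j. ennreal (cmod (fun_calc_dil M \<rho> D A \<theta> \<phi> (t j) x w))))
        \<le> ennreal C * \<rho> (\<lambda>w. ls_norm s {..<n} (\<lambda>j. ennreal (cmod (fun_calc_dil M \<rho> D A \<theta> \<phi> (t' j) x w))))"
    note C1' = C1[folded v_def rel_def]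
    show thesis
    proof (rule that[OF C0])
      fix n :: nat and t t' x
      assume *: "x \<in> bfs M \<rho>" "\<And>j. j < n \<Longrightarrow> 0 < t j \<and> 0 < t' j \<and> rel \<F> (of_real (t j)) (of_real (t' j))"
      show "\<rho> (\<lambda>w. ls_norm s {..<n} (\<lambda>j. ennreal (cmod (v x (t j) w))))
        \<le> ennreal C * \<rho> (\<lambda>w. ls_norm s {..<n} (\<lambda>j. ennreal (cmod (v x (t' j) w))))"
        by (rule C1'[OF *(1)]) (rule *(2))
    qed
  qed (use K L in blast)+
  have pos: "0 < 2 powi j * t" if "t \<in> {1..2}" for j :: int and t :: real
    using that by (intro mult_pos_pos) auto
  have of_real: "complex_of_real (2 powi j) = 2 powi j" "complex_of_real (2 powi j * t) = 2 powi j * of_real t" for j t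
    by (simp_all add: of_real_power_int)
  have comp1: "\<rho> (\<lambda>w. ls_norm s {..<n} (\<lambda>i. ennreal (cmod (v x (2 powi j i * t i) w))))
        \<le> ennreal C * \<rho> (\<lambda>w. ls_norm s {..<n} (\<lambda>i. ennreal (cmod (v x (2 powi (j i - d)) w))))"
    if "x \<in> bfs M \<rho>" "\<And>i. i < n \<Longrightarrow> t i \<in> {1..2}" for n x t and j :: "nat \<Rightarrow> int"
  proof (rule C(2)[OF that(1)], intro conjI)
    fix i assume "i < n"
    then show "rel \<F> (of_real (2 powi j i * t i)) (of_real (2 powi (j i - d)))" "0 < 2 powi j i * t i"
      unfolding of_real using rel pos that(2) by blast+
  qed simp
  have comp2: "\<rho> (\<lambda>w. ls_norm s {..<n} (\<lambda>i. ennreal (cmod (v x (2 powi (j i + d)) w))))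
        \<le> ennreal C * \<rho> (\<lambda>w. ls_norm s {..<n} (\<lambda>i. ennreal (cmod (v x (2 powi j i * t i) w))))"
    if "x \<in> bfs M \<rho>" "\<And>i. i < n \<Longrightarrow> t i \<in> {1..2}" for n x t and j :: "nat \<Rightarrow> int"
  proof (rule C(2)[OF that(1)], intro conjI)
    fix i assume "i < n"
    then show "rel \<F> (of_real (2 powi (j i + d))) (of_real (2 powi j i * t i))" "0 < 2 powi j i * t i"
      unfolding of_real using rel pos that(2) by blast+
  qed simp
  have vm: "v x t \<in> borel_measurable M" if "x \<in> bfs M \<rho>" "0 < t" for x t
    unfolding v_def fun_calc_dil_def
    by (rule bfs_measurable, rule fun_calc_eq(1)[OF \<theta> that(1) decaying_on_dilate[OF dec that(2) \<sigma>0]])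
  have disc: "discrete_sq_fun M \<rho> s D A \<theta> \<phi> x = (\<lambda>w. ls_norm s UNIV (\<lambda>j::int. ennreal (cmod (v x (2 powi j) w))))" for x
    by (simp only: discrete_sq_fun_def v_def)
  \<comment> \<open>The constant \<open>2 * C + 1\<close> covers both cases of the second bound:
    \<open>2 * C\<close> for finite exponents, with the 2 from the dyadic weights, and 1 for
    suprema.\<close>
  have main: "\<rho> (continuous_sq_fun M \<rho> s D A \<theta> \<phi> x) \<le> ennreal C * \<rho> (discrete_sq_fun M \<rho> s D A \<theta> \<phi> x) \<and>
    \<rho> (discrete_sq_fun M \<rho> s D A \<theta> \<phi> x) \<le> ennreal (2 * C + 1) * \<rho> (continuous_sq_fun M \<rho> s D A \<theta> \<phi> x)"
    if x: "x \<in> bfs M \<rho>" for x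
  proof -
    obtain G g K where G: "(\<lambda>(t, w). G t w) \<in> borel_measurable (lborel \<Otimes>\<^sub>M M)"
      and Gv: "\<And>t. 0 < t \<Longrightarrow> AE w in M. G t w = v x t w"
      and Gc: "AE w in M. continuous_on {0<..} (\<lambda>t. G t w)"
      and g: "g \<in> borel_measurable M" "\<rho> g < \<infinity>"
      and Gg: "\<And>j u w. u \<in> {1..2} \<Longrightarrow> ennreal (cmod (G (2 powi j * u) w)) \<le> ennreal (K j) * g w"
      using joint_representative[OF \<theta> x dec] unfolding v_def by blast
    have le: "ennreal (2 * C + 1) = ennreal C * 2 + 1"
      using C(1) by (simp add: ennreal_plus ennreal_mult mult.commute)
    show ?thesis
    proof (cases "s = \<infinity>")
      case True
      have cont: "continuous_sq_fun M \<rho> s D A \<theta> \<phi> x = lattice_sup M ((\<lambda>t w. ennreal (cmod (v x t w))) ` {0<..})"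
        unfolding continuous_sq_fun_def v_def by (simp only: True if_P[OF refl])
      have top: "s = top" using True by simp
      note E = maximal_function_equivalence[of "v x" G C d, OF vm[OF x] Gv Gc comp1[OF x, unfolded top]]
      have "\<rho> (discrete_sq_fun M \<rho> s D A \<theta> \<phi> x) \<le> 1 * \<rho> (continuous_sq_fun M \<rho> s D A \<theta> \<phi> x)"
        unfolding disc cont unfolding top mult_1 by (rule E(2))
      also have "\<dots> \<le> ennreal (2 * C + 1) * \<rho> (continuous_sq_fun M \<rho> s D A \<theta> \<phi> x)"
        unfolding le by (rule mult_right_mono) auto
      finally show ?thesis using E(1) unfolding disc cont unfolding top by blast
    next
      case False
      then have top: "s \<noteq> top" by simp
      have cont: "\<rho> (continuous_sq_fun M \<rho> s D A \<theta> \<phi> x) = \<rho> (cont_sq (enn2real s) G)"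
        by (rule continuous_sq_fun_eq_cont_sq[OF False G Gv[unfolded v_def]])
      have comp1': "\<rho> (\<lambda>w. ls_norm s I (\<lambda>i. ennreal (cmod (v x (2 powi fst i * t i) w))))
          \<le> ennreal C * \<rho> (\<lambda>w. ls_norm s I (\<lambda>i. ennreal (cmod (v x (2 powi (fst i - d)) w))))"
        and comp2': "\<rho> (\<lambda>w. ls_norm s I (\<lambda>i. ennreal (cmod (v x (2 powi (fst i + d)) w))))
          \<le> ennreal C * \<rho> (\<lambda>w. ls_norm s I (\<lambda>i. ennreal (cmod (v x (2 powi fst i * t i) w))))"
        if I: "finite I" "\<And>i. i \<in> I \<Longrightarrow> t i \<in> {1..2}" for I :: "(int \<times> nat) set" and t
      proof -
        \<comment> \<open>Enumerating the pairs brings the comparison into the form of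
          \<open>Rs_bounded\<close>, with indices below \<open>card I\<close>.\<close>
        obtain h where h: "bij_betw h {..<card I} I" using ex_bij_betw_nat_finite[OF I(1)] by (auto simp: atLeast0LessThan)
        have th: "t (h k) \<in> {1..2}" if "k < card I" for k
          by (rule I(2), rule bij_betwE[OF h, rule_format]) (simp add: that)
        show "\<rho> (\<lambda>w. ls_norm s I (\<lambda>i. ennreal (cmod (v x (2 powi fst i * t i) w))))
          \<le> ennreal C * \<rho> (\<lambda>w. ls_norm s I (\<lambda>i. ennreal (cmod (v x (2 powi (fst i - d)) w))))"
          unfolding ls_norm_reindex[OF h I(1)] by (rule comp1[OF x]) (rule th)
        show "\<rho> (\<lambda>w. ls_norm s I (\<lambda>i. ennreal (cmod (v x (2 powi (fst i + d)) w))))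
          \<le> ennreal C * \<rho> (\<lambda>w. ls_norm s I (\<lambda>i. ennreal (cmod (v x (2 powi fst i * t i) w))))"
          unfolding ls_norm_reindex[OF h I(1)] by (rule comp2[OF x]) (rule th)
      qed
      note E = square_function_equivalence[of s "v x" G g K C d, OF ac s top vm[OF x] G Gv Gc g Gg comp1' comp2']
      have "\<rho> (discrete_sq_fun M \<rho> s D A \<theta> \<phi> x) \<le> ennreal C * (2 * \<rho> (cont_sq (enn2real s) G))"
        unfolding disc by (rule E(2))
      also have "\<dots> \<le> ennreal (2 * C + 1) * \<rho> (cont_sq (enn2real s) G)"
        unfolding le mult.assoc[symmetric] by (rule mult_right_mono) auto
      finally show ?thesis using E(1) unfolding disc cont by blast
    qed
  qed
  show thesis
  proof (rule that[of "2 * C + 1"])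
    show "0 < 2 * C + 1" using C(1) by simp
    fix x assume x: "x \<in> bfs M \<rho>"
    show "\<rho> (discrete_sq_fun M \<rho> s D A \<theta> \<phi> x) \<le> ennreal (2 * C + 1) * \<rho> (continuous_sq_fun M \<rho> s D A \<theta> \<phi> x)"
      using main[OF x] by blast
    have "\<rho> (continuous_sq_fun M \<rho> s D A \<theta> \<phi> x) \<le> ennreal C * \<rho> (discrete_sq_fun M \<rho> s D A \<theta> \<phi> x)"
      using main[OF x] by blast
    also have "\<dots> \<le> ennreal (2 * C + 1) * \<rho> (discrete_sq_fun M \<rho> s D A \<theta> \<phi> x)"
      using C(1) by (intro mult_right_mono ennreal_leI) auto
    finally show "\<rho> (continuous_sq_fun M \<rho> s D A \<theta> \<phi> x) \<le> ennreal (2 * C + 1) * \<rho> (discrete_sq_fun M \<rho> s D A \<theta> \<phi> x)" .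
  qed
qed

end

lemma Rs_sectorial_op_of_angle:
  assumes "banach_function_norm M \<Omega> \<rho>" and s: "1 \<le> s" and op: "bfs_operator M \<rho> D A"
    and a: "Rs_sectorial_of_angle M \<rho> s D A a" and \<tau>: "a < \<tau>" "\<tau> < pi"
  obtains B where "Rs_sectorial_op M \<Omega> \<rho> s D A \<tau> B"
proof -
  interpret banach_function_norm M \<Omega> \<rho> by fact
  have a0: "0 \<le> a" and spec: "bfs_spectrum M \<rho> D A \<subseteq> closure (sector a)"
    and Rsb: "Rs_bounded M \<rho> s ((\<lambda>z f w. z * resolvent M \<rho> D A z f w) ` (- closure (sector \<tau>)))"
    using a \<tau> by (auto simp: Rs_sectorial_of_angle_def)
  obtain C where C: "0 < C" "\<And>(n::nat) T x. (\<forall>j<n. T j \<in> (\<lambda>z f w. z * resolvent M \<rho> D A z f w) ` (- closure (sector \<tau>)) \<and> x j \<in> bfs M \<rho>) \<Longrightarrow>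
          \<rho> (\<lambda>w. ls_norm s {..<n} (\<lambda>j. ennreal (cmod (T j (x j) w))))
            \<le> ennreal C * \<rho> (\<lambda>w. ls_norm s {..<n} (\<lambda>j. ennreal (cmod (x j w))))"
    using Rsb unfolding Rs_bounded_def by blast
  \<comment> \<open>The maximum with 1 meets the normalisation of \<open>B\<close> in the
    locale.\<close>
  have "Rs_sectorial_op M \<Omega> \<rho> s D A \<tau> (max 1 C)"
  proof unfold_locales
    show "1 \<le> s" "bfs_operator M \<rho> D A" "0 < \<tau>" "\<tau> < pi" "1 \<le> max 1 C" using s op a0 \<tau> by auto
    show "is_resolvent M \<rho> D A z (resolvent M \<rho> D A z)" if "z \<notin> closure (sector \<tau>)" for z
    proof -
      have "closure (sector a) \<subseteq> closure (sector \<tau>)"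
        using sector_mono_strict[OF a0 \<tau>(1)] \<tau>(2) by (intro closure_mono) simp
      then have "z \<notin> bfs_spectrum M \<rho> D A" using that spec by blast
      then have "\<exists>R. is_resolvent M \<rho> D A z R" by (simp add: bfs_spectrum_def)
      then show ?thesis unfolding resolvent_def by (rule someI_ex)
    qed
    fix n :: nat and z :: "nat \<Rightarrow> complex" and x
    assume z: "\<And>j. j < n \<Longrightarrow> z j \<notin> closure (sector \<tau>)" and x: "\<And>j. j < n \<Longrightarrow> x j \<in> bfs M \<rho>"
    have "\<rho> (\<lambda>w. ls_norm s {..<n} (\<lambda>j. ennreal (cmod (z j * resolvent M \<rho> D A (z j) (x j) w))))
        \<le> ennreal C * \<rho> (\<lambda>w. ls_norm s {..<n} (\<lambda>j. ennreal (cmod (x j w))))"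
      using C(2)[of n "\<lambda>j f w. z j * resolvent M \<rho> D A (z j) f w" x] z x by blast
    also have "\<dots> \<le> ennreal (max 1 C) * \<rho> (\<lambda>w. ls_norm s {..<n} (\<lambda>j. ennreal (cmod (x j w))))"
      by (intro mult_right_mono ennreal_leI) auto
    finally show "\<rho> (\<lambda>w. ls_norm s {..<n} (\<lambda>j. ennreal (cmod (z j * resolvent M \<rho> D A (z j) (x j) w))))
        \<le> ennreal (max 1 C) * \<rho> (\<lambda>w. ls_norm s {..<n} (\<lambda>j. ennreal (cmod (x j w))))" .
  qed
  then show thesis by (rule that)
qed

theorem proposition3p14:
  fixes M :: "'a measure" and \<Omega> :: "nat \<Rightarrow> 'a set" and \<rho> :: "('a \<Rightarrow> ennreal) \<Rightarrow> ennreal"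
    and s :: ennreal
    and D :: "('a \<Rightarrow> complex) set" and A :: "('a \<Rightarrow> complex) \<Rightarrow> 'a \<Rightarrow> complex"
    and \<sigma> \<theta> :: real and \<phi> :: "complex \<Rightarrow> complex"
  assumes "banach_function_norm M \<Omega> \<rho>"
    and "abs_continuous_norm M \<rho>"
    and "1 \<le> s"
    and "Rs_sectorial M \<rho> s D A"
    and "bfs_injective M D A"
    and "bfs_dense M \<rho> D"
    and "bfs_dense M \<rho> (A ` D)"
    and "omega_Rs M \<rho> s D A < \<sigma>" and "\<sigma> \<le> pi"
    and "omega_Rs M \<rho> s D A < \<theta>" and "\<theta> < \<sigma>"
    and "\<phi> \<in> Phi_class \<sigma>"
  shows "\<exists>C::real. C > 0 \<and> (\<forall>x\<in>bfs M \<rho>.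
           ennreal (inverse C) * \<rho> (discrete_sq_fun M \<rho> s D A \<theta> \<phi> x)
             \<le> \<rho> (continuous_sq_fun M \<rho> s D A \<theta> \<phi> x) \<and>
           \<rho> (continuous_sq_fun M \<rho> s D A \<theta> \<phi> x)
             \<le> ennreal C * \<rho> (discrete_sq_fun M \<rho> s D A \<theta> \<phi> x))"
proof -
  have op: "bfs_operator M \<rho> D A" and ne: "{a. Rs_sectorial_of_angle M \<rho> s D A a} \<noteq> {}"
    using assms(4) by (auto simp: Rs_sectorial_def)
  \<comment> \<open>The infimum itself need not be an admissible angle; an admissible one below
    \<theta> exists, and \<tau> is placed between the two.\<close>
  obtain a where a: "Rs_sectorial_of_angle M \<rho> s D A a" "a < \<theta>"
    using cInf_lessD[OF ne] assms(10) unfolding omega_Rs_def by blast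
  obtain \<tau> where \<tau>: "a < \<tau>" "\<tau> < \<theta>" using dense[OF a(2)] by blast
  have "\<tau> < pi" using \<tau> assms(9,11) by simp
  then obtain B where B: "Rs_sectorial_op M \<Omega> \<rho> s D A \<tau> B"
    using Rs_sectorial_op_of_angle[OF assms(1,3) op a(1) \<tau>(1)] by blast
  obtain C :: real where C: "0 < C"
    "\<And>x. x \<in> bfs M \<rho> \<Longrightarrow> \<rho> (discrete_sq_fun M \<rho> s D A \<theta> \<phi> x) \<le> ennreal C * \<rho> (continuous_sq_fun M \<rho> s D A \<theta> \<phi> x)"
    "\<And>x. x \<in> bfs M \<rho> \<Longrightarrow> \<rho> (continuous_sq_fun M \<rho> s D A \<theta> \<phi> x) \<le> ennreal C * \<rho> (discrete_sq_fun M \<rho> s D A \<theta> \<phi> x)"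
    using Rs_sectorial_op.square_functions_equivalent[OF B assms(2) \<tau>(2) assms(11,9,12)] by blast
  have "ennreal (inverse C) * \<rho> (discrete_sq_fun M \<rho> s D A \<theta> \<phi> x) \<le> \<rho> (continuous_sq_fun M \<rho> s D A \<theta> \<phi> x)"
    if "x \<in> bfs M \<rho>" for x
  proof -
    have "ennreal (inverse C) * \<rho> (discrete_sq_fun M \<rho> s D A \<theta> \<phi> x)
      \<le> ennreal (inverse C) * (ennreal C * \<rho> (continuous_sq_fun M \<rho> s D A \<theta> \<phi> x))"
      by (intro mult_left_mono C(2) that) simp
    also have "\<dots> = \<rho> (continuous_sq_fun M \<rho> s D A \<theta> \<phi> x)"
      using C(1) by (simp add: mult.assoc[symmetric] ennreal_mult[symmetric])
    finally show ?thesis .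
  qed
  then show ?thesis using C(1,3) by blast
qed

end
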